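(* Let $X$ be a symmetric space on $[0,1]$ with non-trivial Boyd indices, and let $w$ be a non-trivial weight on $[0,1]$ whose associated sequence $(w_k)_{k\ge1}$ (defined in the context) satisfies: there are $k_0\in\mathbb N$ and $c_0>0$ such that $w_k2^k\ge c_0$ for all $k\ge k_0$. (a) If $X$ is $w$-decomposable, then $X$ is an ultrasymmetric Orlicz space. (b) If $X$ has the Fatou property and $(X,X(w))$ is a $K$-monotone couple, then $X$ is an ultrasymmetric Orlicz space.
   Context: $m$ is Lebesgue measure; functions are identified if they agree a.e., and supports and infima/suprema of $w$ over sets are understood up to null sets. A symmetric space on $[0,1]$ is a Banach space $X\neq\{0\}$ of (classes of) measurable real functions on $[0,1]$ such that (i) $|x|\le|y|$ a.e. with $y\in X$, $x$ measurable, implies $x\in X$, $\|x\|_X\le\|y\|_X$; (ii) if $x\in X$ and $y$ is measurable with $m\{|y|>\lambda\}=m\{|x|>\lambda\}$ for all $\lambda\ge0$, then $y\in X$ and $\|y\|_X=\|x\|_X$. Fatou property: $0\le x_n\uparrow x$ measurable, $x_n\in X$, $\sup_n\|x_n\|_X<\infty$ imply $x\in X$ and $\|x_n\|_X\uparrow\|x\|_X$. Fundamental function: $\varphi_X(t)=\|\chi_{[0,t]}\|_X$; after passing to an equivalent norm on $X$ it may be assumed concave. Boyd indices: $\alpha_X=\lim_{t\to0^+}\frac{\ln\|\sigma_t\|_{X\to X}}{\ln t}$, $\beta_X=\lim_{t\to\infty}\frac{\ln\|\sigma_t\|_{X\to X}}{\ln t}$, where $\sigma_tx(s)=x(s/t)\chi_{[0,1]}(s/t)$,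 $s\in[0,1]$; they are non-trivial if $0<\alpha_X\le\beta_X<1$. With $x^*$ the non-increasing rearrangement of $x$: $\|x\|_{\Lambda_\varphi}=\varphi(0^+)\|x\|_{L_\infty}+\int_0^1x^*(t)\varphi'(t)\,dt$ (Lorentz space, $\varphi$ concave) and $\|x\|_{M_\varphi}=\sup_{0<t\le1}\frac{\varphi(t)}t\int_0^tx^*(s)\,ds$ (Marcinkiewicz space). $X$ is ultrasymmetric if it is an interpolation space between $\Lambda_{\varphi_X}$ and $M_{\varphi_X}$. "$X$ is an ultrasymmetric Orlicz space" means $X$ is ultrasymmetric and coincides, up to equivalence of norms, with an Orlicz space $L_F[0,1]$, where $F:[0,\infty)\to[0,\infty)$ is convex, increasing, $F(0)=0$, and $\|x\|_{L_F}=\inf\{\lambda>0:\int_0^1F(|x(t)|/\lambda)\,dt\le1\}$. A weight on $[0,1]$ is a measurable function positive and finite a.e.; it is non-trivial if $w$ or $1/w$ is unbounded. For the weight $w$ put $M_k=\{t\in[0,1]: w(t)\in[2^k,2^{k+1})\}$, $k\in\mathbb Z$; $(w_k)_{k=1}^\infty$ is the non-increasing rearrangement of $(m(M_k))_{k\in\mathbb Z}$. $X(w)=\{x: xw\in X\}$ with $\|x\|_{X(w)}=\|xw\|_X$. $X$ is $w$-decomposable if there is $C>0$ such that for every $n\in\mathbb N$ and all nonzero $x_1,\dots,x_n,y_1,\dots,y_n\in X$ with $\|x_i\|_X=\|y_i\|_X$ ($1\le i\le n$) and $\inf w(\operatorname{supp}x_i\cup\operatorname{supp}y_i)\ge 2\sup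 w(\operatorname{supp}x_{i+1}\cup\operatorname{supp}y_{i+1})$ ($1\le i\le n-1$), one has $C^{-1}\|\sum_{i=1}^n x_i\|_X\le\|\sum_{i=1}^n y_i\|_X\le C\|\sum_{i=1}^n x_i\|_X$. For a Banach couple $(X_0,X_1)$, $K(t,x;X_0,X_1)=\inf\{\|x_0\|_{X_0}+t\|x_1\|_{X_1}: x=x_0+x_1,\ x_i\in X_i\}$. A Banach space $E$ with $X_0\cap X_1\subset E\subset X_0+X_1$ (continuous embeddings) is an interpolation space between $X_0$ and $X_1$ if every linear operator on $X_0+X_1$ that maps $X_i$ boundedly into $X_i$ for $i=0,1$ maps $E$ boundedly into $E$. $E$ is a $K$-monotone space if there is $C\ge1$ such that whenever $x\in E$, $y\in X_0+X_1$ and $K(t,y;X_0,X_1)\le K(t,x;X_0,X_1)$ for all $t>0$, then $y\in E$ and $\|y\|_E\le C\|x\|_E$. The couple is $K$-monotone if all its interpolation spaces are $K$-monotone spaces. *)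

theory Defs
  imports "HOL-Analysis.Analysis" "HOL-Probability.Essential_Supremum"
begin

text \<open>
  A function on \<open>[0,1]\<close> is represented by a total function on the reals of which only the
  values on \<open>[0,1]\<close> matter. Classes of functions modulo almost everywhere equality are represented
  by sets of functions saturated under that equality (see \<open>banach_fun_space\<close>).
\<close>

abbreviation I01 :: "real measure" where
  "I01 \<equiv> lebesgue_on {0..1}"

definition ae_eq :: "(real \<Rightarrow> real) \<Rightarrow> (real \<Rightarrow> real) \<Rightarrow> bool" where
  "ae_eq x y \<longleftrightarrow> (AE t in I01. x t = y t)"

record fun_space =
  elts :: "(real \<Rightarrow> real) set"
  nrm :: "(real \<Rightarrow> real) \<Rightarrow> real"

definition banach_fun_space :: "fun_space \<Rightarrow> bool" where
  "banach_fun_space X \<longleftrightarrow>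
     elts X \<subseteq> borel_measurable I01 \<and>
     (\<forall>x\<in>elts X. \<forall>y\<in>borel_measurable I01. ae_eq x y \<longrightarrow> y \<in> elts X \<and> nrm X y = nrm X x) \<and>
     (\<lambda>t. 0) \<in> elts X \<and>
     (\<forall>x\<in>elts X. \<forall>y\<in>elts X. (\<lambda>t. x t + y t) \<in> elts X) \<and>
     (\<forall>c. \<forall>x\<in>elts X. (\<lambda>t. c * x t) \<in> elts X) \<and>
     (\<forall>x\<in>elts X. 0 \<le> nrm X x) \<and>
     (\<forall>x\<in>elts X. nrm X x = 0 \<longleftrightarrow> ae_eq x (\<lambda>t. 0)) \<and>
     (\<forall>c. \<forall>x\<in>elts X. nrm X (\<lambda>t. c * x t) = \<bar>c\<bar> * nrm X x) \<and>
     (\<forall>x\<in>elts X. \<forall>y\<in>elts X. nrm X (\<lambda>t. x t + y t) \<le> nrm X x + nrm X y) \<and>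
     (\<forall>u :: nat \<Rightarrow> real \<Rightarrow> real.
        (\<forall>n. u n \<in> elts X) \<and>
        (\<forall>e>0. \<exists>N. \<forall>m\<ge>N. \<forall>n\<ge>N. nrm X (\<lambda>t. u m t - u n t) < e) \<longrightarrow>
        (\<exists>l\<in>elts X. (\<lambda>n. nrm X (\<lambda>t. u n t - l t)) \<longlonglongrightarrow> 0))"

definition distr_fun :: "(real \<Rightarrow> real) \<Rightarrow> real \<Rightarrow> real" where
  "distr_fun x l = measure I01 {t \<in> {0..1}. \<bar>x t\<bar> > l}"

definition symmetric_space :: "fun_space \<Rightarrow> bool" where
  "symmetric_space X \<longleftrightarrow>
     banach_fun_space X \<and>
     (\<exists>x\<in>elts X. \<not> ae_eq x (\<lambda>t. 0)) \<and>
     (\<forall>y\<in>elts X. \<forall>x\<in>borel_measurable I01. (AE t in I01. \<bar>x t\<bar> \<le> \<bar>y t\<bar>) \<longrightarrow>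
        x \<in> elts X \<and> nrm X x \<le> nrm X y) \<and>
     (\<forall>x\<in>elts X. \<forall>y\<in>borel_measurable I01. (\<forall>l\<ge>0. distr_fun y l = distr_fun x l) \<longrightarrow>
        y \<in> elts X \<and> nrm X y = nrm X x)"

definition fatou_property :: "fun_space \<Rightarrow> bool" where
  "fatou_property X \<longleftrightarrow>
     (\<forall>(u :: nat \<Rightarrow> real \<Rightarrow> real) x.
        (\<forall>n. u n \<in> elts X) \<and> x \<in> borel_measurable I01 \<and>
        (AE t in I01. 0 \<le> u 0 t \<and> incseq (\<lambda>n. u n t) \<and> (\<lambda>n. u n t) \<longlonglongrightarrow> x t) \<and>
        bdd_above (range (\<lambda>n. nrm X (u n))) \<longrightarrow>
        x \<in> elts X \<and> incseq (\<lambda>n. nrm X (u n)) \<and> (\<lambda>n. nrm X (u n)) \<longlonglongrightarrow> nrm X x)"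

definition fundamental_fun :: "fun_space \<Rightarrow> real \<Rightarrow> real" where
  "fundamental_fun X t = nrm X (indicator {0..t})"

definition embedded :: "fun_space \<Rightarrow> fun_space \<Rightarrow> bool" where
  "embedded E F \<longleftrightarrow> elts E \<subseteq> elts F \<and> (\<exists>C. \<forall>x\<in>elts E. nrm F x \<le> C * nrm E x)"

definition equivalent_spaces :: "fun_space \<Rightarrow> fun_space \<Rightarrow> bool" where
  "equivalent_spaces E F \<longleftrightarrow> embedded E F \<and> embedded F E"


definition dilation :: "real \<Rightarrow> (real \<Rightarrow> real) \<Rightarrow> real \<Rightarrow> real" where
  "dilation t x s = x (s / t) * indicator {0..1} (s / t)"

text \<open>
  The supremum below is a genuine one for dilations on a symmetric space: these are always bounded.
\<close>

definition op_norm :: "fun_space \<Rightarrow> ((real \<Rightarrow> real) \<Rightarrow> real \<Rightarrow> real) \<Rightarrow> real" where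
  "op_norm X T = Sup {nrm X (T x) | x. x \<in> elts X \<and> nrm X x \<le> 1}"

definition boyd_indices :: "fun_space \<Rightarrow> real \<Rightarrow> real \<Rightarrow> bool" where
  "boyd_indices X \<alpha> \<beta> \<longleftrightarrow>
     ((\<lambda>t. ln (op_norm X (dilation t)) / ln t) \<longlongrightarrow> \<alpha>) (at_right 0) \<and>
     ((\<lambda>t. ln (op_norm X (dilation t)) / ln t) \<longlongrightarrow> \<beta>) at_top"

definition nontrivial_boyd_indices :: "fun_space \<Rightarrow> bool" where
  "nontrivial_boyd_indices X \<longleftrightarrow> (\<exists>\<alpha> \<beta>. boyd_indices X \<alpha> \<beta> \<and> 0 < \<alpha> \<and> \<alpha> \<le> \<beta> \<and> \<beta> < 1)"


text \<open>Only the values at \<open>0 < t\<close> are meaningful (for unbounded \<open>x\<close> the set is empty at \<open>t = 0\<close>).\<close>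

definition rearrangement :: "(real \<Rightarrow> real) \<Rightarrow> real \<Rightarrow> real" where
  "rearrangement x t = Inf {l. 0 \<le> l \<and> distr_fun x l \<le> t}"

text \<open>
  For concave \<open>\<phi>\<close> the derivative exists outside a countable set, so \<open>deriv\<close> is adequate
  under the integral sign.
\<close>

definition lorentz_norm :: "(real \<Rightarrow> real) \<Rightarrow> (real \<Rightarrow> real) \<Rightarrow> ennreal" where
  "lorentz_norm \<phi> x =
     ennreal (Lim (at_right 0) \<phi>) * e2ennreal (esssup I01 (\<lambda>t. ereal \<bar>x t\<bar>)) +
     (\<integral>\<^sup>+ t. ennreal (rearrangement x t * deriv \<phi> t) \<partial>I01)"

definition marcinkiewicz_norm :: "(real \<Rightarrow> real) \<Rightarrow> (real \<Rightarrow> real) \<Rightarrow> ennreal" where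
  "marcinkiewicz_norm \<phi> x =
     (SUP t\<in>{0<..1}. ennreal (\<phi> t / t) *
        (\<integral>\<^sup>+ s. ennreal (rearrangement x s) * indicator {0<..t} s \<partial>I01))"

definition space_of_norm :: "((real \<Rightarrow> real) \<Rightarrow> ennreal) \<Rightarrow> fun_space" where
  "space_of_norm N =
     \<lparr>elts = {x \<in> borel_measurable I01. N x < \<infinity>}, nrm = (\<lambda>x. enn2real (N x))\<rparr>"

definition lorentz_space :: "(real \<Rightarrow> real) \<Rightarrow> fun_space" where
  "lorentz_space \<phi> = space_of_norm (lorentz_norm \<phi>)"

definition marcinkiewicz_space :: "(real \<Rightarrow> real) \<Rightarrow> fun_space" where
  "marcinkiewicz_space \<phi> = space_of_norm (marcinkiewicz_norm \<phi>)"


definition K_functional :: "fun_space \<Rightarrow> fun_space \<Rightarrow> real \<Rightarrow> (real \<Rightarrow> real) \<Rightarrow> real" where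
  "K_functional X0 X1 t x =
     Inf {nrm X0 x0 + t * nrm X1 x1 | x0 x1.
            x0 \<in> elts X0 \<and> x1 \<in> elts X1 \<and> ae_eq x (\<lambda>s. x0 s + x1 s)}"

definition sum_space :: "fun_space \<Rightarrow> fun_space \<Rightarrow> fun_space" where
  "sum_space X0 X1 =
     \<lparr>elts = {x \<in> borel_measurable I01.
                \<exists>x0\<in>elts X0. \<exists>x1\<in>elts X1. ae_eq x (\<lambda>s. x0 s + x1 s)},
      nrm = K_functional X0 X1 1\<rparr>"

definition meet_space :: "fun_space \<Rightarrow> fun_space \<Rightarrow> fun_space" where
  "meet_space X0 X1 =
     \<lparr>elts = elts X0 \<inter> elts X1, nrm = (\<lambda>x. max (nrm X0 x) (nrm X1 x))\<rparr>"

text \<open>Linear operators act on classes: they respect, and are linear up to, equality a.e.\<close>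

definition linear_operator_on :: "fun_space \<Rightarrow> ((real \<Rightarrow> real) \<Rightarrow> real \<Rightarrow> real) \<Rightarrow> bool" where
  "linear_operator_on X T \<longleftrightarrow>
     (\<forall>x\<in>elts X. T x \<in> elts X) \<and>
     (\<forall>x\<in>elts X. \<forall>y\<in>elts X. ae_eq x y \<longrightarrow> ae_eq (T x) (T y)) \<and>
     (\<forall>x\<in>elts X. \<forall>y\<in>elts X. ae_eq (T (\<lambda>t. x t + y t)) (\<lambda>t. T x t + T y t)) \<and>
     (\<forall>c. \<forall>x\<in>elts X. ae_eq (T (\<lambda>t. c * x t)) (\<lambda>t. c * T x t))"

definition maps_boundedly :: "((real \<Rightarrow> real) \<Rightarrow> real \<Rightarrow> real) \<Rightarrow> fun_space \<Rightarrow> bool" where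
  "maps_boundedly T X \<longleftrightarrow>
     (\<forall>x\<in>elts X. T x \<in> elts X) \<and> (\<exists>C. \<forall>x\<in>elts X. nrm X (T x) \<le> C * nrm X x)"

definition interpolation_space :: "fun_space \<Rightarrow> fun_space \<Rightarrow> fun_space \<Rightarrow> bool" where
  "interpolation_space E X0 X1 \<longleftrightarrow>
     banach_fun_space E \<and>
     embedded (meet_space X0 X1) E \<and> embedded E (sum_space X0 X1) \<and>
     (\<forall>T. linear_operator_on (sum_space X0 X1) T \<and> maps_boundedly T X0 \<and> maps_boundedly T X1 \<longrightarrow>
        maps_boundedly T E)"

definition K_monotone_space :: "fun_space \<Rightarrow> fun_space \<Rightarrow> fun_space \<Rightarrow> bool" where
  "K_monotone_space E X0 X1 \<longleftrightarrow>
     (\<exists>C\<ge>1. \<forall>x\<in>elts E. \<forall>y\<in>elts (sum_space X0 X1).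
        (\<forall>t>0. K_functional X0 X1 t y \<le> K_functional X0 X1 t x) \<longrightarrow>
        y \<in> elts E \<and> nrm E y \<le> C * nrm E x)"

definition K_monotone_couple :: "fun_space \<Rightarrow> fun_space \<Rightarrow> bool" where
  "K_monotone_couple X0 X1 \<longleftrightarrow>
     (\<forall>E. interpolation_space E X0 X1 \<longrightarrow> K_monotone_space E X0 X1)"


text \<open>
  The Lorentz space requires a concave function, so the fundamental function is taken after passing
  to an equivalent symmetric norm \<open>Y\<close> for which it is concave. The choice of \<open>Y\<close> is immaterial:
  equivalent concave functions give the same Lorentz and Marcinkiewicz spaces up to equivalence
  of norms.
\<close>

definition ultrasymmetric :: "fun_space \<Rightarrow> bool" where
  "ultrasymmetric X \<longleftrightarrow>
     (\<exists>Y. symmetric_space Y \<and> equivalent_spaces X Y \<and> concave_on {0..1} (fundamental_fun Y) \<and>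
        interpolation_space X (lorentz_space (fundamental_fun Y))
          (marcinkiewicz_space (fundamental_fun Y)))"

definition orlicz_admissible :: "(real \<Rightarrow> real) \<Rightarrow> real \<Rightarrow> (real \<Rightarrow> real) \<Rightarrow> bool" where
  "orlicz_admissible F l x \<longleftrightarrow> 0 < l \<and> (\<integral>\<^sup>+ t. ennreal (F (\<bar>x t\<bar> / l)) \<partial>I01) \<le> 1"

definition orlicz_space :: "(real \<Rightarrow> real) \<Rightarrow> fun_space" where
  "orlicz_space F =
     \<lparr>elts = {x \<in> borel_measurable I01. \<exists>l. orlicz_admissible F l x},
      nrm = (\<lambda>x. Inf {l. orlicz_admissible F l x})\<rparr>"

definition orlicz_function :: "(real \<Rightarrow> real) \<Rightarrow> bool" where
  "orlicz_function F \<longleftrightarrow>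
     F ` {0..} \<subseteq> {0..} \<and> convex_on {0..} F \<and> strict_mono_on {0..} F \<and> F 0 = 0"

definition ultrasymmetric_orlicz :: "fun_space \<Rightarrow> bool" where
  "ultrasymmetric_orlicz X \<longleftrightarrow>
     ultrasymmetric X \<and> (\<exists>F. orlicz_function F \<and> equivalent_spaces X (orlicz_space F))"


definition weight :: "(real \<Rightarrow> real) \<Rightarrow> bool" where
  "weight w \<longleftrightarrow> w \<in> borel_measurable I01 \<and> (AE t in I01. 0 < w t)"

definition nontrivial_weight :: "(real \<Rightarrow> real) \<Rightarrow> bool" where
  "nontrivial_weight w \<longleftrightarrow>
     \<not> (\<exists>C. AE t in I01. w t \<le> C) \<or> \<not> (\<exists>C. AE t in I01. 1 / w t \<le> C)"

definition level_measure :: "(real \<Rightarrow> real) \<Rightarrow> int \<Rightarrow> real" where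
  "level_measure w k = measure I01 {t \<in> {0..1}. w t \<in> {2 powi k..<2 powi (k + 1)}}"

text \<open>
  The \<open>k\<close>-th term (\<open>k \<ge> 1\<close>) of the non-increasing rearrangement of \<open>level_measure w\<close>. The
  finiteness condition is needed since \<open>card\<close> is \<open>0\<close> on infinite sets.
\<close>

definition weight_seq :: "(real \<Rightarrow> real) \<Rightarrow> nat \<Rightarrow> real" where
  "weight_seq w k =
     Inf {l. 0 \<le> l \<and> finite {j. level_measure w j > l} \<and> card {j. level_measure w j > l} < k}"

definition weighted_space :: "fun_space \<Rightarrow> (real \<Rightarrow> real) \<Rightarrow> fun_space" where
  "weighted_space X w =
     \<lparr>elts = {x \<in> borel_measurable I01. (\<lambda>t. x t * w t) \<in> elts X},
      nrm = (\<lambda>x. nrm X (\<lambda>t. x t * w t))\<rparr>"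

definition supp :: "(real \<Rightarrow> real) \<Rightarrow> real set" where
  "supp x = {t \<in> {0..1}. x t \<noteq> 0}"

definition ess_sup_on :: "(real \<Rightarrow> real) \<Rightarrow> real set \<Rightarrow> ereal" where
  "ess_sup_on w A = esssup (lebesgue_on A) (\<lambda>t. ereal (w t))"

definition ess_inf_on :: "(real \<Rightarrow> real) \<Rightarrow> real set \<Rightarrow> ereal" where
  "ess_inf_on w A = - esssup (lebesgue_on A) (\<lambda>t. - ereal (w t))"

definition w_decomposable :: "(real \<Rightarrow> real) \<Rightarrow> fun_space \<Rightarrow> bool" where
  "w_decomposable w X \<longleftrightarrow>
     (\<exists>C>0. \<forall>(n::nat) (x :: nat \<Rightarrow> real \<Rightarrow> real) (y :: nat \<Rightarrow> real \<Rightarrow> real).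
        (\<forall>i\<in>{1..n}. x i \<in> elts X \<and> y i \<in> elts X \<and>
           \<not> ae_eq (x i) (\<lambda>t. 0) \<and> \<not> ae_eq (y i) (\<lambda>t. 0) \<and> nrm X (x i) = nrm X (y i)) \<and>
        (\<forall>i\<in>{1..<n}. ess_inf_on w (supp (x i) \<union> supp (y i))
           \<ge> 2 * ess_sup_on w (supp (x (i + 1)) \<union> supp (y (i + 1)))) \<longrightarrow>
        inverse C * nrm X (\<lambda>t. \<Sum>i=1..n. x i t) \<le> nrm X (\<lambda>t. \<Sum>i=1..n. y i t) \<and>
        nrm X (\<lambda>t. \<Sum>i=1..n. y i t) \<le> C * nrm X (\<lambda>t. \<Sum>i=1..n. x i t))"

end

(*
  Let phi be the fundamental function of X, M_j the j-th level set of w and mu_j its measure.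
  Both hypotheses yield the same level property: if the coefficients a_j > 0 satisfy
  a_i <= 2^(|i-j|/4) a_j and A_j, B_j are subsets of M_j of positive measure, then the functions
  sum_j a_j chi(A_j) / phi(m A_j) and sum_j a_j chi(B_j) / phi(m B_j) have comparable norms.
  For a w-decomposable space one treats even and odd levels separately. For a K-monotone couple,
  the space X(v) with v = 2^(j/2) a_j on M_j is an interpolation space, and up to a constant the
  K-functional of sum_j 2^(-j/2) chi(A_j) / phi(m A_j) does not depend on the sets A_j.

  Since for every k there are k levels of measure at least 2^(-q(k+1)), sets of size 2^(-i) can be
  exchanged for smaller ones at different levels. This forces phi(2^(n-i)) / phi(2^(-i)) to be
  comparable with 2^(n theta) as soon as i >= q(2^n+1), and, replacing A_j by sets of measure
  proportional to a_j^p with p = 1/theta, it makes the norms above comparable with the l_p norm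
  of (a_j). Hence X consists of the functions x for which the sequence phi(2^(-i)) x*(2^(-i))
  is in l_p, with equivalent norms. This condition describes an Orlicz space: the deviation of phi from a
  power on the relevant scales is summable. It is also stable under interpolation between the Lorentz
  and the Marcinkiewicz space, by the usual splitting at a height.
*)
theory Submission
  imports Defs "HOL-Probability.Probability"
begin

text \<open>A quotient phi(2^(n-i)) / phi(2^-i) is the norm of a sum of 2^n normalised indicators of
  sets of size 2^-i in different levels, so by exchange it depends, up to a constant, on n only. Its
  logarithm is then almost additive in n, hence almost linear with a slope theta, and the Boyd
  indices put theta strictly between 0 and 1. The obstacle is that n reaches only about log i, since
  only so many levels are known to be as large as 2^-i: phi need not be equivalent to a power. What
  remains is an error of order 4^-n, about i^-2, in the modular of the i-th dyadic block; with
  shifts up to n instead of 2n it would be about 1/i and not summable. The condition on (w_k) enters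
  a second time: levels of size about 2^(-qk) let the dyadic blocks of one residue class modulo q be
  moved into different levels, which brings decreasing step functions under the exchange. For a
  couple, X(v) is known to be an interpolation space only when v varies slowly from level to level,
  so the exchange is stated for such coefficients; others are treated by slowly varying majorants
  from one side and by their peaks from the other.\<close>

abbreviation BM :: "(real \<Rightarrow> real) set" where
  "BM \<equiv> borel_measurable I01"

lemma sets_I01_iff: "A \<in> sets I01 \<longleftrightarrow> A \<in> sets lebesgue \<and> A \<subseteq> {0..1}"
  by (subst sets_restrict_space_iff) auto

lemma sets_I01_subset: "A \<in> sets I01 \<Longrightarrow> A \<subseteq> {0..1}"
  by (simp add: sets_I01_iff)

lemma measure_I01: "A \<subseteq> {0..1} \<Longrightarrow> measure I01 A = measure lebesgue A"
  by (rule measure_restrict_space) auto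

lemma prob_space_I01: "prob_space I01"
  by (rule prob_spaceI) (simp add: emeasure_restrict_space)

interpretation I: prob_space I01
  by (rule prob_space_I01)

lemma ivl_sets_I01:
  fixes a b :: real
  shows "0 \<le> a \<Longrightarrow> b \<le> 1 \<Longrightarrow> {a..b} \<in> sets I01"
    "0 \<le> a \<Longrightarrow> b \<le> 1 \<Longrightarrow> {a<..b} \<in> sets I01"
    "0 \<le> a \<Longrightarrow> b \<le> 1 \<Longrightarrow> {a..<b} \<in> sets I01"
    "0 \<le> a \<Longrightarrow> b \<le> 1 \<Longrightarrow> {a<..<b} \<in> sets I01"
  by (auto simp: sets_I01_iff)

lemma ivl_measure_I01:
  fixes a b :: real
  assumes "0 \<le> a" "b \<le> 1" "a \<le> b"
  shows "measure I01 {a..b} = b - a" "measure I01 {a<..b} = b - a"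
    "measure I01 {a..<b} = b - a" "measure I01 {a<..<b} = b - a"
  using assms by (auto simp: measure_I01 subset_eq measure_completion)

lemma ae_eq_refl [simp]: "ae_eq x x"
  by (simp add: ae_eq_def)

lemma indicator_BM [simp, intro]: "A \<in> sets I01 \<Longrightarrow> (indicator A :: real \<Rightarrow> real) \<in> BM"
  by simp

subsection \<open>Distribution functions and rearrangements\<close>

lemma distr_set:
  "x \<in> BM \<Longrightarrow> {t \<in> {0..1}. \<bar>x t\<bar> > l} \<in> sets I01"
proof -
  assume "x \<in> BM"
  then have "(\<lambda>t. \<bar>x t\<bar>) \<in> BM" by simp
  then have "{t \<in> space I01. l < \<bar>x t\<bar>} \<in> sets I01"
    by (simp only: borel_measurable_iff_greater)
  then show ?thesis by simp
qed

lemma distr_nonneg [simp]: "0 \<le> distr_fun x l"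
  by (simp add: distr_fun_def)

lemma distr_le_1 [simp]: "distr_fun x l \<le> 1"
  by (simp add: distr_fun_def)

lemma distr_mono:
  assumes "y \<in> BM" "x \<in> BM" "AE t in I01. \<bar>x t\<bar> > l \<longrightarrow> \<bar>y t\<bar> > l'"
  shows "distr_fun x l \<le> distr_fun y l'"
  unfolding distr_fun_def
proof (rule I.finite_measure_mono_AE)
  show "AE t in I01. t \<in> {t \<in> {0..1}. l < \<bar>x t\<bar>} \<longrightarrow> t \<in> {t \<in> {0..1}. l' < \<bar>y t\<bar>}"
    using assms(3) by eventually_elim auto
  show "{t \<in> {0..1}. l' < \<bar>y t\<bar>} \<in> I.events"
    by (rule distr_set) fact
qed

lemma distr_antimono: "x \<in> BM \<Longrightarrow> l \<le> l' \<Longrightarrow> distr_fun x l' \<le> distr_fun x l"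
  by (rule distr_mono) auto

text \<open>This is right-continuity of the distribution function: \<open>{|x| > l}\<close> is the
  increasing union of the sets \<open>{|x| > l + 1/(n+1)}\<close>.\<close>

lemma distr_right_cont:
  assumes x: "x \<in> BM" and t: "t < distr_fun x l"
  shows "\<exists>e>0. t < distr_fun x (l + e)"
proof -
  define A where "A n = {t \<in> {0..1}. \<bar>x t\<bar> > l + inverse (real (Suc n))}" for n
  have 1: "range A \<subseteq> sets I01" unfolding A_def using distr_set[OF x] by blast
  have 2: "incseq A"
  proof (rule incseq_SucI)
    fix n
    have "inverse (real (Suc (Suc n))) \<le> inverse (real (Suc n))" by (simp add: field_simps)
    then have "l + inverse (real (Suc (Suc n))) < \<bar>x t\<bar>" if "l + inverse (real (Suc n)) < \<bar>x t\<bar>" for t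
      using that by (meson add_left_mono order.strict_trans1)
    then show "A n \<le> A (Suc n)" unfolding A_def by blast
  qed
  have 3: "(\<Union>n. A n) = {t \<in> {0..1}. \<bar>x t\<bar> > l}"
  proof
    show "(\<Union>n. A n) \<subseteq> {t \<in> {0..1}. \<bar>x t\<bar> > l}" unfolding A_def
      by clarsimp (smt (verit) inverse_nonnegative_iff_nonnegative of_nat_0_le_iff)
    show "{t \<in> {0..1}. \<bar>x t\<bar> > l} \<subseteq> (\<Union>n. A n)"
    proof
      fix s assume s: "s \<in> {t \<in> {0..1}. \<bar>x t\<bar> > l}"
      then obtain n where "inverse (real (Suc n)) < \<bar>x s\<bar> - l"
        using reals_Archimedean[of "\<bar>x s\<bar> - l"] by auto
      then have "s \<in> A n" using s by (auto simp: A_def)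
      then show "s \<in> (\<Union>n. A n)" by blast
    qed
  qed
  have "(\<lambda>n. measure I01 (A n)) \<longlonglongrightarrow> measure I01 (\<Union>n. A n)"
    by (rule I.finite_Lim_measure_incseq[OF 1 2])
  then have "(\<lambda>n. measure I01 (A n)) \<longlonglongrightarrow> distr_fun x l" by (simp add: 3 distr_fun_def)
  then have "eventually (\<lambda>n. t < measure I01 (A n)) sequentially"
    using t by (rule order_tendstoD)
  then obtain n where "t < measure I01 (A n)" by (auto simp: eventually_sequentially)
  then have "t < distr_fun x (l + inverse (real (Suc n)))" by (simp add: distr_fun_def A_def)
  then show ?thesis by (intro exI[of _ "inverse (real (Suc n))"]) auto
qed

text \<open>Finiteness of x enters here: the sets \<open>{|x| > n}\<close> decrease to the empty
  set. So for positive t the infimum in \<open>rearrangement\<close> is taken over a non-empty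
  set.\<close>

lemma distr_tendsto_0:
  assumes x: "x \<in> BM" and t: "0 < t"
  shows "\<exists>l\<ge>0. distr_fun x l \<le> t"
proof -
  define A where "A n = {t \<in> {0..1}. \<bar>x t\<bar> > real n}" for n
  have 1: "range A \<subseteq> sets I01" unfolding A_def using distr_set[OF x] by blast
  have 2: "decseq A" by (rule decseq_SucI) (auto simp: A_def)
  have 3: "(\<Inter>n. A n) = {}"
  proof -
    have "\<exists>n. \<not> \<bar>x s\<bar> > real n" for s
      using reals_Archimedean2[of "\<bar>x s\<bar>"] by (meson less_asym)
    then show ?thesis unfolding A_def by blast
  qed
  have "(\<lambda>n. measure I01 (A n)) \<longlonglongrightarrow> measure I01 (\<Inter>n. A n)"
    by (rule I.finite_Lim_measure_decseq[OF 1 2])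
  then have "(\<lambda>n. measure I01 (A n)) \<longlonglongrightarrow> 0" by (simp add: 3)
  then have "eventually (\<lambda>n. measure I01 (A n) < t) sequentially"
    using t by (rule order_tendstoD)
  then obtain n where "measure I01 (A n) < t" by (auto simp: eventually_sequentially)
  then have "distr_fun x (real n) \<le> t" by (simp add: distr_fun_def A_def)
  then show ?thesis by (intro exI[of _ "real n"]) auto
qed

text \<open>The strict inequalities match because the distribution function is right-continuous.
  This Galois connection replaces the infimum of the definition in nearly all that follows.\<close>

lemma rearrangement_gt_iff:
  assumes x: "x \<in> BM" and t: "0 < t" and l: "0 \<le> l"
  shows "l < rearrangement x t \<longleftrightarrow> t < distr_fun x l"
proof
  assume "t < distr_fun x l"
  then obtain e where e: "e > 0" "t < distr_fun x (l + e)" using distr_right_cont[OF x] by blast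
  have "l + e \<le> rearrangement x t" unfolding rearrangement_def
  proof (rule cInf_greatest)
    show "{l. 0 \<le> l \<and> distr_fun x l \<le> t} \<noteq> {}" using distr_tendsto_0[OF x t] by auto
    fix l' assume "l' \<in> {l. 0 \<le> l \<and> distr_fun x l \<le> t}"
    then have "distr_fun x l' < distr_fun x (l + e)" using e by auto
    then show "l + e \<le> l'" using distr_antimono[OF x, of l' "l + e"] by linarith
  qed
  then show "l < rearrangement x t" using e by simp
next
  assume a: "l < rearrangement x t"
  show "t < distr_fun x l"
  proof (rule ccontr)
    assume "\<not> t < distr_fun x l"
    then have "rearrangement x t \<le> l" unfolding rearrangement_def
      using l by (intro cInf_lower) (auto intro: bdd_belowI[of _ 0])
    then show False using a by simp
  qed
qed

lemma rearrangement_le_iff: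
  assumes "x \<in> BM" and "0 < t" and "0 \<le> l"
  shows "rearrangement x t \<le> l \<longleftrightarrow> distr_fun x l \<le> t"
  using rearrangement_gt_iff[OF assms] by linarith

lemma rearrangement_nonneg:
  assumes x: "x \<in> BM" and t: "0 < t"
  shows "0 \<le> rearrangement x t"
  unfolding rearrangement_def
  using distr_tendsto_0[OF assms] by (intro cInf_greatest) auto

lemma rearrangement_antimono:
  assumes x: "x \<in> BM" and t: "0 < s" "s \<le> t"
  shows "rearrangement x t \<le> rearrangement x s"
proof -
  have s: "rearrangement x s \<ge> 0" by (rule rearrangement_nonneg) (use assms in auto)
  have "distr_fun x (rearrangement x s) \<le> s"
    using rearrangement_gt_iff[OF x t(1) s] by linarith
  then show ?thesis using rearrangement_le_iff[OF x _ s, of t] t by auto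
qed

lemma rearrangement_mono:
  assumes x: "x \<in> BM" and y: "y \<in> BM" and t: "0 < t"
    and d: "\<And>l. 0 \<le> l \<Longrightarrow> distr_fun x l \<le> distr_fun y l"
  shows "rearrangement x t \<le> rearrangement y t"
proof -
  have s: "rearrangement y t \<ge> 0" by (rule rearrangement_nonneg) (use assms in auto)
  have "distr_fun y (rearrangement y t) \<le> t"
    using rearrangement_gt_iff[OF y t s] by linarith
  then show ?thesis using rearrangement_le_iff[OF x t s] d[OF s] by auto
qed

lemma rearrangement_ge_1:
  assumes x: "x \<in> BM" and t: "1 \<le> t"
  shows "rearrangement x t = 0"
  using rearrangement_le_iff[OF x, of t 0] rearrangement_nonneg[OF x, of t] t
    distr_le_1[of x 0] by auto

text \<open>The value at \<open>0\<close> is fixed because \<open>rearrangement x 0\<close> is junk for unbounded \<open>x\<close>.\<close>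

definition rearr :: "(real \<Rightarrow> real) \<Rightarrow> real \<Rightarrow> real" where
  "rearr x t = (if 0 < t then rearrangement x t else 0)"

lemma rearr_nonneg [simp]: "x \<in> BM \<Longrightarrow> 0 \<le> rearr x t"
  by (simp add: rearr_def rearrangement_nonneg)

lemma rearr_gt_set:
  assumes x: "x \<in> BM" and l: "0 \<le> l"
  shows "{t \<in> {0..1}. l < rearr x t} = {0<..<distr_fun x l}"
proof -
  have "t \<in> {0..1} \<and> l < rearr x t \<longleftrightarrow> t \<in> {0<..<distr_fun x l}" for t
  proof (cases "0 < t")
    case True
    then have "l < rearr x t \<longleftrightarrow> t < distr_fun x l"
      using rearrangement_gt_iff[OF x True l] by (simp add: rearr_def)
    moreover have "t \<le> 1" if "t < distr_fun x l" using that distr_le_1[of x l] by linarith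
    ultimately show ?thesis using True by auto
  qed (use l in \<open>auto simp: rearr_def\<close>)
  then show ?thesis by blast
qed

lemma rearr_BM [simp, intro]: 
  assumes x: "x \<in> BM" shows "rearr x \<in> BM"
  unfolding borel_measurable_iff_greater
proof
  fix l
  show "{w \<in> space I01. l < rearr x w} \<in> I.events"
  proof (cases "0 \<le> l")
    case True
    have "{w \<in> space I01. l < rearr x w} = {0<..<distr_fun x l}"
      using rearr_gt_set[OF x True] by simp
    then show ?thesis using ivl_sets_I01(4)[of 0 "distr_fun x l"] by simp
  next
    case False
    then have "l < rearr x w" for w using rearr_nonneg[OF x, of w] by linarith
    then have "{w \<in> space I01. l < rearr x w} = space I01" by blast
    then show ?thesis by (metis sets.top)
  qed
qed

lemma distr_rearr:
  assumes x: "x \<in> BM" and l: "0 \<le> l"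
  shows "distr_fun (rearr x) l = distr_fun x l"
proof -
  have "{t \<in> {0..1}. \<bar>rearr x t\<bar> > l} = {0<..<distr_fun x l}"
    using rearr_gt_set[OF x l] x by simp
  then show ?thesis
    unfolding distr_fun_def[of "rearr x"] using ivl_measure_I01(4)[of 0 "distr_fun x l"] by simp
qed

text \<open>The measure of the part of B in [0,t] is a 1-Lipschitz function of t, so it takes every
  value between 0 and the measure of B.\<close>

lemma subset_of_measure:
  assumes B: "B \<in> sets I01" and s: "0 \<le> s" "s \<le> measure I01 B"
  shows "\<exists>A\<in>sets I01. A \<subseteq> B \<and> measure I01 A = s"
proof -
  define g where "g t = measure I01 (B \<inter> {0..t})" for t
  have meas: "B \<inter> {0..t} \<in> sets I01" if "t \<le> 1" for t
    using ivl_sets_I01(1)[of 0 t] that B by auto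
  have lip: "\<bar>g t - g u\<bar> \<le> \<bar>t - u\<bar>" if "t \<in> {0..1}" "u \<in> {0..1}" for t u
  proof -
    have *: "\<bar>g t - g u\<bar> \<le> \<bar>t - u\<bar>" if "t \<in> {0..1}" "u \<in> {0..1}" "u \<le> t" for t u
    proof -
      have "g u \<le> g t" unfolding g_def using that meas by (intro I.finite_measure_mono) auto
      have "B \<inter> {0..t} = (B \<inter> {0..u}) \<union> (B \<inter> {u<..t})" using that by auto
      also have "measure I01 \<dots> \<le> measure I01 (B \<inter> {0..u}) + measure I01 (B \<inter> {u<..t})"
        using meas that ivl_sets_I01(2)[of u t] B by (intro measure_Un_le) auto
      also have "measure I01 (B \<inter> {u<..t}) \<le> measure I01 {u<..t}"
        using that ivl_sets_I01(2)[of u t] by (intro I.finite_measure_mono) auto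
      also have "\<dots> = t - u" using that by (intro ivl_measure_I01) auto
      finally have "g t \<le> g u + (t - u)" by (simp add: g_def)
      then show ?thesis using \<open>g u \<le> g t\<close> that by auto
    qed
    show ?thesis
      using *[of t u] *[of u t] that by (cases "u \<le> t") (auto simp: abs_minus_commute)
  qed
  have "continuous_on {0..1} g"
    unfolding continuous_on_iff
  proof (intro ballI allI impI)
    fix t e :: real assume "t \<in> {0..1}" "0 < e"
    have "dist (g u) (g t) < e" if "u \<in> {0..1}" "dist u t < e" for u
      using lip[OF that(1) \<open>t \<in> {0..1}\<close>] that(2) by (simp add: dist_real_def)
    then show "\<exists>d>0. \<forall>x'\<in>{0..1}. dist x' t < d \<longrightarrow> dist (g x') (g t) < e"
      using \<open>0 < e\<close> by blast
  qed
  moreover have "g 0 \<le> s" 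
  proof -
    have "g 0 \<le> measure I01 {0..0}" unfolding g_def by (rule I.finite_measure_mono) (use ivl_sets_I01(1)[of 0 0] in auto)
    then show ?thesis using s ivl_measure_I01(1)[of 0 0] by simp
  qed
  moreover have "s \<le> g 1"
  proof -
    have "B \<inter> {0..1} = B" using sets_I01_subset[OF B] by auto
    then show ?thesis using s by (simp add: g_def)
  qed
  ultimately have "\<exists>t\<ge>0. t \<le> 1 \<and> g t = s" by (intro IVT' zero_le_one)
  then obtain t where t: "t \<le> 1" "g t = s" by blast
  show ?thesis
  proof (intro bexI conjI)
    show "measure I01 (B \<inter> {0..t}) = s" using t by (simp add: g_def)
  qed (use meas t in auto)
qed

subsection \<open>Banach function lattices\<close>

text \<open>Symmetry is left out because a weighted space is a lattice but in general not symmetric,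
  and averaging over signs has to be carried out in weighted spaces too.\<close>

locale fun_lattice =
  fixes X :: fun_space
  assumes bfs: "banach_fun_space X"
    and ideal: "\<And>x y. y \<in> elts X \<Longrightarrow> x \<in> BM \<Longrightarrow> AE t in I01. \<bar>x t\<bar> \<le> \<bar>y t\<bar> \<Longrightarrow>
      x \<in> elts X \<and> nrm X x \<le> nrm X y"
begin

lemma elts_BM: "x \<in> elts X \<Longrightarrow> x \<in> BM"
  using bfs unfolding banach_fun_space_def by blast

lemma zero_elts [simp]: "(\<lambda>t. 0) \<in> elts X"
  using bfs unfolding banach_fun_space_def by blast

lemma add_elts: "x \<in> elts X \<Longrightarrow> y \<in> elts X \<Longrightarrow> (\<lambda>t. x t + y t) \<in> elts X"
  using bfs unfolding banach_fun_space_def by blast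

lemma scale_elts: "x \<in> elts X \<Longrightarrow> (\<lambda>t. c * x t) \<in> elts X"
  using bfs unfolding banach_fun_space_def by blast

lemma nrm_nonneg: "x \<in> elts X \<Longrightarrow> 0 \<le> nrm X x"
  using bfs unfolding banach_fun_space_def by blast

lemma nrm_eq_0_iff: "x \<in> elts X \<Longrightarrow> nrm X x = 0 \<longleftrightarrow> ae_eq x (\<lambda>t. 0)"
  using bfs unfolding banach_fun_space_def by blast

lemma nrm_scale: "x \<in> elts X \<Longrightarrow> nrm X (\<lambda>t. c * x t) = \<bar>c\<bar> * nrm X x"
  using bfs unfolding banach_fun_space_def by blast

lemma nrm_triangle: "x \<in> elts X \<Longrightarrow> y \<in> elts X \<Longrightarrow> nrm X (\<lambda>t. x t + y t) \<le> nrm X x + nrm X y"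
  using bfs unfolding banach_fun_space_def by blast

lemma ae_cong: 
  assumes "x \<in> elts X" "y \<in> BM" "AE t in I01. x t = y t"
  shows "y \<in> elts X" "nrm X y = nrm X x"
  using bfs assms unfolding banach_fun_space_def ae_eq_def by blast+

lemma complete:
  fixes u :: "nat \<Rightarrow> real \<Rightarrow> real"
  assumes "\<And>n. u n \<in> elts X"
    "\<And>e. 0 < e \<Longrightarrow> \<exists>N. \<forall>m\<ge>N. \<forall>n\<ge>N. nrm X (\<lambda>t. u m t - u n t) < e"
  shows "\<exists>l\<in>elts X. (\<lambda>n. nrm X (\<lambda>t. u n t - l t)) \<longlonglongrightarrow> 0"
proof -
  have "\<forall>u :: nat \<Rightarrow> real \<Rightarrow> real.
        (\<forall>n. u n \<in> elts X) \<and>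
        (\<forall>e>0. \<exists>N. \<forall>m\<ge>N. \<forall>n\<ge>N. nrm X (\<lambda>t. u m t - u n t) < e) \<longrightarrow>
        (\<exists>l\<in>elts X. (\<lambda>n. nrm X (\<lambda>t. u n t - l t)) \<longlonglongrightarrow> 0)"
    using bfs unfolding banach_fun_space_def by (elim conjE) assumption
  then show ?thesis using assms by blast
qed

lemma nrm_zero [simp]: "nrm X (\<lambda>t. 0) = 0"
  using nrm_eq_0_iff[OF zero_elts] by simp

lemma diff_elts: 
  assumes "x \<in> elts X" "y \<in> elts X" shows "(\<lambda>t. x t - y t) \<in> elts X"
  using add_elts[OF assms(1) scale_elts[OF assms(2), of "-1"]] by simp

lemma nrm_diff: 
  assumes "x \<in> elts X" "y \<in> elts X" shows "nrm X (\<lambda>t. x t - y t) \<le> nrm X x + nrm X y"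
  using nrm_triangle[OF assms(1) scale_elts[OF assms(2), of "-1"]] nrm_scale[OF assms(2), of "-1"] by simp

lemma ideal_elts: "y \<in> elts X \<Longrightarrow> x \<in> BM \<Longrightarrow> AE t in I01. \<bar>x t\<bar> \<le> \<bar>y t\<bar> \<Longrightarrow> x \<in> elts X"
  and ideal_nrm: "y \<in> elts X \<Longrightarrow> x \<in> BM \<Longrightarrow> AE t in I01. \<bar>x t\<bar> \<le> \<bar>y t\<bar> \<Longrightarrow> nrm X x \<le> nrm X y"
  using ideal by blast+

lemma nrm_abs: "x \<in> elts X \<Longrightarrow> (\<lambda>t. \<bar>x t\<bar>) \<in> elts X \<and> nrm X (\<lambda>t. \<bar>x t\<bar>) = nrm X x"
proof -
  assume x: "x \<in> elts X"
  have 1: "(\<lambda>t. \<bar>x t\<bar>) \<in> elts X \<and> nrm X (\<lambda>t. \<bar>x t\<bar>) \<le> nrm X x"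
    using elts_BM[OF x] by (intro ideal[OF x]) auto
  moreover have "nrm X x \<le> nrm X (\<lambda>t. \<bar>x t\<bar>)"
    using elts_BM[OF x] 1 by (intro ideal_nrm) auto
  ultimately show ?thesis by auto
qed

lemma abs_iff: "x \<in> BM \<Longrightarrow> (\<lambda>t. \<bar>x t\<bar>) \<in> elts X \<longleftrightarrow> x \<in> elts X"
  using nrm_abs ideal_elts[of "\<lambda>t. \<bar>x t\<bar>" x] by auto

lemma sum_elts:
  assumes "\<And>j. j \<in> J \<Longrightarrow> f j \<in> elts X"
  shows "(\<lambda>t. \<Sum>j\<in>J. f j t) \<in> elts X" "nrm X (\<lambda>t. \<Sum>j\<in>J. f j t) \<le> (\<Sum>j\<in>J. nrm X (f j))"
proof -
  have "(\<lambda>t. \<Sum>j\<in>J. f j t) \<in> elts X \<and> nrm X (\<lambda>t. \<Sum>j\<in>J. f j t) \<le> (\<Sum>j\<in>J. nrm X (f j))"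
    using assms
  proof (induction J rule: infinite_finite_induct)
    case (insert j J)
    then have *: "f j \<in> elts X" "(\<lambda>t. \<Sum>j\<in>J. f j t) \<in> elts X"
      "nrm X (\<lambda>t. \<Sum>j\<in>J. f j t) \<le> (\<Sum>j\<in>J. nrm X (f j))" by auto
    show ?case using add_elts[OF *(1,2)] nrm_triangle[OF *(1,2)] *(3) insert(1,2) by auto
  qed auto
  then show "(\<lambda>t. \<Sum>j\<in>J. f j t) \<in> elts X" "nrm X (\<lambda>t. \<Sum>j\<in>J. f j t) \<le> (\<Sum>j\<in>J. nrm X (f j))"
    by auto
qed

lemma mult_elts:
  assumes "x \<in> elts X" "g \<in> BM" "\<And>t. t \<in> {0..1} \<Longrightarrow> \<bar>g t\<bar> \<le> c" 
  shows "(\<lambda>t. g t * x t) \<in> elts X" "nrm X (\<lambda>t. g t * x t) \<le> c * nrm X x"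
proof -
  have c: "0 \<le> c" using assms(3)[of 0] by force
  have "AE t in I01. \<bar>g t * x t\<bar> \<le> \<bar>c * x t\<bar>"
    using assms(3) c by (intro AE_I2) (auto simp: abs_mult intro: mult_right_mono)
  then have "(\<lambda>t. g t * x t) \<in> elts X \<and> nrm X (\<lambda>t. g t * x t) \<le> nrm X (\<lambda>t. c * x t)"
    using assms elts_BM by (intro ideal[OF scale_elts[OF assms(1)]]) auto
  then show "(\<lambda>t. g t * x t) \<in> elts X" "nrm X (\<lambda>t. g t * x t) \<le> c * nrm X x"
    using nrm_scale[OF assms(1), of c] c by auto
qed

lemma indicator_elts:
  assumes "x \<in> elts X" "A \<in> sets I01"
  shows "(\<lambda>t. indicator A t * x t) \<in> elts X" "nrm X (\<lambda>t. indicator A t * x t) \<le> nrm X x"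
  using mult_elts[OF assms(1) indicator_BM[OF assms(2)], of 1] by (auto simp: indicator_def)

end

subsection \<open>Symmetric spaces\<close>

locale sym_space =
  fixes X :: fun_space
  assumes sym: "symmetric_space X"

sublocale sym_space \<subseteq> fun_lattice X
proof unfold_locales
  show "banach_fun_space X"
    using sym unfolding symmetric_space_def by (rule conjunct1)
  have "\<forall>y\<in>elts X. \<forall>x\<in>BM. (AE t in I01. \<bar>x t\<bar> \<le> \<bar>y t\<bar>) \<longrightarrow> x \<in> elts X \<and> nrm X x \<le> nrm X y"
    using sym unfolding symmetric_space_def by (elim conjE) assumption
  then show "x \<in> elts X \<and> nrm X x \<le> nrm X y"
    if "y \<in> elts X" "x \<in> BM" "AE t in I01. \<bar>x t\<bar> \<le> \<bar>y t\<bar>" for x y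
    using that by blast
qed

context sym_space
begin

lemma equimeasurable:
  assumes "x \<in> elts X" "y \<in> BM" "\<And>l. 0 \<le> l \<Longrightarrow> distr_fun y l = distr_fun x l"
  shows "y \<in> elts X" "nrm X y = nrm X x"
proof -
  have "\<forall>x\<in>elts X. \<forall>y\<in>BM. (\<forall>l\<ge>0. distr_fun y l = distr_fun x l) \<longrightarrow> y \<in> elts X \<and> nrm X y = nrm X x"
    using sym unfolding symmetric_space_def by (elim conjE) assumption
  then show "y \<in> elts X" "nrm X y = nrm X x" using assms by blast+
qed

lemma rearr_elts: 
  assumes "x \<in> elts X" shows "rearr x \<in> elts X" "nrm X (rearr x) = nrm X x"
  using equimeasurable[OF assms rearr_BM[OF elts_BM[OF assms]]] distr_rearr[OF elts_BM[OF assms]] by auto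

lemma rearr_eltsD: 
  assumes "x \<in> BM" "rearr x \<in> elts X" shows "x \<in> elts X" "nrm X (rearr x) = nrm X x"
  using equimeasurable[OF assms(2,1)] distr_rearr[OF assms(1)] by auto

text \<open>Passing to rearrangements turns an inequality of distribution functions into a pointwise
  one, to which the ideal property applies.\<close>

lemma distr_ideal:
  assumes x: "x \<in> elts X" and y: "y \<in> BM" and d: "\<And>l. 0 \<le> l \<Longrightarrow> distr_fun y l \<le> distr_fun x l"
  shows "y \<in> elts X" "nrm X y \<le> nrm X x"
proof -
  have "AE t in I01. \<bar>rearr y t\<bar> \<le> \<bar>rearr x t\<bar>"
    using rearrangement_mono[OF y elts_BM[OF x] _ d] y elts_BM[OF x]
    by (intro AE_I2) (simp add: rearr_def rearrangement_nonneg)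
  then have *: "rearr y \<in> elts X \<and> nrm X (rearr y) \<le> nrm X (rearr x)"
    by (intro ideal rearr_elts x rearr_BM y)
  then show "y \<in> elts X" using rearr_eltsD[OF y] by blast
  then show "nrm X y \<le> nrm X x" using * rearr_elts[OF x] rearr_elts[of y] by simp
qed

text \<open>Two copies of the rearrangement, both cut off at length 1/2 and one shifted by 1/2,
  double every superlevel set until the interval is full. Each copy has norm at most that of
  x.\<close>

lemma doubling:
  assumes x: "x \<in> elts X"
  shows "\<exists>z\<in>elts X. nrm X z \<le> 2 * nrm X x \<and> (\<forall>l\<ge>0. distr_fun z l = min 1 (2 * distr_fun x l))"
proof -
  define f where "f t = rearr x t * indicator {0<..1/2} t" for t :: real
  define g where "g t = rearr x (t - 1/2) * indicator {1/2<..1} t" for t :: real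
  have xb: "x \<in> BM" by (rule elts_BM[OF x])
  have [simp]: "rearr x t \<ge> 0" for t using xb by simp
  have S: "l < rearr x t \<longleftrightarrow> 0 < t \<and> t < distr_fun x l" if "t \<in> {0..1}" "0 \<le> l" for t l
  proof -
    have "t \<in> {t \<in> {0..1}. l < rearr x t} \<longleftrightarrow> t \<in> {0<..<distr_fun x l}"
      by (simp only: rearr_gt_set[OF xb that(2)])
    then show ?thesis using that(1) by simp
  qed
  have F: "{t \<in> {0..1}. l < f t} = {0<..<distr_fun x l} \<inter> {0<..1/2}" if l: "0 \<le> l" for l
  proof (rule set_eqI)
    fix t
    show "t \<in> {t \<in> {0..1}. l < f t} \<longleftrightarrow> t \<in> {0<..<distr_fun x l} \<inter> {0<..1/2}"
    proof (cases "0 < t \<and> t \<le> 1/2")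
      case True
      then have "f t = rearr x t" by (simp add: f_def)
      then show ?thesis using True S[of t l] l by simp
    next
      case False
      then have "f t = 0" by (simp add: f_def indicator_def)
      then show ?thesis using False l by simp
    qed
  qed
  have G: "{t \<in> {0..1}. l < g t} = {1/2<..<1/2 + distr_fun x l} \<inter> {1/2<..1}" if l: "0 \<le> l" for l
  proof (rule set_eqI)
    fix t
    show "t \<in> {t \<in> {0..1}. l < g t} \<longleftrightarrow> t \<in> {1/2<..<1/2 + distr_fun x l} \<inter> {1/2<..1}"
    proof (cases "1/2 < t \<and> t \<le> 1")
      case True
      then have "g t = rearr x (t - 1/2)" by (simp add: g_def)
      then show ?thesis using True S[of "t - 1/2" l] l by (simp add: less_diff_eq diff_less_eq add.commute)
    next
      case False
      then have "g t = 0" by (simp add: g_def indicator_def)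
      then show ?thesis using False l by simp
    qed
  qed
  have meas: "h \<in> BM" if "\<And>t. 0 \<le> h t" "\<And>l. 0 \<le> l \<Longrightarrow> {t \<in> {0..1}. l < h t} \<in> sets I01" for h
    unfolding borel_measurable_iff_greater
  proof
    fix l
    show "{t \<in> space I01. l < h t} \<in> sets I01"
    proof (cases "0 \<le> l")
      case False
      then have "l < h t" for t using that(1)[of t] by linarith
      then have "{t \<in> space I01. l < h t} = space I01" by blast
      then show ?thesis by (metis sets.top)
    qed (use that in simp)
  qed
  have mf: "f \<in> BM" 
  proof (rule meas)
    fix l :: real assume "0 \<le> l"
    have "{0<..<distr_fun x l} \<in> sets I01" "{0<..1/2::real} \<in> sets I01"
      using distr_le_1[of x l] by (intro ivl_sets_I01; simp)+
    then show "{t \<in> {0..1}. l < f t} \<in> sets I01" unfolding F[OF \<open>0 \<le> l\<close>] by (rule sets.Int)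
  qed (simp add: f_def)
  have mg: "g \<in> BM" 
  proof (rule meas)
    fix l :: real assume "0 \<le> l"
    have "{1/2<..<1/2 + distr_fun x l} \<inter> {1/2<..1} = {1/2<..<1/2 + distr_fun x l} \<inter> {1/2<..1::real} \<inter> {0..1}"
      by auto
    then show "{t \<in> {0..1}. l < g t} \<in> sets I01" unfolding G[OF \<open>0 \<le> l\<close>]
      by (auto simp: sets_I01_iff)
  qed (auto simp: g_def)
  define z where "z t = f t + g t" for t
  have fe: "f \<in> elts X" "nrm X f \<le> nrm X x"
  proof -
    have "distr_fun f l \<le> distr_fun x l" if "0 \<le> l" for l
    proof -
      have "distr_fun f l = measure I01 ({0<..<distr_fun x l} \<inter> {0<..1/2})"
        using F[OF that] by (simp add: distr_fun_def f_def)
      also have "\<dots> \<le> measure I01 {0<..<distr_fun x l}"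
        by (rule I.finite_measure_mono) (simp_all add: ivl_sets_I01)
      finally show ?thesis by (simp add: ivl_measure_I01)
    qed
    then show "f \<in> elts X" "nrm X f \<le> nrm X x" using distr_ideal[OF x mf] by auto
  qed
  have Gm: "measure I01 ({1/2<..<1/2 + distr_fun x l} \<inter> {1/2<..1}) = min (1/2) (distr_fun x l)" for l
  proof (cases "distr_fun x l \<le> 1/2")
    case True
    then have "{1/2<..<1/2 + distr_fun x l} \<inter> {1/2<..1} = {1/2<..<1/2 + distr_fun x l}" by auto
    then show ?thesis using True ivl_measure_I01(4)[of "1/2" "1/2 + distr_fun x l"] by simp
  next
    case False
    then have "{1/2<..<1/2 + distr_fun x l} \<inter> {1/2<..1} = {1/2<..1}" by auto
    then show ?thesis using False ivl_measure_I01(2)[of "1/2" 1] by simp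
  qed
  have Fm: "measure I01 ({0<..<distr_fun x l} \<inter> {0<..1/2}) = min (1/2) (distr_fun x l)" for l
  proof (cases "distr_fun x l \<le> 1/2")
    case True
    then have "{0<..<distr_fun x l} \<inter> {0<..1/2} = {0<..<distr_fun x l}" by auto
    then show ?thesis using True ivl_measure_I01(4)[of 0 "distr_fun x l"] by simp
  next
    case False
    then have "{0<..<distr_fun x l} \<inter> {0<..1/2} = {0<..1/2}" by auto
    then show ?thesis using False ivl_measure_I01(2)[of 0 "1/2"] by simp
  qed
  have ge: "g \<in> elts X" "nrm X g \<le> nrm X x"
  proof -
    have "distr_fun g l \<le> distr_fun x l" if "0 \<le> l" for l
    proof -
      have "distr_fun g l = measure I01 ({1/2<..<1/2 + distr_fun x l} \<inter> {1/2<..1})"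
        using G[OF that] by (simp add: distr_fun_def g_def)
      then show ?thesis by (simp add: Gm)
    qed
    then show "g \<in> elts X" "nrm X g \<le> nrm X x" using distr_ideal[OF x mg] by auto
  qed
  have ze: "z \<in> elts X" "nrm X z \<le> 2 * nrm X x"
    using add_elts[OF fe(1) ge(1)] nrm_triangle[OF fe(1) ge(1)] fe ge by (auto simp: z_def[abs_def])
  have "distr_fun z l = min 1 (2 * distr_fun x l)" if "0 \<le> l" for l
  proof -
    have zU: "{t \<in> {0..1}. l < \<bar>z t\<bar>} = {t \<in> {0..1}. l < f t} \<union> {t \<in> {0..1}. l < g t}"
      using that by (auto simp: z_def f_def g_def indicator_def split: if_splits)
    have fg: "measure I01 ({t \<in> {0..1}. l < f t} \<union> {t \<in> {0..1}. l < g t})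
      = measure I01 {t \<in> {0..1}. l < f t} + measure I01 {t \<in> {0..1}. l < g t}"
    proof (rule I.finite_measure_Union)
      have "{t \<in> {0..1}. l < f t} = {t \<in> {0..1}. \<bar>f t\<bar> > l}" by (simp add: f_def)
      then show "{t \<in> {0..1}. l < f t} \<in> sets I01" using distr_set[OF mf, of l] by simp
      have "{t \<in> {0..1}. l < g t} = {t \<in> {0..1}. \<bar>g t\<bar> > l}" by (simp add: g_def)
      then show "{t \<in> {0..1}. l < g t} \<in> sets I01" using distr_set[OF mg, of l] by simp
      show "{t \<in> {0..1}. l < f t} \<inter> {t \<in> {0..1}. l < g t} = {}"
        unfolding F[OF that] G[OF that] by auto
    qed
    have "measure I01 {t \<in> {0..1}. l < f t} = min (1/2) (distr_fun x l)"
      by (subst F[OF that]) (rule Fm)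
    moreover have "measure I01 {t \<in> {0..1}. l < g t} = min (1/2) (distr_fun x l)"
      by (subst G[OF that]) (rule Gm)
    ultimately have "distr_fun z l = min (1/2) (distr_fun x l) + min (1/2) (distr_fun x l)"
      by (simp only: distr_fun_def[of z] zU fg)
    then show ?thesis by linarith
  qed
  then show ?thesis using ze by blast
qed

text \<open>Iterated doubling: enlarging superlevel sets by a bounded factor costs a bounded factor
  in the norm. Powers of 2 are enough because exact constants do not matter.\<close>

lemma distr_pow2:
  assumes x: "x \<in> elts X" and y: "y \<in> BM" 
    and d: "\<And>l. 0 \<le> l \<Longrightarrow> distr_fun y l \<le> 2 ^ k * distr_fun x l"
  shows "y \<in> elts X" "nrm X y \<le> 2 ^ k * nrm X x"
proof -
  have "y \<in> elts X \<and> nrm X y \<le> 2 ^ k * nrm X x"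
    using x d
  proof (induction k arbitrary: x)
    case 0
    then show ?case using distr_ideal[OF _ y, of x] by auto
  next
    case (Suc k)
    obtain z where z: "z \<in> elts X" "nrm X z \<le> 2 * nrm X x"
      "\<And>l. l \<ge> 0 \<Longrightarrow> distr_fun z l = min 1 (2 * distr_fun x l)"
      using doubling[OF Suc(2)] by blast
    have "distr_fun y l \<le> 2 ^ k * distr_fun z l" if "0 \<le> l" for l
    proof (cases "1 \<le> 2 * distr_fun x l")
      case True
      then have "distr_fun z l = 1" using z(3)[OF that] by simp
      moreover have "distr_fun y l \<le> 2 ^ k"
        by (rule order_trans[OF distr_le_1]) simp
      ultimately show ?thesis by simp
    next
      case False
      then have "distr_fun z l = 2 * distr_fun x l" using z(3)[OF that] by simp
      then show ?thesis using Suc(3)[OF that] by (simp add: mult_ac)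
    qed
    then have "y \<in> elts X \<and> nrm X y \<le> 2 ^ k * nrm X z" using Suc(1)[OF z(1)] by blast
    moreover have "2 ^ k * nrm X z \<le> 2 ^ k * (2 * nrm X x)" using z(2) by simp
    ultimately show ?case by (auto simp: mult_ac intro: order_trans)
  qed
  then show "y \<in> elts X" "nrm X y \<le> 2 ^ k * nrm X x" by auto
qed

end

subsection \<open>Step functions\<close>

definition step :: "'i set \<Rightarrow> ('i \<Rightarrow> real) \<Rightarrow> ('i \<Rightarrow> real set) \<Rightarrow> real \<Rightarrow> real" where
  "step J c B t = (\<Sum>j\<in>J. c j * indicator (B j) t)"

definition disj_fam :: "'i set \<Rightarrow> ('i \<Rightarrow> real) \<Rightarrow> ('i \<Rightarrow> real set) \<Rightarrow> bool" where
  "disj_fam J \<tau> B \<longleftrightarrow> (\<forall>j\<in>J. B j \<in> sets I01 \<and> measure I01 (B j) = \<tau> j) \<and> disjoint_family_on B J"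

lemma disj_fam_subset: "disj_fam J \<tau> B \<Longrightarrow> K \<subseteq> J \<Longrightarrow> disj_fam K \<tau> B"
  unfolding disj_fam_def by (meson disjoint_family_on_mono subsetD)

lemma disj_fam_sets: "disj_fam J \<tau> B \<Longrightarrow> j \<in> J \<Longrightarrow> B j \<in> sets I01"
  by (simp add: disj_fam_def)

lemma step_BM: "disj_fam J \<tau> B \<Longrightarrow> step J c B \<in> BM"
  unfolding step_def[abs_def] disj_fam_def by (intro borel_measurable_sum) auto

lemma step_in:
  assumes "finite J" "disjoint_family_on B J" "j \<in> J" "t \<in> B j"
  shows "step J c B t = c j"
proof -
  have "indicator (B i) t = (if i = j then 1 else 0 :: real)" if "i \<in> J" for i
    using assms that by (auto simp: disjoint_family_on_def indicator_def)
  then have "step J c B t = (\<Sum>i\<in>J. c i * (if i = j then 1 else 0))"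
    unfolding step_def by (intro sum.cong) auto
  then show ?thesis using assms by (simp add: if_distrib[of "(*) _"] cong: if_cong)
qed

lemma step_out: "(\<And>j. j \<in> J \<Longrightarrow> t \<notin> B j) \<Longrightarrow> step J c B t = 0"
  unfolding step_def by (intro sum.neutral) auto

lemma step_abs_le:
  assumes "finite J" "disjoint_family_on B J" "\<And>j. j \<in> J \<Longrightarrow> \<bar>c j\<bar> \<le> \<bar>d j\<bar>"
  shows "\<bar>step J c B t\<bar> \<le> \<bar>step J d B t\<bar>"
proof (cases "\<exists>j\<in>J. t \<in> B j")
  case True
  then obtain j where "j \<in> J" "t \<in> B j" by blast
  then show ?thesis using step_in[OF assms(1,2)] assms(3) by auto
qed (auto simp: step_out)

text \<open>The right-hand side does not mention the sets, so in a symmetric space the norm of a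
  step function depends only on heights and sizes.\<close>

lemma distr_step:
  assumes J: "finite J" and B: "disj_fam J \<tau> B" and l: "0 \<le> l"
  shows "distr_fun (step J c B) l = (\<Sum>j\<in>{j\<in>J. l < \<bar>c j\<bar>}. \<tau> j)"
proof -
  have "{t \<in> {0..1}. \<bar>step J c B t\<bar> > l} = (\<Union>j\<in>{j\<in>J. l < \<bar>c j\<bar>}. B j)"
  proof
    show "{t \<in> {0..1}. \<bar>step J c B t\<bar> > l} \<subseteq> (\<Union>j\<in>{j\<in>J. l < \<bar>c j\<bar>}. B j)"
    proof
      fix t assume "t \<in> {t \<in> {0..1}. \<bar>step J c B t\<bar> > l}"
      then have t: "\<bar>step J c B t\<bar> > l" by auto
      then obtain j where j: "j \<in> J" "t \<in> B j" using l step_out[of J t B c] by force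
      then have "step J c B t = c j" using step_in[OF J] B by (auto simp: disj_fam_def)
      then show "t \<in> (\<Union>j\<in>{j\<in>J. l < \<bar>c j\<bar>}. B j)" using j t by auto
    qed
    show "(\<Union>j\<in>{j\<in>J. l < \<bar>c j\<bar>}. B j) \<subseteq> {t \<in> {0..1}. \<bar>step J c B t\<bar> > l}"
    proof
      fix t assume "t \<in> (\<Union>j\<in>{j\<in>J. l < \<bar>c j\<bar>}. B j)"
      then obtain j where j: "j \<in> J" "t \<in> B j" "l < \<bar>c j\<bar>" by auto
      then have "step J c B t = c j" using step_in[OF J] B by (auto simp: disj_fam_def)
      moreover have "t \<in> {0..1}" using sets_I01_subset[OF disj_fam_sets[OF B j(1)]] j by auto
      ultimately show "t \<in> {t \<in> {0..1}. \<bar>step J c B t\<bar> > l}" using j by auto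
    qed
  qed
  moreover have "measure I01 (\<Union>j\<in>{j\<in>J. l < \<bar>c j\<bar>}. B j) = (\<Sum>j\<in>{j\<in>J. l < \<bar>c j\<bar>}. measure I01 (B j))"
    using J B by (intro I.finite_measure_finite_Union) (auto simp: disj_fam_def disjoint_family_on_def)
  moreover have "\<dots> = (\<Sum>j\<in>{j\<in>J. l < \<bar>c j\<bar>}. \<tau> j)"
    using B by (intro sum.cong) (auto simp: disj_fam_def)
  ultimately show ?thesis by (simp add: distr_fun_def)
qed

lemma disj_fam_sum_le_1: 
  assumes J: "finite J" and B: "disj_fam J \<tau> B" shows "(\<Sum>j\<in>J. \<tau> j) \<le> 1"
  using distr_step[OF J B, of 0 "\<lambda>_. 1"] distr_le_1[of "step J (\<lambda>_. 1) B" 0] by simp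

lemma disj_fam_exists:
  assumes "finite J" "\<And>j. j \<in> J \<Longrightarrow> 0 \<le> \<tau> j" "(\<Sum>j\<in>J. \<tau> j) \<le> 1"
  shows "\<exists>B. disj_fam J \<tau> B"
  using assms
proof (induction J rule: finite_induct)
  case (insert j J)
  then have le: "(\<Sum>j\<in>J. \<tau> j) \<le> 1" 
  proof -
    have "0 \<le> \<tau> j" by (rule insert.prems(1)) simp
    moreover have "\<tau> j + (\<Sum>j\<in>J. \<tau> j) \<le> 1" using insert.prems(2) insert.hyps by simp
    ultimately show ?thesis by linarith
  qed
  then obtain B where B: "disj_fam J \<tau> B" using insert by auto
  define U where "U = (\<Union>i\<in>J. B i)"
  have U: "U \<in> sets I01" unfolding U_def using insert(1) B by (intro sets.finite_UN) (auto simp: disj_fam_def)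
  have "measure I01 U = (\<Sum>i\<in>J. measure I01 (B i))" unfolding U_def
    using insert(1) B by (intro I.finite_measure_finite_Union) (auto simp: disj_fam_def)
  also have "\<dots> = (\<Sum>i\<in>J. \<tau> i)" using B by (auto simp: disj_fam_def)
  finally have mU: "measure I01 U = (\<Sum>i\<in>J. \<tau> i)" .
  have "measure I01 (space I01 - U) = 1 - (\<Sum>i\<in>J. \<tau> i)"
    using I.prob_compl[OF U] mU by simp
  then obtain A where A: "A \<in> sets I01" "A \<subseteq> space I01 - U" "measure I01 A = \<tau> j"
    using subset_of_measure[of "space I01 - U" "\<tau> j"] U insert by auto
  have "disj_fam (insert j J) \<tau> (B(j := A))"
    using A B insert(2) unfolding disj_fam_def disjoint_family_on_def U_def by auto
  then show ?case by blast
qed (auto simp: disj_fam_def disjoint_family_on_def)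

lemma distr_indicator:
  assumes "A \<in> sets I01" "0 \<le> l"
  shows "distr_fun (indicator A) l = (if l < 1 then measure I01 A else 0)"
proof -
  have "{t \<in> {0..1}. \<bar>indicator A t\<bar> > l} = (if l < 1 then A else {})"
    using sets_I01_subset[OF assms(1)] assms(2) by (auto simp: indicator_def split: if_splits)
  then show ?thesis by (simp add: distr_fun_def)
qed

context sym_space
begin

text \<open>A non-zero element dominates a multiple of the indicator of a set of positive measure,
  and finitely many doublings of that set fill the interval.\<close>

lemma indicator_all: "(indicator {0..1} :: real \<Rightarrow> real) \<in> elts X"
proof -
  obtain x where x: "x \<in> elts X" "\<not> ae_eq x (\<lambda>t. 0)"
    using sym unfolding symmetric_space_def by blast
  have xb: "x \<in> BM" by (rule elts_BM[OF x(1)])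
  have "0 < distr_fun x 0"
  proof (rule ccontr)
    assume "\<not> 0 < distr_fun x 0"
    then have "distr_fun x 0 = 0" using distr_nonneg[of x 0] by linarith
    then have "measure I01 {t \<in> {0..1}. \<bar>x t\<bar> > 0} = 0" by (simp only: distr_fun_def)
    then have "AE t in I01. t \<notin> {t \<in> {0..1}. \<bar>x t\<bar> > 0}"
      using I.prob_eq_0[OF distr_set[OF xb, of 0]] by simp
    then have "AE t in I01. x t = 0" using AE_space by eventually_elim auto
    then show False using x by (simp add: ae_eq_def)
  qed
  then obtain e where e: "e > 0" "0 < distr_fun x e" using distr_right_cont[OF xb, of 0 0] by auto
  define E where "E = {t \<in> {0..1}. \<bar>x t\<bar> > e}"
  have E: "E \<in> sets I01" "measure I01 E > 0" using distr_set[OF xb, of e] e by (auto simp: E_def distr_fun_def)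
  have "(\<lambda>t. e * indicator E t) \<in> elts X"
  proof (rule ideal_elts[OF x(1)])
    show "(\<lambda>t. e * indicator E t) \<in> BM" using E(1) by simp
    show "AE t in I01. \<bar>e * indicator E t\<bar> \<le> \<bar>x t\<bar>"
      using e by (intro AE_I2) (auto simp: E_def indicator_def)
  qed
  then have i: "(\<lambda>t. inverse e * (e * indicator E t)) \<in> elts X" by (rule scale_elts)
  then have i: "(indicator E :: real \<Rightarrow> real) \<in> elts X"
    using e by (simp add: field_simps)
  obtain k where k: "1 / measure I01 E < 2 ^ k" using real_arch_pow[of 2 "1 / measure I01 E"] by auto
  have U: "{0..1::real} \<in> sets I01" by (rule ivl_sets_I01) auto
  have "distr_fun (indicator {0..1}) l \<le> 2 ^ k * distr_fun (indicator E) l" if "0 \<le> l" for l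
    using k E(2) distr_indicator[OF E(1) that] distr_indicator[OF U that] ivl_measure_I01(1)[of 0 1]
    by (simp add: pos_divide_less_eq)
  then show ?thesis by (rule distr_pow2(1)[OF i indicator_BM[OF U]])
qed

lemma indicator_in: "A \<in> sets I01 \<Longrightarrow> (indicator A :: real \<Rightarrow> real) \<in> elts X"
  by (rule ideal_elts[OF indicator_all]) (auto dest: sets_I01_subset simp: indicator_def)

lemma step_elts: "disj_fam J \<tau> B \<Longrightarrow> step J c B \<in> elts X"
  unfolding step_def[abs_def] by (intro sum_elts scale_elts indicator_in) (auto simp: disj_fam_def)

text \<open>By \<open>step_norm_eq\<close> the choice of the family does not matter; the value is junk if there is no family.\<close>

definition step_norm :: "'i set \<Rightarrow> ('i \<Rightarrow> real) \<Rightarrow> ('i \<Rightarrow> real) \<Rightarrow> real" where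
  "step_norm J c \<tau> = nrm X (step J c (SOME B. disj_fam J \<tau> B))"

lemma step_pow2:
  assumes "finite J" "disj_fam J \<tau> B" "disj_fam J \<sigma> A" "\<And>j. j \<in> J \<Longrightarrow> \<sigma> j \<le> 2 ^ k * \<tau> j"
  shows "nrm X (step J c A) \<le> 2 ^ k * nrm X (step J c B)"
proof (rule distr_pow2(2)[OF step_elts step_BM])
  fix l :: real assume l: "0 \<le> l"
  show "distr_fun (step J c A) l \<le> 2 ^ k * distr_fun (step J c B) l"
    unfolding distr_step[OF assms(1,2) l] distr_step[OF assms(1,3) l] sum_distrib_left
    by (intro sum_mono assms(4)) simp
qed (fact assms)+

lemma step_norm_eq:
  assumes "finite J" "disj_fam J \<tau> B"
  shows "step_norm J c \<tau> = nrm X (step J c B)"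
proof -
  have "disj_fam J \<tau> (SOME B. disj_fam J \<tau> B)" using someI[of "disj_fam J \<tau>", OF assms(2)] .
  then show ?thesis unfolding step_norm_def
    using step_pow2[OF assms(1) assms(2), of \<tau> _ 0] step_pow2[OF assms(1) _ assms(2), of \<tau> _ 0] 
    by (intro antisym) auto
qed

lemma step_norm_nonneg:
  assumes "finite J" "\<And>j. j \<in> J \<Longrightarrow> 0 \<le> \<tau> j" "(\<Sum>j\<in>J. \<tau> j) \<le> 1"
  shows "0 \<le> step_norm J c \<tau>"
  using disj_fam_exists[OF assms] step_norm_eq[OF assms(1)] nrm_nonneg[OF step_elts] by metis

lemma step_norm_mono:
  assumes "finite J" "\<And>j. j \<in> J \<Longrightarrow> 0 \<le> \<tau> j" "(\<Sum>j\<in>J. \<tau> j) \<le> 1"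
    and "\<And>j. j \<in> J \<Longrightarrow> \<bar>c j\<bar> \<le> \<bar>d j\<bar>"
  shows "step_norm J c \<tau> \<le> step_norm J d \<tau>"
proof -
  obtain B where B: "disj_fam J \<tau> B" using disj_fam_exists[OF assms(1-3)] by blast
  show ?thesis unfolding step_norm_eq[OF assms(1) B]
    using step_abs_le[OF assms(1) _ assms(4)] B
    by (intro ideal_nrm step_elts[OF B] step_BM[OF B]) (auto simp: disj_fam_def)
qed

lemma step_norm_pow2:
  assumes "finite J" "\<And>j. j \<in> J \<Longrightarrow> 0 \<le> \<tau> j" "(\<Sum>j\<in>J. \<tau> j) \<le> 1"
    "\<And>j. j \<in> J \<Longrightarrow> 0 \<le> \<sigma> j" "(\<Sum>j\<in>J. \<sigma> j) \<le> 1" 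
    "\<And>j. j \<in> J \<Longrightarrow> \<sigma> j \<le> 2 ^ k * \<tau> j"
  shows "step_norm J c \<sigma> \<le> 2 ^ k * step_norm J c \<tau>"
proof -
  obtain B where B: "disj_fam J \<tau> B" using disj_fam_exists[OF assms(1-3)] by blast
  obtain A where A: "disj_fam J \<sigma> A" using disj_fam_exists[OF assms(1,4,5)] by blast
  show ?thesis unfolding step_norm_eq[OF assms(1) A] step_norm_eq[OF assms(1) B]
    by (rule step_pow2[OF assms(1) B A assms(6)])
qed

lemma step_norm_mono_measure:
  assumes "finite J" "\<And>j. j \<in> J \<Longrightarrow> 0 \<le> \<sigma> j" "\<And>j. j \<in> J \<Longrightarrow> \<sigma> j \<le> \<tau> j" "(\<Sum>j\<in>J. \<tau> j) \<le> 1"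
  shows "step_norm J c \<sigma> \<le> step_norm J c \<tau>"
proof -
  have "(\<Sum>j\<in>J. \<sigma> j) \<le> 1" using sum_mono[of J \<sigma> \<tau>] assms by force
  moreover have "0 \<le> \<tau> j" if "j \<in> J" for j using assms(2,3)[OF that] by simp
  ultimately show ?thesis using step_norm_pow2[of J \<tau> \<sigma> 0 c] assms by simp
qed

lemma step_norm_scale:
  assumes "finite J" "\<And>j. j \<in> J \<Longrightarrow> 0 \<le> \<tau> j" "(\<Sum>j\<in>J. \<tau> j) \<le> 1"
  shows "step_norm J (\<lambda>j. k * c j) \<tau> = \<bar>k\<bar> * step_norm J c \<tau>"
proof -
  obtain B where B: "disj_fam J \<tau> B" using disj_fam_exists[OF assms] by blast
  have "step J (\<lambda>j. k * c j) B = (\<lambda>t. k * step J c B t)"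
    by (simp add: step_def fun_eq_iff sum_distrib_left mult.assoc)
  then show ?thesis unfolding step_norm_eq[OF assms(1) B] using nrm_scale[OF step_elts[OF B]] by metis
qed

lemma step_norm_Un_le:
  assumes J: "finite J" "\<And>j. j \<in> J \<Longrightarrow> 0 \<le> \<tau> j" "(\<Sum>j\<in>J. \<tau> j) \<le> 1" and "J = K \<union> L" "K \<inter> L = {}"
  shows "step_norm J c \<tau> \<le> step_norm K c \<tau> + step_norm L c \<tau>"
proof -
  obtain B where B: "disj_fam J \<tau> B" using disj_fam_exists[OF J] by blast
  have BK: "disj_fam K \<tau> B" "disj_fam L \<tau> B" and f: "finite K" "finite L" using disj_fam_subset[OF B] assms by auto
  have "step J c B = (\<lambda>t. step K c B t + step L c B t)"
    unfolding step_def assms(4) fun_eq_iff by (intro allI sum.union_disjoint f assms(5))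
  then show ?thesis
    unfolding step_norm_eq[OF J(1) B] step_norm_eq[OF f(1) BK(1)] step_norm_eq[OF f(2) BK(2)]
    using nrm_triangle[OF step_elts[OF BK(1)] step_elts[OF BK(2)]] by metis
qed

lemma step_norm_subset:
  assumes J: "finite J" "\<And>j. j \<in> J \<Longrightarrow> 0 \<le> \<tau> j" "(\<Sum>j\<in>J. \<tau> j) \<le> 1" and "K \<subseteq> J"
  shows "step_norm K c \<tau> \<le> step_norm J c \<tau>"
proof -
  obtain B where B: "disj_fam J \<tau> B" using disj_fam_exists[OF J] by blast
  have BK: "disj_fam K \<tau> B" and f: "finite K" using disj_fam_subset[OF B] assms finite_subset by auto
  have dJ: "disjoint_family_on B J" and dK: "disjoint_family_on B K" using B BK by (auto simp: disj_fam_def)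
  have "\<bar>step K c B t\<bar> \<le> \<bar>step J c B t\<bar>" for t
  proof (cases "\<exists>j\<in>K. t \<in> B j")
    case True
    then obtain j where "j \<in> K" "t \<in> B j" by blast
    then show ?thesis using step_in[OF f dK] step_in[OF J(1) dJ] assms(4) by (metis order_refl subsetD)
  qed (auto simp: step_out)
  then show ?thesis unfolding step_norm_eq[OF J(1) B] step_norm_eq[OF f BK]
    by (intro ideal_nrm step_elts[OF B] step_BM[OF BK]) auto
qed

lemma step_norm_reindex:
  assumes f: "inj_on f J" and J: "finite J" "\<And>j. j \<in> J \<Longrightarrow> 0 \<le> \<tau> (f j)" "(\<Sum>j\<in>J. \<tau> (f j)) \<le> 1"
  shows "step_norm (f ` J) c \<tau> = step_norm J (\<lambda>j. c (f j)) (\<lambda>j. \<tau> (f j))"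
proof -
  obtain B where B: "disj_fam (f ` J) \<tau> B" using disj_fam_exists[of "f ` J" \<tau>] J f by (auto simp: sum.reindex)
  then have B': "disj_fam J (\<lambda>j. \<tau> (f j)) (\<lambda>j. B (f j))"
    using f unfolding disj_fam_def disjoint_family_on_def by (metis imageI inj_on_contraD)
  have "step (f ` J) c B = step J (\<lambda>j. c (f j)) (\<lambda>j. B (f j))"
    unfolding step_def fun_eq_iff using f by (simp add: sum.reindex)
  then show ?thesis using step_norm_eq[OF _ B] step_norm_eq[OF J(1) B'] J by simp
qed

lemma step_norm_cong:
  assumes J: "finite J" "\<And>j. j \<in> J \<Longrightarrow> 0 \<le> \<tau> j" "(\<Sum>j\<in>J. \<tau> j) \<le> 1" 
    and "\<And>j. j \<in> J \<Longrightarrow> c j = d j" "\<And>j. j \<in> J \<Longrightarrow> \<tau> j = \<sigma> j"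
  shows "step_norm J c \<tau> = step_norm J d \<sigma>"
proof -
  obtain B where B: "disj_fam J \<tau> B" using disj_fam_exists[OF J] by blast
  then have B': "disj_fam J \<sigma> B" using assms(5) by (auto simp: disj_fam_def)
  have "step J c B = step J d B" unfolding step_def fun_eq_iff using assms(4) by auto
  then show ?thesis unfolding step_norm_eq[OF J(1) B] step_norm_eq[OF J(1) B'] by simp
qed

definition fund :: "real \<Rightarrow> real" where "fund t = nrm X (indicator {0..t})"

lemma nrm_indicator:
  assumes A: "A \<in> sets I01" 
  shows "nrm X (indicator A) = fund (measure I01 A)"
  unfolding fund_def
proof (rule equimeasurable(2))
  let ?C = "{0..measure I01 A}"
  have C: "?C \<in> sets I01" by (rule ivl_sets_I01) auto
  show "indicator ?C \<in> elts X" by (rule indicator_in[OF C])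
  fix l :: real assume "0 \<le> l"
  then show "distr_fun (indicator A) l = distr_fun (indicator ?C) l"
    using distr_indicator[OF A] distr_indicator[OF C] ivl_measure_I01(1)[of 0 "measure I01 A"] by simp
qed (use A in auto)

lemma step_norm_const:
  assumes J: "finite J" "\<And>j. j \<in> J \<Longrightarrow> 0 \<le> \<tau> j" "(\<Sum>j\<in>J. \<tau> j) \<le> 1"
  shows "step_norm J (\<lambda>j. k) \<tau> = \<bar>k\<bar> * fund (\<Sum>j\<in>J. \<tau> j)"
proof -
  obtain B where B: "disj_fam J \<tau> B" using disj_fam_exists[OF J] by blast
  have U: "(\<Union>j\<in>J. B j) \<in> sets I01" using B J by (intro sets.finite_UN) (auto simp: disj_fam_def)
  have "measure I01 (\<Union>j\<in>J. B j) = (\<Sum>j\<in>J. measure I01 (B j))"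
    using J(1) B by (intro I.finite_measure_finite_Union) (auto simp: disj_fam_def)
  also have "\<dots> = (\<Sum>j\<in>J. \<tau> j)" using B by (auto simp: disj_fam_def)
  finally have m: "measure I01 (\<Union>j\<in>J. B j) = (\<Sum>j\<in>J. \<tau> j)" .
  have "step J (\<lambda>j. k) B = (\<lambda>t. k * indicator (\<Union>j\<in>J. B j) t)"
    unfolding step_def fun_eq_iff using J(1) B
    by (auto simp: indicator_UN_disjoint disj_fam_def sum_distrib_left)
  then show ?thesis unfolding step_norm_eq[OF J(1) B] using nrm_scale[OF indicator_in[OF U]] nrm_indicator[OF U] m by metis
qed

lemma fund_nonneg: "t \<in> {0..1} \<Longrightarrow> 0 \<le> fund t"
  unfolding fund_def by (intro nrm_nonneg indicator_in ivl_sets_I01) auto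

lemma fund_mono: "0 \<le> s \<Longrightarrow> s \<le> t \<Longrightarrow> t \<le> 1 \<Longrightarrow> fund s \<le> fund t"
  unfolding fund_def by (intro ideal_nrm indicator_in indicator_BM ivl_sets_I01) (auto simp: indicator_def)

lemma fund_0: "fund 0 = 0"
  using nrm_indicator[of "{}"] by (simp add: indicator_def[abs_def])

lemma fund_pos: 
  assumes "0 < t" "t \<le> 1" shows "0 < fund t"
proof -
  have A: "{0..t} \<in> sets I01" using assms by (intro ivl_sets_I01) auto
  have "fund t \<noteq> 0"
  proof
    assume "fund t = 0"
    then have "AE s in I01. indicator {0..t} s = (0::real)"
      using nrm_eq_0_iff[OF indicator_in[OF A]] by (simp add: fund_def ae_eq_def)
    then have "AE s in I01. s \<notin> {0..t}" by eventually_elim (auto simp: indicator_def)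
    then have "measure I01 {0..t} = 0" using I.prob_eq_0[OF A] by simp
    then show False using assms ivl_measure_I01(1)[of 0 t] by simp
  qed
  then show ?thesis using fund_nonneg[of t] assms by auto
qed

lemma fund_pow2:
  assumes "0 \<le> s" "s \<le> 1" "0 \<le> t" "t \<le> 1" "t \<le> 2 ^ k * s"
  shows "fund t \<le> 2 ^ k * fund s"
  using step_norm_pow2[of "{()}" "\<lambda>_. s" "\<lambda>_. t" k "\<lambda>_. 1"] step_norm_const[of "{()}" "\<lambda>_. s" 1] step_norm_const[of "{()}" "\<lambda>_. t" 1] assms
  by simp

end

subsection \<open>Boyd indices and the fundamental function\<close>

text \<open>Iteration gives \<open>\<bar>f (n * m) - m * f n\<bar> \<le> m * K\<close>. Evaluating f
  at the product in both ways shows that every \<open>(f n - K) / n\<close> lies under every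
  \<open>(f m + K) / m\<close>; a number between these two families is the slope.\<close>

lemma quasi_additive:
  fixes f :: "nat \<Rightarrow> real"
  assumes K: "\<And>m n. \<bar>f (m + n) - f m - f n\<bar> \<le> K"
  shows "\<exists>\<theta>. \<forall>n. \<bar>f n - real n * \<theta>\<bar> \<le> K"
proof -
  have A: "\<bar>f (n * Suc m) - real (Suc m) * f n\<bar> \<le> real (Suc m) * K" for n m
  proof (induction m)
    case 0
    have "0 \<le> K" using K[of 0 0] by linarith
    then show ?case by simp
  next
    case (Suc m)
    have "f (n * Suc (Suc m)) = f (n * Suc m + n)" by (simp add: algebra_simps)
    moreover have "real (Suc (Suc m)) * z = real (Suc m) * z + z" for z :: real by (simp add: algebra_simps)
    ultimately show ?case using K[of "n * Suc m" n] Suc by (smt (verit))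
  qed
  have B: "(f n - K) / n \<le> (f m + K) / m" if "0 < n" "0 < m" for m n :: nat
  proof -
    have "\<bar>f (n * m) - real m * f n\<bar> \<le> real m * K" using A[of n "m - 1"] that by simp
    moreover have "\<bar>f (m * n) - real n * f m\<bar> \<le> real n * K" using A[of m "n - 1"] that by simp
    ultimately have "real m * f n - real m * K \<le> real n * f m + real n * K"
      by (simp add: mult.commute[of m n])
    then show ?thesis using that by (simp add: divide_simps algebra_simps)
  qed
  define \<theta> where "\<theta> = (SUP n\<in>{n::nat. 0 < n}. (f n - K) / n)"
  have bdd: "bdd_above ((\<lambda>n. (f n - K) / real n) ` {n. 0 < n})"
    using B[of _ 1] by (intro bdd_aboveI[of _ "(f 1 + K) / real 1"]) auto
  have "\<bar>f n - real n * \<theta>\<bar> \<le> K" for n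
  proof (cases "n = 0")
    case True
    then show ?thesis using K[of 0 0] by simp
  next
    case False
    have "(f n - K) / n \<le> \<theta>" unfolding \<theta>_def using False by (intro cSUP_upper bdd) auto
    moreover have "\<theta> \<le> (f n + K) / n" unfolding \<theta>_def using False
      by (intro cSUP_least) (auto intro: B)
    ultimately show ?thesis using False by (simp add: divide_simps abs_le_iff) (auto simp: algebra_simps)
  qed
  then show ?thesis by blast
qed

text \<open>The ratio is the n-th root of q. Monotonicity bridges the steps that are not a multiple
  of n, at the price of the constant \<open>1 / q\<close>.\<close>

lemma geometric_of_step:
  fixes f :: "nat \<Rightarrow> real"
  assumes pos: "\<And>i. 0 < f i" and mono: "\<And>i j. f (i + j) \<le> f i" and n: "0 < n" and q: "0 < q" "q < 1"
    and step: "\<And>i. f (i + n) \<le> q * f i"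
  shows "\<exists>C r. 0 < C \<and> 0 < r \<and> r < 1 \<and> (\<forall>i j. f (i + j) \<le> C * r ^ j * f i)"
proof -
  define r where "r = root n q"
  have r: "0 < r" "r < 1" "r ^ n = q" unfolding r_def using n q by auto
  have A: "f (i + n * k) \<le> q ^ k * f i" for i k
  proof (induction k)
    case (Suc k)
    have "f (i + n * Suc k) = f (i + n * k + n)" by (simp add: algebra_simps)
    also have "\<dots> \<le> q * f (i + n * k)" by (rule step)
    also have "\<dots> \<le> q * (q ^ k * f i)" using Suc q by (intro mult_left_mono) auto
    finally show ?case by (simp add: mult_ac)
  qed auto
  have "f (i + j) \<le> (1 / q) * r ^ j * f i" for i j
  proof -
    have j: "j = n * (j div n) + j mod n" by simp
    have "f (i + j) \<le> f (i + n * (j div n))"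
      using mono[of "i + n * (j div n)" "j mod n"] j by (metis add.assoc)
    also have "\<dots> \<le> q ^ (j div n) * f i" by (rule A)
    also have "q ^ (j div n) \<le> (1 / q) * r ^ j"
    proof -
      have "r ^ n \<le> r ^ (j mod n)" using r n by (intro power_decreasing) (auto intro: less_imp_le)
      then have "q \<le> r ^ (j mod n)" using r by simp
      then have "q ^ (j div n) * q \<le> q ^ (j div n) * r ^ (j mod n)" using q by (intro mult_left_mono) auto
      also have "\<dots> = r ^ j" using r j by (metis power_add power_mult)
      finally show ?thesis using q by (simp add: field_simps)
    qed
    finally show ?thesis using pos[of i] by (simp add: mult_right_mono)
  qed
  then show ?thesis using r q by (intro exI[of _ "1 / q"] exI[of _ r]) auto
qed

section \<open>Dilations and the dyadic values of the fundamental function\<close>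

context sym_space
begin

lemma dilation_BM:
  assumes x: "x \<in> BM" and T: "0 < T"
  shows "dilation T x \<in> BM"
proof -
  define g where "g s = (if s \<in> {0..1} then x s else 0)" for s
  have "g \<in> borel_measurable lebesgue" unfolding g_def[abs_def]
    using x by (subst borel_measurable_if) auto
  then have "(\<lambda>s. g ((1 / T) *\<^sub>R s)) \<in> borel_measurable lebesgue"
    by (rule measurable_compose[OF lebesgue_measurable_scaling])
  then have "(\<lambda>s. if s / T \<in> {0..1} then x (s / T) else 0) \<in> borel_measurable lebesgue"
    by (simp add: g_def)
  moreover have "dilation T x = (\<lambda>s. if s / T \<in> {0..1} then x (s / T) else 0)"
    by (auto simp: dilation_def fun_eq_iff indicator_def)
  ultimately show ?thesis by (simp add: measurable_restrict_space1)
qed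

text \<open>Only an inequality can hold: for large T a part of the dilated superlevel set leaves
  [0,1].\<close>

lemma distr_dilation:
  assumes x: "x \<in> BM" and T: "0 < T" and l: "0 \<le> l"
  shows "distr_fun (dilation T x) l \<le> T * distr_fun x l"
proof -
  define A where "A = {t \<in> {0..1}. \<bar>x t\<bar> > l}"
  define B where "B = {t \<in> {0..1}. \<bar>dilation T x t\<bar> > l}"
  have A: "A \<in> sets I01" "A \<subseteq> {0..1}" unfolding A_def using distr_set[OF x] by auto
  have "A \<in> lmeasurable"
    using A by (intro bounded_set_imp_lmeasurable bounded_subset[OF bounded_closed_interval, of A 0 1])
      (auto simp: sets_I01_iff)
  then have fA: "emeasure lebesgue A < \<infinity>" "A \<in> sets lebesgue" by (auto simp: fmeasurable_def)
  have TA: "(*\<^sub>R) T ` A \<in> lmeasurable"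
  proof (rule fmeasurableI)
    have "(*\<^sub>R) T ` A = (*\<^sub>R) (1 / T) -` A \<inter> space lebesgue"
    proof
      show "(*\<^sub>R) T ` A \<subseteq> (*\<^sub>R) (1 / T) -` A \<inter> space lebesgue" using T by auto
      show "(*\<^sub>R) (1 / T) -` A \<inter> space lebesgue \<subseteq> (*\<^sub>R) T ` A"
      proof
        fix t assume t: "t \<in> (*\<^sub>R) (1 / T) -` A \<inter> space lebesgue"
        have "t = T *\<^sub>R ((1 / T) *\<^sub>R t)" using T by simp
        then show "t \<in> (*\<^sub>R) T ` A" using t by blast
      qed
    qed
    then show "(*\<^sub>R) T ` A \<in> sets lebesgue"
      using measurable_sets[OF lebesgue_measurable_scaling fA(2), of "1 / T"] by simp
    have "emeasure lebesgue ((*\<^sub>R) T ` A) = ennreal T * emeasure lebesgue A"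
      using emeasure_lebesgue_affine[of T 0 A] T by simp
    then show "emeasure lebesgue ((*\<^sub>R) T ` A) < \<infinity>"
      using fA(1) by (simp add: ennreal_mult_less_top)
  qed
  have "B \<subseteq> (*\<^sub>R) T ` A"
  proof
    fix t assume t: "t \<in> B"
    then have "l < \<bar>dilation T x t\<bar>" by (simp add: B_def)
    then have "t / T \<in> {0..1}" "l < \<bar>x (t / T)\<bar>"
      using l unfolding dilation_def by (cases "t / T \<in> {0..1}"; simp only: indicator_simps mult_zero_right abs_zero mult_1_right)+
    then have "t / T \<in> A" by (simp add: A_def)
    moreover have "t = T *\<^sub>R (t / T)" using T by simp
    ultimately show "t \<in> (*\<^sub>R) T ` A" by blast
  qed
  moreover have "B \<in> sets I01" unfolding B_def by (rule distr_set[OF dilation_BM[OF x T]])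
  ultimately have "measure lebesgue B \<le> measure lebesgue ((*\<^sub>R) T ` A)"
    using TA by (intro measure_mono_fmeasurable) (auto simp: sets_I01_iff)
  also have "\<dots> = T * measure lebesgue A"
    using measure_lebesgue_affine[of T 0 A] T by simp
  finally have "measure lebesgue B \<le> T * measure lebesgue A" .
  moreover have "measure I01 A = measure lebesgue A" by (rule measure_I01[OF A(2)])
  moreover have "measure I01 B = measure lebesgue B" by (rule measure_I01) (auto simp: B_def)
  ultimately show ?thesis unfolding distr_fun_def A_def[symmetric] B_def[symmetric] by simp
qed

lemma dilation_elts:
  assumes x: "x \<in> elts X" and T: "0 < T" "T \<le> 2 ^ k"
  shows "dilation T x \<in> elts X" "nrm X (dilation T x) \<le> 2 ^ k * nrm X x"
proof -
  have *: "distr_fun (dilation T x) l \<le> 2 ^ k * distr_fun x l" if "0 \<le> l" for l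
    using distr_dilation[OF elts_BM[OF x] T(1) that] mult_right_mono[OF T(2) distr_nonneg[of x l]] 
    by linarith
  show "dilation T x \<in> elts X"
    by (rule distr_pow2(1)[OF x dilation_BM[OF elts_BM[OF x] T(1)] *])
  show "nrm X (dilation T x) \<le> 2 ^ k * nrm X x"
    by (rule distr_pow2(2)[OF x dilation_BM[OF elts_BM[OF x] T(1)] *])
qed

text \<open>Boundedness from \<open>dilation_elts\<close> makes the supremum in
  \<open>op_norm\<close> a genuine one; the rest is normalisation.\<close>

lemma op_norm_dilation:
  assumes x: "x \<in> elts X" and T: "0 < T"
  shows "nrm X (dilation T x) \<le> op_norm X (dilation T) * nrm X x"
proof -
  obtain k where "T < 2 ^ k" using real_arch_pow[of 2 T] by auto
  then have k: "T \<le> 2 ^ k" by simp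
  define S where "S = {nrm X (dilation T x) | x. x \<in> elts X \<and> nrm X x \<le> 1}"
  have "v \<le> 2 ^ k" if vS: "v \<in> S" for v
  proof -
    obtain y where y: "v = nrm X (dilation T y)" "y \<in> elts X" "nrm X y \<le> 1"
      using vS by (auto simp: S_def)
    have "nrm X (dilation T y) \<le> 2 ^ k * nrm X y" by (rule dilation_elts(2)[OF y(2) T k])
    also have "\<dots> \<le> 2 ^ k * 1" using y(3) by (intro mult_left_mono) auto
    finally show ?thesis using y by simp
  qed
  then have bdd: "bdd_above S" by (intro bdd_aboveI)
  show ?thesis
  proof (cases "nrm X x = 0")
    case True
    then show ?thesis using dilation_elts(2)[OF x T k] by simp
  next
    case False
    then have pos: "0 < nrm X x" using nrm_nonneg[OF x] by simp
    define y where "y t = inverse (nrm X x) * x t" for t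
    have y: "y \<in> elts X" unfolding y_def[abs_def] by (rule scale_elts[OF x])
    have ny: "nrm X y = 1" unfolding y_def[abs_def] using nrm_scale[OF x] pos by simp
    have dyadic: "dilation T y = (\<lambda>t. inverse (nrm X x) * dilation T x t)"
      by (simp add: dilation_def y_def fun_eq_iff)
    have "nrm X (dilation T y) \<in> S" unfolding S_def using y ny by auto
    then have "nrm X (dilation T y) \<le> op_norm X (dilation T)"
      unfolding op_norm_def S_def[symmetric] by (rule cSup_upper[OF _ bdd])
    then have "inverse (nrm X x) * nrm X (dilation T x) \<le> op_norm X (dilation T)"
      using pos nrm_scale[OF dilation_elts(1)[OF x T k], of "inverse (nrm X x)"] by (simp only: dyadic) simp
    then show ?thesis using pos by (simp only: inverse_eq_divide times_divide_eq_left mult_1_left pos_divide_le_eq)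
  qed
qed

lemma fund_dilation:
  assumes t: "0 < t" "t \<le> 1" and T: "0 < T" "T * t \<le> 1"
  shows "fund (T * t) \<le> op_norm X (dilation T) * fund t"
proof -
  have Tt: "T * t \<le> T" using t T by simp
  have "dilation T (indicator {0..t}) = indicator {0..T * t}"
    using t T order_trans[OF _ Tt] by (auto simp: dilation_def fun_eq_iff indicator_def field_simps)
  moreover have "{0..t} \<in> sets I01" using t by (intro ivl_sets_I01) auto
  ultimately show ?thesis unfolding fund_def using op_norm_dilation[OF indicator_in T(1), of "{0..t}"] by simp
qed

definition psi :: "nat \<Rightarrow> real" where "psi i = fund (1 / 2 ^ i)"

lemma psi_pos [simp]: "0 < psi i"
  unfolding psi_def by (intro fund_pos) auto

lemma psi_antimono: "i \<le> j \<Longrightarrow> psi j \<le> psi i"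
  unfolding psi_def by (intro fund_mono) (auto simp: field_simps power_increasing)

lemma inv_pow2_le_1: "1 / (2::real) ^ i \<le> 1"
  by (simp add: divide_le_eq_1)

lemma psi_doubling: "psi i \<le> 2 ^ j * psi (i + j)"
  unfolding psi_def by (intro fund_pow2 inv_pow2_le_1) (simp_all add: power_add)

text \<open>A positive lower index gives a dilation by some 2^-n with norm under 1, and an upper
  index under 1 gives a dilation by some 2^m with norm under 2^m. Applied to indicators, each yields
  a contraction that \<open>geometric_of_step\<close> turns into a geometric rate.\<close>

lemma boyd_geometric:
  assumes "nontrivial_boyd_indices X"
  shows "\<exists>C r. 0 < C \<and> 0 < r \<and> r < 1 \<and> (\<forall>i j. psi (i + j) \<le> C * r ^ j * psi i) \<and>
    (\<forall>i j. psi i \<le> C * (2 * r) ^ j * psi (i + j))"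
proof -
  obtain \<alpha> \<beta> where ab: "0 < \<alpha>" "\<beta> < 1"
    and l0: "((\<lambda>t. ln (op_norm X (dilation t)) / ln t) \<longlongrightarrow> \<alpha>) (at_right 0)"
    and linf: "((\<lambda>t. ln (op_norm X (dilation t)) / ln t) \<longlongrightarrow> \<beta>) at_top"
    using assms unfolding nontrivial_boyd_indices_def boyd_indices_def by blast
  \<comment> \<open>Positivity keeps the logarithms in the definition of the indices away from their
    junk values.\<close>
  have oppos: "0 < op_norm X (dilation T)" if "0 < T" for T
  proof -
    define t where "t = min 1 (1 / T)"
    have t: "0 < t" "t \<le> 1" "T * t \<le> 1" using that by (auto simp: t_def min_def field_simps)
    have "0 < fund (T * t)" using t that by (intro fund_pos) auto
    then have "0 < op_norm X (dilation T) * fund t" using fund_dilation[OF t(1,2) that t(3)] by linarith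
    then show ?thesis using fund_pos[OF t(1,2)] by (simp add: zero_less_mult_iff)
  qed
  have "eventually (\<lambda>t. \<alpha> / 2 < ln (op_norm X (dilation t)) / ln t) (at_right 0)"
    using ab by (intro order_tendstoD(1)[OF l0]) simp
  then obtain d where d: "d > 0" "\<And>t. 0 < t \<Longrightarrow> t < d \<Longrightarrow> \<alpha> / 2 < ln (op_norm X (dilation t)) / ln t"
    by (auto simp: eventually_at_right_field)
  \<comment> \<open>A dilation by a power of 1/2 acts on \<open>psi\<close> as a shift of the
    index.\<close>
  obtain n where n: "(1/2::real) ^ n < min d 1" using real_arch_pow_inv[of "min d 1" "1/2"] d by auto
  define T where "T = (1/2::real) ^ n"
  have T: "0 < T" "T < d" "T < 1" using n by (auto simp: T_def)
  have n0: "0 < n" using T(3) unfolding T_def by (cases n) auto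
  have lnT: "ln T < 0" using T by simp
  have "ln (op_norm X (dilation T)) < \<alpha> / 2 * ln T"
    using d(2)[OF T(1,2)] lnT by (simp add: neg_less_divide_eq)
  also have "\<dots> < 0" using ab lnT by (simp add: mult_pos_neg)
  finally have q: "op_norm X (dilation T) < 1" using oppos[OF T(1)] by (simp add: ln_less_zero_iff)
  have s1: "psi (i + n) \<le> op_norm X (dilation T) * psi i" for i
  proof -
    have e: "T * (1 / 2 ^ i) = 1 / 2 ^ (i + n)" by (simp add: T_def power_add power_divide)
    show ?thesis
      using fund_dilation[of "1 / 2 ^ i" T] T(1) inv_pow2_le_1[of i] inv_pow2_le_1[of "i + n"] unfolding e
      by (simp only: psi_def) simp
  qed
  obtain C1 r1 where 1: "0 < C1" "0 < r1" "r1 < 1" "\<And>i j. psi (i + j) \<le> C1 * r1 ^ j * psi i"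
    using geometric_of_step[of psi, OF psi_pos psi_antimono[OF le_add1] n0 oppos[OF T(1)] q s1] by blast
  have "eventually (\<lambda>t. ln (op_norm X (dilation t)) / ln t < 1) at_top"
    using ab by (intro order_tendstoD(2)[OF linf]) simp
  then obtain N where N: "\<And>t. N \<le> t \<Longrightarrow> ln (op_norm X (dilation t)) / ln t < 1"
    by (auto simp: eventually_at_top_linorder)
  obtain m where m: "max N 1 < 2 ^ m" using real_arch_pow[of 2 "max N 1"] by auto
  define U where "U = (2::real) ^ m"
  have U: "N \<le> U" "1 < U" using m by (auto simp: U_def)
  have m0: "0 < m" using U(2) unfolding U_def by (cases m) auto
  have "ln (op_norm X (dilation U)) < ln U"
    using N[OF U(1)] U(2) by (simp add: divide_less_eq)
  then have q2: "op_norm X (dilation U) < U" using oppos[of U] U by simp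
  \<comment> \<open>Growth of \<open>1 / psi\<close> slower than that of \<open>2 ^ i\<close> is
    decay of this sequence, so the same lemma serves for the upper index.\<close>
  define f where "f i = 1 / (2 ^ i * psi i)" for i
  have s2: "f (i + m) \<le> op_norm X (dilation U) / U * f i" for i
  proof -
    have "psi i \<le> op_norm X (dilation U) * psi (i + m)"
    proof -
      have e: "U * (1 / 2 ^ (i + m)) = 1 / 2 ^ i" by (simp add: U_def power_add)
      show ?thesis
        using fund_dilation[of "1 / 2 ^ (i + m)" U] U(2) inv_pow2_le_1[of i] inv_pow2_le_1[of "i + m"] unfolding e
        by (simp only: psi_def) simp
    qed
    then show ?thesis using psi_pos[of i] psi_pos[of "i + m"] U(2)
      by (simp add: f_def U_def power_add field_simps)
  qed
  have f_mono: "f (i + j) \<le> f i" for i j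
    using psi_doubling[of i j] psi_pos[of i] psi_pos[of "i + j"]
    by (simp add: f_def power_add field_simps)
  have f_pos: "0 < f i" for i by (simp add: f_def)
  have "0 < op_norm X (dilation U) / U" "op_norm X (dilation U) / U < 1"
    using q2 oppos[of U] U(2) by auto
  then obtain C2 r2 where 2: "0 < C2" "0 < r2" "r2 < 1" "\<And>i j. f (i + j) \<le> C2 * r2 ^ j * f i"
    using geometric_of_step[of f, OF f_pos f_mono m0 _ _ s2] by blast
  define C where "C = max C1 C2"
  define r where "r = max r1 r2"
  have mm: "C1 * r1 ^ j \<le> C * r ^ j" "C2 * r2 ^ j \<le> C * r ^ j" for j
    unfolding C_def r_def using 1 2 by (intro mult_mono power_mono; simp add: less_imp_le)+
  have "psi (i + j) \<le> C * r ^ j * psi i" for i j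
    using 1(4)[of i j] mult_right_mono[OF mm(1)[of j] less_imp_le[OF psi_pos[of i]]] by linarith
  moreover have "psi i \<le> C * (2 * r) ^ j * psi (i + j)" for i j
  proof -
    have "f (i + j) \<le> C * r ^ j * f i"
      using 2(4)[of i j] mult_right_mono[OF mm(2)[of j], of "f i"] f_pos[of i] by linarith
    then show ?thesis using psi_pos[of i] psi_pos[of "i + j"]
      by (simp add: f_def power_add power_mult_distrib field_simps)
  qed
  moreover have "0 < C" "0 < r" "r < 1" using 1 2 by (auto simp: C_def r_def)
  ultimately show ?thesis by blast
qed

end

lemma (in sym_space) psi_neq_0 [simp]: "psi i \<noteq> 0"
  using psi_pos[of i] by linarith

lemma (in sym_space) psi_nonneg [simp]: "0 \<le> psi i"
  using psi_pos[of i] by linarith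

subsection \<open>Spaces in which levels may be exchanged\<close>

text \<open>The rate at which coefficients may vary from one level to the next. What matters is that
  1/4 lies strictly between 0 and 1/2: multiplied by 2^(j/2), such coefficients still grow, and
  still more slowly than 2^j.\<close>

definition s4 :: real where "s4 = 2 powr (- 1 / 4)"

lemma s4: "0 < s4" "s4 < 1"
proof -
  show "0 < s4" by (simp add: s4_def)
  have "2 powr (- 1 / 4) < (2::real) powr 0" by (rule powr_less_mono) auto
  then show "s4 < 1" by (simp add: s4_def)
qed

lemma sum_pow_int_le:
  fixes s :: real
  assumes s: "0 < s" "s < 1" and J: "finite J"
  shows "(\<Sum>l\<in>J. s ^ nat \<bar>l - j\<bar>) \<le> 2 / (1 - s)"
proof -
  have geo: "(\<Sum>n\<in>N. s ^ n) \<le> 1 / (1 - s)" if "finite N" for N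
  proof -
    have "(\<Sum>n\<in>N. s ^ n) \<le> (\<Sum>n. s ^ n)"
      using s that by (intro sum_le_suminf summable_geometric) auto
    then show ?thesis using s by (simp add: suminf_geometric)
  qed
  have "(\<Sum>l\<in>J. s ^ nat \<bar>l - j\<bar>) = (\<Sum>l\<in>{l\<in>J. j \<le> l}. s ^ nat \<bar>l - j\<bar>) + (\<Sum>l\<in>{l\<in>J. \<not> j \<le> l}. s ^ nat \<bar>l - j\<bar>)"
    using J by (subst sum.union_disjoint[symmetric]) (auto intro!: sum.cong)
  also have "(\<Sum>l\<in>{l\<in>J. j \<le> l}. s ^ nat \<bar>l - j\<bar>) = (\<Sum>n\<in>(\<lambda>l. nat \<bar>l - j\<bar>) ` {l\<in>J. j \<le> l}. s ^ n)"
    by (subst sum.reindex) (auto simp: inj_on_def)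
  also have "\<dots> \<le> 1 / (1 - s)" using J by (intro geo) auto
  also have "(\<Sum>l\<in>{l\<in>J. \<not> j \<le> l}. s ^ nat \<bar>l - j\<bar>) = (\<Sum>n\<in>(\<lambda>l. nat \<bar>l - j\<bar>) ` {l\<in>J. \<not> j \<le> l}. s ^ n)"
    by (subst sum.reindex) (auto simp: inj_on_def)
  also have "\<dots> \<le> 1 / (1 - s)" using J by (intro geo) auto
  finally show ?thesis by simp
qed

text \<open>The form in which the Boyd indices are used: \<open>psi_decay\<close> stands for a
  positive lower index, and \<open>psi_growth\<close>, where \<open>2 * r\<close> is less than 2,
  for an upper index under 1.\<close>

locale boyd_space = sym_space +
  fixes Cb r :: real
  assumes Cb: "0 < Cb" and r: "0 < r" "r < 1"
    and psi_decay: "\<And>i j. psi (i + j) \<le> Cb * r ^ j * psi i"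
    and psi_growth: "\<And>i j. psi i \<le> Cb * (2 * r) ^ j * psi (i + j)"

text \<open>Here \<open>\<mu> j\<close> is the measure of the \<open>j\<close>-th level of the weight, and \<open>LP\<close> is all that is used of either
  hypothesis on \<open>X\<close> and \<open>w\<close>.\<close>

locale lp_space = boyd_space +
  fixes \<mu> :: "int \<Rightarrow> real" and L :: real and q :: nat
  assumes mu_nonneg: "\<And>j. 0 \<le> \<mu> j" and mu_sum: "\<And>J. finite J \<Longrightarrow> (\<Sum>j\<in>J. \<mu> j) \<le> 1"
    and L: "1 \<le> L" and q: "1 \<le> q"
    and LP: "\<And>J \<tau> \<sigma> a. finite J \<Longrightarrow> (\<And>j. j \<in> J \<Longrightarrow> 0 < \<tau> j \<and> \<tau> j \<le> \<mu> j) \<Longrightarrow>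
      (\<And>j. j \<in> J \<Longrightarrow> 0 < \<sigma> j \<and> \<sigma> j \<le> \<mu> j) \<Longrightarrow> (\<And>j. j \<in> J \<Longrightarrow> 0 < a j) \<Longrightarrow>
      (\<And>i j. i \<in> J \<Longrightarrow> j \<in> J \<Longrightarrow> a i * s4 ^ nat \<bar>i - j\<bar> \<le> a j) \<Longrightarrow>
      step_norm J (\<lambda>j. a j / fund (\<tau> j)) \<tau> \<le> L * step_norm J (\<lambda>j. a j / fund (\<sigma> j)) \<sigma>"
    and levels: "\<And>k. \<exists>J. finite J \<and> card J = k \<and> (\<forall>j\<in>J. 1 / 2 ^ (q * (k + 1)) \<le> \<mu> j)"
begin

text \<open>For \<open>i \<ge> thresh n\<close> there are \<open>2 ^ n\<close> levels containing sets of measure \<open>1 / 2 ^ i\<close>.\<close>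

definition thresh :: "nat \<Rightarrow> nat" where "thresh n = q * (2 ^ n + 1)"

lemma thresh_ge: "n \<le> thresh n"
proof -
  have "n \<le> 2 ^ n" by (simp add: less_imp_le)
  also have "\<dots> \<le> q * (2 ^ n + 1)" using q by (metis le_add1 mult_le_mono nat_mult_1)
  finally show ?thesis by (simp add: thresh_def)
qed

lemma sum_le_1: "finite J \<Longrightarrow> (\<And>j. j \<in> J \<Longrightarrow> \<tau> j \<le> \<mu> j) \<Longrightarrow> (\<Sum>j\<in>J. \<tau> j) \<le> 1"
  by (rule order_trans[OF sum_mono mu_sum])

text \<open>Each quotient is the norm of one and the same configuration, 2^n levels with coefficient
  1 and one set in each, for sets of size 2^-i or 2^-j: their union has size 2^(n-i) or 2^(n-j). So
  \<open>LP\<close> compares the two.\<close>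

lemma flat:
  assumes i: "thresh n \<le> i" and j: "thresh n \<le> j"
  shows "psi (i - n) / psi i \<le> L * (psi (j - n) / psi j)"
proof -
  obtain J where J: "finite J" "card J = 2 ^ n" "\<And>j. j \<in> J \<Longrightarrow> 1 / 2 ^ (q * (2 ^ n + 1)) \<le> \<mu> j"
    using levels[of "2 ^ n"] by blast
  have N: "step_norm J (\<lambda>_. 1 / fund (1 / 2 ^ k)) (\<lambda>_. 1 / 2 ^ k) = psi (k - n) / psi k" 
    and small: "\<And>l. l \<in> J \<Longrightarrow> 0 < 1 / (2::real) ^ k \<and> 1 / 2 ^ k \<le> \<mu> l" if k: "thresh n \<le> k" for k
  proof -
    show s: "0 < 1 / (2::real) ^ k \<and> 1 / 2 ^ k \<le> \<mu> l" if "l \<in> J" for l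
    proof -
      have "1 / (2::real) ^ k \<le> 1 / 2 ^ thresh n" using k by (simp add: frac_le power_increasing)
      then show ?thesis using J(3)[OF that] by (simp add: thresh_def)
    qed
    have nk: "n \<le> k" using thresh_ge[of n] k by simp
    have "step_norm J (\<lambda>_. 1 / fund (1 / 2 ^ k)) (\<lambda>_. 1 / 2 ^ k) = \<bar>1 / fund (1 / 2 ^ k)\<bar> * fund (\<Sum>j\<in>J. 1 / 2 ^ k)"
      using J(1) s by (intro step_norm_const sum_le_1) auto
    also have "(\<Sum>j\<in>J. 1 / (2::real) ^ k) = 1 / 2 ^ (k - n)" using J(2) nk by (simp add: power_diff)
    finally show "step_norm J (\<lambda>_. 1 / fund (1 / 2 ^ k)) (\<lambda>_. 1 / 2 ^ k) = psi (k - n) / psi k"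
      using psi_pos[of k] by (simp add: psi_def)
  qed
  have "step_norm J (\<lambda>_. 1 / fund (1 / 2 ^ i)) (\<lambda>_. 1 / 2 ^ i) \<le> L * step_norm J (\<lambda>_. 1 / fund (1 / 2 ^ j)) (\<lambda>_. 1 / 2 ^ j)"
    using LP[OF J(1) small[OF i] small[OF j], of "\<lambda>_. 1"] s4 by (simp add: power_le_one)
  then show ?thesis using N[OF i] N[OF j] by simp
qed

text \<open>Four factors L: three are the error of almost additivity in \<open>theta_exists\<close>,
  and one compares a quotient at i with the quotient at the threshold.\<close>

definition D :: real where "D = L ^ 4"

lemma D: "1 \<le> D" "L \<le> D"
  using L unfolding D_def by (auto intro: one_le_power self_le_power)

text \<open>By \<open>flat\<close> the logarithm of the quotient depends on n only, up to
  \<open>log 2 L\<close>. Far out the quotient for a shift by m + n is the product of one for m and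
  one for n, so this function of n is almost additive and \<open>quasi_additive\<close> supplies the
  slope.\<close>

lemma theta_exists:
  "\<exists>\<theta>. 0 < \<theta> \<and> \<theta> < 1 \<and> (\<forall>n i. thresh n \<le> i \<longrightarrow>
     psi (i - n) \<le> D * 2 powr (n * \<theta>) * psi i \<and> 2 powr (n * \<theta>) * psi i \<le> D * psi (i - n))"
proof -
  define f where "f n = log 2 (psi (thresh n - n) / psi (thresh n))" for n
  have Lp: "0 < L" using L by simp
  have qp: "0 < psi (i - n) / psi i" for i n by simp
  have A: "\<bar>log 2 (psi (i - n) / psi i) - f n\<bar> \<le> log 2 L" if "thresh n \<le> i" for i n
  proof -
    have "log 2 (psi (i - n) / psi i) \<le> log 2 (L * (psi (thresh n - n) / psi (thresh n)))"
      using flat[OF that order_refl] qp by (intro log_mono) auto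
    also have "\<dots> = log 2 L + f n" unfolding f_def using Lp qp by (subst log_mult) auto
    finally have 1: "log 2 (psi (i - n) / psi i) \<le> log 2 L + f n" .
    have "f n \<le> log 2 (L * (psi (i - n) / psi i))" unfolding f_def
      using flat[OF order_refl that] qp by (intro log_mono) auto
    also have "\<dots> = log 2 L + log 2 (psi (i - n) / psi i)" using Lp qp by (subst log_mult) auto
    finally show ?thesis using 1 by linarith
  qed
  have "\<bar>f (m + n) - f m - f n\<bar> \<le> 3 * log 2 L" for m n
  proof -
    \<comment> \<open>Any index past the three thresholds will do, for n even after a shift by
      m.\<close>
    define i where "i = thresh (m + n) + thresh n + thresh m + m"
    have i: "thresh (m + n) \<le> i" "thresh m \<le> i" "thresh n \<le> i - m" by (auto simp: i_def)
    have e: "psi (i - (m + n)) / psi i = (psi (i - m - n) / psi (i - m)) * (psi (i - m) / psi i)"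
      using psi_pos[of "i - m"] by simp
    have "log 2 (psi (i - (m + n)) / psi i) = log 2 (psi (i - m - n) / psi (i - m)) + log 2 (psi (i - m) / psi i)"
      unfolding e by (subst log_mult) simp
    then show ?thesis using A[OF i(1)] A[OF i(2)] A[OF i(3)] by linarith
  qed
  then obtain \<theta> where th: "\<And>n. \<bar>f n - real n * \<theta>\<bar> \<le> 3 * log 2 L" using quasi_additive by blast
  have D': "D = 2 powr (4 * log 2 L)"
    using Lp by (simp add: D_def powr_powr[symmetric] mult.commute[of 4] powr_numeral)
  have B: "psi (i - n) \<le> D * 2 powr (n * \<theta>) * psi i \<and> 2 powr (n * \<theta>) * psi i \<le> D * psi (i - n)"
    if "thresh n \<le> i" for n i
  proof -
    define z where "z = log 2 (psi (i - n) / psi i)"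
    have z: "\<bar>z - n * \<theta>\<bar> \<le> 4 * log 2 L" using A[OF that] th[of n] by (simp add: z_def)
    have pz: "2 powr z = psi (i - n) / psi i" unfolding z_def using qp by (intro powr_log_cancel) auto
    have "2 powr z \<le> 2 powr (4 * log 2 L + n * \<theta>)" using z by (intro powr_mono) auto
    then have 1: "psi (i - n) / psi i \<le> D * 2 powr (n * \<theta>)" by (simp add: pz D' powr_add)
    have "2 powr (n * \<theta>) \<le> 2 powr (4 * log 2 L + z)" using z by (intro powr_mono) auto
    then have 2: "2 powr (n * \<theta>) \<le> D * (psi (i - n) / psi i)" by (simp add: pz D' powr_add)
    show ?thesis using 1 2 psi_pos[of i] by (simp add: pos_divide_le_eq pos_le_divide_eq)
  qed
  have rlim: "\<exists>n. K * r ^ n < e" if pos: "0 < e" "0 < K" for K e :: real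
  proof -
    obtain n where "r ^ n < e / K" using real_arch_pow_inv[of "e / K" r] r pos by auto
    then show ?thesis using pos by (auto simp: field_simps)
  qed
  \<comment> \<open>For theta at most 0 the quotients would stay under D, against the geometric
    decay of \<open>psi\<close>.\<close>
  have "0 < \<theta>"
  proof (rule ccontr)
    assume "\<not> 0 < \<theta>"
    obtain n where n: "(Cb * D) * r ^ n < 1" using rlim[of 1 "Cb * D"] Cb D by auto
    define i where "i = thresh n"
    have "psi i \<le> Cb * r ^ n * psi (i - n)" using psi_decay[of "i - n" n] thresh_ge[of n] by (simp add: i_def)
    also have "\<dots> \<le> Cb * r ^ n * (D * 2 powr (n * \<theta>) * psi i)"
      using B[of n i] Cb r by (intro mult_left_mono) (auto simp: i_def)
    also have "\<dots> \<le> Cb * r ^ n * (D * 1 * psi i)"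
    proof -
      have "2 powr (n * \<theta>) \<le> 2 powr 0"
        using \<open>\<not> 0 < \<theta>\<close> by (intro powr_mono) (auto simp: mult_nonneg_nonpos)
      then show ?thesis using Cb r D psi_pos[of i]
        by (intro mult_left_mono mult_right_mono) auto
    qed
    also have "\<dots> = ((Cb * D) * r ^ n) * psi i" by simp
    also have "\<dots> < 1 * psi i" using n by (intro mult_strict_right_mono) auto
    finally show False by simp
  qed
  \<comment> \<open>For theta at least 1 the quotients would be at least \<open>2 ^ n / D\<close>,
    against \<open>psi_growth\<close>.\<close>
  moreover have "\<theta> < 1"
  proof (rule ccontr)
    assume "\<not> \<theta> < 1"
    obtain n where n: "(Cb * D) * r ^ n < 1" using rlim[of 1 "Cb * D"] Cb D by auto
    define i where "i = thresh n"
    have "2 powr n * psi i \<le> 2 powr (n * \<theta>) * psi i"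
      using \<open>\<not> \<theta> < 1\<close> mult_left_mono[of 1 \<theta> "real n"] by (intro mult_right_mono powr_mono) auto
    also have "\<dots> \<le> D * psi (i - n)" using B[of n i] by (simp add: i_def)
    also have "\<dots> \<le> D * (Cb * (2 * r) ^ n * psi i)"
      using psi_growth[of "i - n" n] thresh_ge[of n] D by (intro mult_left_mono) (auto simp: i_def)
    also have "\<dots> = ((Cb * D) * r ^ n) * (2 powr n * psi i)"
      by (simp add: power_mult_distrib powr_realpow)
    also have "\<dots> < 1 * (2 powr n * psi i)" using n by (intro mult_strict_right_mono) auto
    finally show False by simp
  qed
  ultimately show ?thesis using B by blast
qed

end

text \<open>In the regime phi behaves like the power with exponent theta, which is the fundamental
  function of L_p for \<open>p = 1 / \<theta>\<close>.\<close>

locale lp_theta = lp_space +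
  fixes \<theta> p :: real
  assumes theta: "0 < \<theta>" "\<theta> < 1" and p_def: "p = 1 / \<theta>"
    and regime: "\<And>n i. thresh n \<le> i \<Longrightarrow> psi (i - n) \<le> D * 2 powr (n * \<theta>) * psi i"
      "\<And>n i. thresh n \<le> i \<Longrightarrow> 2 powr (n * \<theta>) * psi i \<le> D * psi (i - n)"
begin

lemma p: "1 < p" "p * \<theta> = 1" "\<theta> * p = 1" "0 < p"
  using theta by (auto simp: p_def)

lemma powr_p_theta: "0 \<le> x \<Longrightarrow> (x powr p) powr \<theta> = x" "0 \<le> x \<Longrightarrow> (x powr \<theta>) powr p = x"
  using p by (auto simp: powr_powr)

lemma two_powr_theta: "2 powr \<theta> \<le> 2"
  using powr_mono[of \<theta> 1 2] theta by simp

text \<open>By \<open>LP\<close> the sizes may be changed at will inside the levels. They are chosen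
  so that all heights become comparable; the function is then almost constant on a set of known
  measure, and its norm is read off from phi in the regime.\<close>

lemma step_norm_lip:
  assumes J: "finite J" "J \<noteq> {}" and \<tau>: "\<And>j. j \<in> J \<Longrightarrow> 0 < \<tau> j \<and> \<tau> j \<le> \<mu> j"
    and a: "\<And>j. j \<in> J \<Longrightarrow> 0 < a j" and lip: "\<And>i j. i \<in> J \<Longrightarrow> j \<in> J \<Longrightarrow> a i * s4 ^ nat \<bar>i - j\<bar> \<le> a j"
  shows "step_norm J (\<lambda>j. a j / fund (\<tau> j)) \<tau> \<le> 4 * L * D\<^sup>2 * (\<Sum>j\<in>J. a j powr p) powr \<theta>"
    and "(\<Sum>j\<in>J. a j powr p) powr \<theta> \<le> 4 * L * D\<^sup>2 * step_norm J (\<lambda>j. a j / fund (\<tau> j)) \<tau>"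
proof -
  define \<kappa> where "\<kappa> = Min (a ` J)"
  have \<kappa>: "0 < \<kappa>" "\<And>j. j \<in> J \<Longrightarrow> \<kappa> \<le> a j" unfolding \<kappa>_def using J a by auto
  \<comment> \<open>Rounding: up to a factor \<open>2 powr \<theta>\<close> the coefficient a j is
    kappa times the power \<open>2 powr (m j * \<theta>)\<close>.\<close>
  define m where "m j = nat \<lfloor>log 2 (a j / \<kappa>) / \<theta>\<rfloor>" for j
  have m: "\<kappa> * 2 powr (m j * \<theta>) \<le> a j" "a j \<le> \<kappa> * 2 powr ((m j + 1) * \<theta>)" if "j \<in> J" for j
  proof -
    have "1 \<le> a j / \<kappa>" using \<kappa> that by simp
    then have "0 \<le> log 2 (a j / \<kappa>) / \<theta>" using theta by (simp add: zero_le_log_cancel_iff)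
    then have "real (m j) \<le> log 2 (a j / \<kappa>) / \<theta>" "log 2 (a j / \<kappa>) / \<theta> \<le> real (m j) + 1"
      unfolding m_def by (auto simp: of_nat_floor)
    then have "m j * \<theta> \<le> log 2 (a j / \<kappa>)" "log 2 (a j / \<kappa>) \<le> (m j + 1) * \<theta>"
      using theta by (auto simp: field_simps)
    then have "2 powr (m j * \<theta>) \<le> a j / \<kappa>" "a j / \<kappa> \<le> 2 powr ((m j + 1) * \<theta>)"
      using \<kappa> a[OF that] by (auto simp: le_log_iff log_le_iff)
    then show "\<kappa> * 2 powr (m j * \<theta>) \<le> a j" "a j \<le> \<kappa> * 2 powr ((m j + 1) * \<theta>)"
      using \<kappa> by (auto simp: field_simps)
  qed
  define S where "S = (\<Sum>j\<in>J. (2::nat) ^ m j)"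
  have "1 \<le> S" 
  proof -
    obtain j where "j \<in> J" using J by blast
    then have "(2::nat) ^ m j \<le> S" unfolding S_def using J by (intro member_le_sum) auto
    then show ?thesis using one_le_power[of "2::nat" "m j"] by linarith
  qed
  then obtain M where M: "2 ^ M \<le> S" "S < 2 ^ (M + 1)" using ex_power_ivl1[of 2 S] by auto
  have Sr: "2 ^ M \<le> real S" "real S \<le> 2 ^ (M + 1)"
    using M by (metis of_nat_le_iff of_nat_power of_nat_numeral less_imp_le)+
  have lim: "(\<lambda>i. 2 ^ m j / (2::real) ^ i) \<longlonglongrightarrow> 0" for j
    using tendsto_mult_right_zero[OF LIMSEQ_inverse_realpow_zero[of 2], of "2 ^ m j"]
    by (simp add: divide_inverse)
  \<comment> \<open>A common scale i so fine that sets of measure \<open>2 ^ m j / 2 ^ i\<close> fit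
    into the levels and every shift in use lies in the regime.\<close>
  have "eventually (\<lambda>i. \<forall>j\<in>J. thresh (m j) \<le> i \<and> m j \<le> i \<and> 2 ^ m j / (2::real) ^ i \<le> \<mu> j) sequentially"
  proof (rule eventually_ball_finite[OF J(1)], intro ballI)
    fix j assume "j \<in> J"
    then have "0 < \<mu> j" using \<tau> by force
    then have "eventually (\<lambda>i. 2 ^ m j / (2::real) ^ i < \<mu> j) sequentially" by (rule order_tendstoD(2)[OF lim])
    then show "eventually (\<lambda>i. thresh (m j) \<le> i \<and> m j \<le> i \<and> 2 ^ m j / (2::real) ^ i \<le> \<mu> j) sequentially"
      using eventually_ge_at_top[of "thresh (m j)"] eventually_ge_at_top[of "m j"]
      by eventually_elim auto
  qed
  then have "eventually (\<lambda>i. (\<forall>j\<in>J. thresh (m j) \<le> i \<and> m j \<le> i \<and> 2 ^ m j / (2::real) ^ i \<le> \<mu> j) \<and>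
      thresh M \<le> i \<and> thresh (M + 1) \<le> i) sequentially"
    using eventually_ge_at_top[of "thresh M"] eventually_ge_at_top[of "thresh (M + 1)"] by eventually_elim auto
  then obtain i where i: "\<And>j. j \<in> J \<Longrightarrow> thresh (m j) \<le> i" "\<And>j. j \<in> J \<Longrightarrow> m j \<le> i"
    "\<And>j. j \<in> J \<Longrightarrow> 2 ^ m j / (2::real) ^ i \<le> \<mu> j" "thresh M \<le> i" "thresh (M + 1) \<le> i"
    unfolding eventually_sequentially by blast
  have Mi: "M + 1 \<le> i" using thresh_ge[of "M + 1"] i(5) by linarith
  define \<sigma> where "\<sigma> j = 2 ^ m j / (2::real) ^ i" for j
  have \<sigma>: "0 < \<sigma> j \<and> \<sigma> j \<le> \<mu> j" if "j \<in> J" for j using i(3)[OF that] by (simp add: \<sigma>_def)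
  have \<sigma>1: "(\<Sum>j\<in>J. \<sigma> j) \<le> 1" by (rule sum_le_1) (use J \<sigma> in auto)
  have fund\<sigma>: "fund (\<sigma> j) = psi (i - m j)" if "j \<in> J" for j
    using i(2)[OF that] by (simp add: \<sigma>_def psi_def power_diff)
  have sum\<sigma>: "(\<Sum>j\<in>J. \<sigma> j) = real S / 2 ^ i" by (simp add: \<sigma>_def S_def sum_divide_distrib)
  define N where "N = step_norm J (\<lambda>j. a j / fund (\<sigma> j)) \<sigma>"
  define A where "A = (\<Sum>j\<in>J. a j powr p) powr \<theta>"
  have Dp: "0 < D" using D by simp
  \<comment> \<open>Since p theta = 1, kappa times the theta-th power of S is the l_p norm of the
    rounded coefficients.\<close>
  have kS: "\<kappa> * real S powr \<theta> = (\<Sum>j\<in>J. (\<kappa> * 2 powr (m j * \<theta>)) powr p) powr \<theta>"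
  proof -
    have "(\<kappa> * 2 powr (m j * \<theta>)) powr p = \<kappa> powr p * 2 ^ m j" for j
      using \<kappa> p by (simp add: powr_mult powr_powr mult.assoc powr_realpow)
    then have "(\<Sum>j\<in>J. (\<kappa> * 2 powr (m j * \<theta>)) powr p) = \<kappa> powr p * real S"
      by (simp add: S_def sum_distrib_left)
    then show ?thesis using \<kappa> by (simp add: powr_mult powr_p_theta)
  qed
  have twoM: "2 powr (n * \<theta>) = (2 ^ n) powr \<theta>" for n :: nat
    by (simp add: powr_realpow[symmetric] powr_powr)
  \<comment> \<open>In the regime \<open>fund (\<sigma> j)\<close> is about
    \<open>2 powr (m j * \<theta>) * psi i\<close>, so all heights are at most a constant times
    \<open>\<kappa> / psi i\<close>. The two factors 2 come from rounding a and from rounding S to a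
    power of 2.\<close>
  have up: "N \<le> 4 * D\<^sup>2 * A"
  proof -
    have "fund (real S / 2 ^ i) \<le> psi (i - (M + 1))" unfolding psi_def
    proof (rule fund_mono)
      have "real S / 2 ^ i \<le> 2 ^ (M + 1) / 2 ^ i" using Sr by (intro divide_right_mono) auto
      then show "real S / 2 ^ i \<le> 1 / 2 ^ (i - (M + 1))" using Mi by (simp add: power_diff)
    qed (auto simp: inv_pow2_le_1)
    also have "\<dots> \<le> D * 2 powr ((M + 1) * \<theta>) * psi i" using regime(1)[OF i(5)] by simp
    also have "\<dots> = D * 2 powr \<theta> * 2 powr (M * \<theta>) * psi i" by (simp add: powr_add algebra_simps)
    also have "\<dots> \<le> D * 2 * (real S powr \<theta>) * psi i"
      using Dp two_powr_theta Sr theta unfolding twoM by (intro mult_mono powr_mono2) auto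
    finally have phS: "fund (real S / 2 ^ i) \<le> D * 2 * (real S powr \<theta>) * psi i" .
    have "N \<le> step_norm J (\<lambda>j. 2 * \<kappa> * D / psi i) \<sigma>" unfolding N_def
    proof (rule step_norm_mono)
      fix j assume j: "j \<in> J"
      have "a j * psi i \<le> \<kappa> * 2 powr ((m j + 1) * \<theta>) * psi i" using m(2)[OF j] by (intro mult_right_mono) auto
      also have "\<dots> = \<kappa> * 2 powr \<theta> * (2 powr (m j * \<theta>) * psi i)" by (simp add: powr_add algebra_simps)
      also have "\<dots> \<le> \<kappa> * 2 * (D * psi (i - m j))"
      proof (rule mult_mono)
        show "\<kappa> * 2 powr \<theta> \<le> \<kappa> * 2" using \<kappa> two_powr_theta by (intro mult_left_mono) auto
      qed (use \<kappa> regime(2)[OF i(1)[OF j]] in auto)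
      finally have "a j / psi (i - m j) \<le> 2 * \<kappa> * D / psi i"
        using psi_pos[of i] psi_pos[of "i - m j"] by (simp add: frac_le_eq divide_simps mult_ac)
      then show "\<bar>a j / fund (\<sigma> j)\<bar> \<le> \<bar>2 * \<kappa> * D / psi i\<bar>"
        using a[OF j] \<kappa> Dp by (simp add: fund\<sigma>[OF j])
    qed (use J \<sigma> \<sigma>1 in \<open>auto intro: less_imp_le\<close>)
    also have "\<dots> = 2 * \<kappa> * D / psi i * fund (real S / 2 ^ i)"
      using \<kappa> Dp step_norm_const[OF J(1) _ \<sigma>1, of "2 * \<kappa> * D / psi i"] \<sigma> by (simp add: sum\<sigma> less_imp_le)
    also have "\<dots> \<le> 2 * \<kappa> * D / psi i * (D * 2 * (real S powr \<theta>) * psi i)"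
      using \<kappa> Dp phS by (intro mult_left_mono) auto
    also have "\<dots> = 4 * D\<^sup>2 * (\<kappa> * real S powr \<theta>)" by (simp add: power2_eq_square)
    also have "\<dots> \<le> 4 * D\<^sup>2 * A" unfolding kS A_def
      using m(1) \<kappa> theta p by (intro mult_left_mono powr_mono2 sum_mono sum_nonneg) auto
    finally show ?thesis .
  qed
  have lo: "A \<le> 4 * D\<^sup>2 * N"
  proof -
    have "A \<le> (\<Sum>j\<in>J. 2 * (\<kappa> * 2 powr (m j * \<theta>)) powr p) powr \<theta>" unfolding A_def
    proof (intro powr_mono2 sum_mono)
      fix j assume j: "j \<in> J"
      have "a j powr p \<le> (\<kappa> * 2 powr ((m j + 1) * \<theta>)) powr p" using m(2)[OF j] a[OF j] p by (intro powr_mono2) auto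
      also have "\<dots> = (2 powr \<theta> * (\<kappa> * 2 powr (m j * \<theta>))) powr p" by (simp add: powr_add algebra_simps)
      also have "\<dots> = 2 * (\<kappa> * 2 powr (m j * \<theta>)) powr p"
        using \<kappa> by (subst powr_mult) (auto simp: powr_p_theta)
      finally show "a j powr p \<le> 2 * (\<kappa> * 2 powr (m j * \<theta>)) powr p" .
    qed (use theta in \<open>auto intro: sum_nonneg\<close>)
    also have "\<dots> = 2 powr \<theta> * (\<kappa> * real S powr \<theta>)"
      unfolding kS by (simp add: sum_distrib_left[symmetric] powr_mult sum_nonneg)
    also have "\<dots> \<le> 2 * (\<kappa> * (2 ^ (M + 1)) powr \<theta>)"
      using two_powr_theta \<kappa> Sr theta by (intro mult_mono powr_mono2) auto
    also have "\<dots> = 2 * \<kappa> * 2 powr \<theta> * 2 powr (M * \<theta>)"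
      unfolding twoM by (simp add: powr_mult)
    also have "\<dots> \<le> 2 * \<kappa> * 2 * 2 powr (M * \<theta>)"
      using two_powr_theta \<kappa> by (intro mult_mono) auto
    finally have 1: "A \<le> 4 * \<kappa> * 2 powr (M * \<theta>)" by simp
    \<comment> \<open>Conversely, all heights are at least
      \<open>\<kappa> / (D * psi i)\<close>.\<close>
    have "\<kappa> / (D * psi i) * psi (i - M) \<le> \<kappa> / (D * psi i) * fund (real S / 2 ^ i)"
    proof (rule mult_left_mono)
      show "psi (i - M) \<le> fund (real S / 2 ^ i)" unfolding psi_def
      proof (rule fund_mono)
        have "2 ^ M / 2 ^ i \<le> real S / 2 ^ i" using Sr by (intro divide_right_mono) auto
        then show "1 / 2 ^ (i - M) \<le> real S / 2 ^ i" using Mi by (simp add: power_diff)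
        show "real S / 2 ^ i \<le> 1" using \<sigma>1 by (simp add: sum\<sigma>)
      qed simp
    qed (use \<kappa> Dp in auto)
    also have "\<dots> = step_norm J (\<lambda>j. \<kappa> / (D * psi i)) \<sigma>"
      using \<kappa> Dp step_norm_const[OF J(1) _ \<sigma>1, of "\<kappa> / (D * psi i)"] \<sigma> by (simp add: sum\<sigma> less_imp_le)
    also have "\<dots> \<le> N" unfolding N_def
    proof (rule step_norm_mono)
      fix j assume j: "j \<in> J"
      have "\<kappa> * psi (i - m j) \<le> \<kappa> * (D * 2 powr (m j * \<theta>) * psi i)"
        using \<kappa> regime(1)[OF i(1)[OF j]] by (intro mult_left_mono) auto
      also have "\<dots> = \<kappa> * 2 powr (m j * \<theta>) * (D * psi i)" by simp
      also have "\<dots> \<le> a j * (D * psi i)" using m(1)[OF j] Dp by (intro mult_right_mono) auto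
      finally have "\<kappa> / (D * psi i) \<le> a j / psi (i - m j)"
        using psi_pos[of i] psi_pos[of "i - m j"] Dp by (simp add: divide_simps mult_ac)
      then show "\<bar>\<kappa> / (D * psi i)\<bar> \<le> \<bar>a j / fund (\<sigma> j)\<bar>"
        using a[OF j] \<kappa> Dp by (simp add: fund\<sigma>[OF j])
    qed (use J \<sigma> \<sigma>1 in \<open>auto intro: less_imp_le\<close>)
    finally have 2: "\<kappa> * psi (i - M) \<le> N * (D * psi i)" using Dp psi_pos[of i] by (simp add: field_simps)
    have "4 * \<kappa> * 2 powr (M * \<theta>) * psi i \<le> 4 * \<kappa> * (D * psi (i - M))"
      using regime(2)[OF i(4)] \<kappa> by (simp add: mult.assoc)
    also have "\<dots> \<le> 4 * D * (N * (D * psi i))" using 2 Dp by (simp add: mult_ac)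
    also have "\<dots> = 4 * D\<^sup>2 * N * psi i" by (simp add: power2_eq_square)
    finally have "4 * \<kappa> * 2 powr (M * \<theta>) \<le> 4 * D\<^sup>2 * N" using psi_pos[of i] by simp
    then show ?thesis using 1 by simp
  qed
  have LP1: "step_norm J (\<lambda>j. a j / fund (\<tau> j)) \<tau> \<le> L * N" unfolding N_def
    by (rule LP[OF J(1) \<tau> \<sigma> a lip])
  have LP2: "N \<le> L * step_norm J (\<lambda>j. a j / fund (\<tau> j)) \<tau>" unfolding N_def
    by (rule LP[OF J(1) \<sigma> \<tau> a lip])
  have "L * N \<le> L * (4 * D\<^sup>2 * A)" using up L by (intro mult_left_mono) auto
  then show "step_norm J (\<lambda>j. a j / fund (\<tau> j)) \<tau> \<le> 4 * L * D\<^sup>2 * (\<Sum>j\<in>J. a j powr p) powr \<theta>"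
    using LP1 by (simp add: A_def mult_ac)
  have "4 * D\<^sup>2 * N \<le> 4 * D\<^sup>2 * (L * step_norm J (\<lambda>j. a j / fund (\<tau> j)) \<tau>)" using LP2 by (intro mult_left_mono) auto
  then show "(\<Sum>j\<in>J. a j powr p) powr \<theta> \<le> 4 * L * D\<^sup>2 * step_norm J (\<lambda>j. a j / fund (\<tau> j)) \<tau>"
    using lo by (simp add: A_def mult_ac)
qed

end

section \<open>Dyadic blocks\<close>

lemma sym_space_inv_pow2: "1 / (2::real) ^ i \<le> 1"
  by (simp add: divide_le_eq_1)

text \<open>The blocks partition (0,1]. Block i has size 2^-(i+1), not 2^-i, which is the source of
  the many occurrences of \<open>Suc i\<close>.\<close>

definition dyadic :: "nat \<Rightarrow> real set" where "dyadic i = {1 / 2 ^ Suc i<..1 / 2 ^ i}"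

lemma dyadic_sets: "dyadic i \<in> sets I01"
  unfolding dyadic_def using sym_space_inv_pow2[of i] by (intro ivl_sets_I01) auto

lemma dyadic_measure: "measure I01 (dyadic i) = 1 / 2 ^ Suc i"
  unfolding dyadic_def using sym_space_inv_pow2[of i] by (subst ivl_measure_I01) (auto simp: field_simps)

lemma dyadic_disjoint: 
  assumes "t \<in> dyadic i" "t \<in> dyadic j" shows "i = j"
proof (rule ccontr)
  have *: False if "t \<in> dyadic i" "t \<in> dyadic j" "i < j" for i j
  proof -
    have "1 / (2::real) ^ j \<le> 1 / 2 ^ Suc i" using that(3) by (intro frac_le power_increasing) auto
    then show False using that(1,2) by (auto simp: dyadic_def)
  qed
  assume "i \<noteq> j"
  then show False using *[of i j] *[of j i] assms by linarith
qed

lemma dyadic_disj_fam: "disj_fam J (\<lambda>i. 1 / 2 ^ Suc i) dyadic"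
  unfolding disj_fam_def disjoint_family_on_def using dyadic_sets dyadic_measure dyadic_disjoint by blast

lemma dyadic_cover: 
  assumes "0 < t" "t \<le> 1" shows "\<exists>i. t \<in> dyadic i"
proof -
  obtain n where "(1/2) ^ n < t" using real_arch_pow_inv[of t "1/2"] assms by auto
  then have n: "1 / 2 ^ n < t" by (simp add: power_divide)
  define m where "m = (LEAST n. 1 / 2 ^ n < t)"
  have m: "1 / 2 ^ m < t" unfolding m_def by (rule LeastI) (rule n)
  then have "m \<noteq> 0" using assms by (intro notI) auto
  then obtain i where i: "m = Suc i" by (cases m) auto
  have "\<not> 1 / 2 ^ i < t" using not_less_Least[of i "\<lambda>n. 1 / 2 ^ n < t"] i unfolding m_def by simp
  then show ?thesis using m i by (auto simp: dyadic_def)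
qed

lemma (in sym_space) step_norm_group:
  assumes J: "finite J" "\<And>j. j \<in> J \<Longrightarrow> 0 \<le> \<tau> j" "(\<Sum>j\<in>J. \<tau> j) \<le> 1" and S: "finite S" "g ` J \<subseteq> S"
  shows "step_norm J c \<tau> \<le> (\<Sum>s\<in>S. step_norm {i\<in>J. g i = s} c \<tau>)"
proof -
  obtain B where B: "disj_fam J \<tau> B" using disj_fam_exists[OF J] by blast
  have Bs: "disj_fam {i\<in>J. g i = s} \<tau> B" for s by (rule disj_fam_subset[OF B]) auto
  have e: "step J c B = (\<lambda>t. \<Sum>s\<in>S. step {i\<in>J. g i = s} c B t)"
    unfolding step_def fun_eq_iff by (intro allI sum.group[symmetric] J(1) S)
  have "nrm X (step J c B) \<le> (\<Sum>s\<in>S. nrm X (step {i\<in>J. g i = s} c B))"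
    unfolding e by (rule sum_elts(2)) (rule step_elts[OF Bs])
  then show ?thesis unfolding step_norm_eq[OF J(1) B] using J(1) by (simp add: step_norm_eq[OF _ Bs])
qed

section \<open>Step norms with arbitrary coefficients\<close>

context lp_theta
begin

text \<open>A bound for the sum of \<open>s4 ^ nat \<bar>i - j\<bar>\<close> over any finite set of
  indices, by \<open>sum_pow_int_le\<close>.\<close>

definition G :: real where "G = 2 / (1 - s4)"

lemma G: "1 \<le> G" using s4 by (simp add: G_def field_simps)

definition K0 :: real where "K0 = 4 * L * D\<^sup>2"

lemma K0: "1 \<le> K0"
proof -
  have "1 \<le> D\<^sup>2" using D by simp
  then have "1 * 1 \<le> L * D\<^sup>2" using L by (intro mult_mono) auto
  then show ?thesis by (simp add: K0_def)
qed

lemma s4_powr_p: "(s4 ^ n) powr p \<le> s4 ^ n"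
proof -
  have "(s4 ^ n) powr p \<le> (s4 ^ n) powr 1" 
    using s4 p by (intro powr_mono') (auto intro: power_le_one less_imp_le)
  then show ?thesis using s4 by simp
qed

text \<open>The coefficients are enlarged to slowly varying ones. The enlargement is dominated by a
  convolution with a summable kernel, so it increases the l_p norm by a bounded factor only.\<close>

lemma step_norm_upper:
  assumes J: "finite J" and \<tau>: "\<And>j. j \<in> J \<Longrightarrow> 0 < \<tau> j \<and> \<tau> j \<le> \<mu> j" and c: "\<And>j. j \<in> J \<Longrightarrow> 0 \<le> c j"
  shows "step_norm J c \<tau> \<le> K0 * G * (\<Sum>j\<in>J. (c j * fund (\<tau> j)) powr p) powr \<theta>"
proof -
  have \<tau>0: "\<And>j. j \<in> J \<Longrightarrow> 0 \<le> \<tau> j" using \<tau> by (simp add: less_imp_le)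
  have \<tau>1: "(\<Sum>j\<in>J. \<tau> j) \<le> 1" by (rule sum_le_1[OF J]) (use \<tau> in auto)
  have php: "0 < fund (\<tau> j)" if "j \<in> J" for j
    using \<tau>[OF that] member_le_sum[of j J \<tau>] \<tau>0 J \<tau>1 that by (intro fund_pos) auto
  define a where "a j = c j * fund (\<tau> j)" for j
  have a0: "0 \<le> a j" if "j \<in> J" for j using c[OF that] php[OF that] by (simp add: a_def)
  show ?thesis
  proof (cases "\<exists>j\<in>J. 0 < a j")
    case False
    then have "c j = 0" if "j \<in> J" for j 
      using a0[OF that] php[OF that] that unfolding a_def by (metis less_eq_real_def mult_eq_0_iff less_irrefl)
    then have "step_norm J c \<tau> = step_norm J (\<lambda>_. 0) \<tau>" by (intro step_norm_cong J \<tau>0 \<tau>1) auto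
    also have "\<dots> = 0" using step_norm_const[OF J \<tau>0 \<tau>1, of 0] by simp
    finally show ?thesis using K0 G by simp
  next
    case True
    then obtain j0 where j0: "j0 \<in> J" "0 < a j0" by blast
    \<comment> \<open>The least majorant of a with the slow variation that
      \<open>step_norm_lip\<close> requires; it is positive everywhere because some a j is.\<close>
    define b where "b j = Max ((\<lambda>i. a i * s4 ^ nat \<bar>i - j\<bar>) ` J)" for j
    have ab: "a i * s4 ^ nat \<bar>i - j\<bar> \<le> b j" if "i \<in> J" for i j
      unfolding b_def using J that by (intro Max_ge) auto
    have bex: "\<exists>i\<in>J. b j = a i * s4 ^ nat \<bar>i - j\<bar>" for j
    proof -
      have "b j \<in> (\<lambda>i. a i * s4 ^ nat \<bar>i - j\<bar>) ` J" unfolding b_def using J j0 by (intro Max_in) auto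
      then show ?thesis by blast
    qed
    have bpos: "0 < b j" for j using ab[OF j0(1), of j] j0 s4 
      by (meson less_le_trans mult_pos_pos zero_less_power)
    have blip: "b i * s4 ^ nat \<bar>i - j\<bar> \<le> b j" for i j
    proof -
      obtain k where k: "k \<in> J" "b i = a k * s4 ^ nat \<bar>k - i\<bar>" using bex by blast
      have "s4 ^ nat \<bar>k - i\<bar> * s4 ^ nat \<bar>i - j\<bar> \<le> s4 ^ nat \<bar>k - j\<bar>"
        unfolding power_add[symmetric] using s4 by (intro power_decreasing) auto
      then have "a k * (s4 ^ nat \<bar>k - i\<bar> * s4 ^ nat \<bar>i - j\<bar>) \<le> a k * s4 ^ nat \<bar>k - j\<bar>"
        using a0[OF k(1)] by (intro mult_left_mono) auto
      then show ?thesis using ab[OF k(1), of j] k(2) by (simp add: mult.assoc)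
    qed
    have cb: "c j \<le> b j / fund (\<tau> j)" if "j \<in> J" for j
      using ab[OF that, of j] php[OF that] by (simp add: a_def pos_le_divide_eq)
    have "step_norm J c \<tau> \<le> step_norm J (\<lambda>j. b j / fund (\<tau> j)) \<tau>"
      using cb c bpos php by (intro step_norm_mono J \<tau>0 \<tau>1) (auto simp: less_imp_le)
    also have "\<dots> \<le> K0 * (\<Sum>j\<in>J. b j powr p) powr \<theta>" unfolding K0_def
      using j0 by (intro step_norm_lip(1) J \<tau> bpos blip) auto
    also have "\<dots> \<le> K0 * (G * (\<Sum>j\<in>J. a j powr p)) powr \<theta>"
    proof -
      \<comment> \<open>The maximum is attained, so its p-th power is bounded by a single term of
        the convolution.\<close>
      have "b j powr p \<le> (\<Sum>i\<in>J. a i powr p * s4 ^ nat \<bar>j - i\<bar>)" for j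
      proof -
        obtain i where i: "i \<in> J" "b j = a i * s4 ^ nat \<bar>i - j\<bar>" using bex by blast
        have "b j powr p = a i powr p * (s4 ^ nat \<bar>i - j\<bar>) powr p"
          using a0[OF i(1)] s4 by (simp add: i(2) powr_mult)
        also have "\<dots> \<le> a i powr p * s4 ^ nat \<bar>i - j\<bar>" by (intro mult_left_mono s4_powr_p) auto
        also have "\<dots> = a i powr p * s4 ^ nat \<bar>j - i\<bar>" by (simp add: abs_minus_commute)
        also have "\<dots> \<le> (\<Sum>i\<in>J. a i powr p * s4 ^ nat \<bar>j - i\<bar>)"
          using i(1) J s4 by (intro member_le_sum) auto
        finally show ?thesis .
      qed
      then have "(\<Sum>j\<in>J. b j powr p) \<le> (\<Sum>j\<in>J. \<Sum>i\<in>J. a i powr p * s4 ^ nat \<bar>j - i\<bar>)"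
        by (rule sum_mono)
      also have "\<dots> = (\<Sum>i\<in>J. a i powr p * (\<Sum>j\<in>J. s4 ^ nat \<bar>j - i\<bar>))"
        by (subst sum.swap) (simp add: sum_distrib_left)
      also have "\<dots> \<le> (\<Sum>i\<in>J. a i powr p * G)"
        unfolding G_def by (intro sum_mono mult_left_mono sum_pow_int_le s4 J) auto
      finally have "(\<Sum>j\<in>J. b j powr p) \<le> G * (\<Sum>j\<in>J. a j powr p)"
        by (simp add: sum_distrib_left mult.commute)
      then show ?thesis using K0 theta by (intro mult_left_mono powr_mono2 sum_nonneg) auto
    qed
    also have "(G * (\<Sum>j\<in>J. a j powr p)) powr \<theta> = G powr \<theta> * (\<Sum>j\<in>J. a j powr p) powr \<theta>"
      by (rule powr_mult)
    also have "K0 * (G powr \<theta> * (\<Sum>j\<in>J. a j powr p) powr \<theta>) \<le> K0 * (G * (\<Sum>j\<in>J. a j powr p) powr \<theta>)"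
    proof -
      have "G powr \<theta> \<le> G powr 1" using G theta by (intro powr_mono) auto
      then show ?thesis using K0 G by (intro mult_left_mono mult_right_mono) auto
    qed
    finally show ?thesis by (simp add: a_def mult.assoc)
  qed
qed

text \<open>Only the peaks are kept, the indices where a agrees with its slowly varying majorant. On
  them the coefficients vary slowly, and every other coefficient lies under the geometric tail of
  some peak, so the peaks carry the l_p norm up to the factor G.\<close>

lemma step_norm_lower:
  assumes J: "finite J" and \<tau>: "\<And>j. j \<in> J \<Longrightarrow> 0 < \<tau> j \<and> \<tau> j \<le> \<mu> j" and c: "\<And>j. j \<in> J \<Longrightarrow> 0 \<le> c j"
  shows "(\<Sum>j\<in>J. (c j * fund (\<tau> j)) powr p) powr \<theta> \<le> K0 * G * step_norm J c \<tau>"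
proof -
  have \<tau>0: "\<And>j. j \<in> J \<Longrightarrow> 0 \<le> \<tau> j" using \<tau> by (simp add: less_imp_le)
  have \<tau>1: "(\<Sum>j\<in>J. \<tau> j) \<le> 1" by (rule sum_le_1[OF J]) (use \<tau> in auto)
  have php: "0 < fund (\<tau> j)" if "j \<in> J" for j
    using \<tau>[OF that] member_le_sum[of j J \<tau>] \<tau>0 J \<tau>1 that by (intro fund_pos) auto
  define a where "a j = c j * fund (\<tau> j)" for j
  have a0: "0 \<le> a j" if "j \<in> J" for j using c[OF that] php[OF that] by (simp add: a_def)
  define P where "P = {j\<in>J. 0 < a j \<and> (\<forall>i\<in>J. a i * s4 ^ nat \<bar>i - j\<bar> \<le> a j)}"
  have P: "P \<subseteq> J" "finite P" using J by (auto simp: P_def)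
  \<comment> \<open>A maximiser j of \<open>a j * s4 ^ nat \<bar>i - j\<bar>\<close> is a peak: an
    index k that violates the peak condition at j would do better for i, by the triangle inequality
    for distances.\<close>
  have peak: "\<exists>j\<in>P. a i \<le> a j * s4 ^ nat \<bar>i - j\<bar>" if i: "i \<in> J" "0 < a i" for i
  proof -
    define b where "b = Max ((\<lambda>j. a j * s4 ^ nat \<bar>i - j\<bar>) ` J)"
    have "b \<in> (\<lambda>j. a j * s4 ^ nat \<bar>i - j\<bar>) ` J" unfolding b_def using J i by (intro Max_in) auto
    then obtain j where j: "j \<in> J" "b = a j * s4 ^ nat \<bar>i - j\<bar>" by blast
    have ge: "a k * s4 ^ nat \<bar>i - k\<bar> \<le> a j * s4 ^ nat \<bar>i - j\<bar>" if "k \<in> J" for k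
      using J that unfolding j(2)[symmetric] b_def by (intro Max_ge) auto
    have aij: "a i \<le> a j * s4 ^ nat \<bar>i - j\<bar>" using ge[OF i(1)] by simp
    then have "0 < a j * s4 ^ nat \<bar>i - j\<bar>" using i by linarith
    then have aj: "0 < a j" using s4 by (simp add: zero_less_mult_iff)
    have "a k * s4 ^ nat \<bar>k - j\<bar> \<le> a j" if k: "k \<in> J" for k
    proof -
      have "s4 ^ (nat \<bar>k - j\<bar> + nat \<bar>i - j\<bar>) \<le> s4 ^ nat \<bar>i - k\<bar>"
        using s4 by (intro power_decreasing) auto
      then have "a k * s4 ^ (nat \<bar>k - j\<bar> + nat \<bar>i - j\<bar>) \<le> a k * s4 ^ nat \<bar>i - k\<bar>"
        using a0[OF k] by (intro mult_left_mono) auto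
      also have "\<dots> \<le> a j * s4 ^ nat \<bar>i - j\<bar>" by (rule ge[OF k])
      finally have "(a k * s4 ^ nat \<bar>k - j\<bar>) * s4 ^ nat \<bar>i - j\<bar> \<le> a j * s4 ^ nat \<bar>i - j\<bar>"
        by (simp add: power_add mult.assoc)
      then show ?thesis using s4 by (simp add: mult_le_cancel_right)
    qed
    then show ?thesis using j(1) aj aij by (auto simp: P_def)
  qed
  show ?thesis
  proof (cases "P = {}")
    case True
    then have "a i = 0" if "i \<in> J" for i using peak[OF that] a0[OF that] by force
    then have "(\<Sum>j\<in>J. a j powr p) = 0" by simp
    then show ?thesis using K0 G step_norm_nonneg[OF J \<tau>0 \<tau>1, of c] by (simp add: a_def)
  next
    case False
    have "(\<Sum>i\<in>J. a i powr p) \<le> (\<Sum>i\<in>J. \<Sum>j\<in>P. a j powr p * s4 ^ nat \<bar>i - j\<bar>)"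
    proof (rule sum_mono)
      fix i assume i: "i \<in> J"
      show "a i powr p \<le> (\<Sum>j\<in>P. a j powr p * s4 ^ nat \<bar>i - j\<bar>)"
      proof (cases "0 < a i")
        case False
        then show ?thesis using a0[OF i] s4 by (auto intro!: sum_nonneg)
      next
        case True
        then obtain j where j: "j \<in> P" "a i \<le> a j * s4 ^ nat \<bar>i - j\<bar>" using peak[OF i] by blast
        have "a i powr p \<le> (a j * s4 ^ nat \<bar>i - j\<bar>) powr p" using j True p by (intro powr_mono2) auto
        also have "\<dots> = a j powr p * (s4 ^ nat \<bar>i - j\<bar>) powr p" 
          by (rule powr_mult)
        also have "\<dots> \<le> a j powr p * s4 ^ nat \<bar>i - j\<bar>" by (intro mult_left_mono s4_powr_p) auto
        also have "\<dots> \<le> (\<Sum>j\<in>P. a j powr p * s4 ^ nat \<bar>i - j\<bar>)"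
          using j(1) P s4 by (intro member_le_sum) auto
        finally show ?thesis .
      qed
    qed
    also have "\<dots> = (\<Sum>j\<in>P. a j powr p * (\<Sum>i\<in>J. s4 ^ nat \<bar>i - j\<bar>))"
      by (subst sum.swap) (simp add: sum_distrib_left)
    also have "\<dots> \<le> (\<Sum>j\<in>P. a j powr p * G)"
      unfolding G_def by (intro sum_mono mult_left_mono sum_pow_int_le s4 J) auto
    finally have "(\<Sum>i\<in>J. a i powr p) \<le> G * (\<Sum>j\<in>P. a j powr p)" by (simp add: sum_distrib_left mult.commute)
    then have "(\<Sum>i\<in>J. a i powr p) powr \<theta> \<le> (G * (\<Sum>j\<in>P. a j powr p)) powr \<theta>"
      using theta by (intro powr_mono2 sum_nonneg) auto
    also have "\<dots> = G powr \<theta> * (\<Sum>j\<in>P. a j powr p) powr \<theta>" 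
      by (rule powr_mult)
    also have "\<dots> \<le> G * (\<Sum>j\<in>P. a j powr p) powr \<theta>"
    proof -
      have "G powr \<theta> \<le> G powr 1" using G theta by (intro powr_mono) auto
      then show ?thesis using G by (intro mult_right_mono) auto
    qed
    also have "\<dots> \<le> G * (K0 * step_norm P (\<lambda>j. a j / fund (\<tau> j)) \<tau>)"
    proof (rule mult_left_mono)
      show "(\<Sum>j\<in>P. a j powr p) powr \<theta> \<le> K0 * step_norm P (\<lambda>j. a j / fund (\<tau> j)) \<tau>"
        unfolding K0_def by (rule step_norm_lip(2)[OF P(2) False]) (use \<tau> in \<open>auto simp: P_def\<close>)
    qed (use G in auto)
    also have "step_norm P (\<lambda>j. a j / fund (\<tau> j)) \<tau> = step_norm P c \<tau>"
    proof (rule step_norm_cong)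
      show "(\<Sum>j\<in>P. \<tau> j) \<le> 1" using sum_mono2[of J P \<tau>] J P \<tau>0 \<tau>1 by force
      show "a j / fund (\<tau> j) = c j" if "j \<in> P" for j
      proof -
        have "fund (\<tau> j) \<noteq> 0" using php[of j] that P by force
        then show ?thesis by (simp add: a_def)
      qed
    qed (use P \<tau>0 in auto)
    also have "G * (K0 * step_norm P c \<tau>) \<le> G * (K0 * step_norm J c \<tau>)"
      using G K0 by (intro mult_left_mono step_norm_subset J \<tau>0 \<tau>1 P) auto
    finally show ?thesis by (simp add: a_def mult_ac)
  qed
qed

text \<open>This merges the separate statements for each k into one choice: among n + 1 levels that
  are large enough, at least one has not been used by the first n choices.\<close>

lemma level_inj: "\<exists>l. inj_on l {..<n} \<and> (\<forall>k<n. 1 / 2 ^ (q * (k + 2)) \<le> \<mu> (l k))"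
proof (induction n)
  case (Suc n)
  then obtain l where l: "inj_on l {..<n}" "\<And>k. k < n \<Longrightarrow> 1 / 2 ^ (q * (k + 2)) \<le> \<mu> (l k)" by blast
  obtain J where J: "finite J" "card J = n + 1" "\<And>j. j \<in> J \<Longrightarrow> 1 / 2 ^ (q * (n + 1 + 1)) \<le> \<mu> j"
    using levels[of "n + 1"] by blast
  have "card (l ` {..<n}) \<le> n" using card_image_le[of "{..<n}" l] by simp
  then have "\<not> J \<subseteq> l ` {..<n}" using J card_mono[of "l ` {..<n}" J] by auto
  then obtain j where j: "j \<in> J" "j \<notin> l ` {..<n}" by blast
  have "inj_on (l(n := j)) {..<Suc n}" using l(1) j(2) by (auto simp: inj_on_def less_Suc_eq)
  moreover have "1 / 2 ^ (q * (k + 2)) \<le> \<mu> ((l(n := j)) k)" if "k < Suc n" for k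
    using l(2)[of k] J(3)[OF j(1)] that by (cases "k = n") (auto simp: algebra_simps)
  ultimately show ?case by blast
qed auto

text \<open>Norms of step functions do not depend on the position of the sets, so the k-th set may
  be placed in the k-th level of \<open>level_inj\<close>.\<close>

lemma step_norm_nat:
  assumes K: "finite (K::nat set)" and \<tau>: "\<And>k. k \<in> K \<Longrightarrow> 0 < \<tau> k \<and> \<tau> k \<le> 1 / 2 ^ (q * (k + 2))"
    and c: "\<And>k. k \<in> K \<Longrightarrow> 0 \<le> c k"
  shows "step_norm K c \<tau> \<le> K0 * G * (\<Sum>k\<in>K. (c k * fund (\<tau> k)) powr p) powr \<theta>"
    "(\<Sum>k\<in>K. (c k * fund (\<tau> k)) powr p) powr \<theta> \<le> K0 * G * step_norm K c \<tau>"
    "(\<Sum>k\<in>K. \<tau> k) \<le> 1"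
proof -
  obtain n where n: "K \<subseteq> {..<n}" using K finite_nat_iff_bounded by blast
  obtain l where l: "inj_on l {..<n}" "\<And>k. k < n \<Longrightarrow> 1 / 2 ^ (q * (k + 2)) \<le> \<mu> (l k)"
    using level_inj by blast
  have lK: "inj_on l K" using l(1) n by (rule inj_on_subset)
  define h where "h = the_inv_into K l"
  have h: "h (l k) = k" if "k \<in> K" for k unfolding h_def by (rule the_inv_into_f_f[OF lK that])
  define J where "J = l ` K"
  have J: "finite J" using K by (simp add: J_def)
  have \<tau>J: "0 < \<tau> (h j) \<and> \<tau> (h j) \<le> \<mu> j" if jJ: "j \<in> J" for j
  proof -
    obtain k where k: "k \<in> K" "j = l k" using jJ by (auto simp: J_def)
    then show ?thesis using \<tau>[OF k(1)] l(2)[of k] n h[OF k(1)] by force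
  qed
  have cJ: "0 \<le> c (h j)" if "j \<in> J" for j using that c h by (auto simp: J_def)
  have s1: "(\<Sum>j\<in>J. \<tau> (h j)) \<le> 1" by (rule sum_le_1[OF J]) (use \<tau>J in auto)
  have sK: "(\<Sum>j\<in>J. f (h j)) = (\<Sum>k\<in>K. f k)" for f :: "nat \<Rightarrow> real"
    unfolding J_def by (simp add: sum.reindex[OF lK] h)
  show s2: "(\<Sum>k\<in>K. \<tau> k) \<le> 1" using s1 sK[of \<tau>] by simp
  have "step_norm J (\<lambda>j. c (h j)) (\<lambda>j. \<tau> (h j)) = step_norm K (\<lambda>k. c (h (l k))) (\<lambda>k. \<tau> (h (l k)))"
    unfolding J_def using \<tau> s2 by (intro step_norm_reindex lK K) (auto simp: h less_imp_le)
  also have "\<dots> = step_norm K c \<tau>"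
    using \<tau> s2 by (intro step_norm_cong K) (auto simp: h less_imp_le)
  finally have e: "step_norm J (\<lambda>j. c (h j)) (\<lambda>j. \<tau> (h j)) = step_norm K c \<tau>" .
  show "step_norm K c \<tau> \<le> K0 * G * (\<Sum>k\<in>K. (c k * fund (\<tau> k)) powr p) powr \<theta>"
    unfolding e[symmetric] sK[of "\<lambda>k. (c k * fund (\<tau> k)) powr p", symmetric]
    by (rule step_norm_upper[OF J]) (use \<tau>J cJ in auto)
  show "(\<Sum>k\<in>K. (c k * fund (\<tau> k)) powr p) powr \<theta> \<le> K0 * G * step_norm K c \<tau>"
    unfolding e[symmetric] sK[of "\<lambda>k. (c k * fund (\<tau> k)) powr p", symmetric]
    by (rule step_norm_lower[OF J]) (use \<tau>J cJ in auto)
qed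


text \<open>The power of 2 pays for replacing \<open>psi i\<close> by the fundamental function at
  the shrunken size, and q for adding up the residue classes.\<close>

definition K1 :: real where "K1 = K0 * G * 2 ^ (2 * q + 1) * q"

lemma K1: "1 \<le> K1"
proof -
  have "1 * 1 * 1 * 1 \<le> K0 * G * 2 ^ (2 * q + 1) * real q"
    using K0 G q by (intro mult_mono one_le_power) auto
  then show ?thesis by (simp add: K1_def)
qed

text \<open>Along a residue class modulo q, written as i = q k + s, the sizes fall by 2^-q whenever
  k increases by 1, just as the sizes guaranteed for the levels do. So the class can be distributed
  over different levels.\<close>

lemma blocks_aux:
  fixes n :: nat
  defines "\<tau> \<equiv> \<lambda>i. 1 / 2 ^ (i + 1 + 2 * q)"
  assumes c: "\<And>i. 0 \<le> c i"
  shows "step_norm {i\<in>{..<n}. i mod q = s} c \<tau> \<le> K0 * G * (\<Sum>i\<in>{i\<in>{..<n}. i mod q = s}. (c i * fund (\<tau> i)) powr p) powr \<theta>"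
    "(\<Sum>i\<in>{i\<in>{..<n}. i mod q = s}. (c i * fund (\<tau> i)) powr p) powr \<theta> \<le> K0 * G * step_norm {i\<in>{..<n}. i mod q = s} c \<tau>"
proof -
  define S where "S = {i\<in>{..<n}. i mod q = s}"
  define f where "f i = i div q" for i
  define g where "g k = q * k + s" for k
  have gf: "g (f i) = i" if "i \<in> S" for i using that by (auto simp: S_def f_def g_def)
  have S: "finite S" by (simp add: S_def)
  have inj: "inj_on f S" by (rule inj_on_inverseI[of _ g]) (rule gf)
  have fg: "f (g k) = k" "g k \<in> S" if "k \<in> f ` S" for k using that gf by auto
  have bd: "0 < \<tau> (g k) \<and> \<tau> (g k) \<le> 1 / 2 ^ (q * (k + 2))" for k
  proof -
    \<comment> \<open>The reason for the summand \<open>2 * q\<close> in the exponent of tau: block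
      q k + s now fits into the k-th level.\<close>
    have "q * (k + 2) \<le> q * k + s + 1 + 2 * q" by (simp add: algebra_simps)
    then have "(2::real) ^ (q * (k + 2)) \<le> 2 ^ (q * k + s + 1 + 2 * q)" by (rule power_increasing) simp
    then show ?thesis unfolding \<tau>_def g_def by (simp add: frac_le)
  qed
  note N = step_norm_nat[of "f ` S" "\<lambda>k. \<tau> (g k)" "\<lambda>k. c (g k)", OF _ bd c]
  have sf: "(\<Sum>k\<in>f ` S. h (g k)) = (\<Sum>i\<in>S. h i)" for h :: "nat \<Rightarrow> real"
    by (simp add: sum.reindex[OF inj] gf)
  have s1: "(\<Sum>i\<in>S. \<tau> i) \<le> 1" using N(3) S sf[of \<tau>] by simp
  have "step_norm (f ` S) (\<lambda>k. c (g k)) (\<lambda>k. \<tau> (g k)) = step_norm S (\<lambda>i. c (g (f i))) (\<lambda>i. \<tau> (g (f i)))"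
    using s1 by (intro step_norm_reindex inj S) (auto simp: gf, simp add: \<tau>_def)
  also have "\<dots> = step_norm S c \<tau>" using s1 by (intro step_norm_cong S) (auto simp: gf, simp add: \<tau>_def)
  finally have e: "step_norm (f ` S) (\<lambda>k. c (g k)) (\<lambda>k. \<tau> (g k)) = step_norm S c \<tau>" .
  show "step_norm {i\<in>{..<n}. i mod q = s} c \<tau> \<le> K0 * G * (\<Sum>i\<in>{i\<in>{..<n}. i mod q = s}. (c i * fund (\<tau> i)) powr p) powr \<theta>"
    using N(1) S unfolding S_def[symmetric] e sf[of "\<lambda>i. (c i * fund (\<tau> i)) powr p"] by simp
  show "(\<Sum>i\<in>{i\<in>{..<n}. i mod q = s}. (c i * fund (\<tau> i)) powr p) powr \<theta> \<le> K0 * G * step_norm {i\<in>{..<n}. i mod q = s} c \<tau>"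
    using N(2) S unfolding S_def[symmetric] e sf[of "\<lambda>i. (c i * fund (\<tau> i)) powr p"] by simp
qed

text \<open>The residue classes are estimated one by one. Restoring the sizes from
  \<open>2 ^ - (i + 1 + 2 * q)\<close> to those of the dyadic blocks costs a factor that depends on
  q only.\<close>

lemma blocks:
  fixes n :: nat
  assumes c: "\<And>i. 0 \<le> c i"
  shows "step_norm {..<n} c (\<lambda>i. 1 / 2 ^ Suc i) \<le> K1 * (\<Sum>i<n. (c i * psi i) powr p) powr \<theta>"
    "(\<Sum>i<n. (c i * psi i) powr p) powr \<theta> \<le> K1 * step_norm {..<n} c (\<lambda>i. 1 / 2 ^ Suc i)"
proof -
  define \<tau> where "\<tau> i = 1 / (2::real) ^ (i + 1 + 2 * q)" for i
  define \<sigma> where "\<sigma> i = 1 / (2::real) ^ Suc i" for i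
  define S where "S s = {i\<in>{..<n}. i mod q = s}" for s
  have fin: "finite (S s)" for s by (simp add: S_def)
  have \<sigma>s: "(\<Sum>i\<in>J. \<sigma> i) \<le> 1" if "finite J" for J
    using disj_fam_sum_le_1[OF that dyadic_disj_fam] by (simp add: \<sigma>_def)
  have \<tau>\<sigma>: "\<tau> i \<le> \<sigma> i" for i unfolding \<tau>_def \<sigma>_def by (auto intro!: frac_le power_increasing)
  have \<sigma>\<tau>: "\<sigma> i \<le> 2 ^ (2 * q) * \<tau> i" for i unfolding \<tau>_def \<sigma>_def by (simp add: power_add)
  have pos: "0 \<le> \<tau> i" "0 \<le> \<sigma> i" for i by (auto simp: \<tau>_def \<sigma>_def)
  have \<tau>s: "(\<Sum>i\<in>J. \<tau> i) \<le> 1" if "finite J" for J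
    using \<sigma>s[OF that] sum_mono[of J \<tau> \<sigma>] \<tau>\<sigma> by fastforce
  have fund\<tau>: "fund (\<tau> i) = psi (i + 1 + 2 * q)" for i by (simp add: \<tau>_def psi_def)
  have ph1: "fund (\<tau> i) \<le> psi i" for i unfolding fund\<tau> by (rule psi_antimono) simp
  have ph2: "psi i \<le> 2 ^ (2 * q + 1) * fund (\<tau> i)" for i
    unfolding fund\<tau> using psi_doubling[of i "2 * q + 1"] by (simp add: add_ac)
  define E where "E s = (\<Sum>i\<in>S s. (c i * fund (\<tau> i)) powr p) powr \<theta>" for s
  define A where "A = (\<Sum>i<n. (c i * psi i) powr p)"
  have A0: "0 \<le> A" by (simp add: A_def sum_nonneg)
  have aux1: "step_norm (S s) c \<tau> \<le> K0 * G * E s" and aux2: "E s \<le> K0 * G * step_norm (S s) c \<tau>" for s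
    using blocks_aux[of c n s, OF c] unfolding S_def[symmetric] E_def \<tau>_def by auto
  have "step_norm {..<n} c \<sigma> \<le> (\<Sum>s\<in>{..<q}. step_norm (S s) c \<sigma>)"
    unfolding S_def using q \<sigma>s pos by (intro step_norm_group) auto
  also have "\<dots> \<le> (\<Sum>s\<in>{..<q}. 2 ^ (2 * q) * (K0 * G * A powr \<theta>))"
  proof (rule sum_mono)
    fix s
    have "step_norm (S s) c \<sigma> \<le> 2 ^ (2 * q) * step_norm (S s) c \<tau>"
      using fin \<tau>s \<sigma>s \<sigma>\<tau> pos by (intro step_norm_pow2) auto
    also have "\<dots> \<le> 2 ^ (2 * q) * (K0 * G * E s)" using aux1 by (intro mult_left_mono) auto
    also have "\<dots> \<le> 2 ^ (2 * q) * (K0 * G * A powr \<theta>)"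
    proof -
      have "(\<Sum>i\<in>S s. (c i * fund (\<tau> i)) powr p) \<le> (\<Sum>i\<in>S s. (c i * psi i) powr p)"
        using c ph1 p pos(1) \<tau>s[of "{_}"] by (intro sum_mono powr_mono2 mult_left_mono mult_nonneg_nonneg) (auto simp: fund\<tau>)
      also have "\<dots> \<le> A" unfolding A_def by (rule sum_mono2) (auto simp: S_def)
      finally have "E s \<le> A powr \<theta>" unfolding E_def using theta by (intro powr_mono2 sum_nonneg) auto
      then show ?thesis using K0 G by (intro mult_left_mono) auto
    qed
    finally show "step_norm (S s) c \<sigma> \<le> 2 ^ (2 * q) * (K0 * G * A powr \<theta>)" .
  qed
  also have "\<dots> = (q * 2 ^ (2 * q) * (K0 * G)) * A powr \<theta>" by simp
  also have "\<dots> \<le> K1 * A powr \<theta>"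
    unfolding K1_def using K0 G q by (intro mult_right_mono) auto
  finally show "step_norm {..<n} c (\<lambda>i. 1 / 2 ^ Suc i) \<le> K1 * (\<Sum>i<n. (c i * psi i) powr p) powr \<theta>"
    by (simp add: A_def \<sigma>_def[abs_def])
  define N where "N = step_norm {..<n} c \<sigma>"
  have N0: "0 \<le> N" unfolding N_def using \<sigma>s pos by (intro step_norm_nonneg) auto
  have Es: "E s \<le> K0 * G * N" for s
  proof -
    have "step_norm (S s) c \<tau> \<le> step_norm (S s) c \<sigma>" using fin pos \<tau>\<sigma> \<sigma>s by (intro step_norm_mono_measure) auto
    also have "\<dots> \<le> N" unfolding N_def using pos \<sigma>s by (intro step_norm_subset) (auto simp: S_def)
    finally show ?thesis using aux2[of s] K0 G by (smt (verit) mult_left_mono mult_nonneg_nonneg)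
  qed
  define B where "B = 2 ^ (2 * q + 1) * (K0 * G * N)"
  have B0: "0 \<le> B" unfolding B_def using K0 G N0 by simp
  have "A = (\<Sum>s\<in>{..<q}. \<Sum>i\<in>S s. (c i * psi i) powr p)"
    unfolding A_def S_def using q by (subst sum.group[of "{..<n}" "{..<q}"]) auto
  also have "\<dots> \<le> (\<Sum>s\<in>{..<q}. B powr p)"
  proof (rule sum_mono)
    fix s
    have "(\<Sum>i\<in>S s. (c i * psi i) powr p) \<le> (\<Sum>i\<in>S s. (2 ^ (2 * q + 1)) powr p * (c i * fund (\<tau> i)) powr p)"
    proof (rule sum_mono)
      fix i
      have "c i * psi i \<le> 2 ^ (2 * q + 1) * (c i * fund (\<tau> i))"
        using mult_left_mono[OF ph2[of i] c[of i]] by (simp add: mult_ac)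
      then have "(c i * psi i) powr p \<le> (2 ^ (2 * q + 1) * (c i * fund (\<tau> i))) powr p"
        using p c by (intro powr_mono2) auto
      also have "\<dots> = (2 ^ (2 * q + 1)) powr p * (c i * fund (\<tau> i)) powr p"
        by (rule powr_mult)
      finally show "(c i * psi i) powr p \<le> (2 ^ (2 * q + 1)) powr p * (c i * fund (\<tau> i)) powr p" .
    qed
    also have "\<dots> = (2 ^ (2 * q + 1)) powr p * (E s powr p)"
      unfolding E_def by (simp add: sum_distrib_left powr_p_theta sum_nonneg)
    also have "\<dots> \<le> (2 ^ (2 * q + 1)) powr p * (K0 * G * N) powr p"
      using Es p by (intro mult_left_mono powr_mono2) (auto simp: E_def)
    also have "\<dots> = B powr p" unfolding B_def by (rule powr_mult[symmetric])
    finally show "(\<Sum>i\<in>S s. (c i * psi i) powr p) \<le> B powr p" .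
  qed
  also have "\<dots> = q * B powr p" by simp
  finally have "A powr \<theta> \<le> (q * B powr p) powr \<theta>" using A0 theta by (intro powr_mono2) auto
  also have "\<dots> = q powr \<theta> * B" using B0 by (simp add: powr_mult powr_p_theta)
  also have "\<dots> \<le> q * B"
  proof -
    have "q powr \<theta> \<le> q powr 1" using q theta by (intro powr_mono) auto
    then show ?thesis using B0 q by (intro mult_right_mono) auto
  qed
  also have "\<dots> = K1 * N" by (simp add: B_def K1_def)
  finally show "(\<Sum>i<n. (c i * psi i) powr p) powr \<theta> \<le> K1 * step_norm {..<n} c (\<lambda>i. 1 / 2 ^ Suc i)"
    by (simp add: A_def N_def \<sigma>_def[abs_def])
qed

end

text \<open>The entry with index 0 is always 0, because \<open>rearrangement x 1\<close> is.\<close>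

definition (in sym_space) bcoef :: "(real \<Rightarrow> real) \<Rightarrow> nat \<Rightarrow> real" where
  "bcoef x i = rearrangement x (1 / 2 ^ i) * psi i"

lemma (in sym_space) bcoef_nonneg: "x \<in> BM \<Longrightarrow> 0 \<le> bcoef x i"
  unfolding bcoef_def by (intro mult_nonneg_nonneg rearrangement_nonneg) auto

section \<open>Membership and norm in terms of the sequence \<open>bcoef\<close>\<close>

context lp_theta
begin

text \<open>The rearrangement is decreasing, so it lies above the step function that takes on each
  block the value at its right end.\<close>

lemma partial_lower:
  assumes x: "x \<in> elts X"
  shows "(\<Sum>i<n. bcoef x i powr p) powr \<theta> \<le> K1 * nrm X x"
proof -
  have xb: "x \<in> BM" by (rule elts_BM[OF x])
  define c where "c i = rearrangement x (1 / 2 ^ i)" for i :: nat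
  have c0: "0 \<le> c i" for i unfolding c_def by (rule rearrangement_nonneg[OF xb]) simp
  have "step_norm {..<n} c (\<lambda>i. 1 / 2 ^ Suc i) = nrm X (step {..<n} c dyadic)" by (rule step_norm_eq[OF _ dyadic_disj_fam]) simp
  also have "\<dots> \<le> nrm X (rearr x)"
  proof (rule ideal_nrm[OF rearr_elts(1)[OF x] step_BM[OF dyadic_disj_fam]], rule AE_I2)
    fix t
    show "\<bar>step {..<n} c dyadic t\<bar> \<le> \<bar>rearr x t\<bar>"
    proof (cases "\<exists>i<n. t \<in> dyadic i")
      case True
      then obtain i where i: "i < n" "t \<in> dyadic i" by blast
      have "step {..<n} c dyadic t = c i"
        using dyadic_disj_fam[of "{..<n}"] i by (intro step_in) (auto simp: disj_fam_def)
      moreover have t: "0 < t" "t \<le> 1 / 2 ^ i" using i(2) unfolding dyadic_def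
        by (auto intro: less_trans[rotated])
      moreover have "c i \<le> rearrangement x t" unfolding c_def by (rule rearrangement_antimono[OF xb t])
      ultimately show ?thesis using c0[of i] by (simp add: rearr_def)
    next
      case False
      then have "step {..<n} c dyadic t = 0" by (intro step_out) auto
      then show ?thesis by simp
    qed
  qed
  also have "\<dots> = nrm X x" by (rule rearr_elts(2)[OF x])
  finally have "step_norm {..<n} c (\<lambda>i. 1 / 2 ^ Suc i) \<le> nrm X x" .
  then have "K1 * step_norm {..<n} c (\<lambda>i. 1 / 2 ^ Suc i) \<le> K1 * nrm X x" using K1 by (intro mult_left_mono) auto
  then show ?thesis using blocks(2)[of c n, OF c0] by (simp add: bcoef_def c_def)
qed

lemma bcoef_summable:
  assumes x: "x \<in> elts X"
  shows "summable (\<lambda>i. bcoef x i powr p)" "(\<Sum>i. bcoef x i powr p) powr \<theta> \<le> K1 * nrm X x"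
proof -
  have bd: "(\<Sum>i<n. bcoef x i powr p) \<le> (K1 * nrm X x) powr p" for n
  proof -
    have "((\<Sum>i<n. bcoef x i powr p) powr \<theta>) powr p \<le> (K1 * nrm X x) powr p"
      using partial_lower[OF x] p by (intro powr_mono2) auto
    then show ?thesis by (simp add: powr_p_theta sum_nonneg)
  qed
  show s: "summable (\<lambda>i. bcoef x i powr p)"
    by (rule summableI_nonneg_bounded[OF _ bd]) simp
  have "(\<Sum>i. bcoef x i powr p) \<le> (K1 * nrm X x) powr p" by (rule suminf_le_const[OF s bd])
  then have "(\<Sum>i. bcoef x i powr p) powr \<theta> \<le> ((K1 * nrm X x) powr p) powr \<theta>"
    using theta s by (intro powr_mono2 suminf_nonneg) auto
  then show "(\<Sum>i. bcoef x i powr p) powr \<theta> \<le> K1 * nrm X x"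
    using K1 nrm_nonneg[OF x] by (simp add: powr_p_theta)
qed

text \<open>Completeness does the work here: the step functions over the first n blocks form a
  Cauchy sequence by \<open>blocks\<close>, and their limit in norm agrees almost everywhere with
  the full step function, which dominates the rearrangement.\<close>

lemma elts_of_summable:
  assumes xb: "x \<in> BM" and s: "summable (\<lambda>i. bcoef x i powr p)"
  shows "x \<in> elts X" "nrm X x \<le> 2 * K1 * (\<Sum>i. bcoef x i powr p) powr \<theta>"
proof -
  \<comment> \<open>The value at the left end of block i, an upper bound for the rearrangement
    there; \<open>psi_doubling\<close> pays for the shift of the index.\<close>
  define c where "c i = rearrangement x (1 / 2 ^ Suc i)" for i :: nat
  have c0: "0 \<le> c i" for i unfolding c_def by (rule rearrangement_nonneg[OF xb]) simp
  define e where "e i = (c i * psi i) powr p" for i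
  have e0: "0 \<le> e i" for i by (simp add: e_def)
  have e_le: "e i \<le> 2 powr p * bcoef x (Suc i) powr p" for i
  proof -
    have "c i * psi i \<le> 2 * bcoef x (Suc i)"
      using mult_left_mono[OF psi_doubling[of i 1] c0[of i]] by (simp add: bcoef_def c_def mult_ac)
    then have "e i \<le> (2 * bcoef x (Suc i)) powr p" unfolding e_def using c0 p by (intro powr_mono2) auto
    then show ?thesis by (simp add: powr_mult)
  qed
  have sS: "summable (\<lambda>i. bcoef x (Suc i) powr p)" using s by (subst summable_Suc_iff)
  have se: "summable e"
    by (rule summable_comparison_test'[OF summable_mult[OF sS, of "2 powr p"], of 0]) (use e_le e0 in auto)
  define E where "E = (\<Sum>i. e i) powr \<theta>"
  have E_le: "E \<le> 2 * (\<Sum>i. bcoef x i powr p) powr \<theta>"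
  proof -
    have "(\<Sum>i. e i) \<le> (\<Sum>i. 2 powr p * bcoef x (Suc i) powr p)"
      by (rule suminf_le[OF e_le se summable_mult[OF sS]])
    also have "\<dots> = 2 powr p * (\<Sum>i. bcoef x (Suc i) powr p)" by (rule suminf_mult[OF sS])
    also have "(\<Sum>i. bcoef x (Suc i) powr p) \<le> (\<Sum>i. bcoef x i powr p)"
      using suminf_split_head[OF s] by simp
    finally have "(\<Sum>i. e i) \<le> 2 powr p * (\<Sum>i. bcoef x i powr p)" by simp
    then have "E \<le> (2 powr p * (\<Sum>i. bcoef x i powr p)) powr \<theta>"
      unfolding E_def using theta se e0 by (intro powr_mono2 suminf_nonneg) auto
    also have "\<dots> = 2 * (\<Sum>i. bcoef x i powr p) powr \<theta>" by (simp add: powr_mult powr_p_theta)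
    finally show ?thesis .
  qed
  define u where "u n = step {..<n} c dyadic" for n :: nat
  have u: "u n \<in> elts X" for n unfolding u_def by (rule step_elts[OF dyadic_disj_fam])
  have nu: "nrm X (u n) \<le> K1 * E" for n
  proof -
    have "nrm X (u n) \<le> K1 * (\<Sum>i<n. e i) powr \<theta>"
      using blocks(1)[of c n, OF c0] unfolding e_def u_def by (subst (asm) step_norm_eq[OF _ dyadic_disj_fam]) auto
    also have "\<dots> \<le> K1 * E" unfolding E_def
      using K1 theta se e0 by (intro mult_left_mono powr_mono2 sum_nonneg sum_le_suminf) auto
    finally show ?thesis .
  qed
  have diff: "nrm X (\<lambda>t. u m t - u n t) \<le> K1 * (\<Sum>i\<in>{n..<m}. e i) powr \<theta>" if "n \<le> m" for n m
  proof -
    define c' where "c' i = (if n \<le> i then c i else 0)" for i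
    have c'0: "0 \<le> c' i" for i using c0 by (simp add: c'_def)
    have "u m t - u n t = step {..<m} c' dyadic t" for t
    proof -
      have "step {..<m} c' dyadic t = (\<Sum>i\<in>{n..<m}. c i * indicator (dyadic i) t)"
        unfolding step_def by (rule sum.mono_neutral_cong_right) (auto simp: c'_def)
      moreover have "u m t = u n t + (\<Sum>i\<in>{n..<m}. c i * indicator (dyadic i) t)"
        unfolding u_def step_def using that
        by (subst sum.union_disjoint[symmetric]) (auto intro!: sum.cong)
      ultimately show ?thesis by simp
    qed
    then have "nrm X (\<lambda>t. u m t - u n t) = step_norm {..<m} c' (\<lambda>i. 1 / 2 ^ Suc i)"
      by (subst step_norm_eq[OF _ dyadic_disj_fam]) (auto intro!: arg_cong[of _ _ "nrm X"])
    also have "\<dots> \<le> K1 * (\<Sum>i<m. (c' i * psi i) powr p) powr \<theta>" by (rule blocks(1)[OF c'0])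
    also have "(\<Sum>i<m. (c' i * psi i) powr p) = (\<Sum>i\<in>{n..<m}. e i)"
      by (rule sum.mono_neutral_cong_right) (auto simp: c'_def e_def)
    finally show ?thesis .
  qed
  have cauchy: "\<exists>N. \<forall>m\<ge>N. \<forall>n\<ge>N. nrm X (\<lambda>t. u m t - u n t) < \<epsilon>" if \<epsilon>: "0 < \<epsilon>" for \<epsilon>
  proof -
    define d where "d = (\<epsilon> / (2 * K1)) powr p"
    have d: "0 < d" using \<epsilon> K1 by (simp add: d_def)
    obtain N where N: "\<And>m n. N \<le> m \<Longrightarrow> norm (\<Sum>i\<in>{m..<n}. e i) < d"
      using se d unfolding summable_Cauchy by blast
    have *: "nrm X (\<lambda>t. u m t - u n t) < \<epsilon>" if "N \<le> n" "n \<le> m" for m n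
    proof -
      have "(\<Sum>i\<in>{n..<m}. e i) powr \<theta> \<le> d powr \<theta>"
        using N[OF that(1), of m] theta e0 by (intro powr_mono2 sum_nonneg) auto
      also have "\<dots> = \<epsilon> / (2 * K1)" unfolding d_def using \<epsilon> K1 by (intro powr_p_theta) auto
      finally have "K1 * (\<Sum>i\<in>{n..<m}. e i) powr \<theta> \<le> K1 * (\<epsilon> / (2 * K1))" using K1 by (intro mult_left_mono) auto
      also have "\<dots> < \<epsilon>" using K1 \<epsilon> by simp
      finally show ?thesis using diff[OF that(2)] by linarith
    qed
    have "nrm X (\<lambda>t. u m t - u n t) < \<epsilon>" if "N \<le> m" "N \<le> n" for m n
    proof (cases "n \<le> m")
      case False
      have "(\<lambda>t. u m t - u n t) = (\<lambda>t. - 1 * (u n t - u m t))" by simp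
      then have "nrm X (\<lambda>t. u m t - u n t) = nrm X (\<lambda>t. u n t - u m t)"
        using nrm_scale[OF diff_elts[OF u u], of "-1" n m] by simp
      then show ?thesis using *[of m n] that False by simp
    qed (use * that in auto)
    then show ?thesis by blast
  qed
  obtain l where l: "l \<in> elts X" "(\<lambda>n. nrm X (\<lambda>t. u n t - l t)) \<longlonglongrightarrow> 0"
    using complete[OF u cauchy] by blast
  \<comment> \<open>Restriction to a block does not increase the norm, and on it the partial sums
    are eventually constant, so the limit in norm is known there almost everywhere.\<close>
  have "AE t in I01. t \<in> dyadic i \<longrightarrow> l t = c i" for i
  proof -
    define z where "z t = indicator (dyadic i) t * (c i - l t)" for t
    have ci: "(\<lambda>t. indicator (dyadic i) t * (u n t - l t)) = z" if "i < n" for n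
    proof
      fix t
      show "indicator (dyadic i) t * (u n t - l t) = z t"
      proof (cases "t \<in> dyadic i")
        case True
        have "u n t = c i" unfolding u_def using dyadic_disj_fam[of "{..<n}"] that True 
          by (intro step_in) (auto simp: disj_fam_def)
        then show ?thesis by (simp add: z_def)
      qed (simp add: z_def)
    qed
    have z: "z \<in> elts X" 
      using indicator_elts(1)[OF diff_elts[OF u l(1)] dyadic_sets, of i "Suc i"] ci[of "Suc i"] by simp
    have "nrm X z \<le> nrm X (\<lambda>t. u n t - l t)" if "i < n" for n
      using indicator_elts(2)[OF diff_elts[OF u l(1)] dyadic_sets, of i n] ci[OF that] by simp
    then have "nrm X z \<le> 0"
      by (intro LIMSEQ_le_const[OF l(2)] exI[of _ "Suc i"]) auto
    then have "nrm X z = 0" using nrm_nonneg[OF z] by simp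
    then have "AE t in I01. z t = 0" using nrm_eq_0_iff[OF z] by (simp add: ae_eq_def)
    then show ?thesis by eventually_elim (auto simp: z_def)
  qed
  then have AEl: "AE t in I01. \<forall>i. t \<in> dyadic i \<longrightarrow> l t = c i" by (simp add: AE_all_countable)
  have "AE t in I01. \<bar>rearr x t\<bar> \<le> \<bar>l t\<bar>"
    using AEl AE_space
  proof eventually_elim
    fix t assume a: "\<forall>i. t \<in> dyadic i \<longrightarrow> l t = c i" "t \<in> space I01"
    show "\<bar>rearr x t\<bar> \<le> \<bar>l t\<bar>"
    proof (cases "0 < t")
      case True
      then obtain i where i: "t \<in> dyadic i" using dyadic_cover[of t] a(2) by auto
      have "rearrangement x t \<le> c i" unfolding c_def
        using i by (intro rearrangement_antimono[OF xb]) (auto simp: dyadic_def)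
      then show ?thesis using a(1) i True rearrangement_nonneg[OF xb True] by (simp add: rearr_def)
    qed (simp add: rearr_def)
  qed
  then have st: "rearr x \<in> elts X" "nrm X (rearr x) \<le> nrm X l"
    using ideal[OF l(1) rearr_BM[OF xb]] by auto
  show xX: "x \<in> elts X" by (rule rearr_eltsD(1)[OF xb st(1)])
  have "nrm X l \<le> nrm X (\<lambda>t. u n t - l t) + K1 * E" for n
  proof -
    have "(\<lambda>t. u n t - (u n t - l t)) = l" by simp
    then show ?thesis using nrm_diff[OF u diff_elts[OF u l(1)], of n n] nu[of n] by simp
  qed
  then have "nrm X l \<le> 0 + K1 * E"
    by (intro LIMSEQ_le_const[OF tendsto_add[OF l(2) tendsto_const]] exI[of _ 0]) auto
  then have "nrm X x \<le> K1 * E" using st(2) rearr_elts(2)[OF xX] by simp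
  also have "\<dots> \<le> K1 * (2 * (\<Sum>i. bcoef x i powr p) powr \<theta>)" using E_le K1 by (intro mult_left_mono) auto
  finally show "nrm X x \<le> 2 * K1 * (\<Sum>i. bcoef x i powr p) powr \<theta>" by simp
qed

end

subsection \<open>The discrete description of the norm\<close>

text \<open>The weight has disappeared. The l_p description serves the interpolation property; for
  the Orlicz space the regime of phi is needed as well.\<close>

locale seq_model = boyd_space +
  fixes \<theta> p K D :: real and q :: nat
  assumes theta: "0 < \<theta>" "\<theta> < 1" and p_def: "p = 1 / \<theta>" and K: "1 \<le> K" and D: "1 \<le> D" and q: "1 \<le> q"
    and regime: "\<And>n i. q * (2 ^ n + 1) \<le> i \<Longrightarrow> psi (i - n) \<le> D * 2 powr (n * \<theta>) * psi i"
      "\<And>n i. q * (2 ^ n + 1) \<le> i \<Longrightarrow> 2 powr (n * \<theta>) * psi i \<le> D * psi (i - n)"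
    and elts_iff: "\<And>x. x \<in> BM \<Longrightarrow> x \<in> elts X \<longleftrightarrow> summable (\<lambda>i. bcoef x i powr p)"
    and nrm_le: "\<And>x. x \<in> elts X \<Longrightarrow> nrm X x \<le> K * (\<Sum>i. bcoef x i powr p) powr \<theta>"
    and nrm_ge: "\<And>x. x \<in> elts X \<Longrightarrow> (\<Sum>i. bcoef x i powr p) powr \<theta> \<le> K * nrm X x"

lemma (in lp_space) seq_model_exists: "\<exists>\<theta> p K D. seq_model X Cb r \<theta> p K D q"
proof -
  obtain \<theta> where th: "0 < \<theta>" "\<theta> < 1" "\<And>n i. thresh n \<le> i \<Longrightarrow>
     psi (i - n) \<le> D * 2 powr (n * \<theta>) * psi i \<and> 2 powr (n * \<theta>) * psi i \<le> D * psi (i - n)"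
    using theta_exists by blast
  interpret lp_theta X Cb r \<mu> L q \<theta> "1 / \<theta>"
    by unfold_locales (use th in auto)
  have "seq_model X Cb r \<theta> (1 / \<theta>) (2 * K1) D q"
  proof unfold_locales
    fix x assume "x \<in> BM"
    then show "x \<in> elts X \<longleftrightarrow> summable (\<lambda>i. bcoef x i powr (1 / \<theta>))"
      using bcoef_summable(1) elts_of_summable(1) by blast
  next
    fix x assume x: "x \<in> elts X"
    show "nrm X x \<le> 2 * K1 * (\<Sum>i. bcoef x i powr (1 / \<theta>)) powr \<theta>"
      by (rule elts_of_summable(2)[OF elts_BM[OF x] bcoef_summable(1)[OF x]])
    have "K1 * nrm X x \<le> 2 * K1 * nrm X x" using nrm_nonneg[OF x] K1 by simp
    then show "(\<Sum>i. bcoef x i powr (1 / \<theta>)) powr \<theta> \<le> 2 * K1 * nrm X x"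
      using bcoef_summable(2)[OF x] by linarith
  qed (use th K1 D q in \<open>auto simp: thresh_def\<close>)
  then show ?thesis by blast
qed

section \<open>Integrals of rearrangements over dyadic blocks\<close>

lemma distr_rearr_eq:
  assumes x: "x \<in> BM"
  shows "distr I01 borel (\<lambda>t. \<bar>x t\<bar>) = distr I01 borel (rearr x)"
proof (rule cdf_unique)
  have xa: "(\<lambda>t. \<bar>x t\<bar>) \<in> BM" using x by simp
  show "real_distribution (distr I01 borel (\<lambda>t. \<bar>x t\<bar>))" by (rule I.real_distribution_distr[OF xa])
  show "real_distribution (distr I01 borel (rearr x))" by (rule I.real_distribution_distr[OF rearr_BM[OF x]])
  have c: "cdf (distr I01 borel y) a = (if 0 \<le> a then 1 - distr_fun y a else 0)"
    if y: "y \<in> BM" "\<And>t. 0 \<le> y t" for y a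
  proof -
    have 1: "cdf (distr I01 borel y) a = measure I01 {t \<in> {0..1}. y t \<le> a}"
      unfolding cdf_def using y(1) by (subst measure_distr) (auto intro!: arg_cong[of _ _ "measure I01"])
    show ?thesis
    proof (cases "0 \<le> a")
      case True
      have "{t \<in> {0..1}. y t \<le> a} = space I01 - {t \<in> {0..1}. \<bar>y t\<bar> > a}" using y(2) by auto
      then show ?thesis using I.prob_compl[OF distr_set[OF y(1), of a]] True 1 by (simp add: distr_fun_def)
    next
      case False
      then have e: "{t \<in> {0..1}. y t \<le> a} = {}" using y(2) by (auto simp: not_le intro: less_le_trans)
      show ?thesis unfolding 1 e using False by simp
    qed
  qed
  show "cdf (distr I01 borel (\<lambda>t. \<bar>x t\<bar>)) = cdf (distr I01 borel (rearr x))"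
  proof
    fix a
    have "distr_fun (\<lambda>t. \<bar>x t\<bar>) a = distr_fun x a" by (simp add: distr_fun_def)
    then show "cdf (distr I01 borel (\<lambda>t. \<bar>x t\<bar>)) a = cdf (distr I01 borel (rearr x)) a"
      using c[OF xa, of a] c[OF rearr_BM[OF x], of a] x distr_rearr[OF x, of a] by simp
  qed
qed

text \<open>The law of |x| is determined by its distribution function, so an integral of a function
  of |x| may be taken over the rearrangement.\<close>

lemma nn_integral_rearr:
  assumes x: "x \<in> BM" and h: "h \<in> borel_measurable borel"
  shows "(\<integral>\<^sup>+t. h \<bar>x t\<bar> \<partial>I01) = (\<integral>\<^sup>+t. h (rearr x t) \<partial>I01)"
proof -
  have xa: "(\<lambda>t. \<bar>x t\<bar>) \<in> BM" using x by simp
  have "(\<integral>\<^sup>+t. h \<bar>x t\<bar> \<partial>I01) = (\<integral>\<^sup>+s. h s \<partial>distr I01 borel (\<lambda>t. \<bar>x t\<bar>))"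
    by (rule nn_integral_distr[symmetric, OF xa]) (use h in simp)
  also have "\<dots> = (\<integral>\<^sup>+s. h s \<partial>distr I01 borel (rearr x))" by (simp add: distr_rearr_eq[OF x])
  also have "\<dots> = (\<integral>\<^sup>+t. h (rearr x t) \<partial>I01)" by (rule nn_integral_distr[OF rearr_BM[OF x]]) (use h in simp)
  finally show ?thesis .
qed

lemma AE_dyadic: "AE t in I01. \<exists>i. t \<in> dyadic i"
proof -
  have "measure I01 {0..0} = 0" by (subst ivl_measure_I01) auto
  then have "AE t in I01. t \<notin> {0..0}" using I.prob_eq_0[OF ivl_sets_I01(1)[of 0 0]] by simp
  then show ?thesis using AE_space
  proof eventually_elim
    fix t :: real assume "t \<notin> {0..0}" "t \<in> space I01"
    then show "\<exists>i. t \<in> dyadic i" by (intro dyadic_cover) auto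
  qed
qed

lemma dyadic_disjoint_family: "disjoint_family dyadic"
  unfolding disjoint_family_on_def using dyadic_disjoint by blast

lemma nn_integral_dyadic:
  "(\<integral>\<^sup>+t. (\<Sum>i. g i * indicator (dyadic i) t) \<partial>I01) = (\<Sum>i. g i * ennreal (1 / 2 ^ Suc i))"
proof -
  have "(\<integral>\<^sup>+t. (\<Sum>i. g i * indicator (dyadic i) t) \<partial>I01) = (\<Sum>i. \<integral>\<^sup>+t. g i * indicator (dyadic i) t \<partial>I01)"
    by (rule nn_integral_suminf) (use dyadic_sets in simp)
  also have "\<dots> = (\<Sum>i. g i * emeasure I01 (dyadic i))"
    by (intro suminf_cong nn_integral_cmult_indicator dyadic_sets)
  also have "\<dots> = (\<Sum>i. g i * ennreal (1 / 2 ^ Suc i))"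
    by (simp only: I.emeasure_eq_measure dyadic_measure)
  finally show ?thesis .
qed

text \<open>The almost everywhere form is for the Lorentz norm, where the derivative is computed
  only in the interior of the blocks.\<close>

lemma nn_integral_le_dyadic_AE:
  assumes "AE t in I01. \<forall>i. t \<in> dyadic i \<longrightarrow> f t \<le> g i"
  shows "(\<integral>\<^sup>+t. f t \<partial>I01) \<le> (\<Sum>i. g i * ennreal (1 / 2 ^ Suc i))"
  unfolding nn_integral_dyadic[symmetric]
proof (rule nn_integral_mono_AE, use AE_dyadic assms in eventually_elim)
  fix t assume "\<exists>i. t \<in> dyadic i" and a: "\<forall>i. t \<in> dyadic i \<longrightarrow> f t \<le> g i"
  then obtain i where i: "t \<in> dyadic i" by blast
  then show "f t \<le> (\<Sum>i. g i * indicator (dyadic i) t)"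
    unfolding suminf_cmult_indicator[OF dyadic_disjoint_family i] using a by blast
qed

lemma nn_integral_le_dyadic:
  assumes "\<And>i t. t \<in> dyadic i \<Longrightarrow> f t \<le> g i"
  shows "(\<integral>\<^sup>+t. f t \<partial>I01) \<le> (\<Sum>i. g i * ennreal (1 / 2 ^ Suc i))"
  by (rule nn_integral_le_dyadic_AE) (use assms in auto)

lemma nn_integral_ge_dyadic_AE:
  assumes "AE t in I01. \<forall>i. t \<in> dyadic i \<longrightarrow> g i \<le> f t"
  shows "(\<Sum>i. g i * ennreal (1 / 2 ^ Suc i)) \<le> (\<integral>\<^sup>+t. f t \<partial>I01)"
  unfolding nn_integral_dyadic[symmetric]
proof (rule nn_integral_mono_AE, use AE_dyadic assms in eventually_elim)
  fix t assume "\<exists>i. t \<in> dyadic i" and a: "\<forall>i. t \<in> dyadic i \<longrightarrow> g i \<le> f t"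
  then obtain i where i: "t \<in> dyadic i" by blast
  then show "(\<Sum>i. g i * indicator (dyadic i) t) \<le> f t"
    unfolding suminf_cmult_indicator[OF dyadic_disjoint_family i] using a by blast
qed

lemma nn_integral_ge_dyadic:
  assumes "\<And>i t. t \<in> dyadic i \<Longrightarrow> g i \<le> f t"
  shows "(\<Sum>i. g i * ennreal (1 / 2 ^ Suc i)) \<le> (\<integral>\<^sup>+t. f t \<partial>I01)"
  by (rule nn_integral_ge_dyadic_AE) (use assms in auto)

lemma rearr_dyadic:
  assumes x: "x \<in> BM" and t: "t \<in> dyadic i"
  shows "rearrangement x (1 / 2 ^ i) \<le> rearr x t" "rearr x t \<le> rearrangement x (1 / 2 ^ Suc i)" "0 < t" "t \<le> 1"
proof -
  have "0 < 1 / (2::real) ^ Suc i" by simp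
  then show t0: "0 < t" using t unfolding dyadic_def by (auto intro: less_trans)
  have "t \<le> 1 / 2 ^ i" using t by (simp add: dyadic_def)
  then show "t \<le> 1" using sym_space_inv_pow2 by (rule order_trans)
  show "rearrangement x (1 / 2 ^ i) \<le> rearr x t" "rearr x t \<le> rearrangement x (1 / 2 ^ Suc i)"
    using t t0 unfolding rearr_def by (auto simp: dyadic_def intro!: rearrangement_antimono[OF x])
qed

section \<open>The Orlicz function\<close>

context boyd_space
begin

text \<open>The slope grows by \<open>2 ^ i\<close> at \<open>1 / psi i\<close>, so that up to constants \<open>orlicz_fun (1 / psi i)\<close> is \<open>2 ^ i\<close>,
  as it must be for the fundamental function.\<close>

definition orlicz_fun :: "real \<Rightarrow> real" where
  "orlicz_fun v = v + (\<Sum>i. 2 ^ i * max 0 (v * psi i - 1))"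

lemma psi_small: "0 < e \<Longrightarrow> \<exists>h. Cb * r ^ h * e \<le> 1"
proof -
  assume e: "0 < e"
  obtain h where "r ^ h < 1 / (Cb * e)" using real_arch_pow_inv[of "1 / (Cb * e)" r] r Cb e by auto
  then have "Cb * r ^ h * e \<le> 1" using Cb e by (simp add: field_simps)
  then show ?thesis by blast
qed

lemma orlicz_fun_finite: 
  assumes "0 \<le> v" shows "\<exists>N. \<forall>i\<ge>N. v * psi i \<le> 1"
proof -
  obtain h where h: "Cb * r ^ h * ((v + 1) * psi 0) \<le> 1" using psi_small[of "(v + 1) * psi 0"] assms by auto
  have "v * psi i \<le> 1" if "h \<le> i" for i
  proof -
    have "v * psi i \<le> (v + 1) * psi i" by (intro mult_right_mono) auto
    also have "\<dots> \<le> (v + 1) * psi h" using assms that by (intro mult_left_mono psi_antimono) auto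
    also have "\<dots> \<le> (v + 1) * (Cb * r ^ h * psi 0)" using psi_decay[of 0 h] assms by (intro mult_left_mono) auto
    finally show ?thesis using h by (simp add: mult_ac)
  qed
  then show ?thesis by blast
qed

lemma orlicz_fun_summable: 
  assumes "0 \<le> v" shows "summable (\<lambda>i. 2 ^ i * max 0 (v * psi i - 1))"
proof -
  obtain N where "\<And>i. N \<le> i \<Longrightarrow> v * psi i \<le> 1" using orlicz_fun_finite[OF assms] by blast
  then show ?thesis by (intro summable_finite[of "{..<N}"]) (auto simp: not_less)
qed

lemma orlicz_fun_mono_sum:
  assumes "0 \<le> v" "v \<le> w"
  shows "(\<Sum>i. 2 ^ i * max 0 (v * psi i - 1)) \<le> (\<Sum>i. 2 ^ i * max 0 (w * psi i - 1))"
proof (rule suminf_le)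
  fix i
  have "v * psi i \<le> w * psi i" using assms by (intro mult_right_mono) auto
  then have "max 0 (v * psi i - 1) \<le> max 0 (w * psi i - 1)" by (intro max.mono) auto
  then show "2 ^ i * max 0 (v * psi i - 1) \<le> 2 ^ i * max 0 (w * psi i - 1)"
    by (intro mult_left_mono) auto
qed (use assms orlicz_fun_summable in auto)

lemma orlicz_fun_mono: "0 \<le> v \<Longrightarrow> v \<le> w \<Longrightarrow> orlicz_fun v \<le> orlicz_fun w"
  using orlicz_fun_mono_sum[of v w] by (simp add: orlicz_fun_def)

lemma orlicz_fun_0: "orlicz_fun 0 = 0" by (simp add: orlicz_fun_def)

lemma orlicz_fun_nonneg: "0 \<le> v \<Longrightarrow> 0 \<le> orlicz_fun v"
  using orlicz_fun_mono[of 0 v] by (simp add: orlicz_fun_0)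

lemma orlicz_fun_convex: "convex_on {0..} orlicz_fun"
  unfolding convex_on_def
proof (intro conjI ballI allI impI)
  fix x y u v :: real
  assume xy: "x \<in> {0..}" "y \<in> {0..}" and uv: "0 \<le> u" "0 \<le> v" "u + v = 1"
  let ?f = "\<lambda>z i. 2 ^ i * max 0 (z * psi i - 1)"
  have z: "0 \<le> u * x + v * y" using xy uv by simp
  have sx: "summable (?f x)" and sy: "summable (?f y)" using xy orlicz_fun_summable by auto
  have "(\<Sum>i. ?f (u * x + v * y) i) \<le> (\<Sum>i. u * ?f x i + v * ?f y i)"
  proof (rule suminf_le)
    fix i
    have "u * (x * psi i - 1) \<le> u * max 0 (x * psi i - 1)" "v * (y * psi i - 1) \<le> v * max 0 (y * psi i - 1)"
      using uv by (intro mult_left_mono; simp)+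
    moreover have "(u * x + v * y) * psi i - 1 = u * (x * psi i - 1) + v * (y * psi i - 1)"
      using uv(3) by (simp add: algebra_simps)
    moreover have "0 \<le> u * max 0 (x * psi i - 1)" "0 \<le> v * max 0 (y * psi i - 1)" using uv by auto
    ultimately have "max 0 ((u * x + v * y) * psi i - 1) \<le> u * max 0 (x * psi i - 1) + v * max 0 (y * psi i - 1)"
      by linarith
    then have "?f (u * x + v * y) i \<le> 2 ^ i * (u * max 0 (x * psi i - 1) + v * max 0 (y * psi i - 1))"
      by (intro mult_left_mono) auto
    then show "?f (u * x + v * y) i \<le> u * ?f x i + v * ?f y i" by (simp add: algebra_simps)
  qed (use z sx sy orlicz_fun_summable in \<open>auto intro!: summable_add summable_mult\<close>)
  also have "\<dots> = u * (\<Sum>i. ?f x i) + v * (\<Sum>i. ?f y i)"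
    using sx sy by (subst suminf_add[symmetric]) (auto simp: suminf_mult intro: summable_mult)
  finally show "orlicz_fun (u *\<^sub>R x + v *\<^sub>R y) \<le> u * orlicz_fun x + v * orlicz_fun y"
    by (simp add: orlicz_fun_def algebra_simps)
qed simp

lemma orlicz_function_orlicz_fun: "orlicz_function orlicz_fun"
  unfolding orlicz_function_def
proof (intro conjI)
  \<comment> \<open>The summand v provides strictness: the series vanishes as long as
    \<open>v * psi 0\<close> is at most 1.\<close>
  show "strict_mono_on {0..} orlicz_fun"
    using orlicz_fun_mono_sum by (intro strict_mono_onI) (auto simp: orlicz_fun_def intro!: add_less_le_mono)
qed (use orlicz_fun_nonneg orlicz_fun_convex orlicz_fun_0 in auto)

lemma orlicz_fun_scale: 
  assumes "0 \<le> v" "0 \<le> e" "e \<le> 1" shows "orlicz_fun (e * v) \<le> e * orlicz_fun v"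
proof -
  have "\<forall>u\<ge>0. \<forall>w\<ge>0. u + w = 1 \<longrightarrow> orlicz_fun (u *\<^sub>R v + w *\<^sub>R 0) \<le> u * orlicz_fun v + w * orlicz_fun 0"
    using orlicz_fun_convex assms unfolding convex_on_def by (meson atLeast_iff order_refl)
  from this[rule_format, of e "1 - e"] show ?thesis using assms by (simp add: orlicz_fun_0)
qed

lemma orlicz_fun_ge: 
  assumes "0 \<le> v" "2 \<le> v * psi k" shows "2 ^ k \<le> orlicz_fun v"
proof -
  have "2 ^ k * 1 \<le> 2 ^ k * max 0 (v * psi k - 1)" using assms by (intro mult_left_mono) auto
  also have "\<dots> = (\<Sum>i\<in>{k}. 2 ^ i * max 0 (v * psi i - 1))" by simp
  also have "\<dots> \<le> (\<Sum>i. 2 ^ i * max 0 (v * psi i - 1))"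
    using orlicz_fun_summable[OF assms(1)] by (intro sum_le_suminf) auto
  finally show ?thesis using assms(1) by (simp add: orlicz_fun_def)
qed

definition CF :: real where "CF = 2 * Cb / (1 - r) + 2 / psi 0"

lemma CF: "0 < CF" using Cb r by (simp add: CF_def add_pos_pos)

text \<open>Terms beyond k vanish, and those up to k are dominated by a geometric sequence ending at
  k, because of \<open>psi_growth\<close>. This gives the first summand of \<open>CF\<close>; the
  linear term of \<open>orlicz_fun\<close> gives the second.\<close>

lemma orlicz_fun_le:
  assumes v: "0 \<le> v" "v * psi (Suc k) \<le> 1" shows "orlicz_fun v \<le> CF * 2 ^ k"
proof -
  have "(\<Sum>i. 2 ^ i * max 0 (v * psi i - 1)) = (\<Sum>i\<in>{..k}. 2 ^ i * max 0 (v * psi i - 1))"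
  proof (rule suminf_finite)
    fix i assume "i \<notin> {..k}"
    then have "v * psi i \<le> v * psi (Suc k)" using v by (intro mult_left_mono psi_antimono) auto
    then show "2 ^ i * max 0 (v * psi i - 1) = 0" using v by simp
  qed simp
  also have "\<dots> \<le> (\<Sum>i\<in>{..k}. (2 * Cb * 2 ^ k) * r ^ (k - i))"
  proof (rule sum_mono)
    fix i assume i: "i \<in> {..k}"
    have vk: "v * psi k \<le> 2"
      using mult_left_mono[OF psi_doubling[of k 1] v(1)] v(2) by simp
    have "2 ^ i * max 0 (v * psi i - 1) \<le> 2 ^ i * (v * psi i)"
      using v by (intro mult_left_mono) auto
    also have "\<dots> \<le> 2 ^ i * (v * (Cb * (2 * r) ^ (k - i) * psi k))"
      using psi_growth[of i "k - i"] i v by (intro mult_left_mono) auto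
    also have "\<dots> = Cb * (2 ^ i * 2 ^ (k - i)) * r ^ (k - i) * (v * psi k)"
      by (simp add: power_mult_distrib)
    also have "2 ^ i * 2 ^ (k - i) = (2::real) ^ k" using i by (simp add: power_add[symmetric])
    also have "Cb * 2 ^ k * r ^ (k - i) * (v * psi k) \<le> Cb * 2 ^ k * r ^ (k - i) * 2"
      using vk Cb r by (intro mult_left_mono) auto
    finally show "2 ^ i * max 0 (v * psi i - 1) \<le> (2 * Cb * 2 ^ k) * r ^ (k - i)" by (simp add: mult_ac)
  qed
  also have "\<dots> = (2 * Cb * 2 ^ k) * (\<Sum>i\<in>{..k}. r ^ i)"
    by (simp add: sum_distrib_left[symmetric] sum.atLeastAtMost_rev[of "\<lambda>i. r ^ i" 0 k, simplified atLeast0AtMost])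
  also have "\<dots> \<le> (2 * Cb * 2 ^ k) * (1 / (1 - r))"
  proof (rule mult_left_mono)
    have "(\<Sum>i\<in>{..k}. r ^ i) \<le> (\<Sum>i. r ^ i)" using r by (intro sum_le_suminf summable_geometric) auto
    then show "(\<Sum>i\<in>{..k}. r ^ i) \<le> 1 / (1 - r)" using r by (simp add: suminf_geometric)
  qed (use Cb in auto)
  finally have 1: "(\<Sum>i. 2 ^ i * max 0 (v * psi i - 1)) \<le> (2 * Cb * 2 ^ k) * (1 / (1 - r))" .
  have "v * psi 0 \<le> v * (2 ^ Suc k * psi (Suc k))" using psi_doubling[of 0 "Suc k"] v by (intro mult_left_mono) auto
  also have "\<dots> \<le> 2 ^ Suc k" using v(2) by (simp add: mult_ac)
  finally have "v \<le> 2 ^ Suc k / psi 0" by (simp add: pos_le_divide_eq)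
  then show ?thesis using 1 by (simp add: orlicz_fun_def CF_def algebra_simps)
qed

end

section \<open>Comparison of the Orlicz modular with sums of p-th powers\<close>

context seq_model
begin

lemma p: "1 < p" "p * \<theta> = 1" "\<theta> * p = 1" "0 < p"
  using theta by (auto simp: p_def)

lemma powr_p_theta: "0 \<le> x \<Longrightarrow> (x powr p) powr \<theta> = x" "0 \<le> x \<Longrightarrow> (x powr \<theta>) powr p = x"
  using p by (auto simp: powr_powr)

definition R :: real where "R = 36 * real q ^ 2"

text \<open>n is the largest number with \<open>3 * q * 2 ^ n \<le> i\<close>, or 0 for small i.
  Then i + 1 is at most \<open>6 * q * 2 ^ n\<close>, and R is the square of 6 q.\<close>

lemma regime_scale: "\<exists>n. (n = 0 \<or> 3 * q * 2 ^ n \<le> i) \<and> 1 / 4 ^ n \<le> R / (real i + 1) ^ 2"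
proof -
  have *: "1 / 4 ^ n \<le> R / (real i + 1) ^ 2" if "i + 1 \<le> 6 * q * 2 ^ n" for n
  proof -
    have "real (i + 1) \<le> real (6 * q * 2 ^ n)" using that by (simp only: of_nat_le_iff)
    then have "(real i + 1)\<^sup>2 \<le> (6 * real q * 2 ^ n)\<^sup>2" by (intro power_mono) auto
    also have "\<dots> = R * 4 ^ n" 
      by (simp add: R_def power_mult_distrib power_mult[symmetric] mult.commute[of n 2]) (simp add: power_mult)
    finally show ?thesis by (simp add: divide_simps mult.commute)
  qed
  show ?thesis
  proof (cases "3 * q \<le> i")
    case False
    then show ?thesis using *[of 0] by (intro exI[of _ 0]) auto
  next
    case True
    define m where "m = i div (3 * q)"
    have m1: "1 \<le> m" using True q by (simp add: m_def Suc_le_eq div_greater_zero_iff)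
    then obtain n where n: "2 ^ n \<le> m" "m < 2 ^ (n + 1)" using ex_power_ivl1[of 2 m] by auto
    have "3 * q * 2 ^ n \<le> 3 * q * m" using n by simp
    also have "\<dots> \<le> i" unfolding m_def by (simp add: mult.commute)
    finally have a: "3 * q * 2 ^ n \<le> i" .
    have "i < 3 * q * (m + 1)" unfolding m_def using q 
      by (metis dividend_less_times_div mult_pos_pos zero_less_numeral less_le_trans zero_less_one add.commute plus_1_eq_Suc mult_Suc_right)
    also have "\<dots> \<le> 3 * q * 2 ^ (n + 1)" using n by (intro mult_left_mono) auto
    finally have "i + 1 \<le> 6 * q * 2 ^ n" by simp
    then show ?thesis using a * by blast
  qed
qed

text \<open>Two applications of the regime double the admissible shift. This matters: the error
  2^-n, about 1/i, would not be summable, whereas 4^-n, about i^-2, is. The factor 3 in the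
  hypothesis keeps the index in the regime after the first shift.\<close>

lemma regime2:
  assumes n: "n = 0 \<or> 3 * q * 2 ^ n \<le> i" and m: "m \<le> 2 * n"
  shows "m \<le> i" "psi (i - m) \<le> D\<^sup>2 * 2 powr (m * \<theta>) * psi i" "2 powr (m * \<theta>) * psi i \<le> D\<^sup>2 * psi (i - m)"
proof -
  have "m \<le> i \<and> psi (i - m) \<le> D\<^sup>2 * 2 powr (m * \<theta>) * psi i \<and> 2 powr (m * \<theta>) * psi i \<le> D\<^sup>2 * psi (i - m)"
  proof (cases "n = 0")
    case True
    have "1 \<le> D\<^sup>2" using D by simp
    then have "1 * psi i \<le> D\<^sup>2 * psi i" by (intro mult_right_mono) auto
    then show ?thesis using True m by simp
  next
    case False
    then have n3: "3 * q * 2 ^ n \<le> i" using n by blast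
    define m1 where "m1 = min m n"
    define m2 where "m2 = m - m1"
    have mm: "m = m1 + m2" "m1 \<le> n" "m2 \<le> n" using m by (auto simp: m1_def m2_def)
    have "n \<le> 2 ^ n" by (simp add: less_imp_le)
    also have "\<dots> \<le> q * 2 ^ n" using q by simp
    finally have nq: "n \<le> q * 2 ^ n" .
    have qq: "q \<le> q * 2 ^ n" by simp
    have p1: "q * 2 ^ k \<le> q * 2 ^ n" if "k \<le> n" for k
      using that by (intro mult_left_mono power_increasing) auto
    have n4: "3 * (q * 2 ^ n) \<le> i" using n3 by (simp only: mult.assoc)
    have e: "q * (2 ^ k + 1) = q * 2 ^ k + q" for k by simp
    have c1: "q * (2 ^ m1 + 1) \<le> i" unfolding e using p1[OF mm(2)] qq n4 nq by linarith
    have c2: "q * (2 ^ m2 + 1) \<le> i - m1" unfolding e using p1[OF mm(3)] qq n4 nq mm(2) by linarith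
    have im: "i - m1 - m2 = i - m" using mm by simp
    have mi: "m \<le> i" using mm nq n4 by linarith
    have pw: "2 powr (m * \<theta>) = 2 powr (m2 * \<theta>) * 2 powr (m1 * \<theta>)"
      by (simp add: mm(1) powr_add[symmetric] algebra_simps)
    have "psi (i - m) \<le> D * 2 powr (m2 * \<theta>) * psi (i - m1)" using regime(1)[OF c2] by (simp only: im)
    also have "\<dots> \<le> D * 2 powr (m2 * \<theta>) * (D * 2 powr (m1 * \<theta>) * psi i)"
      using regime(1)[OF c1] D by (intro mult_left_mono) auto
    finally have 1: "psi (i - m) \<le> D\<^sup>2 * 2 powr (m * \<theta>) * psi i"
      unfolding pw by (simp add: power2_eq_square mult_ac)
    have "2 powr (m * \<theta>) * psi i = 2 powr (m2 * \<theta>) * (2 powr (m1 * \<theta>) * psi i)" by (simp add: pw)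
    also have "\<dots> \<le> 2 powr (m2 * \<theta>) * (D * psi (i - m1))" using regime(2)[OF c1] by (intro mult_left_mono) auto
    also have "\<dots> = D * (2 powr (m2 * \<theta>) * psi (i - m1))" by simp
    also have "\<dots> \<le> D * (D * psi (i - m))" using regime(2)[OF c2, unfolded im] D by (intro mult_left_mono) auto
    finally show ?thesis using 1 mi by (simp add: power2_eq_square)
  qed
  then show "m \<le> i" "psi (i - m) \<le> D\<^sup>2 * 2 powr (m * \<theta>) * psi i" "2 powr (m * \<theta>) * psi i \<le> D\<^sup>2 * psi (i - m)"
    by auto
qed

lemma exists_dyadic:
  fixes z :: real
  assumes "1 / 4 ^ n \<le> z" "z \<le> 1"
  shows "\<exists>m\<le>2 * n. 1 / 2 ^ Suc m \<le> z \<and> z \<le> 1 / 2 ^ m \<and> 1 / 2 ^ (2 * n) \<le> z"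
proof -
  have 4: "(4::real) ^ n = 2 ^ (2 * n)" by (simp add: power_mult)
  define m where "m = (GREATEST m. m \<le> 2 * n \<and> z \<le> 1 / 2 ^ m)"
  have m: "m \<le> 2 * n \<and> z \<le> 1 / 2 ^ m" unfolding m_def
    by (rule GreatestI_nat[of _ 0 "2 * n"]) (use assms in auto)
  have "1 / 2 ^ Suc m \<le> z"
  proof (cases "m = 2 * n")
    case True
    have "1 / (2::real) ^ Suc m \<le> 1 / 2 ^ m" by (simp add: divide_simps)
    then show ?thesis using assms(1) True by (simp add: 4)
  next
    case False
    then have "\<not> z \<le> 1 / 2 ^ Suc m"
      using Greatest_le_nat[of "\<lambda>m. m \<le> 2 * n \<and> z \<le> 1 / 2 ^ m" "Suc m" "2 * n"] m unfolding m_def[symmetric] by auto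
    then show ?thesis by simp
  qed
  then show ?thesis using m assms 4 by auto
qed

lemma powr_theta_pow2: "(1 / 2 ^ m) powr \<theta> = 1 / 2 powr (m * \<theta>)"
  by (simp add: powr_divide powr_realpow[symmetric] powr_powr)

text \<open>After so many further dyadic steps the decay of \<open>psi\<close> has absorbed the
  constant that the regime loses.\<close>

definition hshift :: nat where "hshift = (SOME h. Cb * r ^ h * D\<^sup>2 \<le> 1)"

lemma hshift: "Cb * r ^ hshift * D\<^sup>2 \<le> 1"
  unfolding hshift_def by (rule someI_ex) (rule psi_small, use D in auto)

definition M1 :: real where "M1 = CF * 2 ^ hshift * (2 + R)"

text \<open>The left-hand side is, up to a constant, the modular of a function equal to
  \<open>a / psi i\<close> on the i-th block. If a^p is about 2^-m, then \<open>a / psi i\<close> is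
  about \<open>1 / psi (i - m)\<close>, where the Orlicz function is about
  \<open>2 ^ (i - m)\<close>.\<close>

lemma modular_upper:
  assumes a: "0 \<le> a" "a \<le> 1"
  shows "orlicz_fun (a / psi i) / 2 ^ i \<le> M1 * (a powr p + 1 / (real i + 1) ^ 2)"
proof -
  obtain n where n: "n = 0 \<or> 3 * q * 2 ^ n \<le> i" "1 / 4 ^ n \<le> R / (real i + 1) ^ 2" using regime_scale by blast
  have ap: "0 \<le> a powr p" "a powr p \<le> 1" using a p powr_mono2[of p a 1] by auto
  \<comment> \<open>If a^p is smaller than 4^-n, it is replaced by 4^-n; this is the source of the
    second summand.\<close>
  obtain m where m: "m \<le> 2 * n" "a powr p \<le> 1 / 2 ^ m" "1 / 2 ^ m \<le> 2 * a powr p + 1 / 4 ^ n"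
  proof (cases "1 / 4 ^ n \<le> a powr p")
    case True
    then obtain m where "m \<le> 2 * n" "1 / 2 ^ Suc m \<le> a powr p" "a powr p \<le> 1 / 2 ^ m"
      using exists_dyadic[OF True ap(2)] by blast
    then show ?thesis by (intro that[of m]) (auto intro: add_increasing2)
  next
    case False
    have "(4::real) ^ n = 2 ^ (2 * n)" by (simp add: power_mult)
    then show ?thesis using False ap by (intro that[of "2 * n"]) auto
  qed
  note reg = regime2[OF n(1) m(1)]
  have "a = (a powr p) powr \<theta>" using a by (simp add: powr_p_theta)
  also have "\<dots> \<le> (1 / 2 ^ m) powr \<theta>" using m(2) theta by (intro powr_mono2) auto
  finally have a2: "a \<le> 1 / 2 powr (m * \<theta>)" by (simp add: powr_theta_pow2)
  define k where "k = i - m + hshift"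
  have "a / psi i * psi (Suc k) \<le> a / psi i * psi k" using a by (intro mult_left_mono psi_antimono) auto
  also have "\<dots> \<le> a / psi i * (Cb * r ^ hshift * psi (i - m))"
    unfolding k_def using a by (intro mult_left_mono psi_decay) auto
  also have "\<dots> \<le> a / psi i * (Cb * r ^ hshift * (D\<^sup>2 * 2 powr (m * \<theta>) * psi i))"
    using reg(2) Cb r a by (intro mult_left_mono) auto
  also have "\<dots> = (Cb * r ^ hshift * D\<^sup>2) * (a * 2 powr (m * \<theta>))" by simp
  also have "\<dots> \<le> 1 * 1"
    using hshift a2 a Cb r by (intro mult_mono) (auto simp: field_simps)
  finally have "orlicz_fun (a / psi i) \<le> CF * 2 ^ k" using a by (intro orlicz_fun_le) auto
  then have "orlicz_fun (a / psi i) / 2 ^ i \<le> CF * 2 ^ k / 2 ^ i" by (intro divide_right_mono) auto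
  also have "\<dots> = CF * 2 ^ hshift * (1 / 2 ^ m)"
  proof -
    have "(2::real) ^ i = 2 ^ (i - m) * 2 ^ m" using reg(1) by (simp add: power_add[symmetric])
    then show ?thesis by (simp add: k_def power_add)
  qed
  also have "\<dots> \<le> CF * 2 ^ hshift * (2 * a powr p + R / (real i + 1) ^ 2)"
    using m(3) n(2) CF by (intro mult_left_mono) auto
  also have "\<dots> \<le> CF * 2 ^ hshift * ((2 + R) * (a powr p + 1 / (real i + 1) ^ 2))"
    using CF ap by (intro mult_left_mono) (auto simp: R_def algebra_simps intro!: add_mono)
  finally show ?thesis by (simp add: M1_def mult.assoc)
qed

definition M2 :: real where "M2 = (8 * D\<^sup>2) powr p * (2 + R)"

text \<open>The same comparison from the other side. The hypothesis on the modular only serves to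
  bound a, so that after normalisation its p-th power is comparable with a power of 1/2.\<close>

lemma modular_lower:
  assumes a: "0 \<le> a" and F: "orlicz_fun (a / psi i) / 2 ^ i \<le> 2"
  shows "a powr p \<le> M2 * (orlicz_fun (a / psi i) / 2 ^ i + 1 / (real i + 1) ^ 2)"
proof -
  define F' where "F' = orlicz_fun (a / psi i) / 2 ^ i"
  have F'0: "0 \<le> F'" unfolding F'_def using a orlicz_fun_nonneg by simp
  \<comment> \<open>Otherwise the term with index i + 2 alone would make the modular at least
    4.\<close>
  have "a \<le> 8"
  proof (rule ccontr)
    assume "\<not> a \<le> 8"
    then have "8 * psi (i + 2) \<le> a * psi (i + 2)" by (intro mult_right_mono) auto
    moreover have "psi i \<le> 4 * psi (i + 2)" using psi_doubling[of i 2] by simp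
    ultimately have "2 * psi i \<le> a * psi (i + 2)" by linarith
    then have "2 \<le> a / psi i * psi (i + 2)" by (simp add: pos_le_divide_eq)
    then have "2 ^ (i + 2) \<le> orlicz_fun (a / psi i)" using a by (intro orlicz_fun_ge) auto
    moreover have "orlicz_fun (a / psi i) \<le> 2 * 2 ^ i" using F by (simp add: divide_le_eq)
    moreover have "0 < (2::real) ^ i" by simp
    moreover have "(2::real) ^ (i + 2) = 4 * 2 ^ i" by (simp add: power_add)
    ultimately show False by linarith
  qed
  \<comment> \<open>At most 1 by the choice of 8; the factor \<open>D\<^sup>2\<close> compensates
    the loss in the regime, and the 8 also covers the 2 demanded by
    \<open>orlicz_fun_ge\<close>.\<close>
  define b where "b = a / (8 * D\<^sup>2)"
  have D2: "1 \<le> D\<^sup>2" using D by simp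
  have b: "0 \<le> b" "b \<le> 1" using a \<open>a \<le> 8\<close> D2 by (auto simp: b_def divide_le_eq)
  have ab: "a = 8 * D\<^sup>2 * b" using D by (simp add: b_def)
  obtain n where n: "n = 0 \<or> 3 * q * 2 ^ n \<le> i" "1 / 4 ^ n \<le> R / (real i + 1) ^ 2" using regime_scale by blast
  have bp: "0 \<le> b powr p" "b powr p \<le> 1" using b p powr_mono2[of p b 1] by auto
  have "b powr p \<le> 2 * F' + R / (real i + 1) ^ 2"
  proof (cases "1 / 4 ^ n \<le> b powr p")
    case False
    then show ?thesis using n(2) F'0 by linarith
  next
    case True
    obtain m0 where m0: "m0 \<le> 2 * n" "1 / 2 ^ Suc m0 \<le> b powr p" "b powr p \<le> 1 / 2 ^ m0" "1 / 2 ^ (2 * n) \<le> b powr p"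
      using exists_dyadic[OF True bp(2)] by blast
    \<comment> \<open>Rounding goes downwards, so that \<open>1 / 2 ^ m\<close> is at most b^p, but
      m must not exceed the largest shift in the regime.\<close>
    define m where "m = min (Suc m0) (2 * n)"
    have m: "m \<le> 2 * n" "1 / 2 ^ m \<le> b powr p" using m0 by (auto simp: m_def min_def)
    have m2: "b powr p \<le> 2 * (1 / 2 ^ m)"
    proof -
      have "m \<le> Suc m0" by (simp add: m_def)
      then have "(2::real) ^ m \<le> 2 ^ Suc m0" by (intro power_increasing) auto
      then have "1 / 2 ^ m0 \<le> 2 * (1 / (2::real) ^ m)" by (simp add: field_simps)
      then show ?thesis using m0(3) by linarith
    qed
    note reg = regime2[OF n(1) m(1)]
    have "(1 / 2 ^ m) powr \<theta> \<le> (b powr p) powr \<theta>" using m(2) theta by (intro powr_mono2) auto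
    then have "1 / 2 powr (m * \<theta>) \<le> b" using b by (simp add: powr_theta_pow2 powr_p_theta)
    then have b2: "1 \<le> b * 2 powr (m * \<theta>)" by (simp add: field_simps)
    have "2 * psi i \<le> 8 * b * (2 powr (m * \<theta>) * psi i)"
      using mult_right_mono[OF b2, of "psi i"] by (simp add: mult_ac)
    also have "\<dots> \<le> 8 * b * (D\<^sup>2 * psi (i - m))" using reg(3) b by (intro mult_left_mono) auto
    finally have "2 \<le> a / psi i * psi (i - m)" by (simp add: ab field_simps)
    then have "2 ^ (i - m) \<le> orlicz_fun (a / psi i)" using a by (intro orlicz_fun_ge) auto
    then have "1 / 2 ^ m \<le> F'" unfolding F'_def using reg(1) by (simp add: power_diff field_simps)
    moreover have "0 \<le> R / (real i + 1) ^ 2" by (simp add: R_def)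
    ultimately show ?thesis using m2 by linarith
  qed
  also have "\<dots> \<le> (2 + R) * (F' + 1 / (real i + 1) ^ 2)"
    using F'0 by (auto simp: R_def algebra_simps)
  finally have "(8 * D\<^sup>2) powr p * b powr p \<le> (8 * D\<^sup>2) powr p * ((2 + R) * (F' + 1 / (real i + 1) ^ 2))"
    by (intro mult_left_mono) auto
  then show ?thesis by (simp add: ab powr_mult M2_def F'_def mult.assoc)
qed

end

lemma ennreal_suminf_bound:
  fixes f :: "nat \<Rightarrow> real"
  assumes "\<And>i. 0 \<le> f i" "(\<Sum>i. ennreal (f i)) \<le> ennreal b" "0 \<le> b"
  shows "summable f" "suminf f \<le> b"
proof -
  have "(\<Sum>i. ennreal (f i)) < top" using assms(2) by (rule le_less_trans) simp
  then show s: "summable f" using assms(1) by (intro summable_suminf_not_top) auto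
  have "ennreal (suminf f) \<le> ennreal b" using suminf_ennreal2[OF assms(1) s] assms(2) by simp
  then show "suminf f \<le> b" using assms(3) by simp
qed

lemma summable_inverse_sq: "summable (\<lambda>i. 1 / (real i + 1) ^ 2)"
proof -
  have "summable (\<lambda>i. inverse ((real (Suc i)) ^ 2))"
    by (subst summable_Suc_iff) (rule inverse_power_summable, simp)
  then show ?thesis by (simp add: inverse_eq_divide add.commute)
qed

section \<open>Equivalence with the Orlicz space\<close>

context seq_model
begin

text \<open>Monotonicity is known on the non-negative reals only; \<open>max 0\<close> extends it to
  the whole line, and a monotone function is Borel.\<close>

lemma orlicz_fun_measurable: "(\<lambda>v. ennreal (orlicz_fun (max 0 v / l))) \<in> borel_measurable borel" if "0 < l"
proof -
  have "mono (\<lambda>v. orlicz_fun (max 0 v / l))"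
    using that by (intro monoI orlicz_fun_mono) (auto intro!: divide_right_mono max.mono)
  then have "(\<lambda>v. orlicz_fun (max 0 v / l)) \<in> borel_measurable borel" by (rule borel_measurable_mono)
  then show ?thesis by (rule measurable_compose[OF _ measurable_ennreal])
qed

lemma orlicz_int_rearr:
  assumes x: "x \<in> BM" and l: "0 < l"
  shows "(\<integral>\<^sup>+t. ennreal (orlicz_fun (\<bar>x t\<bar> / l)) \<partial>I01) = (\<integral>\<^sup>+t. ennreal (orlicz_fun (rearr x t / l)) \<partial>I01)"
  using nn_integral_rearr[OF x orlicz_fun_measurable[OF l]] x by simp

lemma rearr_bcoef: "rearrangement x (1 / 2 ^ i) / l = bcoef x i / l / psi i"
  by (simp add: bcoef_def)

definition Z :: real where "Z = (\<Sum>i. 1 / (real i + 1) ^ 2)"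

lemma Z: "0 \<le> Z" unfolding Z_def by (rule suminf_nonneg[OF summable_inverse_sq]) simp

definition M3 :: real where "M3 = max 1 (M1 * (1 + Z))"

lemma M1: "0 < M1" using CF by (simp add: M1_def R_def add_pos_nonneg)

lemma M2: "0 < M2" using D by (simp add: M2_def R_def add_pos_nonneg)

text \<open>After division by s the modulars of the blocks add up to at most \<open>M3\<close>; by
  convexity a further division by \<open>M3\<close> brings the integral under 1.\<close>

lemma orlicz_upper:
  assumes x: "x \<in> BM" and sm: "summable (\<lambda>i. bcoef x i powr p)" and s: "0 < s" "(\<Sum>i. bcoef x i powr p) powr \<theta> \<le> s"
  shows "orlicz_admissible orlicz_fun (M3 * s) x"
proof -
  define a where "a i = bcoef x i / s" for i
  have b0: "0 \<le> bcoef x i" for i by (rule bcoef_nonneg[OF x])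
  have a0: "0 \<le> a i" for i using b0 s by (simp add: a_def)
  have ap: "a i powr p = bcoef x i powr p / s powr p" for i unfolding a_def by (rule powr_divide)
  have sa: "summable (\<lambda>i. a i powr p)" unfolding ap using sm by (rule summable_divide)
  have "(\<Sum>i. bcoef x i powr p) = ((\<Sum>i. bcoef x i powr p) powr \<theta>) powr p"
    by (simp add: powr_p_theta suminf_nonneg[OF sm])
  also have "\<dots> \<le> s powr p" using s p by (intro powr_mono2) auto
  finally have A1: "(\<Sum>i. a i powr p) \<le> 1" unfolding ap using s by (subst suminf_divide[OF sm]) simp
  have a1: "a i \<le> 1" for i
  proof -
    have "a i powr p \<le> (\<Sum>i. a i powr p)" using sum_le_suminf[OF sa, of "{i}"] by simp
    then have "a i powr p \<le> 1" using A1 by simp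
    then have "(a i powr p) powr \<theta> \<le> 1 powr \<theta>" using theta by (intro powr_mono2) auto
    then show ?thesis using a0 by (simp add: powr_p_theta)
  qed
  define g where "g i = orlicz_fun (a i / psi i) / 2 ^ i" for i
  have g: "g i \<le> M1 * (a i powr p + 1 / (real i + 1) ^ 2)" for i
    unfolding g_def by (rule modular_upper[OF a0 a1])
  have sg: "summable (\<lambda>i. M1 * (a i powr p + 1 / (real i + 1) ^ 2))"
    by (intro summable_mult summable_add sa summable_inverse_sq)
  have g0: "0 \<le> g i" for i unfolding g_def using a0 by (intro divide_nonneg_pos orlicz_fun_nonneg) auto
  have sumg: "summable g" by (rule summable_comparison_test'[OF sg, of 0]) (use g g0 in auto)
  have "suminf g \<le> (\<Sum>i. M1 * (a i powr p + 1 / (real i + 1) ^ 2))" by (rule suminf_le[OF g sumg sg])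
  also have "\<dots> = M1 * ((\<Sum>i. a i powr p) + Z)"
    unfolding Z_def by (subst suminf_mult) (auto simp: suminf_add sa summable_inverse_sq intro: summable_add)
  also have "\<dots> \<le> M1 * (1 + Z)" using A1 M1 by (intro mult_left_mono) auto
  also have "\<dots> \<le> M3" by (simp add: M3_def)
  finally have G: "suminf g \<le> M3" .
  have M3: "1 \<le> M3" by (simp add: M3_def)
  have int: "(\<integral>\<^sup>+t. ennreal (orlicz_fun (rearr x t / s)) \<partial>I01) \<le> ennreal M3"
  proof -
    \<comment> \<open>On block i the rearrangement is bounded by its value at the left end, which
      belongs to index \<open>Suc i\<close>.\<close>
    have "(\<integral>\<^sup>+t. ennreal (orlicz_fun (rearr x t / s)) \<partial>I01) \<le> (\<Sum>i. ennreal (orlicz_fun (a (Suc i) / psi (Suc i))) * ennreal (1 / 2 ^ Suc i))"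
    proof (rule nn_integral_le_dyadic)
      fix i t assume "t \<in> dyadic i"
      then have "rearr x t / s \<le> rearrangement x (1 / 2 ^ Suc i) / s"
        using rearr_dyadic(2)[OF x] s by (intro divide_right_mono) auto
      then show "ennreal (orlicz_fun (rearr x t / s)) \<le> ennreal (orlicz_fun (a (Suc i) / psi (Suc i)))"
        unfolding a_def rearr_bcoef[symmetric] using x s by (intro ennreal_leI orlicz_fun_mono) auto
    qed
    also have "\<dots> = (\<Sum>i. ennreal (g (Suc i)))"
      unfolding g_def using a0 by (intro suminf_cong) (simp add: ennreal_mult[symmetric] orlicz_fun_nonneg)
    also have "\<dots> = ennreal (\<Sum>i. g (Suc i))"
      using g0 sumg by (intro suminf_ennreal2) (auto simp: summable_Suc_iff)
    also have "\<dots> \<le> ennreal M3" using suminf_split_head[OF sumg] g0[of 0] G by (intro ennreal_leI) auto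
    finally show ?thesis .
  qed
  have "(\<integral>\<^sup>+t. ennreal (orlicz_fun (\<bar>x t\<bar> / (M3 * s))) \<partial>I01) \<le> (\<integral>\<^sup>+t. ennreal (1 / M3) * ennreal (orlicz_fun (rearr x t / s)) \<partial>I01)"
    unfolding orlicz_int_rearr[OF x mult_pos_pos[OF less_le_trans[OF zero_less_one M3] s(1)]]
  proof (rule nn_integral_mono)
    fix t
    have "orlicz_fun (1 / M3 * (rearr x t / s)) \<le> 1 / M3 * orlicz_fun (rearr x t / s)"
      using M3 s x by (intro orlicz_fun_scale) auto
    then show "ennreal (orlicz_fun (rearr x t / (M3 * s))) \<le> ennreal (1 / M3) * ennreal (orlicz_fun (rearr x t / s))"
      using M3 s x by (subst ennreal_mult[symmetric]) (auto intro!: ennreal_leI orlicz_fun_nonneg)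
  qed
  also have "\<dots> = ennreal (1 / M3) * (\<integral>\<^sup>+t. ennreal (orlicz_fun (rearr x t / s)) \<partial>I01)"
  proof (rule nn_integral_cmult)
    have "(\<lambda>t. ennreal (orlicz_fun (max 0 (rearr x t) / s))) \<in> borel_measurable I01"
      using measurable_compose[OF rearr_BM[OF x] orlicz_fun_measurable[OF s(1)]] .
    then show "(\<lambda>t. ennreal (orlicz_fun (rearr x t / s))) \<in> borel_measurable I01" using x by simp
  qed
  also have "\<dots> \<le> ennreal (1 / M3) * ennreal M3" using int by (intro mult_left_mono) auto
  also have "\<dots> = 1" using M3 by (simp add: ennreal_mult[symmetric])
  finally show ?thesis using M3 s by (simp add: orlicz_admissible_def)
qed

definition M4 :: real where "M4 = (M2 * (2 + Z)) powr \<theta>"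

text \<open>Block i has size 2^-(i+1), so an integral of at most 1 bounds the sum of the block
  modulars by 2. In particular each of them is at most 2, as \<open>modular_lower\<close>
  requires.\<close>

lemma orlicz_lower:
  assumes x: "x \<in> BM" and adm: "orlicz_admissible orlicz_fun l x"
  shows "summable (\<lambda>i. bcoef x i powr p)" "(\<Sum>i. bcoef x i powr p) powr \<theta> \<le> M4 * l"
proof -
  have l: "0 < l" and int: "(\<integral>\<^sup>+t. ennreal (orlicz_fun (\<bar>x t\<bar> / l)) \<partial>I01) \<le> 1"
    using adm by (auto simp: orlicz_admissible_def)
  define a where "a i = bcoef x i / l" for i
  have b0: "0 \<le> bcoef x i" for i by (rule bcoef_nonneg[OF x])
  have a0: "0 \<le> a i" for i using b0 l by (simp add: a_def)
  define g where "g i = orlicz_fun (a i / psi i) / 2 ^ i" for i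
  have g0: "0 \<le> g i" for i unfolding g_def using a0 by (intro divide_nonneg_pos orlicz_fun_nonneg) auto
  have "(\<Sum>i. ennreal (g i / 2)) = (\<Sum>i. ennreal (orlicz_fun (a i / psi i)) * ennreal (1 / 2 ^ Suc i))"
    unfolding g_def using a0 by (intro suminf_cong) (simp add: ennreal_mult[symmetric] orlicz_fun_nonneg mult.commute)
  also have "\<dots> \<le> (\<integral>\<^sup>+t. ennreal (orlicz_fun (rearr x t / l)) \<partial>I01)"
  proof (rule nn_integral_ge_dyadic)
    fix i t assume "t \<in> dyadic i"
    then have "rearrangement x (1 / 2 ^ i) / l \<le> rearr x t / l"
      using rearr_dyadic(1)[OF x] l by (intro divide_right_mono) auto
    then show "ennreal (orlicz_fun (a i / psi i)) \<le> ennreal (orlicz_fun (rearr x t / l))"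
      using a0 unfolding a_def rearr_bcoef[symmetric] using x l
      by (intro ennreal_leI orlicz_fun_mono divide_nonneg_pos rearrangement_nonneg) auto
  qed
  also have "\<dots> \<le> ennreal 1" using int unfolding orlicz_int_rearr[OF x l] by simp
  finally have gs: "(\<Sum>i. ennreal (g i / 2)) \<le> ennreal 1" .
  have gh: "0 \<le> g i / 2" for i using g0[of i] by simp
  note h = ennreal_suminf_bound[OF gh gs zero_le_one]
  have sg: "summable g" using summable_mult[OF h(1), of 2] by simp
  have G: "suminf g \<le> 2" using h(2) suminf_divide[OF sg, of 2] by simp
  have g2: "g i \<le> 2" for i using sum_le_suminf[OF sg, of "{i}"] g0 G by simp
  have ap: "a i powr p \<le> M2 * (g i + 1 / (real i + 1) ^ 2)" for i
    using modular_lower[OF a0, of i] g2[of i] by (simp add: g_def)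
  have sg2: "summable (\<lambda>i. M2 * (g i + 1 / (real i + 1) ^ 2))"
    by (intro summable_mult summable_add sg summable_inverse_sq)
  have sa: "summable (\<lambda>i. a i powr p)"
    by (rule summable_comparison_test'[OF sg2, of 0]) (use ap in auto)
  have "(\<Sum>i. a i powr p) \<le> (\<Sum>i. M2 * (g i + 1 / (real i + 1) ^ 2))" by (rule suminf_le[OF ap sa sg2])
  also have "\<dots> = M2 * (suminf g + Z)"
    unfolding Z_def by (subst suminf_mult) (auto simp: suminf_add sg summable_inverse_sq intro: summable_add)
  also have "\<dots> \<le> M2 * (2 + Z)" using G M2 by (intro mult_left_mono) auto
  finally have A: "(\<Sum>i. a i powr p) \<le> M2 * (2 + Z)" .
  have bp: "bcoef x i powr p = l powr p * a i powr p" for i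
    using l by (simp add: a_def powr_mult[symmetric])
  show "summable (\<lambda>i. bcoef x i powr p)" unfolding bp using sa by (rule summable_mult)
  have "(\<Sum>i. bcoef x i powr p) = l powr p * (\<Sum>i. a i powr p)" unfolding bp using sa by (rule suminf_mult)
  also have "\<dots> \<le> l powr p * (M2 * (2 + Z))" using A by (intro mult_left_mono) auto
  finally have "(\<Sum>i. bcoef x i powr p) powr \<theta> \<le> (l powr p * (M2 * (2 + Z))) powr \<theta>"
    using theta by (intro powr_mono2) (auto simp: bp intro!: suminf_nonneg summable_mult sa)
  also have "\<dots> = M4 * l" using l by (simp add: powr_mult powr_p_theta M4_def)
  finally show "(\<Sum>i. bcoef x i powr p) powr \<theta> \<le> M4 * l" .
qed

lemma orlicz_equivalent: "equivalent_spaces X (orlicz_space orlicz_fun)"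
proof -
  have bdd: "bdd_below {l. orlicz_admissible orlicz_fun l x}" for x
    by (rule bdd_belowI[of _ 0]) (auto simp: orlicz_admissible_def)
  have 1: "x \<in> elts (orlicz_space orlicz_fun) \<and> nrm (orlicz_space orlicz_fun) x \<le> M3 * K * nrm X x" if x: "x \<in> elts X" for x
  proof -
    have xb: "x \<in> BM" by (rule elts_BM[OF x])
    have sm: "summable (\<lambda>i. bcoef x i powr p)" using elts_iff[OF xb] x by simp
    \<comment> \<open>The summand e keeps the scale positive when x vanishes; it is removed by
      letting e tend to 0.\<close>
    have adm: "orlicz_admissible orlicz_fun (M3 * (K * nrm X x + e)) x" if "0 < e" for e
    proof (rule orlicz_upper[OF xb sm])
      show "0 < K * nrm X x + e" using that K nrm_nonneg[OF x] by (simp add: add_nonneg_pos)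
      show "(\<Sum>i. bcoef x i powr p) powr \<theta> \<le> K * nrm X x + e" using nrm_ge[OF x] that by simp
    qed
    have M3: "1 \<le> M3" by (simp add: M3_def)
    have "nrm (orlicz_space orlicz_fun) x \<le> M3 * K * nrm X x + e" if "0 < e" for e
    proof -
      have "nrm (orlicz_space orlicz_fun) x \<le> M3 * (K * nrm X x + e / M3)"
        unfolding orlicz_space_def using adm[of "e / M3"] that M3 bdd by (auto intro!: cInf_lower)
      then show ?thesis using M3 by (simp add: algebra_simps)
    qed
    then have "nrm (orlicz_space orlicz_fun) x \<le> M3 * K * nrm X x" by (rule field_le_epsilon)
    then show ?thesis using adm[of 1] xb by (auto simp: orlicz_space_def)
  qed
  have 2: "x \<in> elts X \<and> nrm X x \<le> K * M4 * nrm (orlicz_space orlicz_fun) x" if x: "x \<in> elts (orlicz_space orlicz_fun)" for x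
  proof -
    have xb: "x \<in> BM" and ne: "{l. orlicz_admissible orlicz_fun l x} \<noteq> {}" using x by (auto simp: orlicz_space_def)
    then obtain l where l: "orlicz_admissible orlicz_fun l x" by blast
    have xX: "x \<in> elts X" using elts_iff[OF xb] orlicz_lower(1)[OF xb l] by simp
    have M4: "0 < M4" using M2 Z by (simp add: M4_def)
    have "nrm X x \<le> K * M4 * l" if "orlicz_admissible orlicz_fun l x" for l
    proof -
      have "nrm X x \<le> K * (\<Sum>i. bcoef x i powr p) powr \<theta>" by (rule nrm_le[OF xX])
      also have "\<dots> \<le> K * (M4 * l)" using orlicz_lower(2)[OF xb that] K by (intro mult_left_mono) auto
      finally show ?thesis by simp
    qed
    then have "nrm X x / (K * M4) \<le> l" if "orlicz_admissible orlicz_fun l x" for l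
      using that K M4 by (simp add: divide_le_eq mult.commute)
    then have "nrm X x / (K * M4) \<le> Inf {l. orlicz_admissible orlicz_fun l x}"
      using ne by (intro cInf_greatest) auto
    then have "nrm X x \<le> K * M4 * nrm (orlicz_space orlicz_fun) x"
      using K M4 by (simp add: orlicz_space_def divide_le_eq mult.commute)
    then show ?thesis using xX by blast
  qed
  show ?thesis unfolding equivalent_spaces_def embedded_def using 1 2 by blast
qed

end

section \<open>A concave fundamental function for an equivalent norm\<close>

context boyd_space
begin

lemma Cb_ge_1: "1 \<le> Cb"
  using psi_decay[of 0 0] by simp

text \<open>One constant for both indices: tails of the sum of \<open>psi i\<close> are at most Q
  times their first term, and initial parts of the sum of \<open>2 ^ i * psi i\<close> at most Q
  times their last term.\<close>

definition Q :: real where "Q = Cb / (1 - r)"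

lemma Q: "1 \<le> Q" using Cb_ge_1 r by (simp add: Q_def le_divide_eq)

lemma psi_tail: "summable (\<lambda>j. psi (i + j))" "(\<Sum>j. psi (i + j)) \<le> Q * psi i"
proof -
  have sg: "summable (\<lambda>j. Cb * r ^ j * psi i)" using r by (intro summable_mult2 summable_mult summable_geometric) auto
  show s: "summable (\<lambda>j. psi (i + j))"
    by (rule summable_comparison_test'[OF sg, of 0]) (use psi_decay in auto)
  have "(\<Sum>j. psi (i + j)) \<le> (\<Sum>j. Cb * r ^ j * psi i)" by (rule suminf_le[OF psi_decay s sg])
  also have "\<dots> = Cb * (\<Sum>j. r ^ j) * psi i"
    using r by (simp add: suminf_mult suminf_mult2[symmetric] summable_geometric summable_mult)
  also have "\<dots> = Q * psi i" using r by (simp add: suminf_geometric Q_def)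
  finally show "(\<Sum>j. psi (i + j)) \<le> Q * psi i" .
qed

lemma geo_le: "(\<Sum>i\<in>{..k}. r ^ i) \<le> 1 / (1 - r)"
proof -
  have "(\<Sum>i\<in>{..k}. r ^ i) \<le> (\<Sum>i. r ^ i)" using r by (intro sum_le_suminf summable_geometric) auto
  then show ?thesis using r by (simp add: suminf_geometric)
qed

lemma psi_head: "(\<Sum>i\<in>{..k}. 2 ^ i * psi i) \<le> Q * 2 ^ k * psi k"
proof -
  have "(\<Sum>i\<in>{..k}. 2 ^ i * psi i) \<le> (\<Sum>i\<in>{..k}. Cb * 2 ^ k * psi k * r ^ (k - i))"
  proof (rule sum_mono)
    fix i assume i: "i \<in> {..k}"
    have "2 ^ i * psi i \<le> 2 ^ i * (Cb * (2 * r) ^ (k - i) * psi k)"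
      using psi_growth[of i "k - i"] i by (intro mult_left_mono) auto
    also have "\<dots> = Cb * (2 ^ i * 2 ^ (k - i)) * psi k * r ^ (k - i)"
      by (simp add: power_mult_distrib)
    also have "2 ^ i * 2 ^ (k - i) = (2::real) ^ k" using i by (simp add: power_add[symmetric])
    finally show "2 ^ i * psi i \<le> Cb * 2 ^ k * psi k * r ^ (k - i)" .
  qed
  also have "\<dots> = Cb * 2 ^ k * psi k * (\<Sum>i\<in>{..k}. r ^ i)"
    by (simp add: sum_distrib_left[symmetric] sum.atLeastAtMost_rev[of "\<lambda>i. r ^ i" 0 k, simplified atLeast0AtMost])
  also have "\<dots> \<le> Cb * 2 ^ k * psi k * (1 / (1 - r))"
    using geo_le Cb by (intro mult_left_mono) auto
  finally show ?thesis by (simp add: Q_def)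
qed

text \<open>A concave function equivalent to the fundamental function.\<close>

definition cfund :: "real \<Rightarrow> real" where "cfund t = 2 * (\<Sum>i. psi i * min 1 (2 ^ i * t))"

lemma cfund_summable: "0 \<le> t \<Longrightarrow> summable (\<lambda>i. psi i * min 1 (2 ^ i * t))"
  by (rule summable_comparison_test'[OF psi_tail(1)[of 0], of 0]) (auto simp: abs_mult mult_left_le)

lemma cfund_mono: "0 \<le> s \<Longrightarrow> s \<le> t \<Longrightarrow> cfund s \<le> cfund t"
  unfolding cfund_def by (intro mult_left_mono suminf_le cfund_summable min.mono) auto

lemma cfund_0 [simp]: "cfund 0 = 0" by (simp add: cfund_def)

lemma cfund_nonneg: "0 \<le> t \<Longrightarrow> 0 \<le> cfund t"
  using cfund_mono[of 0 t] by simp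

lemma cfund_concave: "concave_on {0..1} cfund"
  unfolding concave_on_iff
proof (intro conjI ballI allI impI)
  fix x y u v :: real
  assume xy: "x \<in> {0..1}" "y \<in> {0..1}" and uv: "0 \<le> u" "0 \<le> v" "u + v = 1"
  let ?f = "\<lambda>t i. psi i * min 1 (2 ^ i * t)"
  have z: "0 \<le> u * x + v * y" using xy uv by simp
  have sx: "summable (?f x)" and sy: "summable (?f y)" using xy cfund_summable by auto
  have "u * (\<Sum>i. ?f x i) + v * (\<Sum>i. ?f y i) = (\<Sum>i. u * ?f x i + v * ?f y i)"
    using sx sy by (subst suminf_add[symmetric]) (auto simp: suminf_mult intro: summable_mult)
  also have "\<dots> \<le> (\<Sum>i. ?f (u * x + v * y) i)"
  proof (rule suminf_le)
    fix i
    have "u * min 1 (2 ^ i * x) \<le> u * 1" "v * min 1 (2 ^ i * y) \<le> v * 1"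
      "u * min 1 (2 ^ i * x) \<le> u * (2 ^ i * x)" "v * min 1 (2 ^ i * y) \<le> v * (2 ^ i * y)"
      using uv by (intro mult_left_mono; simp)+
    moreover have "2 ^ i * (u * x + v * y) = u * (2 ^ i * x) + v * (2 ^ i * y)" by (simp add: algebra_simps)
    ultimately have "u * min 1 (2 ^ i * x) + v * min 1 (2 ^ i * y) \<le> min 1 (2 ^ i * (u * x + v * y))"
      using uv(3) by linarith
    then have "psi i * (u * min 1 (2 ^ i * x) + v * min 1 (2 ^ i * y)) \<le> ?f (u * x + v * y) i"
      by (intro mult_left_mono) auto
    then show "u * ?f x i + v * ?f y i \<le> ?f (u * x + v * y) i" by (simp add: algebra_simps)
  qed (use z sx sy cfund_summable in \<open>auto intro!: summable_add summable_mult\<close>)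
  finally show "u * cfund x + v * cfund y \<le> cfund (u *\<^sub>R x + v *\<^sub>R y)"
    by (simp add: cfund_def algebra_simps)
qed simp

definition head_sum :: "nat \<Rightarrow> real" where "head_sum k = (\<Sum>i\<in>{..k}. 2 ^ i * psi i)"

definition tail_sum :: "nat \<Rightarrow> real" where "tail_sum k = (\<Sum>j. psi (Suc k + j))"

text \<open>The i-th term bends only at t = 2^-i, so \<open>cfund\<close> is affine on every dyadic
  block. The derivative in the Lorentz norm is read off from this.\<close>

lemma cfund_eq:
  assumes t: "1 / 2 ^ Suc k \<le> t" "t \<le> 1 / 2 ^ k"
  shows "cfund t = 2 * (head_sum k * t + tail_sum k)"
proof -
  have t0: "0 \<le> t" by (rule order_trans[OF _ t(1)]) simp
  have hi: "psi (i + Suc k) * min 1 (2 ^ (i + Suc k) * t) = psi (Suc k + i)" for i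
  proof -
    have "1 \<le> 2 ^ Suc k * t" using t(1) by (simp add: divide_le_eq mult.commute)
    also have "\<dots> \<le> 2 ^ (i + Suc k) * t" using t0 by (intro mult_right_mono power_increasing) auto
    finally show ?thesis by (simp add: add.commute)
  qed
  have lo: "psi i * min 1 (2 ^ i * t) = 2 ^ i * psi i * t" if "i < Suc k" for i
  proof -
    have "2 ^ i * t \<le> 2 ^ k * t" using t0 that by (intro mult_right_mono power_increasing) auto
    also have "\<dots> \<le> 1" using t(2) by (simp add: le_divide_eq mult.commute)
    finally show ?thesis by simp
  qed
  have S: "(\<Sum>i. psi i * min 1 (2 ^ i * t)) = (\<Sum>i. psi (i + Suc k) * min 1 (2 ^ (i + Suc k) * t)) + (\<Sum>i<Suc k. psi i * min 1 (2 ^ i * t))"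
    by (rule suminf_split_initial_segment[OF cfund_summable[OF t0]])
  have H: "(\<Sum>i. psi (i + Suc k) * min 1 (2 ^ (i + Suc k) * t)) = tail_sum k"
    unfolding tail_sum_def by (rule suminf_cong) (rule hi)
  have "(\<Sum>i<Suc k. psi i * min 1 (2 ^ i * t)) = (\<Sum>i<Suc k. 2 ^ i * psi i * t)"
    by (intro sum.cong lo) auto
  then have L: "(\<Sum>i<Suc k. psi i * min 1 (2 ^ i * t)) = head_sum k * t" 
    by (simp only: head_sum_def sum_distrib_right lessThan_Suc_atMost)
  show ?thesis unfolding cfund_def S H L by simp
qed

lemma tail_sum_le: "tail_sum k \<le> Q * psi k"
proof -
  have "tail_sum k \<le> Q * psi (Suc k)" unfolding tail_sum_def by (rule psi_tail(2))
  also have "\<dots> \<le> Q * psi k" using Q by (intro mult_left_mono psi_antimono) auto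
  finally show ?thesis .
qed

lemma head_sum_ge: "2 ^ k * psi k \<le> head_sum k"
  unfolding head_sum_def by (rule member_le_sum) auto

lemma cfund_le: "0 \<le> t \<Longrightarrow> t \<le> 1 / 2 ^ k \<Longrightarrow> cfund t \<le> 4 * Q * psi k"
proof -
  assume t: "0 \<le> t" "t \<le> 1 / 2 ^ k"
  have "cfund t \<le> cfund (1 / 2 ^ k)" by (rule cfund_mono) (use t in auto)
  also have "\<dots> = 2 * (head_sum k * (1 / 2 ^ k) + tail_sum k)" by (rule cfund_eq) (auto simp: field_simps)
  also have "head_sum k * (1 / 2 ^ k) \<le> Q * psi k" using psi_head[of k] by (simp add: head_sum_def divide_le_eq mult_ac)
  finally show ?thesis using tail_sum_le[of k] by simp
qed

lemma cfund_ge: "t \<in> dyadic k \<Longrightarrow> psi k \<le> cfund t"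
proof -
  assume t: "t \<in> dyadic k"
  have t0: "1 / 2 ^ Suc k < t" "t \<le> 1 / 2 ^ k" using t by (auto simp: dyadic_def)
  have t1: "0 \<le> t" using t0(1) by (rule order_trans[rotated, OF less_imp_le]) simp
  have "1 / 2 \<le> 2 ^ k * t" using t0(1) by (simp add: divide_less_eq mult.commute)
  then have "psi k * (1 / 2) \<le> psi k * min 1 (2 ^ k * t)" by (intro mult_left_mono) auto
  also have "\<dots> = (\<Sum>i\<in>{k}. psi i * min 1 (2 ^ i * t))" by simp
  also have "\<dots> \<le> (\<Sum>i. psi i * min 1 (2 ^ i * t))"
    using t1 by (intro sum_le_suminf cfund_summable) auto
  finally show ?thesis by (simp add: cfund_def)
qed

text \<open>The factor 2 in \<open>cfund\<close> is there for this inequality: it makes the second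
  norm in the definition of Y the larger one on indicators.\<close>

lemma fund_le_cfund:
  assumes "0 \<le> t" "t \<le> 1" shows "fund t \<le> cfund t"
proof (cases "t = 0")
  case False
  then obtain k where k: "t \<in> dyadic k" using dyadic_cover[of t] assms by auto
  have "fund t \<le> psi k" unfolding psi_def using k assms sym_space_inv_pow2[of k] by (intro fund_mono) (auto simp: dyadic_def)
  also have "\<dots> \<le> cfund t" by (rule cfund_ge[OF k])
  finally show ?thesis .
qed (simp add: fund_0)

lemma cfund_div_mono:
  assumes "0 < s" "s \<le> t" shows "cfund t * s \<le> cfund s * t"
proof -
  have "(\<Sum>i. psi i * min 1 (2 ^ i * t)) * s = (\<Sum>i. psi i * min 1 (2 ^ i * t) * s)"
    using assms by (intro suminf_mult2 cfund_summable) auto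
  also have "\<dots> \<le> (\<Sum>i. psi i * min 1 (2 ^ i * s) * t)"
  proof (rule suminf_le)
    fix i
    have "min 1 (2 ^ i * t) * s \<le> min 1 (2 ^ i * s) * t"
    proof (cases "2 ^ i * s \<le> 1")
      case True
      have "min 1 (2 ^ i * t) * s \<le> (2 ^ i * t) * s" using assms by (intro mult_right_mono) auto
      then show ?thesis using True by (simp add: mult_ac)
    next
      case False
      have "min 1 (2 ^ i * t) * s \<le> 1 * s" using assms by (intro mult_right_mono) auto
      also have "1 * s \<le> min 1 (2 ^ i * s) * t" using False assms by simp
      finally show ?thesis .
    qed
    then show "psi i * min 1 (2 ^ i * t) * s \<le> psi i * min 1 (2 ^ i * s) * t"
      by (simp add: mult.assoc)
  qed (use assms in \<open>auto intro!: summable_mult2 cfund_summable\<close>)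
  also have "\<dots> = (\<Sum>i. psi i * min 1 (2 ^ i * s)) * t"
    using assms by (intro suminf_mult2[symmetric] cfund_summable) auto
  finally show ?thesis by (simp add: cfund_def)
qed

text \<open>The sum bounds the integral over (0, 2^-k] of a decreasing function with values
  \<open>c i\<close> at 2^-i. If \<open>c i * psi i\<close> is bounded, then by
  \<open>psi_growth\<close> the sum is geometric, so averages over (0,t] are no worse than values at
  t. This is where an upper index under 1 is used for the Marcinkiewicz norm.\<close>

lemma tail_weak:
  assumes B: "0 \<le> B" and c: "\<And>i. 0 \<le> c i" "\<And>i. c i * psi i \<le> B"
  shows "(\<Sum>i. (if k \<le> i then ennreal (c (Suc i)) else 0) * ennreal (1 / 2 ^ Suc i)) \<le> ennreal (B * Q / 2 ^ k / psi k)"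
proof -
  have cb: "c (k + j) / 2 ^ (k + j) \<le> B * Cb * r ^ j / 2 ^ k / psi k" for j
  proof -
    have "c (k + j) * psi k \<le> c (k + j) * (Cb * (2 * r) ^ j * psi (k + j))"
      using c(1) by (intro mult_left_mono psi_growth) auto
    also have "\<dots> = (c (k + j) * psi (k + j)) * (Cb * (2 * r) ^ j)" by simp
    also have "\<dots> \<le> B * (Cb * (2 * r) ^ j)" using c(2) Cb r by (intro mult_right_mono) auto
    finally have "c (k + j) \<le> B * (Cb * (2 * r) ^ j) / psi k" by (simp add: le_divide_eq)
    then have "c (k + j) / 2 ^ (k + j) \<le> B * (Cb * (2 * r) ^ j) / psi k / 2 ^ (k + j)" by (intro divide_right_mono) auto
    also have "\<dots> = B * Cb * r ^ j / 2 ^ k / psi k" by (simp add: power_add power_mult_distrib mult_ac)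
    finally show ?thesis .
  qed
  define f where "f i = (if k \<le> i then ennreal (c (Suc i)) else 0) * ennreal (1 / 2 ^ Suc i)" for i
  define h where "h j = B * Cb * r ^ j / 2 ^ k / psi k" for j
  have h0: "0 \<le> h j" for j using B Cb r by (simp add: h_def)
  have sh: "summable h" unfolding h_def using r by (intro summable_divide summable_mult summable_geometric) auto
  have "suminf f = (\<Sum>i. f (i + k)) + (\<Sum>i<k. f i)" by (rule suminf_offset) (rule summableI)
  also have "(\<Sum>i<k. f i) = 0" by (rule sum.neutral) (auto simp: f_def)
  also have "(\<Sum>i. f (i + k)) + 0 \<le> (\<Sum>i. ennreal (h (Suc i)))"
  proof -
    have "f (i + k) \<le> ennreal (h (Suc i))" for i
      using cb[of "Suc i"] c(1) unfolding f_def h_def 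
      by (simp add: ennreal_mult[symmetric] add.commute[of k] ennreal_leI)
    then show ?thesis by (simp add: suminf_le summableI)
  qed
  also have "\<dots> = ennreal (\<Sum>i. h (Suc i))" using h0 sh by (intro suminf_ennreal2) (auto simp: summable_Suc_iff)
  also have "\<dots> \<le> ennreal (suminf h)" using suminf_split_head[OF sh] h0[of 0] by (intro ennreal_leI) auto
  also have "suminf h = B * Cb * (\<Sum>j. r ^ j) / 2 ^ k / psi k"
    unfolding h_def using r by (simp add: suminf_divide[symmetric] suminf_mult[symmetric] summable_geometric summable_mult summable_divide)
  also have "\<dots> = B * Q / 2 ^ k / psi k" using r by (simp add: suminf_geometric Q_def)
  finally show ?thesis by (simp add: f_def)
qed

text \<open>The infimum of this expression over l is the K-functional of x between L_1 and
  L_infinity, that is, the integral of the rearrangement over (0,t). In this form subadditivity is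
  immediate. Negative values of \<open>\<bar>x s\<bar> - l\<close> are cut off by
  \<open>ennreal\<close>.\<close>

definition kfun :: "real \<Rightarrow> (real \<Rightarrow> real) \<Rightarrow> real \<Rightarrow> ennreal" where
  "kfun t x l = (\<integral>\<^sup>+s. ennreal (\<bar>x s\<bar> - l) \<partial>I01) + ennreal (t * l)"

definition kinf :: "real \<Rightarrow> (real \<Rightarrow> real) \<Rightarrow> ennreal" where
  "kinf t x = (INF l\<in>{0..}. kfun t x l)"

definition marc :: "(real \<Rightarrow> real) \<Rightarrow> ennreal" where
  "marc x = (SUP t\<in>{0<..1}. ennreal (cfund t / t) * kinf t x)"

lemma kinf_le: "0 \<le> l \<Longrightarrow> kinf t x \<le> kfun t x l"
  unfolding kinf_def by (rule INF_lower) simp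

lemma kinf_approx:
  assumes "kinf t x < top" "0 < e" shows "\<exists>l\<ge>0. kfun t x l < kinf t x + ennreal e"
proof -
  have "kinf t x \<noteq> \<infinity>" using assms(1) by auto
  then have "\<exists>l\<in>{0..}. kfun t x l < kinf t x + ennreal e" by (rule INF_approx_ennreal[OF assms(2) kinf_def])
  then show ?thesis by auto
qed

lemma kinf_add:
  assumes x: "x \<in> BM" and y: "y \<in> BM" and t: "0 \<le> t"
  shows "kinf t (\<lambda>s. x s + y s) \<le> kinf t x + kinf t y"
proof (rule ennreal_le_epsilon)
  fix e :: real assume fin: "kinf t x + kinf t y < top" and e: "0 < e"
  have e2: "0 < e / 2" using e by simp
  have "kinf t x < top" "kinf t y < top" using fin by (auto simp: less_top)
  then obtain l m where l: "0 \<le> l" "kfun t x l < kinf t x + ennreal (e / 2)"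
    and m: "0 \<le> m" "kfun t y m < kinf t y + ennreal (e / 2)"
    using kinf_approx[OF _ e2] by meson
  have "kinf t (\<lambda>s. x s + y s) \<le> kfun t (\<lambda>s. x s + y s) (l + m)" using l m by (intro kinf_le) auto
  also have "\<dots> \<le> kfun t x l + kfun t y m"
  proof -
    have "(\<integral>\<^sup>+s. ennreal (\<bar>x s + y s\<bar> - (l + m)) \<partial>I01) \<le> (\<integral>\<^sup>+s. ennreal (\<bar>x s\<bar> - l) + ennreal (\<bar>y s\<bar> - m) \<partial>I01)"
    proof (rule nn_integral_mono)
      fix s
      have "ennreal (\<bar>x s + y s\<bar> - (l + m)) \<le> ennreal (max 0 (\<bar>x s\<bar> - l) + max 0 (\<bar>y s\<bar> - m))"
        by (intro ennreal_leI) linarith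
      also have "\<dots> = ennreal (\<bar>x s\<bar> - l) + ennreal (\<bar>y s\<bar> - m)"
        by (simp add: ennreal_plus max_def ennreal_neg)
      finally show "ennreal (\<bar>x s + y s\<bar> - (l + m)) \<le> ennreal (\<bar>x s\<bar> - l) + ennreal (\<bar>y s\<bar> - m)" .
    qed
    also have "\<dots> = (\<integral>\<^sup>+s. ennreal (\<bar>x s\<bar> - l) \<partial>I01) + (\<integral>\<^sup>+s. ennreal (\<bar>y s\<bar> - m) \<partial>I01)"
      by (rule nn_integral_add) (use x y in simp_all)
    finally have "(\<integral>\<^sup>+s. ennreal (\<bar>x s + y s\<bar> - (l + m)) \<partial>I01) \<le> \<dots>" .
    moreover have "ennreal (t * (l + m)) = ennreal (t * l) + ennreal (t * m)"
      using t l m by (simp add: distrib_left ennreal_plus)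
    ultimately show ?thesis unfolding kfun_def by (simp add: add_mono ac_simps)
  qed
  also have "\<dots> \<le> (kinf t x + ennreal (e / 2)) + (kinf t y + ennreal (e / 2))"
    using l m by (intro add_mono less_imp_le) auto
  also have "\<dots> = kinf t x + kinf t y + (ennreal (e / 2) + ennreal (e / 2))" by (simp add: ac_simps)
  also have "ennreal (e / 2) + ennreal (e / 2) = ennreal e" using e by (simp flip: ennreal_plus)
  finally show "kinf t (\<lambda>s. x s + y s) \<le> kinf t x + kinf t y + ennreal e" .
qed

lemma kfun_scale:
  assumes x: "x \<in> BM" and l: "0 \<le> l" and t: "0 \<le> t"
  shows "kfun t (\<lambda>s. c * x s) (\<bar>c\<bar> * l) = ennreal \<bar>c\<bar> * kfun t x l"
proof -
  have "(\<integral>\<^sup>+s. ennreal (\<bar>c * x s\<bar> - \<bar>c\<bar> * l) \<partial>I01) = (\<integral>\<^sup>+s. ennreal \<bar>c\<bar> * ennreal (\<bar>x s\<bar> - l) \<partial>I01)"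
    by (intro nn_integral_cong) (simp add: abs_mult right_diff_distrib[symmetric] ennreal_mult')
  also have "\<dots> = ennreal \<bar>c\<bar> * (\<integral>\<^sup>+s. ennreal (\<bar>x s\<bar> - l) \<partial>I01)"
    by (rule nn_integral_cmult) (use x in simp)
  finally show ?thesis using l t unfolding kfun_def
    by (simp add: distrib_left ennreal_mult[symmetric] mult_ac)
qed

lemma kinf_scale_le:
  assumes x: "x \<in> BM" and t: "0 \<le> t"
  shows "kinf t (\<lambda>s. c * x s) \<le> ennreal \<bar>c\<bar> * kinf t x"
proof (cases "c = 0")
  case True
  have "kinf t (\<lambda>s. c * x s) \<le> kfun t (\<lambda>s. c * x s) 0" by (rule kinf_le) simp
  also have "\<dots> = 0" using True by (simp add: kfun_def)
  finally show ?thesis by simp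
next
  case c: False
  show ?thesis
  proof (cases "kinf t x = top")
    case True
    then show ?thesis using c by (simp add: ennreal_mult_top)
  next
    case fin: False
    show ?thesis
    proof (rule ennreal_le_epsilon)
      fix e :: real assume e: "0 < e"
      obtain l where l: "0 \<le> l" "kfun t x l < kinf t x + ennreal (e / \<bar>c\<bar>)"
      proof -
        have "kinf t x < top" using fin by (simp add: less_top)
        moreover have "0 < e / \<bar>c\<bar>" using e c by simp
        ultimately have "\<exists>l\<ge>0. kfun t x l < kinf t x + ennreal (e / \<bar>c\<bar>)" by (rule kinf_approx)
        then show thesis using that by blast
      qed
      have "kinf t (\<lambda>s. c * x s) \<le> kfun t (\<lambda>s. c * x s) (\<bar>c\<bar> * l)" using l by (intro kinf_le) auto
      also have "\<dots> = ennreal \<bar>c\<bar> * kfun t x l" by (rule kfun_scale[OF x l(1) t])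
      also have "\<dots> \<le> ennreal \<bar>c\<bar> * (kinf t x + ennreal (e / \<bar>c\<bar>))"
        by (rule mult_left_mono[OF less_imp_le[OF l(2)]]) simp
      also have "\<dots> = ennreal \<bar>c\<bar> * kinf t x + ennreal e"
        using c e by (simp add: distrib_left ennreal_mult[symmetric])
      finally show "kinf t (\<lambda>s. c * x s) \<le> ennreal \<bar>c\<bar> * kinf t x + ennreal e" .
    qed
  qed
qed

lemma marc_add:
  assumes x: "x \<in> BM" and y: "y \<in> BM"
  shows "marc (\<lambda>s. x s + y s) \<le> marc x + marc y"
  unfolding marc_def[of "\<lambda>s. x s + y s"]
proof (rule SUP_least)
  fix t :: real assume t: "t \<in> {0<..1}"
  have "ennreal (cfund t / t) * kinf t (\<lambda>s. x s + y s) \<le> ennreal (cfund t / t) * (kinf t x + kinf t y)"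
    using t by (intro mult_left_mono kinf_add x y) auto
  also have "\<dots> = ennreal (cfund t / t) * kinf t x + ennreal (cfund t / t) * kinf t y" by (rule distrib_left)
  also have "\<dots> \<le> marc x + marc y" unfolding marc_def using t by (intro add_mono SUP_upper)
  finally show "ennreal (cfund t / t) * kinf t (\<lambda>s. x s + y s) \<le> marc x + marc y" .
qed

lemma marc_scale:
  assumes x: "x \<in> BM" shows "marc (\<lambda>s. c * x s) \<le> ennreal \<bar>c\<bar> * marc x"
  unfolding marc_def[of "\<lambda>s. c * x s"]
proof (rule SUP_least)
  fix t :: real assume t: "t \<in> {0<..1}"
  have "ennreal (cfund t / t) * kinf t (\<lambda>s. c * x s) \<le> ennreal (cfund t / t) * (ennreal \<bar>c\<bar> * kinf t x)"
    using t by (intro mult_left_mono kinf_scale_le x) auto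
  also have "\<dots> = ennreal \<bar>c\<bar> * (ennreal (cfund t / t) * kinf t x)" by (simp add: ac_simps)
  also have "\<dots> \<le> ennreal \<bar>c\<bar> * marc x" unfolding marc_def using t by (intro mult_left_mono SUP_upper) auto
  finally show "ennreal (cfund t / t) * kinf t (\<lambda>s. c * x s) \<le> ennreal \<bar>c\<bar> * marc x" .
qed

lemma marc_mono:
  assumes "AE s in I01. \<bar>x s\<bar> \<le> \<bar>y s\<bar>" shows "marc x \<le> marc y"
proof -
  have "kfun t x l \<le> kfun t y l" for t l unfolding kfun_def
  proof (intro add_mono nn_integral_mono_AE order_refl)
    show "AE s in I01. ennreal (\<bar>x s\<bar> - l) \<le> ennreal (\<bar>y s\<bar> - l)"
      using assms by eventually_elim (intro ennreal_leI, simp)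
  qed
  then have "kinf t x \<le> kinf t y" for t unfolding kinf_def by (intro INF_mono) auto
  then have "ennreal (cfund t / t) * kinf t x \<le> ennreal (cfund t / t) * kinf t y" for t by (rule mult_left_mono) simp
  then show ?thesis unfolding marc_def by (rule SUP_mono')
qed

lemma kfun_rearr:
  assumes x: "x \<in> BM" shows "kfun t x l = kfun t (rearr x) l"
proof -
  have "(\<lambda>v. ennreal (v - l)) \<in> borel_measurable borel" by simp
  from nn_integral_rearr[OF x this] show ?thesis using x by (simp add: kfun_def)
qed

lemma marc_rearr:
  assumes x: "x \<in> BM" shows "marc x = marc (rearr x)"
proof -
  have e: "kfun t x = kfun t (rearr x)" for t by (rule ext) (rule kfun_rearr[OF x])
  show ?thesis unfolding marc_def kinf_def e ..
qed

lemma marc_equimeasurable: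
  assumes x: "x \<in> BM" and y: "y \<in> BM" and d: "\<And>l. 0 \<le> l \<Longrightarrow> distr_fun y l = distr_fun x l"
  shows "marc y = marc x"
proof -
  have "rearr y = rearr x"
  proof
    fix t
    show "rearr y t = rearr x t"
      using rearrangement_mono[OF x y, of t] rearrangement_mono[OF y x, of t] d
      by (auto simp: rearr_def intro!: antisym)
  qed
  then show ?thesis using marc_rearr[OF x] marc_rearr[OF y] by simp
qed

text \<open>In l the expression is affine on [0,1] and non-decreasing afterwards, so the minimum is
  attained at l = 0 or l = 1.\<close>

lemma kinf_indicator:
  assumes A: "A \<in> sets I01" and t: "0 < t" "t \<le> 1"
  shows "kinf t (indicator A) = ennreal (min (measure I01 A) t)"
proof -
  have kfun: "kfun t (indicator A) l = ennreal (max 0 (1 - l) * measure I01 A + t * l)" if l: "0 \<le> l" for l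
  proof -
    have "(\<integral>\<^sup>+s. ennreal (\<bar>indicator A s\<bar> - l) \<partial>I01) = (\<integral>\<^sup>+s. ennreal (1 - l) * indicator A s \<partial>I01)"
      using l by (intro nn_integral_cong) (auto simp: indicator_def ennreal_neg)
    also have "\<dots> = ennreal (1 - l) * emeasure I01 A" by (rule nn_integral_cmult_indicator[OF A])
    also have "\<dots> = ennreal (max 0 (1 - l)) * ennreal (measure I01 A)"
      by (simp add: I.emeasure_eq_measure max_def ennreal_neg)
    also have "\<dots> = ennreal (max 0 (1 - l) * measure I01 A)" by (simp add: ennreal_mult)
    finally show ?thesis unfolding kfun_def using l t by (simp add: ennreal_plus)
  qed
  show ?thesis
  proof (rule antisym)
    have "kinf t (indicator A) \<le> kfun t (indicator A) 0" "kinf t (indicator A) \<le> kfun t (indicator A) 1"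
      by (rule kinf_le, simp)+
    then show "kinf t (indicator A) \<le> ennreal (min (measure I01 A) t)"
      using kfun[of 0] kfun[of 1] by (simp add: min_def)
    show "ennreal (min (measure I01 A) t) \<le> kinf t (indicator A)"
      unfolding kinf_def
    proof (rule INF_greatest)
      fix l :: real assume "l \<in> {0..}"
      then have l: "0 \<le> l" by simp
      define m where "m = min (measure I01 A) t"
      have m: "0 \<le> m" "m \<le> measure I01 A" "m \<le> t" using t by (auto simp: m_def)
      have "max 0 (1 - l) * m + m * l \<le> max 0 (1 - l) * measure I01 A + t * l"
        using m l by (intro add_mono mult_left_mono mult_right_mono) auto
      moreover have "m \<le> max 0 (1 - l) * m + m * l"
      proof (cases "l \<le> 1")
        case False
        then have "m * 1 \<le> m * l" using m by (intro mult_left_mono) auto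
        then show ?thesis using False by simp
      qed (simp add: algebra_simps)
      ultimately show "ennreal (min (measure I01 A) t) \<le> kfun t (indicator A) l"
        unfolding kfun[OF l] m_def by (intro ennreal_leI) linarith
    qed
  qed
qed

text \<open>The supremum is attained at the measure of A: for smaller t it is bounded because
  \<open>cfund\<close> increases, for larger t because \<open>cfund t / t\<close> decreases.\<close>

lemma marc_indicator:
  assumes A: "A \<in> sets I01" shows "marc (indicator A) = ennreal (cfund (measure I01 A))"
proof -
  define s where "s = measure I01 A"
  have s: "0 \<le> s" "s \<le> 1" by (auto simp: s_def)
  have e: "ennreal (cfund t / t) * kinf t (indicator A) = ennreal (cfund t / t * min s t)" if "t \<in> {0<..1}" for t
  proof -
    have "kinf t (indicator A) = ennreal (min s t)" unfolding s_def using that by (intro kinf_indicator A) auto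
    moreover have "ennreal (cfund t / t * min s t) = ennreal (cfund t / t) * ennreal (min s t)"
      using that s cfund_nonneg[of t] by (intro ennreal_mult) auto
    ultimately show ?thesis by simp
  qed
  show ?thesis unfolding marc_def s_def[symmetric]
  proof (rule antisym)
    show "(SUP t\<in>{0<..1}. ennreal (cfund t / t) * kinf t (indicator A)) \<le> ennreal (cfund s)"
    proof (rule SUP_least)
      fix t :: real assume t: "t \<in> {0<..1}"
      have "cfund t / t * min s t \<le> cfund s"
      proof (cases "t \<le> s")
        case True
        then show ?thesis using t cfund_mono[of t s] by simp
      next
        case False
        then show ?thesis using t s cfund_div_mono[of s t] 
          by (cases "s = 0") (auto simp: divide_le_eq)
      qed
      then show "ennreal (cfund t / t) * kinf t (indicator A) \<le> ennreal (cfund s)"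
        unfolding e[OF t] by (rule ennreal_leI)
    qed
    show "ennreal (cfund s) \<le> (SUP t\<in>{0<..1}. ennreal (cfund t / t) * kinf t (indicator A))"
    proof (cases "s = 0")
      case False
      then have "s \<in> {0<..1}" using s by auto
      then have "ennreal (cfund s / s) * kinf s (indicator A) \<le> (SUP t\<in>{0<..1}. ennreal (cfund t / t) * kinf t (indicator A))"
        by (rule SUP_upper)
      then show ?thesis using e[OF \<open>s \<in> {0<..1}\<close>] False by simp
    qed simp
  qed
qed

lemma cfund_div_le: "t \<in> dyadic k \<Longrightarrow> cfund t / t \<le> 8 * Q * psi k * 2 ^ k"
proof -
  assume t: "t \<in> dyadic k"
  have t0: "1 / 2 ^ Suc k < t" "t \<le> 1 / 2 ^ k" using t by (auto simp: dyadic_def)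
  have upper_part: "0 < t" using t0(1) by (rule less_trans[rotated]) simp
  have "cfund t \<le> 4 * Q * psi k" by (rule cfund_le) (use upper_part t0 in auto)
  also have "\<dots> \<le> 4 * Q * psi k * (2 ^ Suc k * t)"
    using t0(1) Q by (simp add: divide_less_eq mult.commute)
  finally show ?thesis using upper_part by (simp add: divide_le_eq mult_ac)
qed

text \<open>In this class of spaces the Marcinkiewicz norm is controlled by the weak quantity, the
  supremum of phi times the rearrangement.\<close>

lemma marc_bound:
  assumes x: "x \<in> BM" and B: "0 \<le> B" and b: "\<And>i. bcoef x i \<le> B"
  shows "marc x \<le> ennreal (8 * Q * (Q + 2 * Cb) * B)"
proof -
  have "ennreal (cfund t / t) * kinf t (rearr x) \<le> ennreal (8 * Q * (Q + 2 * Cb) * B)" if tI: "t \<in> {0<..1}" for t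
  proof -
  obtain k where k: "t \<in> dyadic k" using dyadic_cover[of t] tI by auto
  have tk: "t \<le> 1 / 2 ^ k" "0 < t" using rearr_dyadic(3)[OF x k] k by (auto simp: dyadic_def)
  define c where "c i = rearrangement x (1 / 2 ^ i)" for i :: nat
  have c0: "0 \<le> c i" for i unfolding c_def by (rule rearrangement_nonneg[OF x]) simp
  have cB: "c i * psi i \<le> B" for i using b[of i] by (simp add: bcoef_def c_def)
  \<comment> \<open>A cut at about the value of the rearrangement at t, where the infimum over l is
    attained up to a constant: only blocks from k on exceed it.\<close>
  define l where "l = c (Suc k)"
  have cmono: "c i \<le> c j" if "i \<le> j" for i j
    unfolding c_def using that by (intro rearrangement_antimono[OF x]) (auto simp: frac_le)
  have "(\<integral>\<^sup>+s. ennreal (\<bar>rearr x s\<bar> - l) \<partial>I01) \<le> (\<Sum>i. (if k \<le> i then ennreal (c (Suc i)) else 0) * ennreal (1 / 2 ^ Suc i))"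
  proof (rule nn_integral_le_dyadic)
    fix i s assume s: "s \<in> dyadic i"
    have "rearr x s \<le> c (Suc i)" unfolding c_def by (rule rearr_dyadic(2)[OF x s])
    show "ennreal (\<bar>rearr x s\<bar> - l) \<le> (if k \<le> i then ennreal (c (Suc i)) else 0)"
    proof (cases "k \<le> i")
      case True
      then show ?thesis using \<open>rearr x s \<le> c (Suc i)\<close> c0[of "Suc k"] x by (auto simp: l_def intro!: ennreal_leI)
    next
      case False
      then have "rearr x s \<le> l" using \<open>rearr x s \<le> c (Suc i)\<close> cmono[of "Suc i" "Suc k"] by (simp add: l_def)
      then show ?thesis using False x by (simp add: ennreal_neg)
    qed
  qed
  also have "\<dots> \<le> ennreal (B * Q / 2 ^ k / psi k)" by (rule tail_weak[OF B c0 cB])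
  finally have 1: "(\<integral>\<^sup>+s. ennreal (\<bar>rearr x s\<bar> - l) \<partial>I01) \<le> ennreal (B * Q / 2 ^ k / psi k)" .
  have "l * psi k \<le> l * (2 * psi (Suc k))" using psi_doubling[of k 1] c0 by (intro mult_left_mono) (auto simp: l_def)
  also have "\<dots> \<le> 2 * B" using cB[of "Suc k"] by (simp add: l_def)
  also have "\<dots> \<le> 2 * Cb * B" using Cb_ge_1 B by (simp add: mult_right_mono)
  finally have lB: "l \<le> 2 * Cb * B / psi k" by (simp add: le_divide_eq)
  have "t * l \<le> 1 / 2 ^ k * (2 * Cb * B / psi k)" using tk lB c0 by (intro mult_mono) (auto simp: l_def)
  then have "ennreal (t * l) \<le> ennreal (2 * Cb * B / 2 ^ k / psi k)" by (intro ennreal_leI) (simp add: mult_ac)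
  with 1 have "kfun t (rearr x) l \<le> ennreal (B * Q / 2 ^ k / psi k) + ennreal (2 * Cb * B / 2 ^ k / psi k)"
    unfolding kfun_def by (rule add_mono)
  also have "\<dots> = ennreal ((Q + 2 * Cb) * B / 2 ^ k / psi k)"
    using B Q Cb by (subst ennreal_plus[symmetric]) (auto simp: add_divide_distrib algebra_simps)
  finally have "kinf t (rearr x) \<le> ennreal ((Q + 2 * Cb) * B / 2 ^ k / psi k)"
    using kinf_le[of l t "rearr x"] c0 by (auto simp: l_def intro: order_trans)
  then have "ennreal (cfund t / t) * kinf t (rearr x) \<le> ennreal (8 * Q * psi k * 2 ^ k) * ennreal ((Q + 2 * Cb) * B / 2 ^ k / psi k)"
    using cfund_div_le[OF k] by (intro mult_mono ennreal_leI) auto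
  also have "\<dots> = ennreal (8 * Q * (Q + 2 * Cb) * B)"
    using Q Cb B by (subst ennreal_mult[symmetric]) auto
  finally show ?thesis .
  qed
  then show ?thesis unfolding marc_rearr[OF x] unfolding marc_def by (rule SUP_least)
qed

text \<open>On [0, 2^-i] the rearrangement is at least its value at the right end, so it dominates a
  multiple of an indicator.\<close>

lemma bcoef_le_nrm: 
  assumes x: "x \<in> elts X" shows "bcoef x i \<le> nrm X x"
proof -
  have xb: "x \<in> BM" by (rule elts_BM[OF x])
  define c where "c = rearrangement x (1 / 2 ^ i)"
  have c0: "0 \<le> c" unfolding c_def by (rule rearrangement_nonneg[OF xb]) simp
  have A: "{0..1 / 2 ^ i} \<in> sets I01" using sym_space_inv_pow2[of i] by (intro ivl_sets_I01) auto
  have "AE t in I01. \<bar>c * indicator {0..1 / 2 ^ i} t\<bar> \<le> \<bar>rearr x t\<bar>" using AE_dyadic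
  proof eventually_elim
    fix t assume "\<exists>i. t \<in> dyadic i"
    then have t: "0 < t" using rearr_dyadic(3)[OF xb] by blast
    show "\<bar>c * indicator {0..1 / 2 ^ i} t\<bar> \<le> \<bar>rearr x t\<bar>"
    proof (cases "t \<le> 1 / 2 ^ i")
      case True
      then have "c \<le> rearr x t" unfolding c_def rearr_def using t rearrangement_antimono[OF xb t True] by simp
      then show ?thesis using c0 t True by simp
    qed simp
  qed
  then have "nrm X (\<lambda>t. c * indicator {0..1 / 2 ^ i} t) \<le> nrm X (rearr x)"
    using A by (intro ideal_nrm rearr_elts(1)[OF x]) auto
  then show ?thesis using nrm_scale[OF indicator_in[OF A], of c] c0 rearr_elts(2)[OF x]
    by (simp add: bcoef_def psi_def fund_def c_def)
qed

definition CN :: real where "CN = 8 * Q * (Q + 2 * Cb)"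

lemma marc_le: "x \<in> elts X \<Longrightarrow> marc x \<le> ennreal (CN * nrm X x)"
  unfolding CN_def by (rule marc_bound) (auto intro: elts_BM nrm_nonneg bcoef_le_nrm)

lemma marc_finite: 
  assumes "x \<in> elts X" shows "marc x < top"
  by (rule le_less_trans[OF marc_le[OF assms]]) simp

text \<open>The second norm has fundamental function \<open>cfund\<close> and dominates the first on
  indicators, so the maximum has a concave fundamental function. Both are symmetric, and
  \<open>marc_le\<close> makes the maximum equivalent to the norm of X.\<close>

definition Y :: fun_space where
  "Y = \<lparr>elts = elts X, nrm = (\<lambda>x. max (nrm X x) (enn2real (marc x)))\<rparr>"

lemma Y_simps [simp]: "elts Y = elts X" "nrm Y x = max (nrm X x) (enn2real (marc x))"
  by (simp_all add: Y_def)

lemma marc_real: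
  assumes "x \<in> elts X" "y \<in> elts X"
  shows "enn2real (marc (\<lambda>s. x s + y s)) \<le> enn2real (marc x) + enn2real (marc y)"
    "enn2real (marc (\<lambda>s. c * x s)) \<le> \<bar>c\<bar> * enn2real (marc x)"
    "enn2real (marc x) \<le> CN * nrm X x"
proof -
  have f: "marc x < top" "marc y < top" using assms marc_finite by auto
  have "enn2real (marc (\<lambda>s. x s + y s)) \<le> enn2real (marc x + marc y)"
    using f marc_add[OF elts_BM[OF assms(1)] elts_BM[OF assms(2)]] by (intro enn2real_mono) auto
  then show "enn2real (marc (\<lambda>s. x s + y s)) \<le> enn2real (marc x) + enn2real (marc y)"
    using f by (simp add: enn2real_plus)
  have "enn2real (marc (\<lambda>s. c * x s)) \<le> enn2real (ennreal \<bar>c\<bar> * marc x)"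
    using f marc_scale[OF elts_BM[OF assms(1)]] by (intro enn2real_mono) (auto simp: ennreal_mult_less_top)
  then show "enn2real (marc (\<lambda>s. c * x s)) \<le> \<bar>c\<bar> * enn2real (marc x)" by (simp add: enn2real_mult)
  have "0 \<le> CN * nrm X x" using Q Cb nrm_nonneg[OF assms(1)] by (simp add: CN_def)
  then show "enn2real (marc x) \<le> CN * nrm X x" using marc_le[OF assms(1)] 
    by (metis enn2real_ennreal enn2real_mono ennreal_less_top)
qed

lemma marc_scale_eq:
  assumes x: "x \<in> elts X" shows "enn2real (marc (\<lambda>s. c * x s)) = \<bar>c\<bar> * enn2real (marc x)"
proof (cases "c = 0")
  case True
  then show ?thesis by (intro antisym marc_real(2)[OF x x]) simp
next
  case False
  have "enn2real (marc (\<lambda>s. inverse c * (c * x s))) \<le> \<bar>inverse c\<bar> * enn2real (marc (\<lambda>s. c * x s))"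
    by (rule marc_real(2)[OF scale_elts[OF x] scale_elts[OF x]])
  then have "enn2real (marc x) \<le> inverse \<bar>c\<bar> * enn2real (marc (\<lambda>s. c * x s))"
    using False by (simp add: mult.assoc[symmetric])
  then have "\<bar>c\<bar> * enn2real (marc x) \<le> enn2real (marc (\<lambda>s. c * x s))"
    using False by (simp add: field_simps)
  then show ?thesis using marc_real(2)[OF x x, of c] by linarith
qed

lemma Y_le: "x \<in> elts X \<Longrightarrow> nrm Y x \<le> max 1 CN * nrm X x"
  using marc_real(3)[of x x] nrm_nonneg[of x] mult_right_mono[of 1 "max 1 CN" "nrm X x"] 
    mult_right_mono[of CN "max 1 CN" "nrm X x"] by simp

lemma Y_banach: "banach_fun_space Y"
  unfolding banach_fun_space_def
proof (intro conjI ballI allI impI)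
  show "elts Y \<subseteq> BM" using elts_BM by auto
next
  fix x y assume x: "x \<in> elts Y" and y: "y \<in> BM" and e: "ae_eq x y"
  have x': "x \<in> elts X" using x by simp
  have ae: "AE t in I01. x t = y t" using e by (simp add: ae_eq_def)
  have "AE t in I01. \<bar>x t\<bar> \<le> \<bar>y t\<bar>" using ae by eventually_elim simp
  moreover have "AE t in I01. \<bar>y t\<bar> \<le> \<bar>x t\<bar>" using ae by eventually_elim simp
  ultimately have "marc y = marc x" by (intro antisym marc_mono)
  then show "y \<in> elts Y" "nrm Y y = nrm Y x" using ae_cong[OF x' y ae] by auto
next
  fix x c assume x: "x \<in> elts Y"
  then have x': "x \<in> elts X" by simp
  show "nrm Y (\<lambda>t. c * x t) = \<bar>c\<bar> * nrm Y x"
    using nrm_scale[OF x'] marc_scale_eq[OF x'] by (simp add: max_mult_distrib_left)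
  show "0 \<le> nrm Y x" using nrm_nonneg[OF x'] by simp
  show "(nrm Y x = 0) = ae_eq x (\<lambda>t. 0)"
  proof
    assume "nrm Y x = 0"
    then have "nrm X x = 0" using nrm_nonneg[OF x'] by simp
    then show "ae_eq x (\<lambda>t. 0)" using nrm_eq_0_iff[OF x'] by simp
  next
    assume "ae_eq x (\<lambda>t. 0)"
    then have "nrm X x = 0" using nrm_eq_0_iff[OF x'] by simp
    then show "nrm Y x = 0" using marc_real(3)[OF x' x'] by (simp add: antisym)
  qed
next
  fix x y assume "x \<in> elts Y" "y \<in> elts Y"
  then show "nrm Y (\<lambda>t. x t + y t) \<le> nrm Y x + nrm Y y"
    using nrm_triangle[of x y] marc_real(1)[of x y] unfolding Y_simps by linarith
next
  fix u :: "nat \<Rightarrow> real \<Rightarrow> real"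
  assume u: "(\<forall>n. u n \<in> elts Y) \<and> (\<forall>e>0. \<exists>N. \<forall>m\<ge>N. \<forall>n\<ge>N. nrm Y (\<lambda>t. u m t - u n t) < e)"
  have uX: "\<And>n. u n \<in> elts X" using u by simp
  have cau: "\<exists>N. \<forall>m\<ge>N. \<forall>n\<ge>N. nrm X (\<lambda>t. u m t - u n t) < e" if e: "0 < e" for e
  proof -
    have "\<exists>N. \<forall>m\<ge>N. \<forall>n\<ge>N. nrm Y (\<lambda>t. u m t - u n t) < e"
      by (rule conjunct2[OF u, rule_format, OF e])
    then obtain N where "\<forall>m\<ge>N. \<forall>n\<ge>N. nrm Y (\<lambda>t. u m t - u n t) < e" by (rule exE)
    then show ?thesis by (intro exI[of _ N]) simp
  qed
  obtain l where l: "l \<in> elts X" "(\<lambda>n. nrm X (\<lambda>t. u n t - l t)) \<longlonglongrightarrow> 0"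
    using complete[OF uX cau] by blast
  have "(\<lambda>n. nrm Y (\<lambda>t. u n t - l t)) \<longlonglongrightarrow> 0"
  proof (rule tendsto_sandwich)
    show "\<forall>\<^sub>F n in sequentially. 0 \<le> nrm Y (\<lambda>t. u n t - l t)"
      by (intro always_eventually allI) (simp add: le_max_iff_disj)
    show "\<forall>\<^sub>F n in sequentially. nrm Y (\<lambda>t. u n t - l t) \<le> max 1 CN * nrm X (\<lambda>t. u n t - l t)"
      by (intro always_eventually allI Y_le diff_elts uX l(1))
    show "(\<lambda>n. max 1 CN * nrm X (\<lambda>t. u n t - l t)) \<longlonglongrightarrow> 0" by (rule tendsto_mult_right_zero[OF l(2)])
  qed simp
  then show "\<exists>l\<in>elts Y. (\<lambda>n. nrm Y (\<lambda>t. u n t - l t)) \<longlonglongrightarrow> 0" using l(1) by auto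
qed (auto intro: add_elts scale_elts)

lemma Y_symmetric: "symmetric_space Y"
  unfolding symmetric_space_def
proof (intro conjI ballI impI)
  show "banach_fun_space Y" by (rule Y_banach)
  have "\<exists>x\<in>elts X. \<not> ae_eq x (\<lambda>t. 0)" using sym unfolding symmetric_space_def by (elim conjE) assumption
  then show "\<exists>x\<in>elts Y. \<not> ae_eq x (\<lambda>t. 0)" by simp
next
  fix x y assume y: "y \<in> elts Y" and x: "x \<in> BM" and le: "AE t in I01. \<bar>x t\<bar> \<le> \<bar>y t\<bar>"
  then have "x \<in> elts X \<and> nrm X x \<le> nrm X y" by (intro ideal) auto
  moreover have "enn2real (marc x) \<le> enn2real (marc y)" using marc_mono[OF le] marc_finite y by (intro enn2real_mono) auto
  ultimately show "x \<in> elts Y" "nrm Y x \<le> nrm Y y" by auto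
next
  fix x y assume x: "x \<in> elts Y" and y: "y \<in> BM" and d: "\<forall>l\<ge>0. distr_fun y l = distr_fun x l"
  have x': "x \<in> elts X" using x by simp
  have d': "\<And>l. 0 \<le> l \<Longrightarrow> distr_fun y l = distr_fun x l" using d by blast
  have "y \<in> elts X" by (rule equimeasurable(1)[OF x' y d'])
  then show "y \<in> elts Y" by simp
  have "nrm X y = nrm X x" by (rule equimeasurable(2)[OF x' y d'])
  moreover have "marc y = marc x" by (rule marc_equimeasurable[OF elts_BM[OF x'] y d'])
  ultimately show "nrm Y y = nrm Y x" by simp
qed

lemma Y_equivalent: "equivalent_spaces X Y"
  unfolding equivalent_spaces_def embedded_def
proof (intro conjI)
  show "\<exists>C. \<forall>x\<in>elts X. nrm Y x \<le> C * nrm X x" using Y_le by blast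
  show "\<exists>C. \<forall>x\<in>elts Y. nrm X x \<le> C * nrm Y x" by (intro exI[of _ 1]) auto
qed auto

lemma fund_Y: 
  assumes t: "t \<in> {0..1}" shows "fundamental_fun Y t = cfund t"
proof -
  have A: "{0..t} \<in> sets I01" using t by (intro ivl_sets_I01) auto
  have "marc (indicator {0..t}) = ennreal (cfund t)"
    using marc_indicator[OF A] ivl_measure_I01(1)[of 0 t] t by simp
  then show ?thesis using fund_le_cfund[of t] cfund_nonneg[of t] t
    by (simp add: fundamental_fun_def fund_def max_def)
qed

lemma fund_Y_concave: "concave_on {0..1} (fundamental_fun Y)"
  unfolding concave_on_iff
proof (intro conjI ballI allI impI)
  fix x y u v :: real
  assume a: "x \<in> {0..1}" "y \<in> {0..1}" "0 \<le> u" "0 \<le> v" "u + v = 1"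
  have "u *\<^sub>R x + v *\<^sub>R y \<in> {0..1}" by (rule convexD[OF convex_real_interval(5)]) (use a in auto)
  moreover have "u * cfund x + v * cfund y \<le> cfund (u *\<^sub>R x + v *\<^sub>R y)"
    using cfund_concave a unfolding concave_on_iff by blast
  ultimately show "u * fundamental_fun Y x + v * fundamental_fun Y y \<le> fundamental_fun Y (u *\<^sub>R x + v *\<^sub>R y)"
    using a by (simp add: fund_Y)
qed simp

end

subsection \<open>Lorentz and Marcinkiewicz spaces\<close>

lemma finite_superlevel:
  fixes b :: "nat \<Rightarrow> real"
  assumes b: "\<And>i. 0 \<le> b i" and sm: "summable (\<lambda>i. b i powr p)" and p: "0 < p" and l: "0 < l"
  shows "finite {i. l < b i}"
proof -
  have "(\<lambda>i. b i powr p) \<longlonglongrightarrow> 0" by (rule summable_LIMSEQ_zero[OF sm])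
  then have "eventually (\<lambda>i. b i powr p < l powr p) sequentially" using l by (intro order_tendstoD) auto
  then obtain N where N: "\<And>i. N \<le> i \<Longrightarrow> b i powr p < l powr p" unfolding eventually_sequentially by blast
  have "{i. l < b i} \<subseteq> {..<N}"
  proof
    fix i assume "i \<in> {i. l < b i}"
    then have "l powr p \<le> b i powr p" using l p by (intro powr_mono2) auto
    then show "i \<in> {..<N}" using N[of i] by (cases "N \<le> i") auto
  qed
  then show ?thesis by (rule finite_subset) simp
qed

text \<open>The Marcinkiewicz argument between l_1 and l_infinity: H bounds the large entries of the
  image by the large entries of b. Multiplied by l^(p-1) for l = 2^n and summed over n, it recovers
  p-th powers: on the left from the n that fits the entry, on the right from a series that is
  geometric because p > 1. Its sum is the last factor of C2.\<close>

lemma marcinkiewicz_sequences: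
  fixes b b' :: "nat \<Rightarrow> real"
  assumes b: "\<And>i. 0 \<le> b i" and b': "\<And>i. 0 \<le> b' i" and p: "1 < p"
    and sm: "summable (\<lambda>i. b i powr p)" and k: "0 < \<kappa>" and C: "0 \<le> C"
    and H: "\<And>l F. 0 < l \<Longrightarrow> finite F \<Longrightarrow> (\<And>k. k \<in> F \<Longrightarrow> \<kappa> * l < b' k) \<Longrightarrow>
      (\<Sum>k\<in>F. b' k) \<le> C * (\<Sum>i\<in>{i. l < b i}. b i)"
  defines "C2 \<equiv> (2 * \<kappa>) powr (p - 1) * C * (2 / (1 - 2 powr (1 - p)))"
  shows "summable (\<lambda>i. b' i powr p)" "(\<Sum>i. b' i powr p) \<le> C2 * (\<Sum>i. b i powr p)"
proof -
  define s where "s = 2 powr (1 - p)"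
  have s: "0 < s" "s < 1" using p powr_less_mono[of "1 - p" 0 2] by (auto simp: s_def)
  have fin: "finite {i. l < b i}" if "0 < l" for l by (rule finite_superlevel[OF b sm _ that]) (use p in simp)
  \<comment> \<open>Strict on the left, to match the strict superlevel sets in H.\<close>
  have int: "\<exists>n::int. 2 powr real_of_int n < z \<and> z \<le> 2 powr (real_of_int n + 1)" if z: "0 < z" for z :: real
  proof -
    define n where "n = \<lceil>log 2 z\<rceil> - 1"
    have n: "real_of_int n < log 2 z" "log 2 z \<le> real_of_int n + 1" unfolding n_def by linarith+
    have "2 powr real_of_int n < 2 powr log 2 z" using n(1) by (intro powr_less_mono) auto
    moreover have "2 powr log 2 z \<le> 2 powr (real_of_int n + 1)" using n(2) by (intro powr_mono) auto
    ultimately show ?thesis using z by auto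
  qed
  have split: "z powr p = z * z powr (p - 1)" if "0 \<le> z" for z :: real
    using that by (cases "z = 0") (auto simp: powr_mult_base)
  have main: "(\<Sum>k<m. b' k powr p) \<le> C2 * (\<Sum>i. b i powr p)" for m
  proof -
    define S where "S = {k\<in>{..<m}. 0 < b' k}"
    have S: "finite S" by (simp add: S_def)
    have "\<forall>k\<in>S. \<exists>n::int. \<kappa> * 2 powr n < b' k \<and> b' k \<le> 2 * \<kappa> * 2 powr n"
    proof
      fix k assume "k \<in> S"
      then have "0 < b' k / \<kappa>" using assms(5) by (simp add: S_def)
      then obtain n :: int where "2 powr n < b' k / \<kappa>" "b' k / \<kappa> \<le> 2 powr (real_of_int n + 1)" using int by blast
      then have "\<kappa> * 2 powr n < b' k \<and> b' k \<le> 2 * \<kappa> * 2 powr n"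
        using assms(5) by (simp add: powr_add field_simps)
      then show "\<exists>n::int. \<kappa> * 2 powr n < b' k \<and> b' k \<le> 2 * \<kappa> * 2 powr n" by blast
    qed
    then obtain nk :: "nat \<Rightarrow> int" where nk: "\<And>k. k \<in> S \<Longrightarrow> \<kappa> * 2 powr nk k < b' k"
      "\<And>k. k \<in> S \<Longrightarrow> b' k \<le> 2 * \<kappa> * 2 powr nk k" by metis
    define W where "W = nk ` S"
    have W: "finite W" using S by (simp add: W_def)
    define g where "g n = (2 powr real_of_int n) powr (p - 1)" for n :: int
    have g0: "0 \<le> g n" for n by (simp add: g_def)
    \<comment> \<open>Only finitely many n occur, so a finite set holds all entries of b that matter
      and the sums can be interchanged.\<close>
    define U where "U = (\<Union>n\<in>W. {i. 2 powr n < b i})"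
    have U: "finite U" unfolding U_def using W fin by auto
    have "(\<Sum>k<m. b' k powr p) = (\<Sum>k\<in>S. b' k powr p)"
      by (rule sum.mono_neutral_right) (use b' in \<open>auto simp: S_def less_eq_real_def\<close>)
    also have "\<dots> \<le> (\<Sum>k\<in>S. \<Sum>n\<in>W. (2 * \<kappa>) powr (p - 1) * (if \<kappa> * 2 powr n < b' k then g n * b' k else 0))"
    proof (rule sum_mono)
      fix k assume kS: "k \<in> S"
      have "b' k powr p = b' k * b' k powr (p - 1)" using b' by (rule split)
      also have "\<dots> \<le> b' k * (2 * \<kappa> * 2 powr nk k) powr (p - 1)"
        using nk(2)[OF kS] b' p by (intro mult_left_mono powr_mono2) auto
      also have "\<dots> = (2 * \<kappa>) powr (p - 1) * (if \<kappa> * 2 powr nk k < b' k then g (nk k) * b' k else 0)"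
        using nk(1)[OF kS] by (simp add: g_def powr_mult)
      also have "\<dots> \<le> (\<Sum>n\<in>W. (2 * \<kappa>) powr (p - 1) * (if \<kappa> * 2 powr n < b' k then g n * b' k else 0))"
        using kS W g0 b' by (intro member_le_sum) (auto simp: W_def)
      finally show "b' k powr p \<le> \<dots>" .
    qed
    also have "\<dots> = (2 * \<kappa>) powr (p - 1) * (\<Sum>n\<in>W. g n * (\<Sum>k\<in>{k\<in>S. \<kappa> * 2 powr n < b' k}. b' k))"
      using S by (subst sum.swap) (simp add: sum_distrib_left sum.inter_filter if_distrib[of "\<lambda>x. _ * x"] cong: if_cong)
    also have "\<dots> \<le> (2 * \<kappa>) powr (p - 1) * (\<Sum>n\<in>W. g n * (C * (\<Sum>i\<in>{i. 2 powr n < b i}. b i)))"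
    proof (intro mult_left_mono sum_mono)
      fix n
      show "(\<Sum>k\<in>{k\<in>S. \<kappa> * 2 powr n < b' k}. b' k) \<le> C * (\<Sum>i\<in>{i. 2 powr n < b i}. b i)"
        by (rule H) (use S in auto)
    qed (use g0 in auto)
    also have "(\<Sum>n\<in>W. g n * (C * (\<Sum>i\<in>{i. 2 powr n < b i}. b i))) = (\<Sum>n\<in>W. g n * (C * (\<Sum>i\<in>{i\<in>U. 2 powr n < b i}. b i)))"
      by (intro sum.cong refl arg_cong2[where f = "(*)"] sum.cong) (auto simp: U_def)
    also have "\<dots> = C * (\<Sum>i\<in>U. b i * (\<Sum>n\<in>{n\<in>W. 2 powr n < b i}. g n))"
    proof -
      have "(\<Sum>n\<in>W. g n * (C * (\<Sum>i\<in>{i\<in>U. 2 powr n < b i}. b i)))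
        = (\<Sum>n\<in>W. \<Sum>i\<in>U. C * (if 2 powr n < b i then b i * g n else 0))"
        using U by (intro sum.cong refl) (simp add: sum_distrib_left sum.inter_filter if_distrib[of "\<lambda>x. _ * x"] mult_ac cong: if_cong)
      also have "\<dots> = (\<Sum>i\<in>U. \<Sum>n\<in>W. C * (if 2 powr n < b i then b i * g n else 0))" by (rule sum.swap)
      also have "\<dots> = C * (\<Sum>i\<in>U. b i * (\<Sum>n\<in>{n\<in>W. 2 powr n < b i}. g n))"
        using W by (simp add: sum_distrib_left sum.inter_filter if_distrib[of "\<lambda>x. _ * x"] mult_ac cong: if_cong)
      finally show ?thesis .
    qed
    also have "(2 * \<kappa>) powr (p - 1) * (C * (\<Sum>i\<in>U. b i * (\<Sum>n\<in>{n\<in>W. 2 powr n < b i}. g n)))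
      \<le> (2 * \<kappa>) powr (p - 1) * (C * (\<Sum>i\<in>U. b i powr p * (2 / (1 - s))))"
    proof (intro mult_left_mono sum_mono)
      fix i assume "i \<in> U"
      show "b i * (\<Sum>n\<in>{n\<in>W. 2 powr n < b i}. g n) \<le> b i powr p * (2 / (1 - s))"
      proof (cases "b i = 0")
        case False
        then have bi: "0 < b i" using b[of i] by simp
        then obtain N :: int where N: "2 powr N < b i" "b i \<le> 2 powr (real_of_int N + 1)" using int by blast
        \<comment> \<open>Only exponents up to N occur, and from N downwards g decreases by the
          factor s at each step.\<close>
        have "(\<Sum>n\<in>{n\<in>W. 2 powr n < b i}. g n) \<le> (\<Sum>n\<in>{n\<in>W. 2 powr n < b i}. g N * s ^ nat \<bar>n - N\<bar>)"
        proof (rule sum_mono)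
          fix n assume "n \<in> {n\<in>W. 2 powr n < b i}"
          then have "2 powr real_of_int n < b i" by simp
          then have "2 powr real_of_int n < 2 powr (real_of_int N + 1)" using N(2) by (rule less_le_trans)
          then have nN: "n \<le> N" by simp
          have "g N * s ^ nat \<bar>n - N\<bar> = 2 powr (N * (p - 1)) * 2 powr ((1 - p) * (N - n))"
            using nN by (simp add: g_def s_def powr_powr powr_realpow[symmetric])
          also have "\<dots> = g n" by (simp add: powr_add[symmetric] g_def powr_powr algebra_simps)
          finally show "g n \<le> g N * s ^ nat \<bar>n - N\<bar>" by simp
        qed
        also have "\<dots> \<le> g N * (2 / (1 - s))"
          unfolding sum_distrib_left[symmetric] using W by (intro mult_left_mono sum_pow_int_le s g0) auto
        also have "\<dots> \<le> b i powr (p - 1) * (2 / (1 - s))"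
          unfolding g_def using N p s by (intro mult_right_mono powr_mono2) auto
        finally have "b i * (\<Sum>n\<in>{n\<in>W. 2 powr n < b i}. g n) \<le> b i * (b i powr (p - 1) * (2 / (1 - s)))"
          using bi by (intro mult_left_mono) auto
        then show ?thesis using split[OF b, of i] by (simp add: mult.assoc)
      qed simp
    qed (use C in auto)
    also have "\<dots> = C2 * (\<Sum>i\<in>U. b i powr p)"
    proof -
      have e: "(\<Sum>i\<in>U. b i powr p * (2 / (1 - s))) = (\<Sum>i\<in>U. b i powr p) * (2 / (1 - s))"
        by (rule sum_distrib_right[symmetric])
      show ?thesis unfolding e C2_def s_def[symmetric] by simp
    qed
    also have "\<dots> \<le> C2 * (\<Sum>i. b i powr p)"
      using sm U C s unfolding C2_def s_def by (intro mult_left_mono sum_le_suminf) auto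
    finally show ?thesis .
  qed
  show "summable (\<lambda>i. b' i powr p)" by (rule summableI_nonneg_bounded[OF _ main]) simp
  then show "(\<Sum>i. b' i powr p) \<le> C2 * (\<Sum>i. b i powr p)" by (rule suminf_le_const[OF _ main])
qed

lemma distr_rearrangement_le:
  assumes x: "x \<in> BM" and t: "0 < t"
  shows "distr_fun x (rearrangement x t) \<le> t"
  using rearrangement_le_iff[OF x t rearrangement_nonneg[OF x t]] by simp

lemma rearrangement_add:
  assumes x: "x \<in> BM" and y: "y \<in> BM" and z: "z \<in> BM" and ae: "AE s in I01. z s = x s + y s" and t: "0 < t"
  shows "rearrangement z (2 * t) \<le> rearrangement x t + rearrangement y t"
proof -
  let ?l = "rearrangement x t" and ?m = "rearrangement y t"
  have l: "0 \<le> ?l" "0 \<le> ?m" using rearrangement_nonneg t x y by auto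
  let ?X = "{s \<in> {0..1}. \<bar>x s\<bar> > ?l}" and ?Y = "{s \<in> {0..1}. \<bar>y s\<bar> > ?m}"
  have "distr_fun z (?l + ?m) \<le> measure I01 (?X \<union> ?Y)"
    unfolding distr_fun_def
  proof (rule I.finite_measure_mono_AE)
    show "AE s in I01. s \<in> {s \<in> {0..1}. ?l + ?m < \<bar>z s\<bar>} \<longrightarrow> s \<in> ?X \<union> ?Y"
      using ae by eventually_elim auto
    show "?X \<union> ?Y \<in> I.events" using distr_set[OF x] distr_set[OF y] by (rule sets.Un)
  qed
  also have "\<dots> \<le> measure I01 ?X + measure I01 ?Y"
    by (rule measure_Un_le[OF distr_set[OF x] distr_set[OF y]])
  also have "\<dots> = distr_fun x ?l + distr_fun y ?m" by (simp only: distr_fun_def)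
  also have "\<dots> \<le> 2 * t" using distr_rearrangement_le[OF x t] distr_rearrangement_le[OF y t] by simp
  finally show ?thesis using rearrangement_le_iff[OF z, of "2 * t" "?l + ?m"] l t by simp
qed

lemma AE_dyadic_interior: "AE t in I01. \<forall>i. t \<in> dyadic i \<longrightarrow> t \<in> {1 / 2 ^ Suc i<..<1 / 2 ^ i}"
proof -
  have "AE t in I01. t \<noteq> 1 / 2 ^ i" for i :: nat
  proof -
    have s: "{1 / 2 ^ i .. 1 / 2 ^ i} \<in> sets I01" using sym_space_inv_pow2[of i] by (intro ivl_sets_I01) auto
    have "measure I01 {1 / 2 ^ i .. 1 / 2 ^ i} = 0" using sym_space_inv_pow2[of i] by (subst ivl_measure_I01) auto
    then have "AE t in I01. t \<notin> {1 / 2 ^ i .. 1 / 2 ^ i}" using I.prob_eq_0[OF s] by simp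
    then show ?thesis by eventually_elim auto
  qed
  then have "AE t in I01. \<forall>i. t \<noteq> 1 / 2 ^ i" by (simp add: AE_all_countable)
  then show ?thesis by eventually_elim (auto simp: dyadic_def less_eq_real_def)
qed

section \<open>The endpoint spaces as summability conditions on \<open>bcoef\<close>\<close>

context boyd_space
begin

abbreviation fY :: "real \<Rightarrow> real" where "fY \<equiv> fundamental_fun Y"

lemma deriv_fY:
  assumes t: "t \<in> {1 / 2 ^ Suc k<..<1 / 2 ^ k}" shows "deriv fY t = 2 * head_sum k"
proof -
  have "eventually (\<lambda>s. s \<in> {1 / 2 ^ Suc k<..<1 / 2 ^ k}) (nhds t)"
    by (rule eventually_nhds_in_open) (use t in auto)
  then have "eventually (\<lambda>s. fY s = 2 * (head_sum k * s + tail_sum k)) (nhds t)"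
  proof eventually_elim
    fix s assume s: "s \<in> {1 / 2 ^ Suc k<..<1 / (2::real) ^ k}"
    have "0 \<le> 1 / (2::real) ^ Suc k" by simp
    then have "0 \<le> s" using s by (auto intro: order_trans less_imp_le)
    moreover have "s \<le> 1" using s sym_space_inv_pow2[of k] by (auto intro: order_trans less_imp_le)
    ultimately have "fY s = cfund s" by (intro fund_Y) auto
    also have "\<dots> = 2 * (head_sum k * s + tail_sum k)" by (rule cfund_eq) (use s in auto)
    finally show "fY s = 2 * (head_sum k * s + tail_sum k)" .
  qed
  then have "deriv fY t = deriv (\<lambda>s. 2 * (head_sum k * s + tail_sum k)) t" by (rule deriv_cong_ev) simp
  also have "\<dots> = 2 * head_sum k" by (rule DERIV_imp_deriv) (auto intro!: derivative_eq_intros)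
  finally show ?thesis .
qed

text \<open>\<open>psi\<close> tends to 0 because the lower index is positive. So the L_infinity
  term of the Lorentz norm drops out.\<close>

lemma Lim_fY: "Lim (at_right 0) fY = 0"
proof (rule tendsto_Lim)
  show "(fY \<longlongrightarrow> 0) (at_right 0)"
  proof (rule tendstoI)
    fix e :: real assume e: "0 < e"
    obtain k where k: "Cb * r ^ k * (8 * Q * psi 0 / e) \<le> 1"
      using psi_small[of "8 * Q * psi 0 / e"] Q e by auto
    have "8 * Q * psi k \<le> 8 * Q * (Cb * r ^ k * psi 0)" using psi_decay[of 0 k] Q by (intro mult_left_mono) auto
    also have "\<dots> \<le> e" using k e by (simp add: field_simps)
    finally have kinf: "4 * Q * psi k < e" using Q e mult_pos_pos[of Q "psi k"] by simp
    have "eventually (\<lambda>t. t \<in> {0<..<1 / 2 ^ k}) (at_right (0::real))" by (rule eventually_at_right_real) simp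
    then show "eventually (\<lambda>t. dist (fY t) 0 < e) (at_right 0)"
    proof eventually_elim
      fix t :: real assume t: "t \<in> {0<..<1 / 2 ^ k}"
      then have "t \<in> {0..1}" using sym_space_inv_pow2[of k] by (auto intro: order_trans less_imp_le)
      moreover have "cfund t \<le> 4 * Q * psi k" by (rule cfund_le) (use t in auto)
      ultimately show "dist (fY t) 0 < e" using kinf cfund_nonneg[of t] by (simp add: fund_Y)
    qed
  qed
qed simp

lemma lorentz_norm_fY: "lorentz_norm fY x = (\<integral>\<^sup>+t. ennreal (rearrangement x t * deriv fY t) \<partial>I01)"
  by (simp add: lorentz_norm_def Lim_fY)

text \<open>On block i the derivative \<open>2 * head_sum i\<close> times the size 2^-(i+1) is
  comparable with \<open>psi i\<close>. So the Lorentz space is the l_1 condition on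
  \<open>bcoef\<close>, of which this is one half.\<close>

lemma lorentz_lower:
  assumes x: "x \<in> BM"
  shows "(\<Sum>i. ennreal (bcoef x i)) \<le> lorentz_norm fY x"
proof -
  define c where "c i = rearrangement x (1 / 2 ^ i)" for i :: nat
  have c0: "0 \<le> c i" for i unfolding c_def by (rule rearrangement_nonneg[OF x]) simp
  have A0: "0 \<le> head_sum i" for i unfolding head_sum_def by (rule sum_nonneg) simp
  have "(\<Sum>i. ennreal (bcoef x i)) \<le> (\<Sum>i. ennreal (c i * (2 * head_sum i)) * ennreal (1 / 2 ^ Suc i))"
  proof (intro suminf_le summableI)
    fix i
    have "bcoef x i \<le> c i * (head_sum i / 2 ^ i)" unfolding bcoef_def c_def[symmetric]
      using head_sum_ge[of i] c0 by (intro mult_left_mono) (auto simp: le_divide_eq mult.commute)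
    then have "bcoef x i \<le> c i * (2 * head_sum i) * (1 / 2 ^ Suc i)" by simp
    then show "ennreal (bcoef x i) \<le> ennreal (c i * (2 * head_sum i)) * ennreal (1 / 2 ^ Suc i)"
      using c0 A0 by (subst ennreal_mult[symmetric]) (auto intro!: ennreal_leI)
  qed
  also have "\<dots> \<le> (\<integral>\<^sup>+t. ennreal (rearrangement x t * deriv fY t) \<partial>I01)"
  proof (rule nn_integral_ge_dyadic_AE)
    show "AE t in I01. \<forall>i. t \<in> dyadic i \<longrightarrow> ennreal (c i * (2 * head_sum i)) \<le> ennreal (rearrangement x t * deriv fY t)"
      using AE_dyadic_interior
    proof eventually_elim
      fix t assume a: "\<forall>i. t \<in> dyadic i \<longrightarrow> t \<in> {1 / 2 ^ Suc i<..<1 / 2 ^ i}"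
      show "\<forall>i. t \<in> dyadic i \<longrightarrow> ennreal (c i * (2 * head_sum i)) \<le> ennreal (rearrangement x t * deriv fY t)"
      proof (intro allI impI)
        fix i assume i: "t \<in> dyadic i"
        have "c i \<le> rearrangement x t" using rearr_dyadic(1,3)[OF x i] by (simp add: c_def rearr_def)
        then show "ennreal (c i * (2 * head_sum i)) \<le> ennreal (rearrangement x t * deriv fY t)"
          using deriv_fY[of t i] a i A0 by (intro ennreal_leI) (auto intro: mult_right_mono)
      qed
    qed
  qed
  finally show ?thesis by (simp add: lorentz_norm_fY)
qed

lemma lorentz_upper:
  assumes x: "x \<in> BM" and s: "summable (bcoef x)"
  shows "lorentz_norm fY x \<le> ennreal (2 * Q * (\<Sum>i. bcoef x i))"
proof -
  define c where "c i = rearrangement x (1 / 2 ^ i)" for i :: nat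
  have c0: "0 \<le> c i" for i unfolding c_def by (rule rearrangement_nonneg[OF x]) simp
  have A0: "0 \<le> head_sum i" for i unfolding head_sum_def by (rule sum_nonneg) simp
  have b0: "0 \<le> bcoef x i" for i by (rule bcoef_nonneg[OF x])
  have "lorentz_norm fY x \<le> (\<Sum>i. ennreal (c (Suc i) * (2 * head_sum i)) * ennreal (1 / 2 ^ Suc i))"
    unfolding lorentz_norm_fY
  proof (rule nn_integral_le_dyadic_AE)
    show "AE t in I01. \<forall>i. t \<in> dyadic i \<longrightarrow> ennreal (rearrangement x t * deriv fY t) \<le> ennreal (c (Suc i) * (2 * head_sum i))"
      using AE_dyadic_interior
    proof eventually_elim
      fix t assume a: "\<forall>i. t \<in> dyadic i \<longrightarrow> t \<in> {1 / 2 ^ Suc i<..<1 / 2 ^ i}"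
      show "\<forall>i. t \<in> dyadic i \<longrightarrow> ennreal (rearrangement x t * deriv fY t) \<le> ennreal (c (Suc i) * (2 * head_sum i))"
      proof (intro allI impI)
        fix i assume i: "t \<in> dyadic i"
        have "rearrangement x t \<le> c (Suc i)" using rearr_dyadic(2,3)[OF x i] by (simp add: c_def rearr_def)
        then show "ennreal (rearrangement x t * deriv fY t) \<le> ennreal (c (Suc i) * (2 * head_sum i))"
          using deriv_fY[of t i] a i A0 by (intro ennreal_leI) (auto intro: mult_right_mono)
      qed
    qed
  qed
  also have "\<dots> \<le> (\<Sum>i. ennreal (2 * Q * bcoef x (Suc i)))"
  proof (intro suminf_le summableI)
    fix i
    have "head_sum i / 2 ^ i \<le> Q * psi i" using psi_head[of i] by (simp add: head_sum_def divide_le_eq mult_ac)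
    also have "\<dots> \<le> Q * (2 * psi (Suc i))" using psi_doubling[of i 1] Q by (intro mult_left_mono) auto
    finally have "c (Suc i) * (head_sum i / 2 ^ i) \<le> c (Suc i) * (Q * (2 * psi (Suc i)))" using c0 by (intro mult_left_mono) auto
    then have "c (Suc i) * (2 * head_sum i) * (1 / 2 ^ Suc i) \<le> 2 * Q * bcoef x (Suc i)" by (simp add: bcoef_def c_def mult_ac)
    then show "ennreal (c (Suc i) * (2 * head_sum i)) * ennreal (1 / 2 ^ Suc i) \<le> ennreal (2 * Q * bcoef x (Suc i))"
      using c0 A0 by (subst ennreal_mult[symmetric]) (auto intro!: ennreal_leI)
  qed
  also have "\<dots> = ennreal (\<Sum>i. 2 * Q * bcoef x (Suc i))"
    using b0 Q s by (intro suminf_ennreal2) (auto simp: summable_Suc_iff intro!: summable_mult)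
  also have "\<dots> \<le> ennreal (2 * Q * (\<Sum>i. bcoef x i))"
  proof (rule ennreal_leI)
    have "(\<Sum>i. bcoef x (Suc i)) \<le> (\<Sum>i. bcoef x i)" using suminf_split_head[OF s] b0[of 0] by simp
    then have "2 * Q * (\<Sum>i. bcoef x (Suc i)) \<le> 2 * Q * (\<Sum>i. bcoef x i)" using Q by (intro mult_left_mono) auto
    then show "(\<Sum>i. 2 * Q * bcoef x (Suc i)) \<le> 2 * Q * (\<Sum>i. bcoef x i)"
      using s by (subst suminf_mult) (auto simp: summable_Suc_iff)
  qed
  finally show ?thesis .
qed

text \<open>The average of the rearrangement over (0, 2^-i] is at least its value at the right end.
  With \<open>marc_upper\<close> this makes the Marcinkiewicz space the l_infinity condition on
  \<open>bcoef\<close>.\<close>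

lemma marc_lower:
  assumes x: "x \<in> BM"
  shows "ennreal (bcoef x i) \<le> marcinkiewicz_norm fY x"
proof -
  define c where "c = rearrangement x (1 / 2 ^ i)"
  have c0: "0 \<le> c" unfolding c_def by (rule rearrangement_nonneg[OF x]) simp
  define t where "t = 1 / (2::real) ^ i"
  have t: "t \<in> {0<..1}" using sym_space_inv_pow2[of i] by (simp add: t_def)
  have tdy: "t \<in> dyadic i" by (simp add: t_def dyadic_def field_simps)
  have s: "{0<..t} \<in> sets I01" using t by (intro ivl_sets_I01) auto
  have "ennreal c * ennreal t = (\<integral>\<^sup>+s. ennreal c * indicator {0<..t} s \<partial>I01)"
    using s t ivl_measure_I01(2)[of 0 t] by (subst nn_integral_cmult_indicator) (auto simp: I.emeasure_eq_measure)
  also have "\<dots> \<le> (\<integral>\<^sup>+s. ennreal (rearrangement x s) * indicator {0<..t} s \<partial>I01)"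
  proof (rule nn_integral_mono)
    fix s
    show "ennreal c * indicator {0<..t} s \<le> ennreal (rearrangement x s) * indicator {0<..t} s"
      using rearrangement_antimono[OF x, of s t] by (auto simp: indicator_def c_def t_def intro!: ennreal_leI)
  qed
  finally have 1: "ennreal c * ennreal t \<le> (\<integral>\<^sup>+s. ennreal (rearrangement x s) * indicator {0<..t} s \<partial>I01)" .
  have "ennreal (bcoef x i) = ennreal (psi i / t) * (ennreal c * ennreal t)"
    using c0 t by (simp add: bcoef_def c_def ennreal_mult[symmetric] mult.commute)
  also have "\<dots> \<le> ennreal (fY t / t) * (\<integral>\<^sup>+s. ennreal (rearrangement x s) * indicator {0<..t} s \<partial>I01)"
    using cfund_ge[OF tdy] t by (intro mult_mono 1 ennreal_leI divide_right_mono) (auto simp: fund_Y)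
  also have "\<dots> \<le> marcinkiewicz_norm fY x" unfolding marcinkiewicz_norm_def using t by (rule SUP_upper)
  finally show ?thesis .
qed

lemma marc_upper:
  assumes x: "x \<in> BM" and B: "0 \<le> B" and b: "\<And>i. bcoef x i \<le> B"
  shows "marcinkiewicz_norm fY x \<le> ennreal (8 * Q * Q * B)"
proof -
  have "ennreal (fY t / t) * (\<integral>\<^sup>+s. ennreal (rearrangement x s) * indicator {0<..t} s \<partial>I01) \<le> ennreal (8 * Q * Q * B)"
    if tI: "t \<in> {0<..1}" for t
  proof -
    obtain k where k: "t \<in> dyadic k" using dyadic_cover[of t] tI by auto
    define c where "c i = rearrangement x (1 / 2 ^ i)" for i :: nat
    have c0: "0 \<le> c i" for i unfolding c_def by (rule rearrangement_nonneg[OF x]) simp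
    have cB: "c i * psi i \<le> B" for i using b[of i] by (simp add: bcoef_def c_def)
    have "(\<integral>\<^sup>+s. ennreal (rearrangement x s) * indicator {0<..t} s \<partial>I01)
      \<le> (\<Sum>i. (if k \<le> i then ennreal (c (Suc i)) else 0) * ennreal (1 / 2 ^ Suc i))"
    proof (rule nn_integral_le_dyadic)
      fix i s assume s: "s \<in> dyadic i"
      have sc: "rearrangement x s \<le> c (Suc i)" using rearr_dyadic(2,3)[OF x s] by (simp add: c_def rearr_def)
      show "ennreal (rearrangement x s) * indicator {0<..t} s \<le> (if k \<le> i then ennreal (c (Suc i)) else 0)"
      proof (cases "k \<le> i")
        case True
        then show ?thesis using sc by (auto simp: indicator_def intro!: ennreal_leI)
      next
        case False
        have "1 / (2::real) ^ k \<le> 1 / 2 ^ Suc i" using False by (intro frac_le power_increasing) auto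
        then have "t < s" using s k by (auto simp: dyadic_def)
        then show ?thesis by simp
      qed
    qed
    also have "\<dots> \<le> ennreal (B * Q / 2 ^ k / psi k)" by (rule tail_weak[OF B c0 cB])
    finally have "ennreal (fY t / t) * (\<integral>\<^sup>+s. ennreal (rearrangement x s) * indicator {0<..t} s \<partial>I01)
      \<le> ennreal (8 * Q * psi k * 2 ^ k) * ennreal (B * Q / 2 ^ k / psi k)"
      using cfund_div_le[OF k] tI by (intro mult_mono ennreal_leI) (auto simp: fund_Y)
    also have "\<dots> = ennreal (8 * Q * Q * B)"
      using Q B by (subst ennreal_mult[symmetric]) (auto simp: mult_ac)
    finally show ?thesis .
  qed
  then show ?thesis unfolding marcinkiewicz_norm_def by (rule SUP_least)
qed

abbreviation LL :: fun_space where "LL \<equiv> lorentz_space fY"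
abbreviation MM :: fun_space where "MM \<equiv> marcinkiewicz_space fY"

lemma LL_elts:
  assumes "x \<in> elts LL" shows "x \<in> BM" "summable (bcoef x)" "(\<Sum>i. bcoef x i) \<le> nrm LL x"
proof -
  show x: "x \<in> BM" using assms by (simp add: lorentz_space_def space_of_norm_def)
  have f: "lorentz_norm fY x < top" using assms by (simp add: lorentz_space_def space_of_norm_def)
  have "(\<Sum>i. ennreal (bcoef x i)) \<le> ennreal (enn2real (lorentz_norm fY x))"
    using lorentz_lower[OF x] f by simp
  then show "summable (bcoef x)" "(\<Sum>i. bcoef x i) \<le> nrm LL x"
    using ennreal_suminf_bound[OF bcoef_nonneg[OF x]] by (auto simp: lorentz_space_def space_of_norm_def)
qed

lemma LL_I:
  assumes x: "x \<in> BM" and s: "summable (bcoef x)" shows "x \<in> elts LL" "nrm LL x \<le> 2 * Q * (\<Sum>i. bcoef x i)"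
proof -
  have *: "lorentz_norm fY x \<le> ennreal (2 * Q * (\<Sum>i. bcoef x i))" by (rule lorentz_upper[OF x s])
  then have "lorentz_norm fY x < top" by (rule le_less_trans) simp
  then show "x \<in> elts LL" using x by (simp add: lorentz_space_def space_of_norm_def)
  have "0 \<le> 2 * Q * (\<Sum>i. bcoef x i)" using Q suminf_nonneg[OF s bcoef_nonneg[OF x]] by simp
  then show "nrm LL x \<le> 2 * Q * (\<Sum>i. bcoef x i)" using enn2real_mono[OF *]
    by (simp add: lorentz_space_def space_of_norm_def)
qed

lemma MM_elts:
  assumes "x \<in> elts MM" shows "x \<in> BM" "bcoef x i \<le> nrm MM x"
proof -
  show x: "x \<in> BM" using assms by (simp add: marcinkiewicz_space_def space_of_norm_def)
  have f: "marcinkiewicz_norm fY x < top" using assms by (simp add: marcinkiewicz_space_def space_of_norm_def)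
  have "enn2real (ennreal (bcoef x i)) \<le> enn2real (marcinkiewicz_norm fY x)"
    using f by (intro enn2real_mono marc_lower[OF x])
  then show "bcoef x i \<le> nrm MM x" using bcoef_nonneg[OF x] by (simp add: marcinkiewicz_space_def space_of_norm_def)
qed

lemma MM_I:
  assumes x: "x \<in> BM" and B: "0 \<le> B" and b: "\<And>i. bcoef x i \<le> B"
  shows "x \<in> elts MM" "nrm MM x \<le> 8 * Q * Q * B"
proof -
  have *: "marcinkiewicz_norm fY x \<le> ennreal (8 * Q * Q * B)" by (rule marc_upper[OF x B b])
  then have "marcinkiewicz_norm fY x < top" by (rule le_less_trans) simp
  then show "x \<in> elts MM" using x by (simp add: marcinkiewicz_space_def space_of_norm_def)
  have "0 \<le> 8 * Q * Q * B" using Q B by simp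
  then show "nrm MM x \<le> 8 * Q * Q * B" using enn2real_mono[OF *]
    by (simp add: marcinkiewicz_space_def space_of_norm_def)
qed

lemma LL_MM_nonneg: "0 \<le> nrm LL x" "0 \<le> nrm MM x"
  by (auto simp: lorentz_space_def marcinkiewicz_space_def space_of_norm_def)

lemma zero_bcoef: "bcoef (\<lambda>t. 0) = (\<lambda>i. 0)"
proof
  fix i
  have "distr_fun (\<lambda>t. 0) 0 = 0" by (simp add: distr_fun_def)
  then have "rearrangement (\<lambda>t. 0) (1 / 2 ^ i) \<le> 0" by (subst rearrangement_le_iff) auto
  then show "bcoef (\<lambda>t. 0) i = 0" using rearrangement_nonneg[of "\<lambda>t. 0" "1 / 2 ^ i"] by (simp add: bcoef_def)
qed

lemma zero_LL: "(\<lambda>t. 0) \<in> elts LL" "nrm LL (\<lambda>t. 0) = 0"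
proof -
  have "summable (bcoef (\<lambda>t. 0))" by (simp add: zero_bcoef)
  from LL_I[OF _ this] show "(\<lambda>t. 0) \<in> elts LL" "nrm LL (\<lambda>t. 0) = 0"
    using LL_MM_nonneg(1)[of "\<lambda>t. 0"] by (auto simp: zero_bcoef)
qed

end

lemma sum_space_I:
  assumes "x \<in> BM" "x0 \<in> elts X0" "x1 \<in> elts X1" "ae_eq x (\<lambda>s. x0 s + x1 s)"
  shows "x \<in> elts (sum_space X0 X1)"
proof -
  have "\<exists>x0\<in>elts X0. \<exists>x1\<in>elts X1. ae_eq x (\<lambda>s. x0 s + x1 s)"
    using assms(2-4) by blast
  then show ?thesis using assms(1) by (simp add: sum_space_def)
qed

section \<open>Interpolation between the Lorentz and the Marcinkiewicz space\<close>

context seq_model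
begin

lemma X_MM:
  assumes x: "x \<in> elts X" shows "x \<in> elts MM" "nrm MM x \<le> 8 * Q * Q * nrm X x"
proof -
  show "x \<in> elts MM" by (rule MM_I(1)[OF elts_BM[OF x] nrm_nonneg[OF x] bcoef_le_nrm[OF x]])
  show "nrm MM x \<le> 8 * Q * Q * nrm X x" by (rule MM_I(2)[OF elts_BM[OF x] nrm_nonneg[OF x] bcoef_le_nrm[OF x]])
qed

text \<open>The inclusion of l_1 in l_p: an entry is at most the sum S, so its p-th power is at most
  S^(p-1) times the entry.\<close>

lemma LL_X:
  assumes x: "x \<in> elts LL" shows "x \<in> elts X" "nrm X x \<le> K * nrm LL x"
proof -
  have xb: "x \<in> BM" and s: "summable (bcoef x)" and le: "(\<Sum>i. bcoef x i) \<le> nrm LL x" using LL_elts[OF x] by auto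
  define S where "S = (\<Sum>i. bcoef x i)"
  have b0: "0 \<le> bcoef x i" for i by (rule bcoef_nonneg[OF xb])
  have S0: "0 \<le> S" unfolding S_def by (rule suminf_nonneg[OF s b0])
  have bS: "bcoef x i \<le> S" for i unfolding S_def using sum_le_suminf[OF s, of "{i}"] b0 by simp
  have split: "z powr p = z powr (p - 1) * z" if "0 \<le> z" for z :: real
    using that by (cases "z = 0") (auto simp: powr_mult_base mult.commute)
  have le1: "bcoef x i powr p \<le> S powr (p - 1) * bcoef x i" for i
    unfolding split[OF b0] using bS b0 p by (intro mult_right_mono powr_mono2) auto
  have sp: "summable (\<lambda>i. bcoef x i powr p)"
    by (rule summable_comparison_test'[OF summable_mult[OF s, of "S powr (p - 1)"], of 0]) (use le1 in auto)
  show xX: "x \<in> elts X" using elts_iff[OF xb] sp by simp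
  have "(\<Sum>i. bcoef x i powr p) \<le> (\<Sum>i. S powr (p - 1) * bcoef x i)" by (rule suminf_le[OF le1 sp summable_mult[OF s]])
  also have "\<dots> = S powr p" using split[OF S0] by (simp add: suminf_mult[OF s] S_def)
  finally have "(\<Sum>i. bcoef x i powr p) powr \<theta> \<le> (S powr p) powr \<theta>"
    using theta sp by (intro powr_mono2 suminf_nonneg) auto
  then have "(\<Sum>i. bcoef x i powr p) powr \<theta> \<le> nrm LL x" using S0 le by (simp add: powr_p_theta S_def)
  then have "K * (\<Sum>i. bcoef x i powr p) powr \<theta> \<le> K * nrm LL x" using K by (intro mult_left_mono) auto
  then show "nrm X x \<le> K * nrm LL x" using nrm_le[OF xX] by linarith
qed

text \<open>A cut at one height of x would not do, since the height that corresponds to l varies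
  with the scale. The range of |x| is divided at the values of the rearrangement at 2^-i, and the
  slices whose upper end violates the bound l form x0.\<close>

lemma splitting:
  assumes x: "x \<in> elts X" and l: "0 < l"
  shows "\<exists>x0 x1. x0 \<in> elts LL \<and> x1 \<in> elts MM \<and> x = (\<lambda>t. x0 t + x1 t) \<and>
    nrm LL x0 \<le> 2 * Q * Q * (\<Sum>i\<in>{i. l < bcoef x i}. bcoef x i) \<and> nrm MM x1 \<le> 8 * Q * Q * l"
proof -
  have xb: "x \<in> BM" by (rule elts_BM[OF x])
  have b0: "0 \<le> bcoef x i" for i by (rule bcoef_nonneg[OF xb])
  have sp: "summable (\<lambda>i. bcoef x i powr p)" using elts_iff[OF xb] x by simp
  define c where "c i = rearrangement x (1 / 2 ^ i)" for i :: nat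
  have c0: "0 \<le> c i" for i unfolding c_def by (rule rearrangement_nonneg[OF xb]) simp
  have cmono: "c i \<le> c j" if "i \<le> j" for i j
    unfolding c_def using that by (intro rearrangement_antimono[OF xb]) (auto simp: frac_le)
  have c00: "c 0 = 0" unfolding c_def by (rule rearrangement_ge_1[OF xb]) simp
  have dc: "distr_fun x (c k) \<le> 1 / 2 ^ k" for k
    unfolding c_def by (rule distr_rearrangement_le[OF xb]) simp
  have bc: "bcoef x i = c i * psi i" for i by (simp add: bcoef_def c_def)
  \<comment> \<open>As \<open>c 0\<close> is 0, these slices cover all points except the zeros of x
    and a null set where |x| exceeds every c i.\<close>
  define Bs where "Bs i = {t \<in> {0..1}. c i < \<bar>x t\<bar>} - {t \<in> {0..1}. c (Suc i) < \<bar>x t\<bar>}" for i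
  have Bs: "Bs i \<in> sets I01" for i unfolding Bs_def by (intro sets.Diff distr_set xb)
  have fin0: "finite {i. l < bcoef x i}" by (rule finite_superlevel[OF b0 sp _ l]) (use p in simp)
  define J where "J = {i. l < bcoef x (Suc i)}"
  have J: "finite J"
  proof (rule finite_imageD)
    show "finite (Suc ` J)" by (rule finite_subset[OF _ fin0]) (auto simp: J_def)
  qed simp
  define E where "E = (\<Union>i\<in>J. Bs i)"
  have E: "E \<in> sets I01" unfolding E_def using J Bs by auto
  define x0 where "x0 t = indicator E t * x t" for t
  define x1 where "x1 t = (1 - indicator E t) * x t" for t
  have x0b: "x0 \<in> BM" and x1b: "x1 \<in> BM" unfolding x0_def[abs_def] x1_def[abs_def] using E xb by auto
  have xe: "x = (\<lambda>t. x0 t + x1 t)" by (simp add: x0_def x1_def fun_eq_iff algebra_simps)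
  \<comment> \<open>A bound for x0 on the slices before k. A sum is used instead of a maximum so
    that the order of summation can be exchanged later.\<close>
  define m where "m k = (\<Sum>i\<in>{i\<in>J. i < k}. c (Suc i))" for k
  have m0: "0 \<le> m k" for k unfolding m_def by (rule sum_nonneg) (rule c0)
  have r0: "rearrangement x0 (1 / 2 ^ k) \<le> m k" for k
  proof (subst rearrangement_le_iff[OF x0b _ m0])
    have "distr_fun x0 (m k) \<le> distr_fun x (c k)"
    proof (rule distr_mono[OF xb x0b], rule AE_I2, rule impI)
      fix t assume t: "m k < \<bar>x0 t\<bar>"
      have "t \<in> E"
      proof (rule ccontr)
        assume "t \<notin> E"
        then have "x0 t = 0" by (simp add: x0_def)
        then show False using t m0[of k] by simp
      qed
      then obtain i where i: "i \<in> J" "t \<in> Bs i" by (auto simp: E_def)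
      have xt: "m k < \<bar>x t\<bar>" using t \<open>t \<in> E\<close> by (simp add: x0_def)
      have "\<not> i < k"
      proof
        assume "i < k"
        then have "c (Suc i) \<le> m k" unfolding m_def using i J c0 by (intro member_le_sum) auto
        then show False using xt i(2) by (auto simp: Bs_def)
      qed
      then show "c k < \<bar>x t\<bar>" using cmono[of k i] i(2) by (auto simp: Bs_def)
    qed
    then show "distr_fun x0 (m k) \<le> 1 / 2 ^ k" using dc[of k] by linarith
  qed simp
  define W where "W = (\<Sum>i\<in>{i. l < bcoef x i}. bcoef x i)"
  have part: "(\<Sum>k<n. bcoef x0 k) \<le> Q * W" for n
  proof -
    have "(\<Sum>k<n. bcoef x0 k) \<le> (\<Sum>k<n. \<Sum>i\<in>J. if i < k then c (Suc i) * psi k else 0)"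
    proof (rule sum_mono)
      fix k
      have "bcoef x0 k \<le> m k * psi k" unfolding bcoef_def using r0[of k] by (intro mult_right_mono) auto
      also have "\<dots> = (\<Sum>i\<in>J. if i < k then c (Suc i) * psi k else 0)"
        unfolding m_def sum_distrib_right by (rule sum.inter_filter[OF J])
      finally show "bcoef x0 k \<le> \<dots>" .
    qed
    \<comment> \<open>For fixed i there remains the tail of the sum of \<open>psi\<close> after i,
      which \<open>psi_tail\<close> bounds by its first term.\<close>
    also have "\<dots> = (\<Sum>i\<in>J. \<Sum>k<n. if i < k then c (Suc i) * psi k else 0)" by (rule sum.swap)
    also have "\<dots> \<le> (\<Sum>i\<in>J. Q * bcoef x (Suc i))"
    proof (rule sum_mono)
      fix i
      have "(\<Sum>k<n. if i < k then c (Suc i) * psi k else 0) = (\<Sum>k\<in>{Suc i..<n}. c (Suc i) * psi k)"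
        by (rule sum.mono_neutral_cong_right) auto
      also have "\<dots> = c (Suc i) * (\<Sum>j<n - Suc i. psi (Suc i + j))"
        by (simp add: sum_distrib_left[symmetric] atLeast0LessThan[symmetric] sum.atLeastLessThan_shift_0[of _ "Suc i" n] add.commute)
      also have "\<dots> \<le> c (Suc i) * (Q * psi (Suc i))"
      proof (rule mult_left_mono[OF _ c0])
        have "(\<Sum>j<n - Suc i. psi (Suc i + j)) \<le> (\<Sum>j. psi (Suc i + j))" by (rule sum_le_suminf[OF psi_tail(1)]) auto
        then show "(\<Sum>j<n - Suc i. psi (Suc i + j)) \<le> Q * psi (Suc i)" using psi_tail(2)[of "Suc i"] by linarith
      qed
      finally show "(\<Sum>k<n. if i < k then c (Suc i) * psi k else 0) \<le> Q * bcoef x (Suc i)"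
        by (simp only: bc mult.left_commute)
    qed
    also have "\<dots> = Q * (\<Sum>i\<in>Suc ` J. bcoef x i)" by (simp add: sum_distrib_left sum.reindex)
    also have "\<dots> \<le> Q * W" unfolding W_def
      using fin0 b0 Q by (intro mult_left_mono sum_mono2) (auto simp: J_def)
    finally show ?thesis .
  qed
  have s0: "summable (bcoef x0)" by (rule summableI_nonneg_bounded[OF bcoef_nonneg[OF x0b] part])
  have "(\<Sum>i. bcoef x0 i) \<le> Q * W" by (rule suminf_le_const[OF s0 part])
  then have "2 * Q * (\<Sum>i. bcoef x0 i) \<le> 2 * Q * (Q * W)" using Q by (intro mult_left_mono) auto
  then have n0: "x0 \<in> elts LL" "nrm LL x0 \<le> 2 * Q * Q * W" using LL_I[OF x0b s0] by auto
  have b1: "bcoef x1 k \<le> l" for k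
  proof -
    have lp: "0 \<le> l / psi k" using l by simp
    have "distr_fun x1 (l / psi k) \<le> distr_fun x (c k)"
    \<comment> \<open>A point with |x| at most c k lies in a slice ending at some c j with j at most
      k. If the slice is not in E, its upper end obeys the bound l at j, hence also at k because
      \<open>psi\<close> decreases.\<close>
    proof (rule distr_mono[OF xb x1b], rule AE_I2, rule impI)
      fix t assume tI: "t \<in> space I01" and t: "l / psi k < \<bar>x1 t\<bar>"
      then have "t \<notin> E" using lp by (auto simp: x1_def)
      then have xt: "l / psi k < \<bar>x t\<bar>" using t by (simp add: x1_def)
      show "c k < \<bar>x t\<bar>"
      proof (rule ccontr)
        assume "\<not> c k < \<bar>x t\<bar>"
        then have ck: "\<bar>x t\<bar> \<le> c k" by simp
        define j where "j = (LEAST j. \<bar>x t\<bar> \<le> c j)"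
        have j: "\<bar>x t\<bar> \<le> c j" unfolding j_def by (rule LeastI[of _ k]) (rule ck)
        have jk: "j \<le> k" unfolding j_def by (rule Least_le) (rule ck)
        have "j \<noteq> 0" using j c00 xt lp by (intro notI) auto
        then obtain i where i: "j = Suc i" by (cases j) auto
        have "\<not> \<bar>x t\<bar> \<le> c i" using not_less_Least[of i "\<lambda>j. \<bar>x t\<bar> \<le> c j"] i unfolding j_def by simp
        then have "t \<in> Bs i" using tI j i by (auto simp: Bs_def)
        then have "i \<notin> J" using \<open>t \<notin> E\<close> by (auto simp: E_def)
        then have "c (Suc i) * psi (Suc i) \<le> l" by (simp add: J_def bc)
        moreover have "c (Suc i) * psi k \<le> c (Suc i) * psi (Suc i)"
          using jk i c0 by (intro mult_left_mono psi_antimono) auto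
        ultimately have "c (Suc i) \<le> l / psi k" by (simp add: le_divide_eq)
        then show False using xt j i by simp
      qed
    qed
    then have "distr_fun x1 (l / psi k) \<le> 1 / 2 ^ k" using dc[of k] by linarith
    then have "rearrangement x1 (1 / 2 ^ k) \<le> l / psi k" using rearrangement_le_iff[OF x1b _ lp, of "1 / 2 ^ k"] by simp
    then show ?thesis by (simp add: bcoef_def le_divide_eq)
  qed
  have "x1 \<in> elts MM" "nrm MM x1 \<le> 8 * Q * Q * l" using MM_I[OF x1b less_imp_le[OF l] b1] by auto
  then show ?thesis using n0 xe unfolding W_def by blast
qed

lemma K_nonneg_bdd: "bdd_below {nrm LL x0 + t * nrm MM x1 | x0 x1. x0 \<in> elts LL \<and> x1 \<in> elts MM \<and> ae_eq x (\<lambda>s. x0 s + x1 s)}"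
  if "0 \<le> t" for t x
  by (rule bdd_belowI[of _ 0]) (use that LL_MM_nonneg in auto)

lemma X_sum:
  assumes x: "x \<in> elts X"
  shows "x \<in> elts (sum_space LL MM)" "nrm (sum_space LL MM) x \<le> 8 * Q * Q * nrm X x"
proof -
  have ae: "ae_eq x (\<lambda>s. (\<lambda>t. 0) s + x s)" by (simp add: ae_eq_def)
  show "x \<in> elts (sum_space LL MM)"
    by (rule sum_space_I[OF elts_BM[OF x] zero_LL(1) X_MM(1)[OF x] ae])
  have "K_functional LL MM 1 x \<le> nrm LL (\<lambda>t. 0) + 1 * nrm MM x"
    unfolding K_functional_def
  proof (rule cInf_lower[OF _ K_nonneg_bdd])
    show "nrm LL (\<lambda>t. 0) + 1 * nrm MM x \<in> {nrm LL x0 + 1 * nrm MM x1 | x0 x1.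
      x0 \<in> elts LL \<and> x1 \<in> elts MM \<and> ae_eq x (\<lambda>s. x0 s + x1 s)}"
      using zero_LL(1) X_MM(1)[OF x] ae by blast
  qed simp
  then show "nrm (sum_space LL MM) x \<le> 8 * Q * Q * nrm X x"
    using X_MM(2)[OF x] zero_LL(2) by (simp add: sum_space_def)
qed

text \<open>The image of the second part of the splitting contributes at most half of
  \<open>\<kappa> * l\<close>. So at an index where the image of x exceeds
  \<open>\<kappa> * l\<close>, the image of the first part accounts for at least half of the entry.
  Summing these entries gives the hypothesis H of \<open>marcinkiewicz_sequences\<close>.\<close>

lemma interpolation_bound:
  assumes lin: "linear_operator_on (sum_space LL MM) T" and TL: "maps_boundedly T LL" and TM: "maps_boundedly T MM"
  shows "maps_boundedly T X"
proof -
  obtain D0 where D0: "\<And>x. x \<in> elts LL \<Longrightarrow> nrm LL (T x) \<le> D0 * nrm LL x"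
    and T0: "\<And>x. x \<in> elts LL \<Longrightarrow> T x \<in> elts LL" using TL unfolding maps_boundedly_def by blast
  obtain D1 where D1: "\<And>x. x \<in> elts MM \<Longrightarrow> nrm MM (T x) \<le> D1 * nrm MM x"
    and T1: "\<And>x. x \<in> elts MM \<Longrightarrow> T x \<in> elts MM" using TM unfolding maps_boundedly_def by blast
  define C0 where "C0 = max 0 D0"
  define C1 where "C1 = max 1 D1"
  have C0: "0 \<le> C0" "nrm LL (T x) \<le> C0 * nrm LL x" if "x \<in> elts LL" for x
    using D0[OF that] mult_right_mono[of D0 C0 "nrm LL x"] LL_MM_nonneg(1)[of x] by (auto simp: C0_def)
  have C0': "0 \<le> C0" by (simp add: C0_def)
  have C1: "nrm MM (T x) \<le> C1 * nrm MM x" if "x \<in> elts MM" for x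
    using D1[OF that] mult_right_mono[of D1 C1 "nrm MM x"] LL_MM_nonneg(2)[of x] by (auto simp: C1_def)
  have C1': "1 \<le> C1" by (simp add: C1_def)
  \<comment> \<open>\<open>8 * Q * Q * l\<close> bounds the second part and C1 the norm of T on it;
    one factor 2 is lost by \<open>psi_doubling\<close>, another leaves a half to spare.\<close>
  define \<kappa> where "\<kappa> = 32 * Q * Q * C1"
  have kp: "0 < \<kappa>" using Q C1' by (simp add: \<kappa>_def)
  define C where "C = 8 * C0 * Q * Q"
  have Cp: "0 \<le> C" using C0' Q by (simp add: C_def)
  define C2 where "C2 = (2 * \<kappa>) powr (p - 1) * C * (2 / (1 - 2 powr (1 - p)))"
  have C2: "0 \<le> C2" 
  proof -
    have "2 powr (1 - p) \<le> 2 powr 0" using p by (intro powr_mono) auto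
    then show ?thesis using Cp by (simp add: C2_def)
  qed
  have main: "T x \<in> elts X \<and> nrm X (T x) \<le> K * (C2 powr \<theta> * K) * nrm X x" if x: "x \<in> elts X" for x
  proof -
    have xb: "x \<in> BM" by (rule elts_BM[OF x])
    have b0: "0 \<le> bcoef x i" for i by (rule bcoef_nonneg[OF xb])
    have sp: "summable (\<lambda>i. bcoef x i powr p)" using elts_iff[OF xb] x by simp
    have xs: "x \<in> elts (sum_space LL MM)" by (rule X_sum(1)[OF x])
    define y where "y = T x"
    have "y \<in> elts (sum_space LL MM)" using lin xs unfolding linear_operator_on_def y_def by blast
    then have yb: "y \<in> BM" by (simp add: sum_space_def)
    have H: "(\<Sum>k\<in>F. bcoef y k) \<le> C * (\<Sum>i\<in>{i. l < bcoef x i}. bcoef x i)"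
      if l: "0 < l" and F: "finite F" and Fk: "\<And>k. k \<in> F \<Longrightarrow> \<kappa> * l < bcoef y k" for l F
    proof -
      define W where "W = (\<Sum>i\<in>{i. l < bcoef x i}. bcoef x i)"
      obtain x0 x1 where x01: "x0 \<in> elts LL" "x1 \<in> elts MM" "x = (\<lambda>t. x0 t + x1 t)"
        "nrm LL x0 \<le> 2 * Q * Q * W" "nrm MM x1 \<le> 8 * Q * Q * l"
        using splitting[OF x l] unfolding W_def by blast
      have zM: "(\<lambda>t. 0) \<in> elts MM" using X_MM(1)[OF zero_elts] .
      have "x0 \<in> elts (sum_space LL MM)"
        by (rule sum_space_I[OF LL_elts(1)[OF x01(1)] x01(1) zM]) (simp add: ae_eq_def)
      moreover have "x1 \<in> elts (sum_space LL MM)"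
        by (rule sum_space_I[OF MM_elts(1)[OF x01(2)] zero_LL(1) x01(2)]) (simp add: ae_eq_def)
      ultimately have "ae_eq (T (\<lambda>t. x0 t + x1 t)) (\<lambda>t. T x0 t + T x1 t)"
        using lin unfolding linear_operator_on_def by blast
      then have ae: "AE t in I01. y t = T x0 t + T x1 t" unfolding y_def x01(3)[symmetric] by (simp add: ae_eq_def)
      have t0: "T x0 \<in> BM" "summable (bcoef (T x0))" "(\<Sum>i. bcoef (T x0) i) \<le> nrm LL (T x0)" using LL_elts[OF T0[OF x01(1)]] by auto
      have t1: "T x1 \<in> BM" "bcoef (T x1) i \<le> nrm MM (T x1)" for i using MM_elts[OF T1[OF x01(2)]] by auto
      have t0b: "0 \<le> bcoef (T x0) i" for i by (rule bcoef_nonneg[OF t0(1)])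
      have bT1: "bcoef (T x1) i \<le> C1 * (8 * Q * Q * l)" for i
        using t1(2)[of i] C1[OF x01(2)] mult_left_mono[OF x01(5), of C1] C1' by linarith
      have "(\<Sum>i. bcoef (T x0) i) \<le> C0 * (2 * Q * Q * W)"
        using t0(3) C0(2)[OF x01(1)] mult_left_mono[OF x01(4) C0'] by linarith
      have ble: "bcoef y k \<le> 4 * bcoef (T x0) (Suc k)" if k: "k \<in> F" for k
      proof -
        have "rearrangement y (2 * (1 / 2 ^ Suc k)) \<le> rearrangement (T x0) (1 / 2 ^ Suc k) + rearrangement (T x1) (1 / 2 ^ Suc k)"
          by (rule rearrangement_add[OF t0(1) t1(1) yb ae]) simp
        then have "bcoef y k \<le> (rearrangement (T x0) (1 / 2 ^ Suc k) + rearrangement (T x1) (1 / 2 ^ Suc k)) * psi k"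
          unfolding bcoef_def by (intro mult_right_mono) auto
        also have "\<dots> \<le> (rearrangement (T x0) (1 / 2 ^ Suc k) + rearrangement (T x1) (1 / 2 ^ Suc k)) * (2 * psi (Suc k))"
          using psi_doubling[of k 1] rearrangement_nonneg[OF t0(1), of "1 / 2 ^ Suc k"] rearrangement_nonneg[OF t1(1), of "1 / 2 ^ Suc k"]
          by (intro mult_left_mono) auto
        also have "\<dots> = 2 * bcoef (T x0) (Suc k) + 2 * bcoef (T x1) (Suc k)" by (simp add: bcoef_def algebra_simps)
        finally have "bcoef y k \<le> 2 * bcoef (T x0) (Suc k) + 2 * bcoef (T x1) (Suc k)" .
        then have "bcoef y k \<le> 2 * bcoef (T x0) (Suc k) + \<kappa> * l / 2" 
        proof -
          have "2 * (C1 * (8 * Q * Q * l)) = \<kappa> * l / 2" by (simp add: \<kappa>_def)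
          then show ?thesis using \<open>bcoef y k \<le> 2 * bcoef (T x0) (Suc k) + 2 * bcoef (T x1) (Suc k)\<close> bT1[of "Suc k"] by linarith
        qed
        then show ?thesis using Fk[OF k] by simp
      qed
      have "(\<Sum>k\<in>F. bcoef y k) \<le> (\<Sum>k\<in>F. 4 * bcoef (T x0) (Suc k))" by (rule sum_mono) (rule ble)
      also have "\<dots> = 4 * (\<Sum>k\<in>Suc ` F. bcoef (T x0) k)" by (simp add: sum_distrib_left sum.reindex)
      also have "\<dots> \<le> 4 * (\<Sum>i. bcoef (T x0) i)" using F t0(2) t0b by (intro mult_left_mono sum_le_suminf) auto
      also have "\<dots> \<le> 4 * (C0 * (2 * Q * Q * W))" using \<open>(\<Sum>i. bcoef (T x0) i) \<le> C0 * (2 * Q * Q * W)\<close>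
        by (rule mult_left_mono) simp
      finally show ?thesis by (simp add: C_def W_def mult_ac)
    qed
    have s': "summable (\<lambda>i. bcoef y i powr p)" "(\<Sum>i. bcoef y i powr p) \<le> C2 * (\<Sum>i. bcoef x i powr p)"
      unfolding C2_def
      by (rule marcinkiewicz_sequences[OF b0 bcoef_nonneg[OF yb] p(1) sp kp Cp H]; assumption)+
    have yX: "y \<in> elts X" using elts_iff[OF yb] s'(1) by simp
    have "nrm X y \<le> K * (\<Sum>i. bcoef y i powr p) powr \<theta>" by (rule nrm_le[OF yX])
    also have "\<dots> \<le> K * (C2 * (\<Sum>i. bcoef x i powr p)) powr \<theta>"
      using s' K theta by (intro mult_left_mono powr_mono2 suminf_nonneg) auto
    also have "\<dots> = K * (C2 powr \<theta> * (\<Sum>i. bcoef x i powr p) powr \<theta>)" by (simp add: powr_mult)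
    also have "\<dots> \<le> K * (C2 powr \<theta> * (K * nrm X x))"
      using nrm_ge[OF x] K by (intro mult_left_mono) auto
    finally show ?thesis using yX by (simp add: y_def mult_ac)
  qed
  then show ?thesis unfolding maps_boundedly_def by blast
qed

lemma interpolation_X: "interpolation_space X LL MM"
  unfolding interpolation_space_def
proof (intro conjI allI impI)
  show "banach_fun_space X" by (rule bfs)
  show "embedded (meet_space LL MM) X" unfolding embedded_def
  proof (intro conjI exI ballI)
    show "elts (meet_space LL MM) \<subseteq> elts X" using LL_X(1) by (auto simp: meet_space_def)
    fix x assume "x \<in> elts (meet_space LL MM)"
    then have "nrm X x \<le> K * nrm LL x" using LL_X(2) by (simp add: meet_space_def)
    also have "\<dots> \<le> K * nrm (meet_space LL MM) x" using K by (intro mult_left_mono) (auto simp: meet_space_def)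
    finally show "nrm X x \<le> K * nrm (meet_space LL MM) x" .
  qed
  show "embedded X (sum_space LL MM)" unfolding embedded_def using X_sum by blast
  fix T assume "linear_operator_on (sum_space LL MM) T \<and> maps_boundedly T LL \<and> maps_boundedly T MM"
  then show "maps_boundedly T X" using interpolation_bound by blast
qed

lemma ultrasymmetric_orlicz_X: "ultrasymmetric_orlicz X"
  unfolding ultrasymmetric_orlicz_def ultrasymmetric_def
  using Y_symmetric Y_equivalent fund_Y_concave interpolation_X orlicz_function_orlicz_fun orlicz_equivalent by blast

end

subsection \<open>Interpolation of weighted couples\<close>

text \<open>Orthogonality of the sign functions: toggling whether j belongs to S is an involution
  that reverses the sign of the product.\<close>

lemma sum_signs:
  fixes j k :: 'a
  assumes F: "finite F" and jk: "j \<in> F" "k \<in> F"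
  defines "e \<equiv> \<lambda>(S :: 'a set) i. if i \<in> S then 1 else - 1 :: real"
  shows "(\<Sum>S\<in>Pow F. e S j * e S k) = (if j = k then 2 ^ card F else 0)"
proof (cases "j = k")
  case True
  have "(\<Sum>S\<in>Pow F. e S j * e S k) = (\<Sum>S\<in>Pow F. 1)" by (rule sum.cong) (auto simp: True e_def)
  then show ?thesis using F True by (simp add: card_Pow)
next
  case False
  define h where "h S = (if j \<in> S then S - {j} else insert j S)" for S
  have hinv: "h (h S) = S" for S by (auto simp: h_def)
  have hF: "h S \<in> Pow F" if "S \<in> Pow F" for S using that jk by (auto simp: h_def)
  have e: "e (h S) j * e (h S) k = - (e S j * e S k)" for S using False by (auto simp: e_def h_def)
  have "(\<Sum>S\<in>Pow F. e S j * e S k) = (\<Sum>S\<in>Pow F. e (h S) j * e (h S) k)"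
    by (rule sum.reindex_bij_witness[of _ h h]) (auto simp: hinv hF[simplified])
  also have "\<dots> = - (\<Sum>S\<in>Pow F. e S j * e S k)" unfolding e by (rule sum_negf)
  finally show ?thesis using False by simp
qed

section \<open>Averaging over signs and weighted lattices\<close>

context fun_lattice
begin

lemma linear_sum:
  assumes add: "\<And>x y. x \<in> elts X \<Longrightarrow> y \<in> elts X \<Longrightarrow> AE t in I01. T (\<lambda>s. x s + y s) t = T x t + T y t"
    and scale: "\<And>c x. x \<in> elts X \<Longrightarrow> AE t in I01. T (\<lambda>s. c * x s) t = c * T x t"
    and F: "finite F" and f: "\<And>k. k \<in> F \<Longrightarrow> f k \<in> elts X"
  shows "AE t in I01. T (\<lambda>s. \<Sum>k\<in>F. c k * f k s) t = (\<Sum>k\<in>F. c k * T (f k) t)"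
  using F f
proof (induction F rule: finite_induct)
  case empty
  show ?case using scale[OF zero_elts, of 0] by simp
next
  case (insert k F)
  have fk: "f k \<in> elts X" and S: "(\<lambda>s. \<Sum>k\<in>F. c k * f k s) \<in> elts X"
    using insert.prems by (auto intro!: sum_elts(1) scale_elts)
  have "AE t in I01. T (\<lambda>s. c k * f k s + (\<Sum>k\<in>F. c k * f k s)) t = T (\<lambda>s. c k * f k s) t + T (\<lambda>s. \<Sum>k\<in>F. c k * f k s) t"
    by (rule add[OF scale_elts[OF fk] S])
  moreover have "AE t in I01. T (\<lambda>s. c k * f k s) t = c k * T (f k) t" by (rule scale[OF fk])
  moreover have "AE t in I01. T (\<lambda>s. \<Sum>k\<in>F. c k * f k s) t = (\<Sum>k\<in>F. c k * T (f k) t)"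
    using insert by auto
  ultimately show ?case
  proof eventually_elim
    fix t
    assume "T (\<lambda>s. c k * f k s + (\<Sum>k\<in>F. c k * f k s)) t = T (\<lambda>s. c k * f k s) t + T (\<lambda>s. \<Sum>k\<in>F. c k * f k s) t"
      "T (\<lambda>s. c k * f k s) t = c k * T (f k) t" "T (\<lambda>s. \<Sum>k\<in>F. c k * f k s) t = (\<Sum>k\<in>F. c k * T (f k) t)"
    then show "T (\<lambda>s. \<Sum>k\<in>insert k F. c k * f k s) t = (\<Sum>k\<in>insert k F. c k * T (f k) t)"
      using insert.hyps by simp
  qed
qed

text \<open>Multiply z by signs on the sets B k, apply T, and multiply by the same signs on the sets
  A j. Summed over all sign patterns, the off-diagonal terms cancel by \<open>sum_signs\<close>, and
  each summand has norm at most \<open>C * nrm X z\<close> because the multipliers are bounded by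
  1.\<close>

lemma diagonal_bound:
  assumes add: "\<And>x y. x \<in> elts X \<Longrightarrow> y \<in> elts X \<Longrightarrow> AE t in I01. T (\<lambda>s. x s + y s) t = T x t + T y t"
    and scale: "\<And>c x. x \<in> elts X \<Longrightarrow> AE t in I01. T (\<lambda>s. c * x s) t = c * T x t"
    and T: "\<And>x. x \<in> elts X \<Longrightarrow> T x \<in> elts X" "\<And>x. x \<in> elts X \<Longrightarrow> nrm X (T x) \<le> C * nrm X x" and C: "0 \<le> C"
    and F: "finite F" and A: "\<And>j. j \<in> F \<Longrightarrow> A j \<in> sets I01" "disjoint_family_on A F"
    and B: "\<And>j. j \<in> F \<Longrightarrow> B j \<in> sets I01" "disjoint_family_on B F" and z: "z \<in> elts X"
  shows "(\<lambda>t. \<Sum>j\<in>F. indicator (A j) t * T (\<lambda>s. indicator (B j) s * z s) t) \<in> elts X"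
    "nrm X (\<lambda>t. \<Sum>j\<in>F. indicator (A j) t * T (\<lambda>s. indicator (B j) s * z s) t) \<le> C * nrm X z"
proof -
  define e where "e S i = (if i \<in> S then 1 else - 1 :: real)" for S and i :: 'a
  define f where "f k = (\<lambda>s. indicator (B k) s * z s)" for k
  have f: "f k \<in> elts X" if "k \<in> F" for k unfolding f_def by (rule indicator_elts(1)[OF z B(1)[OF that]])
  define zS where "zS S = (\<lambda>s. \<Sum>k\<in>F. e S k * f k s)" for S
  have zS: "zS S \<in> elts X" for S unfolding zS_def using f by (intro sum_elts(1) scale_elts)
  have small: "\<bar>\<Sum>j\<in>F. e S j * indicator (D j) t\<bar> \<le> 1" if "disjoint_family_on D F" for S D and t :: real
  proof -
    have eq: "(\<Sum>j\<in>F. e S j * indicator (D j) t) = step F (e S) D t" by (simp add: step_def)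
    show ?thesis
    proof (cases "\<exists>j\<in>F. t \<in> D j")
      case True
      then obtain j where j: "j \<in> F" "t \<in> D j" by blast
      then show ?thesis unfolding eq using step_in[OF F that j] by (simp add: e_def)
    next
      case False
      then have "step F (e S) D t = 0" by (intro step_out) auto
      then show ?thesis unfolding eq by simp
    qed
  qed
  have nz: "nrm X (zS S) \<le> nrm X z" for S
  proof (rule ideal_nrm[OF z elts_BM[OF zS]], rule AE_I2)
    fix t
    have "zS S t = (\<Sum>j\<in>F. e S j * indicator (B j) t) * z t"
      unfolding zS_def f_def by (simp only: sum_distrib_right mult.assoc)
    then show "\<bar>zS S t\<bar> \<le> \<bar>z t\<bar>" using small[OF B(2), of S t] by (simp only: abs_mult) (rule mult_left_le_one_le, auto)
  qed
  define GS where "GS S t = (\<Sum>j\<in>F. e S j * indicator (A j) t) * T (zS S) t" for S t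
  have gb: "(\<lambda>t. \<Sum>j\<in>F. e S j * indicator (A j) t) \<in> BM" for S using A(1) by (intro borel_measurable_sum) auto
  have GS: "GS S \<in> elts X" "nrm X (GS S) \<le> C * nrm X z" for S
  proof -
    have "(\<lambda>t. (\<Sum>j\<in>F. e S j * indicator (A j) t) * T (zS S) t) \<in> elts X"
      "nrm X (\<lambda>t. (\<Sum>j\<in>F. e S j * indicator (A j) t) * T (zS S) t) \<le> 1 * nrm X (T (zS S))"
      using mult_elts[OF T(1)[OF zS] gb small[OF A(2)]] by auto
    then show "GS S \<in> elts X" "nrm X (GS S) \<le> C * nrm X z"
      using T(2)[OF zS, of S] mult_left_mono[OF nz C, of S] unfolding GS_def[abs_def] by auto
  qed
  define D where "D t = (\<Sum>j\<in>F. indicator (A j) t * T (f j) t)" for t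
  have D: "D \<in> elts X" unfolding D_def[abs_def]
    using A f T(1) by (intro sum_elts(1) indicator_elts(1)) auto
  have "AE t in I01. T (zS S) t = (\<Sum>k\<in>F. e S k * T (f k) t)" for S
    unfolding zS_def by (rule linear_sum[OF add scale F f])
  then have "AE t in I01. \<forall>S\<in>Pow F. T (zS S) t = (\<Sum>k\<in>F. e S k * T (f k) t)"
    using F by (intro AE_finite_allI) auto
  then have ae: "AE t in I01. (\<Sum>S\<in>Pow F. GS S t) = 2 ^ card F * D t"
  proof eventually_elim
    fix t assume a: "\<forall>S\<in>Pow F. T (zS S) t = (\<Sum>k\<in>F. e S k * T (f k) t)"
    have "(\<Sum>S\<in>Pow F. GS S t) = (\<Sum>S\<in>Pow F. \<Sum>j\<in>F. \<Sum>k\<in>F. (e S j * e S k) * (indicator (A j) t * T (f k) t))"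
      unfolding GS_def using a by (intro sum.cong refl) (simp add: sum_product mult_ac)
    also have "\<dots> = (\<Sum>j\<in>F. \<Sum>S\<in>Pow F. \<Sum>k\<in>F. (e S j * e S k) * (indicator (A j) t * T (f k) t))"
      by (rule sum.swap)
    also have "\<dots> = (\<Sum>j\<in>F. \<Sum>k\<in>F. (\<Sum>S\<in>Pow F. e S j * e S k) * (indicator (A j) t * T (f k) t))"
      by (intro sum.cong refl) (subst sum.swap, simp add: sum_distrib_right)
    also have "\<dots> = (\<Sum>j\<in>F. \<Sum>k\<in>F. (if j = k then 2 ^ card F * (indicator (A j) t * T (f k) t) else 0))"
      unfolding e_def by (intro sum.cong refl) (simp add: sum_signs[OF F])
    also have "\<dots> = (\<Sum>j\<in>F. 2 ^ card F * (indicator (A j) t * T (f j) t))"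
      using F by (intro sum.cong refl) (simp only: sum.delta' if_True)
    also have "\<dots> = 2 ^ card F * D t" unfolding D_def by (rule sum_distrib_left[symmetric])
    finally show "(\<Sum>S\<in>Pow F. GS S t) = 2 ^ card F * D t" .
  qed
  have "2 ^ card F * nrm X D = nrm X (\<lambda>t. 2 ^ card F * D t)" using nrm_scale[OF D, of "2 ^ card F"] by simp
  also have "\<dots> = nrm X (\<lambda>t. \<Sum>S\<in>Pow F. GS S t)"
    using ae by (intro ae_cong(2) sum_elts(1) GS(1) elts_BM[OF scale_elts[OF D]])
  also have "\<dots> \<le> (\<Sum>S\<in>Pow F. nrm X (GS S))" by (rule sum_elts(2)) (rule GS(1))
  also have "\<dots> \<le> (\<Sum>S\<in>Pow F. C * nrm X z)" by (rule sum_mono) (rule GS(2))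
  also have "\<dots> = 2 ^ card F * (C * nrm X z)" using F by (simp add: card_Pow)
  finally have "nrm X D \<le> C * nrm X z" by simp
  then show "nrm X (\<lambda>t. \<Sum>j\<in>F. indicator (A j) t * T (\<lambda>s. indicator (B j) s * z s) t) \<le> C * nrm X z"
    "(\<lambda>t. \<Sum>j\<in>F. indicator (A j) t * T (\<lambda>s. indicator (B j) s * z s) t) \<in> elts X"
    using D unfolding D_def[abs_def] f_def by auto
qed

text \<open>Multiplication by v is an isometry onto X; division by v recovers limits, since v is
  positive almost everywhere.\<close>

lemma weighted_lattice:
  assumes v: "weight v" shows "fun_lattice (weighted_space X v)"
proof
  let ?W = "weighted_space X v"
  have vb: "v \<in> BM" and vp: "AE t in I01. 0 < v t" using v by (auto simp: weight_def)
  have el: "x \<in> elts ?W \<longleftrightarrow> x \<in> BM \<and> (\<lambda>t. x t * v t) \<in> elts X" for x by (simp add: weighted_space_def)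
  have nr: "nrm ?W x = nrm X (\<lambda>t. x t * v t)" for x by (simp add: weighted_space_def)
  have sc: "(\<lambda>t. c * x t * v t) = (\<lambda>t. c * (x t * v t))" for c x by (simp add: fun_eq_iff)
  have ad: "(\<lambda>t. (x t + y t) * v t) = (\<lambda>t. x t * v t + y t * v t)" for x y by (simp add: fun_eq_iff algebra_simps)
  show "banach_fun_space ?W"
    unfolding banach_fun_space_def
  proof (intro conjI ballI allI impI)
    show "elts ?W \<subseteq> BM" by (auto simp: el)
  next
    fix x y assume x: "x \<in> elts ?W" and y: "y \<in> BM" and ae: "ae_eq x y"
    have "AE t in I01. x t * v t = y t * v t" using ae unfolding ae_eq_def by eventually_elim simp
    from ae_cong[OF _ _ this] show "y \<in> elts ?W" "nrm ?W y = nrm ?W x" using x y vb by (auto simp: el nr)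
  next
    fix x assume x: "x \<in> elts ?W"
    show "0 \<le> nrm ?W x" using x by (simp add: el nr nrm_nonneg)
    have "(AE t in I01. x t * v t = 0) \<longleftrightarrow> (AE t in I01. x t = 0)"
    proof
      assume "AE t in I01. x t * v t = 0"
      then show "AE t in I01. x t = 0" using vp by eventually_elim auto
    next
      assume "AE t in I01. x t = 0"
      then show "AE t in I01. x t * v t = 0" by eventually_elim auto
    qed
    then show "(nrm ?W x = 0) = ae_eq x (\<lambda>t. 0)" using x nrm_eq_0_iff by (simp add: el nr ae_eq_def)
    fix c
    show "nrm ?W (\<lambda>t. c * x t) = \<bar>c\<bar> * nrm ?W x" using x unfolding nr sc el by (simp add: nrm_scale)
    show "(\<lambda>t. c * x t) \<in> elts ?W" using x unfolding el sc by (auto simp: scale_elts)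
  next
    fix x y assume "x \<in> elts ?W" "y \<in> elts ?W"
    then show "nrm ?W (\<lambda>t. x t + y t) \<le> nrm ?W x + nrm ?W y" "(\<lambda>t. x t + y t) \<in> elts ?W"
      unfolding nr ad el by (auto simp: nrm_triangle add_elts)
  next
    show "(\<lambda>t. 0) \<in> elts ?W" by (simp add: el)
  next
    fix u :: "nat \<Rightarrow> real \<Rightarrow> real"
    assume u: "(\<forall>n. u n \<in> elts ?W) \<and> (\<forall>e>0. \<exists>N. \<forall>m\<ge>N. \<forall>n\<ge>N. nrm ?W (\<lambda>t. u m t - u n t) < e)"
    have df: "(\<lambda>t. (x t - y t) * v t) = (\<lambda>t. x t * v t - y t * v t)" for x y by (simp add: fun_eq_iff algebra_simps)
    have ub: "u n \<in> BM" and uX: "(\<lambda>t. u n t * v t) \<in> elts X" for n using u by (auto simp: el)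
    have cau: "\<exists>N. \<forall>m\<ge>N. \<forall>n\<ge>N. nrm X (\<lambda>t. u m t * v t - u n t * v t) < e" if e: "0 < e" for e
      using conjunct2[OF u, rule_format, OF e] unfolding nr df .
    obtain l where l: "l \<in> elts X" "(\<lambda>n. nrm X (\<lambda>t. u n t * v t - l t)) \<longlonglongrightarrow> 0"
      using complete[OF uX cau] by blast
    define l' where "l' t = l t / v t" for t
    have l'b: "l' \<in> BM" unfolding l'_def[abs_def] using elts_BM[OF l(1)] vb by simp
    have ae: "AE t in I01. l t = l' t * v t" using vp by eventually_elim (simp add: l'_def)
    have l'X: "(\<lambda>t. l' t * v t) \<in> elts X" by (rule ae_cong(1)[OF l(1) _ ae]) (use l'b vb in simp)
    have eq: "nrm ?W (\<lambda>t. u n t - l' t) = nrm X (\<lambda>t. u n t * v t - l t)" for n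
    proof -
      have "AE t in I01. u n t * v t - l t = u n t * v t - l' t * v t" using ae by eventually_elim simp
      then show ?thesis unfolding nr df by (intro ae_cong(2) diff_elts uX l(1) elts_BM[OF diff_elts[OF uX l'X]])
    qed
    show "\<exists>l\<in>elts ?W. (\<lambda>n. nrm ?W (\<lambda>t. u n t - l t)) \<longlonglongrightarrow> 0"
      using l(2) l'b l'X unfolding eq[symmetric] by (intro bexI[of _ l']) (auto simp: el)
  qed
  fix x y assume y: "y \<in> elts ?W" and x: "x \<in> BM" and le: "AE t in I01. \<bar>x t\<bar> \<le> \<bar>y t\<bar>"
  have "AE t in I01. \<bar>x t * v t\<bar> \<le> \<bar>y t * v t\<bar>" using le by eventually_elim (simp add: abs_mult mult_right_mono)
  then show "x \<in> elts ?W \<and> nrm ?W x \<le> nrm ?W y" using y x vb ideal[of "\<lambda>t. y t * v t" "\<lambda>t. x t * v t"] by (simp add: el nr)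
qed

end

lemma powr_int: "(2::real) powi j = 2 powr real_of_int j"
  by (cases "0 \<le> j") (simp_all add: power_int_def powr_real_of_int inverse_eq_divide power_one_over)

section \<open>Levels of the weight\<close>

locale weighted_lattice = fun_lattice X for X +
  fixes w :: "real \<Rightarrow> real" assumes wt: "weight w"
begin

abbreviation XW :: fun_space where "XW \<equiv> weighted_space X w"

lemma w_BM: "w \<in> BM" and w_pos: "AE t in I01. 0 < w t"
  using wt by (auto simp: weight_def)

text \<open>Where w t is not positive, a null set, this is a junk value; hence the condition
  \<open>0 < w t\<close> in \<open>level_set_iff\<close>.\<close>

definition level :: "real \<Rightarrow> int" where "level t = \<lfloor>log 2 (w t)\<rfloor>"

definition level_set :: "int \<Rightarrow> real set" where "level_set j = {t \<in> {0..1}. w t \<in> {2 powi j..<2 powi (j + 1)}}"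

lemma level_set_iff: "t \<in> level_set j \<longleftrightarrow> t \<in> {0..1} \<and> 0 < w t \<and> level t = j"
proof -
  have "w t \<in> {2 powi j..<2 powi (j + 1)} \<longleftrightarrow> 0 < w t \<and> level t = j"
  proof (cases "0 < w t")
    case True
    then show ?thesis unfolding level_def floor_eq_iff powr_int
      by (simp add: le_log_iff log_less_iff)
  next
    case False
    then have "w t < 2 powi j" unfolding powr_int using powr_gt_zero[of 2 "real_of_int j"] by linarith
    then show ?thesis using False by simp
  qed
  then show ?thesis by (simp add: level_set_def)
qed

lemma level_set_bounds: "t \<in> level_set j \<Longrightarrow> 2 powr j \<le> w t" "t \<in> level_set j \<Longrightarrow> w t \<le> 2 * 2 powr j"
  unfolding level_set_def powr_int by (auto simp: powr_add)

lemma level_set_sets: "level_set j \<in> sets I01"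
proof -
  have "{t \<in> space I01. w t \<in> {2 powi j..<2 powi (j + 1)}} \<in> sets I01"
    using w_BM by (rule measurable_sets_Collect[where P = "\<lambda>s. s \<in> {2 powi j..<2 powi (j + 1)}"]) simp
  then show ?thesis by (simp add: level_set_def)
qed

lemma level_set_disjoint: "disjoint_family_on level_set F"
  unfolding disjoint_family_on_def by (auto simp: level_set_iff)

lemma level_measurable: "level \<in> measurable I01 (count_space UNIV)"
  unfolding level_def[abs_def] using w_BM by (intro measurable_compose[OF _ measurable_real_floor]) simp

lemma level_sets: "{t \<in> {0..1}. P (level t)} \<in> sets I01"
  using measurable_sets[OF level_measurable, of "Collect P"] by (simp add: vimage_def Int_def conj_commute)

lemma el: "x \<in> elts (weighted_space X v) \<longleftrightarrow> x \<in> BM \<and> (\<lambda>t. x t * v t) \<in> elts X"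
  and nr: "nrm (weighted_space X v) x = nrm X (\<lambda>t. x t * v t)"
  by (simp_all add: weighted_space_def)

lemma level_sum:
  assumes "finite F"
  shows "t \<in> level_set j \<Longrightarrow> (\<Sum>i\<in>F. indicator (level_set i) t * g i) = (if j \<in> F then g j else (0::real))"
    and "(\<And>j. t \<notin> level_set j) \<Longrightarrow> (\<Sum>i\<in>F. indicator (level_set i) t * g i) = 0"
proof -
  assume t: "t \<in> level_set j"
  then have "(\<Sum>i\<in>F. indicator (level_set i) t * g i) = (\<Sum>i\<in>F. if i = j then g j else 0)"
    by (intro sum.cong refl) (auto simp: indicator_def level_set_iff)
  then show "(\<Sum>i\<in>F. indicator (level_set i) t * g i) = (if j \<in> F then g j else 0)" using assms by simp
qed (auto intro: sum.neutral)

end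

lemma s4_pow: "s4 ^ n = 2 powr (- real n / 4)"
  by (simp add: s4_def powr_realpow[symmetric] powr_powr mult.commute)

text \<open>A double sum over a matrix is arranged along its diagonals.\<close>

lemma sum_by_difference:
  fixes h :: "int \<Rightarrow> int \<Rightarrow> real"
  assumes F: "finite F" and K: "finite K"
  shows "(\<Sum>j\<in>F. \<Sum>k\<in>K. h j k) = (\<Sum>n\<in>(\<lambda>(j, k). j - k) ` (F \<times> K). \<Sum>j\<in>{j\<in>F. j - n \<in> K}. h j (j - n))"
proof -
  let ?d = "\<lambda>(j, k). j - k :: int"
  have "(\<Sum>j\<in>F. \<Sum>k\<in>K. h j k) = (\<Sum>p\<in>F \<times> K. h (fst p) (snd p))"
    by (simp add: sum.cartesian_product case_prod_beta)
  also have "\<dots> = (\<Sum>n\<in>?d ` (F \<times> K). \<Sum>p\<in>{p\<in>F \<times> K. ?d p = n}. h (fst p) (snd p))"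
    using F K by (intro sum.group[symmetric]) auto
  also have "\<dots> = (\<Sum>n\<in>?d ` (F \<times> K). \<Sum>j\<in>{j\<in>F. j - n \<in> K}. h j (j - n))"
    by (intro sum.cong refl, rule sum.reindex_bij_witness[of _ "\<lambda>j. (j, j - n)" fst for n]) auto
  finally show ?thesis .
qed

text \<open>Since \<open>1 / 4 < 1 / 2\<close>, the weight \<open>V\<close> grows strictly faster than \<open>1\<close> and strictly slower than \<open>2 ^ j\<close>. This
  makes the off-diagonal blocks of an operator decay geometrically, while each diagonal is
  controlled by averaging over signs (\<open>diagonal_bound\<close>).\<close>

locale weighted_interpolation = weighted_lattice X w for X w +
  fixes V :: "int \<Rightarrow> real"
  assumes Vpos: "\<And>j. 0 < V j"
    and Vratio: "\<And>j k. V j \<le> V k * 2 powr ((real_of_int j - real_of_int k) / 2 + \<bar>real_of_int j - real_of_int k\<bar> / 4)"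
begin

definition v :: "real \<Rightarrow> real" where "v t = V (level t)"

abbreviation XV :: fun_space where "XV \<equiv> weighted_space X v"

lemma v_weight: "weight v"
  unfolding weight_def v_def[abs_def] using Vpos
  by (auto intro!: measurable_compose[OF level_measurable])

lemma v_BM: "v \<in> BM" using v_weight by (simp add: weight_def)

lemma v_pos: "0 < v t" by (simp add: v_def Vpos)

lemma V_inverse: "1 / V j \<le> (1 / V 0) * 2 powr (- real_of_int j / 2 + \<bar>real_of_int j\<bar> / 4)"
  using Vratio[of 0 j] Vpos[of 0] Vpos[of j] by (simp add: field_simps)

definition level_part :: "int \<Rightarrow> (real \<Rightarrow> real) \<Rightarrow> real \<Rightarrow> real" where "level_part k x = (\<lambda>s. indicator (level_set k) s * x s)"

definition upper_part :: "nat \<Rightarrow> (real \<Rightarrow> real) \<Rightarrow> real \<Rightarrow> real" where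
  "upper_part N x = (\<lambda>t. indicator {t \<in> {0..1}. int N \<le> level t} t * x t)"

definition lower_part :: "nat \<Rightarrow> (real \<Rightarrow> real) \<Rightarrow> real \<Rightarrow> real" where
  "lower_part N x = (\<lambda>t. indicator {t \<in> {0..1}. level t < - int N} t * x t)"

lemma level_part_X:
  assumes x: "x \<in> elts XV" shows "level_part k x \<in> elts X"
proof -
  have xb: "x \<in> BM" and xv: "(\<lambda>t. x t * v t) \<in> elts X" using x by (auto simp: el)
  have "AE t in I01. \<bar>level_part k x t\<bar> \<le> \<bar>(1 / V k) * (x t * v t)\<bar>"
  proof (rule AE_I2)
    fix t
    show "\<bar>level_part k x t\<bar> \<le> \<bar>(1 / V k) * (x t * v t)\<bar>"
    proof (cases "t \<in> level_set k")
      case True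
      then have "v t = V k" by (simp add: v_def level_set_iff)
      then show ?thesis using True Vpos[of k] by (simp add: level_part_def)
    qed (simp add: level_part_def)
  qed
  then show ?thesis using xb level_set_sets by (intro ideal_elts[OF scale_elts[OF xv, of "1 / V k"]]) (simp_all add: level_part_def)
qed

text \<open>On levels from N upwards v is at least \<open>V 0 * 2 powr (N / 4)\<close>, so this part
  is small in X.\<close>

lemma upper_part_X:
  assumes x: "x \<in> elts XV" 
  shows "upper_part N x \<in> elts X" "nrm X (upper_part N x) \<le> (1 / V 0) * s4 ^ N * nrm XV x"
proof -
  have xb: "x \<in> BM" and xv: "(\<lambda>t. x t * v t) \<in> elts X" using x by (auto simp: el)
  let ?c = "(1 / V 0) * s4 ^ N"
  have c0: "0 \<le> ?c" using Vpos[of 0] s4 by simp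
  have "AE t in I01. \<bar>upper_part N x t\<bar> \<le> \<bar>?c * (x t * v t)\<bar>"
  proof (rule AE_I2)
    fix t
    show "\<bar>upper_part N x t\<bar> \<le> \<bar>?c * (x t * v t)\<bar>"
    proof (cases "t \<in> {0..1} \<and> int N \<le> level t")
      case True
      have "1 / v t \<le> (1 / V 0) * 2 powr (- real_of_int (level t) / 2 + \<bar>real_of_int (level t)\<bar> / 4)"
        unfolding v_def by (rule V_inverse)
      also have "\<dots> \<le> (1 / V 0) * 2 powr (- real N / 4)"
        using True Vpos[of 0] by (intro mult_left_mono powr_mono) auto
      finally have "1 / v t \<le> ?c" by (simp add: s4_pow)
      then have "1 \<le> ?c * v t" using v_pos[of t] by (simp add: pos_divide_le_eq)
      then have "1 * \<bar>x t\<bar> \<le> (?c * v t) * \<bar>x t\<bar>" by (intro mult_right_mono) auto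
      then have "\<bar>x t\<bar> \<le> \<bar>?c\<bar> * \<bar>v t\<bar> * \<bar>x t\<bar>" by (simp only: abs_of_nonneg[OF c0] abs_of_pos[OF v_pos] mult_1)
      moreover have "upper_part N x t = x t" using True by (simp add: upper_part_def)
      moreover have "\<bar>?c * (x t * v t)\<bar> = \<bar>?c\<bar> * \<bar>v t\<bar> * \<bar>x t\<bar>" by (simp only: abs_mult mult_ac)
      ultimately show ?thesis by metis
    qed (auto simp: upper_part_def)
  qed
  then have "upper_part N x \<in> elts X \<and> nrm X (upper_part N x) \<le> nrm X (\<lambda>t. ?c * (x t * v t))"
    using xb level_sets[of "\<lambda>j. int N \<le> j"] by (intro ideal[OF scale_elts[OF xv]]) (auto simp: upper_part_def)
  then show "upper_part N x \<in> elts X" "nrm X (upper_part N x) \<le> (1 / V 0) * s4 ^ N * nrm XV x"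
    unfolding nrm_scale[OF xv] abs_of_nonneg[OF c0] nr by auto
qed

lemma AE_level: "AE t in I01. t \<in> level_set (level t)"
  using w_pos AE_space by eventually_elim (simp add: level_set_iff)

text \<open>On levels under -N the quotient w / v is at most
  \<open>2 / V 0 * 2 powr (- N / 4)\<close>, so this part is small in X(w).\<close>

lemma lower_part_XW:
  assumes x: "x \<in> elts XV" 
  shows "lower_part N x \<in> elts XW" "nrm XW (lower_part N x) \<le> 2 * (1 / V 0) * s4 ^ N * nrm XV x"
proof -
  have xb: "x \<in> BM" and xv: "(\<lambda>t. x t * v t) \<in> elts X" using x by (auto simp: el)
  have tb: "lower_part N x \<in> BM" using xb level_sets[of "\<lambda>j. j < - int N"] by (simp add: lower_part_def)
  let ?c = "2 * (1 / V 0) * s4 ^ N"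
  have c0: "0 \<le> ?c" using Vpos[of 0] s4 by simp
  have "AE t in I01. \<bar>lower_part N x t * w t\<bar> \<le> \<bar>?c * (x t * v t)\<bar>"
    using AE_level
  proof eventually_elim
    fix t assume t: "t \<in> level_set (level t)"
    then have wp: "0 < w t" by (simp add: level_set_iff)
    show "\<bar>lower_part N x t * w t\<bar> \<le> \<bar>?c * (x t * v t)\<bar>"
    proof (cases "t \<in> {0..1} \<and> level t < - int N")
      case True
      define j where "j = level t"
      have "w t * (1 / v t) \<le> (2 * 2 powr j) * ((1 / V 0) * 2 powr (- real_of_int j / 2 + \<bar>real_of_int j\<bar> / 4))"
        unfolding v_def j_def using level_set_bounds(2)[OF t] V_inverse Vpos by (intro mult_mono) (auto simp: less_imp_le)
      also have "\<dots> = 2 * (1 / V 0) * 2 powr (j - real_of_int j / 2 + \<bar>real_of_int j\<bar> / 4)"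
        by (simp add: powr_add[symmetric] algebra_simps)
      also have "\<dots> \<le> 2 * (1 / V 0) * 2 powr (- real N / 4)"
        using True Vpos[of 0] unfolding j_def by (intro mult_left_mono powr_mono) auto
      finally have "w t / v t \<le> ?c" by (simp add: s4_pow)
      then have "w t \<le> ?c * v t" using v_pos[of t] by (simp add: pos_divide_le_eq)
      then have "w t * \<bar>x t\<bar> \<le> (?c * v t) * \<bar>x t\<bar>" by (intro mult_right_mono) auto
      then have "\<bar>w t\<bar> * \<bar>x t\<bar> \<le> \<bar>?c\<bar> * \<bar>v t\<bar> * \<bar>x t\<bar>" by (simp only: abs_of_nonneg[OF c0] abs_of_pos[OF v_pos] abs_of_pos[OF wp])
      moreover have "\<bar>lower_part N x t * w t\<bar> = \<bar>w t\<bar> * \<bar>x t\<bar>" using True by (simp add: lower_part_def abs_mult)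
      moreover have "\<bar>?c * (x t * v t)\<bar> = \<bar>?c\<bar> * \<bar>v t\<bar> * \<bar>x t\<bar>" by (simp only: abs_mult mult_ac)
      ultimately show ?thesis by metis
    qed (auto simp: lower_part_def)
  qed
  then have "(\<lambda>t. lower_part N x t * w t) \<in> elts X \<and> nrm X (\<lambda>t. lower_part N x t * w t) \<le> nrm X (\<lambda>t. ?c * (x t * v t))"
    using tb w_BM by (intro ideal[OF scale_elts[OF xv]]) auto
  then show "lower_part N x \<in> elts XW" "nrm XW (lower_part N x) \<le> 2 * (1 / V 0) * s4 ^ N * nrm XV x"
    using tb unfolding nrm_scale[OF xv] abs_of_nonneg[OF c0] nr el by auto
qed

lemma decompose: "AE t in I01. x t = (\<Sum>k\<in>{- int N..<int N}. level_part k x t) + (upper_part N x t + lower_part N x t)"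
  using AE_level
proof eventually_elim
  fix t assume t: "t \<in> level_set (level t)"
  have "(\<Sum>k\<in>{- int N..<int N}. level_part k x t) = (if level t \<in> {- int N..<int N} then x t else 0)"
    unfolding level_part_def by (rule level_sum(1)[OF _ t]) simp
  moreover have "t \<in> {0..1}" using t by (simp add: level_set_iff)
  ultimately show "x t = (\<Sum>k\<in>{- int N..<int N}. level_part k x t) + (upper_part N x t + lower_part N x t)"
    by (cases "level t < - int N"; cases "int N \<le> level t") (auto simp: upper_part_def lower_part_def)
qed

sublocale W: fun_lattice XW
  by (rule weighted_lattice[OF wt])

sublocale VL: fun_lattice XV
  by (rule weighted_lattice[OF v_weight])

lemma X_SS: "x \<in> elts X \<Longrightarrow> x \<in> elts (sum_space X XW)"
  by (rule sum_space_I[OF elts_BM _ W.zero_elts]) (auto simp: ae_eq_def)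

lemma XW_SS: "x \<in> elts XW \<Longrightarrow> x \<in> elts (sum_space X XW)"
  by (rule sum_space_I[OF W.elts_BM zero_elts]) (auto simp: ae_eq_def)

lemma XV_ae: "AE t in I01. x t = upper_part 0 x t + lower_part 0 x t"
  using decompose[of x 0] by simp

lemma XV_SS: "x \<in> elts XV \<Longrightarrow> x \<in> elts (sum_space X XW)"
  using XV_ae[of x] by (intro sum_space_I[OF VL.elts_BM upper_part_X(1) lower_part_XW(1)]) (auto simp: ae_eq_def)

lemma SS_add:
  assumes "x \<in> elts (sum_space X XW)" "y \<in> elts (sum_space X XW)"
  shows "(\<lambda>t. x t + y t) \<in> elts (sum_space X XW)"
proof -
  obtain x0 x1 where x: "x \<in> BM" "x0 \<in> elts X" "x1 \<in> elts XW" "AE t in I01. x t = x0 t + x1 t"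
    using assms(1) by (auto simp: sum_space_def ae_eq_def)
  obtain y0 y1 where y: "y \<in> BM" "y0 \<in> elts X" "y1 \<in> elts XW" "AE t in I01. y t = y0 t + y1 t"
    using assms(2) by (auto simp: sum_space_def ae_eq_def)
  have ae: "AE t in I01. x t + y t = (x0 t + y0 t) + (x1 t + y1 t)" using x(4) y(4) by eventually_elim simp
  show ?thesis
    by (rule sum_space_I[OF _ add_elts[OF x(2) y(2)] W.add_elts[OF x(3) y(3)]]) (use x(1) y(1) ae in \<open>auto simp: ae_eq_def\<close>)
qed

section \<open>Operators bounded on both spaces of the couple\<close>

context
  fixes T :: "(real \<Rightarrow> real) \<Rightarrow> real \<Rightarrow> real" and C :: real
  assumes lin: "linear_operator_on (sum_space X XW) T"
    and TX: "\<And>x. x \<in> elts X \<Longrightarrow> T x \<in> elts X" "\<And>x. x \<in> elts X \<Longrightarrow> nrm X (T x) \<le> C * nrm X x"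
    and TW: "\<And>x. x \<in> elts XW \<Longrightarrow> T x \<in> elts XW" "\<And>x. x \<in> elts XW \<Longrightarrow> nrm XW (T x) \<le> C * nrm XW x"
    and C: "0 \<le> C"
begin

lemma T_add: "x \<in> elts (sum_space X XW) \<Longrightarrow> y \<in> elts (sum_space X XW) \<Longrightarrow> AE t in I01. T (\<lambda>s. x s + y s) t = T x t + T y t"
  using lin unfolding linear_operator_on_def ae_eq_def by blast

lemma T_scale: "x \<in> elts (sum_space X XW) \<Longrightarrow> AE t in I01. T (\<lambda>s. c * x s) t = c * T x t"
  using lin unfolding linear_operator_on_def ae_eq_def by blast

lemma T_cong: "x \<in> elts (sum_space X XW) \<Longrightarrow> y \<in> elts (sum_space X XW) \<Longrightarrow> AE t in I01. x t = y t \<Longrightarrow> AE t in I01. T x t = T y t"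
  using lin unfolding linear_operator_on_def ae_eq_def by blast

lemma T_BM: "x \<in> elts (sum_space X XW) \<Longrightarrow> T x \<in> BM"
  using lin unfolding linear_operator_on_def by (auto simp: sum_space_def)

text \<open>E collects the blocks of T from level j - n to level j. For n at most 0 the bound on X
  is used: V itself is smaller at j by 2^(-|n|/4). For positive n, V grows by at most 2^(3n/4), and
  the bound on X(w) gains 2^-n. Either way a factor 2^(-|n|/4) is left.\<close>

lemma shifted_diagonal:
  fixes n :: int
  assumes x: "x \<in> elts XV" and F: "finite F"
  defines "E \<equiv> \<lambda>t. \<Sum>j\<in>F. indicator (level_set j) t * (V j * T (level_part (j - n) x) t)"
  shows "E \<in> elts X" "nrm X E \<le> 2 * C * s4 ^ nat \<bar>n\<bar> * nrm XV x"
proof -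
  have xb: "x \<in> BM" and xv: "(\<lambda>t. x t * v t) \<in> elts X" using x by (auto simp: el)
  have PX: "level_part k x \<in> elts X" for k by (rule level_part_X[OF x])
  have disjB: "disjoint_family_on (\<lambda>j. level_set (j - n)) F"
    unfolding disjoint_family_on_def by (auto simp: level_set_iff)
  have EX: "E \<in> elts X"
    unfolding E_def by (intro sum_elts(1) indicator_elts(1) scale_elts TX PX level_set_sets)
  have s4n: "s4 ^ nat \<bar>n\<bar> = 2 powr (- \<bar>real_of_int n\<bar> / 4)" by (simp add: s4_pow)
  have s4p: "0 < s4 ^ nat \<bar>n\<bar>" using s4 by simp
  have nX: "0 \<le> nrm XV x" by (rule VL.nrm_nonneg[OF x])
  have Eval: "E t = (if j \<in> F then V j * T (level_part (j - n) x) t else 0)" if "t \<in> level_set j" for t j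
    unfolding E_def by (rule level_sum(1)[OF F that])
  show "nrm X E \<le> 2 * C * s4 ^ nat \<bar>n\<bar> * nrm XV x"
  proof (cases "n \<le> 0")
    case True
    define z where "z t = x t * v t" for t
    have z: "z \<in> elts X" using xv by (simp add: z_def[abs_def])
    define D where "D = (\<lambda>t. \<Sum>j\<in>F. indicator (level_set j) t * T (\<lambda>s. indicator (level_set (j - n)) s * z s) t)"
    have D: "D \<in> elts X" "nrm X D \<le> C * nrm X z" unfolding D_def
      by (rule diagonal_bound[OF T_add[OF X_SS X_SS] T_scale[OF X_SS] TX C F level_set_sets level_set_disjoint level_set_sets disjB z]; assumption)+
    have Tz: "AE t in I01. \<forall>j\<in>F. T (\<lambda>s. indicator (level_set (j - n)) s * z s) t = V (j - n) * T (level_part (j - n) x) t"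
    proof (rule AE_finite_allI[OF F])
      fix j
      have "(\<lambda>s. indicator (level_set (j - n)) s * z s) = (\<lambda>s. V (j - n) * level_part (j - n) x s)"
      proof
        fix s
        show "indicator (level_set (j - n)) s * z s = V (j - n) * level_part (j - n) x s"
          by (cases "s \<in> level_set (j - n)") (auto simp: level_part_def z_def v_def level_set_iff)
      qed
      then show "AE t in I01. T (\<lambda>s. indicator (level_set (j - n)) s * z s) t = V (j - n) * T (level_part (j - n) x) t"
        using T_scale[OF X_SS[OF PX], of "V (j - n)" "j - n"] by simp
    qed
    have "AE t in I01. \<bar>E t\<bar> \<le> \<bar>s4 ^ nat \<bar>n\<bar> * D t\<bar>"
      using Tz AE_level
    proof eventually_elim
      fix t assume a: "\<forall>j\<in>F. T (\<lambda>s. indicator (level_set (j - n)) s * z s) t = V (j - n) * T (level_part (j - n) x) t" and t: "t \<in> level_set (level t)"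
      define j where "j = level t"
      define g where "g = T (level_part (j - n) x) t"
      show "\<bar>E t\<bar> \<le> \<bar>s4 ^ nat \<bar>n\<bar> * D t\<bar>"
      proof (cases "j \<in> F")
        case jF: True
        have Dt: "D t = V (j - n) * g" unfolding D_def j_def g_def
          using level_sum(1)[OF F t, of "\<lambda>j. T (\<lambda>s. indicator (level_set (j - n)) s * z s) t"] a jF by (simp add: j_def)
        have Et: "E t = V j * g" using Eval[OF t] jF by (simp add: j_def g_def)
        have "V j \<le> V (j - n) * 2 powr (real_of_int n / 2 + \<bar>real_of_int n\<bar> / 4)" using Vratio[of j "j - n"] by simp
        also have "real_of_int n / 2 + \<bar>real_of_int n\<bar> / 4 = - \<bar>real_of_int n\<bar> / 4" using True by simp
        finally have "V j \<le> s4 ^ nat \<bar>n\<bar> * V (j - n)" by (simp add: s4n mult.commute)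
        then have "V j * \<bar>g\<bar> \<le> s4 ^ nat \<bar>n\<bar> * V (j - n) * \<bar>g\<bar>" by (intro mult_right_mono) auto
        then show ?thesis unfolding Dt Et using Vpos s4p by (simp add: abs_mult less_imp_le mult.assoc)
      next
        case False
        then show ?thesis using Eval[OF t] by (simp add: j_def)
      qed
    qed
    then have "nrm X E \<le> nrm X (\<lambda>t. s4 ^ nat \<bar>n\<bar> * D t)" by (intro ideal_nrm scale_elts D elts_BM[OF EX])
    also have "\<dots> = s4 ^ nat \<bar>n\<bar> * nrm X D" using nrm_scale[OF D(1)] s4p by simp
    also have "\<dots> \<le> s4 ^ nat \<bar>n\<bar> * (C * nrm X z)" using D(2) s4p by (intro mult_left_mono) auto
    also have "nrm X z = nrm XV x" by (simp add: nr z_def[abs_def])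
    also have "s4 ^ nat \<bar>n\<bar> * (C * nrm XV x) \<le> 2 * C * s4 ^ nat \<bar>n\<bar> * nrm XV x"
      using C s4p nX by (simp add: mult_ac mult_left_mono)
    finally show ?thesis .
  next
    case False
    then have n: "0 < n" by simp
    \<comment> \<open>Scaled so that the norm of z in X(w) is comparable with the norm of x in XV:
      on a level, w is about \<open>2 powr level t\<close>.\<close>
    define z where "z t = x t * (V (level t) * 2 powr (- real_of_int (level t)))" for t
    have zb: "z \<in> BM" unfolding z_def[abs_def]
      using xb by (intro borel_measurable_times) (auto intro!: measurable_compose[OF level_measurable])
    have "AE t in I01. \<bar>z t * w t\<bar> \<le> \<bar>2 * (x t * v t)\<bar>" using AE_level
    proof eventually_elim
      fix t assume t: "t \<in> level_set (level t)"
      then have wp: "0 < w t" by (simp add: level_set_iff)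
      have "2 powr (- real_of_int (level t)) * w t \<le> 2 powr (- real_of_int (level t)) * (2 * 2 powr level t)"
        using level_set_bounds(2)[OF t] by (intro mult_left_mono) auto
      also have "\<dots> = 2" by (simp add: powr_add[symmetric])
      finally have "\<bar>x t * v t\<bar> * (2 powr (- real_of_int (level t)) * w t) \<le> \<bar>x t * v t\<bar> * 2" by (intro mult_left_mono) auto
      then show "\<bar>z t * w t\<bar> \<le> \<bar>2 * (x t * v t)\<bar>" using wp by (simp add: z_def v_def abs_mult mult_ac)
    qed
    then have zw: "(\<lambda>t. z t * w t) \<in> elts X \<and> nrm X (\<lambda>t. z t * w t) \<le> nrm X (\<lambda>t. 2 * (x t * v t))"
      using zb w_BM by (intro ideal[OF scale_elts[OF xv]]) auto
    have z: "z \<in> elts XW" using zw zb by (simp add: el)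
    have nz: "nrm XW z \<le> 2 * nrm XV x" using zw nrm_scale[OF xv, of 2] by (simp add: nr)
    define D where "D = (\<lambda>t. \<Sum>j\<in>F. indicator (level_set j) t * T (\<lambda>s. indicator (level_set (j - n)) s * z s) t)"
    have D: "D \<in> elts XW" "nrm XW D \<le> C * nrm XW z" unfolding D_def
      by (rule W.diagonal_bound[OF T_add[OF XW_SS XW_SS] T_scale[OF XW_SS] TW C F level_set_sets level_set_disjoint level_set_sets disjB z]; assumption)+
    have Tz: "AE t in I01. \<forall>j\<in>F. T (\<lambda>s. indicator (level_set (j - n)) s * z s) t
        = (V (j - n) * 2 powr (- real_of_int (j - n))) * T (level_part (j - n) x) t"
    proof (rule AE_finite_allI[OF F])
      fix j
      have "(\<lambda>s. indicator (level_set (j - n)) s * z s) = (\<lambda>s. (V (j - n) * 2 powr (- real_of_int (j - n))) * level_part (j - n) x s)"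
      proof
        fix s
        show "indicator (level_set (j - n)) s * z s = (V (j - n) * 2 powr (- real_of_int (j - n))) * level_part (j - n) x s"
          by (cases "s \<in> level_set (j - n)") (auto simp: level_part_def z_def level_set_iff)
      qed
      then show "AE t in I01. T (\<lambda>s. indicator (level_set (j - n)) s * z s) t
        = (V (j - n) * 2 powr (- real_of_int (j - n))) * T (level_part (j - n) x) t"
        using T_scale[OF X_SS[OF PX], of "V (j - n) * 2 powr (- real_of_int (j - n))" "j - n"] by simp
    qed
    have DW: "(\<lambda>t. D t * w t) \<in> elts X" and nD: "nrm XW D = nrm X (\<lambda>t. D t * w t)" using D(1) by (auto simp: el nr)
    have "AE t in I01. \<bar>E t\<bar> \<le> \<bar>s4 ^ nat \<bar>n\<bar> * (D t * w t)\<bar>"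
      using Tz AE_level
    proof eventually_elim
      fix t assume a: "\<forall>j\<in>F. T (\<lambda>s. indicator (level_set (j - n)) s * z s) t
        = (V (j - n) * 2 powr (- real_of_int (j - n))) * T (level_part (j - n) x) t" and t: "t \<in> level_set (level t)"
      define j where "j = level t"
      define g where "g = T (level_part (j - n) x) t"
      have wp: "0 < w t" using t by (simp add: level_set_iff)
      show "\<bar>E t\<bar> \<le> \<bar>s4 ^ nat \<bar>n\<bar> * (D t * w t)\<bar>"
      proof (cases "j \<in> F")
        case jF: True
        have Dt: "D t = V (j - n) * 2 powr (- real_of_int (j - n)) * g" unfolding D_def j_def g_def
          using level_sum(1)[OF F t, of "\<lambda>j. T (\<lambda>s. indicator (level_set (j - n)) s * z s) t"] a jF by (simp add: j_def)
        have Et: "E t = V j * g" using Eval[OF t] jF by (simp add: j_def g_def)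
        have "V j \<le> V (j - n) * 2 powr (real_of_int n / 2 + \<bar>real_of_int n\<bar> / 4)" using Vratio[of j "j - n"] by simp
        also have "real_of_int n / 2 + \<bar>real_of_int n\<bar> / 4 = - \<bar>real_of_int n\<bar> / 4 + (- real_of_int (j - n) + real_of_int j)"
          using n by simp
        also have "2 powr \<dots> = s4 ^ nat \<bar>n\<bar> * (2 powr (- real_of_int (j - n)) * 2 powr real_of_int j)"
          by (simp only: powr_add s4n)
        also have "V (j - n) * (s4 ^ nat \<bar>n\<bar> * (2 powr (- real_of_int (j - n)) * 2 powr real_of_int j))
          \<le> V (j - n) * (s4 ^ nat \<bar>n\<bar> * (2 powr (- real_of_int (j - n)) * w t))"
          using level_set_bounds(1)[OF t] Vpos[of "j - n"] s4p by (intro mult_left_mono) (auto simp: j_def)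
        finally have "V j * \<bar>g\<bar> \<le> V (j - n) * (s4 ^ nat \<bar>n\<bar> * (2 powr (- real_of_int (j - n)) * w t)) * \<bar>g\<bar>"
          by (intro mult_right_mono) auto
        then show ?thesis unfolding Dt Et using Vpos s4p wp by (simp add: abs_mult less_imp_le mult_ac)
      next
        case False
        then show ?thesis using Eval[OF t] by (simp add: j_def)
      qed
    qed
    then have "nrm X E \<le> nrm X (\<lambda>t. s4 ^ nat \<bar>n\<bar> * (D t * w t))" by (intro ideal_nrm scale_elts DW elts_BM[OF EX])
    also have "\<dots> = s4 ^ nat \<bar>n\<bar> * nrm XW D" using nrm_scale[OF DW] s4p by (simp add: nD)
    also have "\<dots> \<le> s4 ^ nat \<bar>n\<bar> * (C * (2 * nrm XV x))"
      using D(2) mult_left_mono[OF nz C] s4p by (intro mult_left_mono) auto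
    finally show ?thesis by (simp add: mult_ac)
  qed
  show "E \<in> elts X" by (rule EX)
qed

definition interp_const :: real where "interp_const = 2 * C * (2 / (1 - s4))"

text \<open>The part of x in the middle levels is treated diagonal by diagonal, with a geometric
  series as total. The two remaining parts of x are small by a factor s4^N, so they disappear as N
  grows while the window F stays fixed.\<close>

lemma window_bound:
  fixes F :: "int set"
  assumes x: "x \<in> elts XV" and F: "finite F"
  defines "Z \<equiv> \<lambda>t. \<Sum>j\<in>F. indicator (level_set j) t * (V j * T x t)"
  shows "Z \<in> elts X" "nrm X Z \<le> interp_const * nrm XV x"
proof -
  have nX: "0 \<le> nrm XV x" by (rule VL.nrm_nonneg[OF x])
  \<comment> \<open>These constants depend on the window, which is harmless: in the end they are
    multiplied by s4^N.\<close>
  define vF where "vF = (\<Sum>j\<in>F. V j)"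
  define vF' where "vF' = (\<Sum>j\<in>F. V j * 2 powr (- real_of_int j))"
  have vF: "0 \<le> vF" "0 \<le> vF'" unfolding vF_def vF'_def using Vpos by (auto intro!: sum_nonneg simp: less_imp_le)
  have gen1: "(\<lambda>t. \<Sum>j\<in>F. indicator (level_set j) t * (V j * y t)) \<in> elts X \<and>
      nrm X (\<lambda>t. \<Sum>j\<in>F. indicator (level_set j) t * (V j * y t)) \<le> vF * nrm X y" if y: "y \<in> elts X" for y
  proof -
    have "nrm X (\<lambda>t. \<Sum>j\<in>F. indicator (level_set j) t * (V j * y t)) \<le> (\<Sum>j\<in>F. nrm X (\<lambda>t. indicator (level_set j) t * (V j * y t)))"
      by (rule sum_elts(2)) (intro indicator_elts(1) scale_elts y level_set_sets)
    also have "\<dots> \<le> (\<Sum>j\<in>F. V j * nrm X y)"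
    proof (rule sum_mono)
      fix j
      show "nrm X (\<lambda>t. indicator (level_set j) t * (V j * y t)) \<le> V j * nrm X y"
        using indicator_elts(2)[OF scale_elts[OF y, of "V j"] level_set_sets[of j]] nrm_scale[OF y, of "V j"] Vpos[of j] by simp
    qed
    finally show ?thesis by (auto simp: vF_def sum_distrib_right intro!: sum_elts(1) indicator_elts(1) scale_elts y level_set_sets)
  qed
  have gen2: "(\<lambda>t. \<Sum>j\<in>F. indicator (level_set j) t * (V j * y t)) \<in> elts X \<and>
      nrm X (\<lambda>t. \<Sum>j\<in>F. indicator (level_set j) t * (V j * y t)) \<le> vF' * nrm XW y" if y: "y \<in> elts XW" for y
  proof -
    have yb: "y \<in> BM" and yw: "(\<lambda>t. y t * w t) \<in> elts X" using y by (auto simp: el)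
    have one: "(\<lambda>t. indicator (level_set j) t * (V j * y t)) \<in> elts X \<and>
      nrm X (\<lambda>t. indicator (level_set j) t * (V j * y t)) \<le> nrm X (\<lambda>t. (V j * 2 powr (- real_of_int j)) * (y t * w t))" for j
    proof (rule ideal[OF scale_elts[OF yw]])
      show "(\<lambda>t. indicator (level_set j) t * (V j * y t)) \<in> BM" using yb level_set_sets by simp
      show "AE t in I01. \<bar>indicator (level_set j) t * (V j * y t)\<bar> \<le> \<bar>V j * 2 powr - real_of_int j * (y t * w t)\<bar>"
      proof (rule AE_I2)
        fix t
        show "\<bar>indicator (level_set j) t * (V j * y t)\<bar> \<le> \<bar>V j * 2 powr - real_of_int j * (y t * w t)\<bar>"
        proof (cases "t \<in> level_set j")
          case True
          have "2 powr (- real_of_int j) * 2 powr j \<le> 2 powr (- real_of_int j) * w t"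
            using level_set_bounds(1)[OF True] by (intro mult_left_mono) auto
          then have "1 \<le> 2 powr (- real_of_int j) * w t" by (simp add: powr_add[symmetric])
          then have "(V j * \<bar>y t\<bar>) * 1 \<le> (V j * \<bar>y t\<bar>) * (2 powr (- real_of_int j) * w t)"
            using Vpos[of j] by (intro mult_left_mono) auto
          moreover have "0 < w t" using True by (simp add: level_set_iff)
          ultimately show ?thesis using True Vpos[of j] by (simp add: abs_mult mult_ac)
        qed simp
      qed
    qed
    have "nrm X (\<lambda>t. \<Sum>j\<in>F. indicator (level_set j) t * (V j * y t)) \<le> (\<Sum>j\<in>F. nrm X (\<lambda>t. indicator (level_set j) t * (V j * y t)))"
      by (rule sum_elts(2)) (use one in blast)
    also have "\<dots> \<le> (\<Sum>j\<in>F. (V j * 2 powr (- real_of_int j)) * nrm XW y)"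
    proof (rule sum_mono)
      fix j
      show "nrm X (\<lambda>t. indicator (level_set j) t * (V j * y t)) \<le> (V j * 2 powr (- real_of_int j)) * nrm XW y"
        using one[of j] nrm_scale[OF yw, of "V j * 2 powr (- real_of_int j)"] Vpos[of j] by (simp add: nr abs_mult)
    qed
    finally show ?thesis using one by (auto simp: vF'_def sum_distrib_right intro!: sum_elts(1))
  qed
  have Tadd: "AE t in I01. T x t = (\<Sum>k\<in>{- int N..<int N}. T (level_part k x) t) + (T (upper_part N x) t + T (lower_part N x) t)" for N
  proof -
    let ?K = "{- int N..<int N}"
    define m where "m = (\<lambda>t. \<Sum>k\<in>?K. level_part k x t)"
    have m: "m \<in> elts X" unfolding m_def by (rule sum_elts(1)) (rule level_part_X[OF x])
    have s1: "upper_part N x \<in> elts (sum_space X XW)" by (rule X_SS[OF upper_part_X(1)[OF x]])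
    have s2: "lower_part N x \<in> elts (sum_space X XW)" by (rule XW_SS[OF lower_part_XW(1)[OF x]])
    have s3: "(\<lambda>t. upper_part N x t + lower_part N x t) \<in> elts (sum_space X XW)" by (rule SS_add[OF s1 s2])
    have s4': "(\<lambda>t. m t + (upper_part N x t + lower_part N x t)) \<in> elts (sum_space X XW)" by (rule SS_add[OF X_SS[OF m] s3])
    have a1: "AE t in I01. T x t = T (\<lambda>t. m t + (upper_part N x t + lower_part N x t)) t"
      by (rule T_cong[OF XV_SS[OF x] s4']) (use decompose[of x N] in \<open>simp add: m_def\<close>)
    have a2: "AE t in I01. T (\<lambda>t. m t + (upper_part N x t + lower_part N x t)) t = T m t + T (\<lambda>t. upper_part N x t + lower_part N x t) t"
      by (rule T_add[OF X_SS[OF m] s3])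
    have a3: "AE t in I01. T (\<lambda>t. upper_part N x t + lower_part N x t) t = T (upper_part N x) t + T (lower_part N x) t" by (rule T_add[OF s1 s2])
    have "AE t in I01. T (\<lambda>s. \<Sum>k\<in>?K. 1 * level_part k x s) t = (\<Sum>k\<in>?K. 1 * T (level_part k x) t)"
      by (rule linear_sum[OF T_add[OF X_SS X_SS] T_scale[OF X_SS] _ level_part_X[OF x]]) auto
    then have a4: "AE t in I01. T m t = (\<Sum>k\<in>?K. T (level_part k x) t)" by (simp add: m_def)
    show ?thesis using a1 a2 a3 a4 by eventually_elim simp
  qed
  have bound: "Z \<in> elts X \<and> nrm X Z \<le> interp_const * nrm XV x + (vF * (C * (1 / V 0)) + vF' * (C * (2 * (1 / V 0)))) * nrm XV x * s4 ^ N" for N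
  proof -
    let ?K = "{- int N..<int N}"
    let ?R = "(\<lambda>(j, k). j - k) ` (F \<times> ?K)"
    define En where "En n t = (\<Sum>j\<in>{j\<in>F. j - n \<in> ?K}. indicator (level_set j) t * (V j * T (level_part (j - n) x) t))" for n t
    have En: "En n \<in> elts X" "nrm X (En n) \<le> 2 * C * s4 ^ nat \<bar>n\<bar> * nrm XV x" for n
      unfolding En_def[abs_def] by (rule shifted_diagonal[OF x]; use F in simp)+
    define Y1 where "Y1 t = (\<Sum>n\<in>?R. En n t)" for t
    define Y2 where "Y2 t = (\<Sum>j\<in>F. indicator (level_set j) t * (V j * T (upper_part N x) t))" for t
    define Y3 where "Y3 t = (\<Sum>j\<in>F. indicator (level_set j) t * (V j * T (lower_part N x) t))" for t
    have Y1: "Y1 \<in> elts X" unfolding Y1_def[abs_def] by (rule sum_elts(1)) (rule En(1))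
    have "nrm X Y1 \<le> (\<Sum>n\<in>?R. nrm X (En n))" unfolding Y1_def[abs_def] by (rule sum_elts(2)) (rule En(1))
    also have "\<dots> \<le> (\<Sum>n\<in>?R. (2 * C * nrm XV x) * s4 ^ nat \<bar>n - 0\<bar>)"
      using En(2) by (intro sum_mono) (simp add: mult_ac)
    also have "\<dots> \<le> (2 * C * nrm XV x) * (2 / (1 - s4))"
      unfolding sum_distrib_left[symmetric] using F C nX by (intro mult_left_mono sum_pow_int_le s4) auto
    finally have nY1: "nrm X Y1 \<le> interp_const * nrm XV x" by (simp add: interp_const_def mult_ac)
    have Y2: "Y2 \<in> elts X" "nrm X Y2 \<le> vF * nrm X (T (upper_part N x))"
      using gen1[OF TX(1)[OF upper_part_X(1)[OF x]]] unfolding Y2_def[abs_def] by auto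
    have Y3: "Y3 \<in> elts X" "nrm X Y3 \<le> vF' * nrm XW (T (lower_part N x))"
      using gen2[OF TW(1)[OF lower_part_XW(1)[OF x]]] unfolding Y3_def[abs_def] by auto
    have "nrm X (T (upper_part N x)) \<le> C * ((1 / V 0) * s4 ^ N * nrm XV x)"
      using TX(2)[OF upper_part_X(1)[OF x]] mult_left_mono[OF upper_part_X(2)[OF x] C] by (rule order_trans)
    then have nY2: "nrm X Y2 \<le> vF * (C * ((1 / V 0) * s4 ^ N * nrm XV x))"
      using Y2(2) mult_left_mono[OF _ vF(1)] by (blast intro: order_trans)
    have "nrm XW (T (lower_part N x)) \<le> C * (2 * (1 / V 0) * s4 ^ N * nrm XV x)"
      using TW(2)[OF lower_part_XW(1)[OF x]] mult_left_mono[OF lower_part_XW(2)[OF x] C] by (rule order_trans)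
    then have nY3: "nrm X Y3 \<le> vF' * (C * (2 * (1 / V 0) * s4 ^ N * nrm XV x))"
      using Y3(2) mult_left_mono[OF _ vF(2)] by (blast intro: order_trans)
    have ae: "AE t in I01. Y1 t + (Y2 t + Y3 t) = Z t" using Tadd[of N]
    proof eventually_elim
      fix t assume a: "T x t = (\<Sum>k\<in>?K. T (level_part k x) t) + (T (upper_part N x) t + T (lower_part N x) t)"
      have "Y1 t = (\<Sum>j\<in>F. \<Sum>k\<in>?K. indicator (level_set j) t * (V j * T (level_part k x) t))"
        unfolding Y1_def En_def by (rule sum_by_difference[symmetric]) (use F in auto)
      also have "\<dots> = (\<Sum>j\<in>F. indicator (level_set j) t * (V j * (\<Sum>k\<in>?K. T (level_part k x) t)))"
        by (simp only: sum_distrib_left)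
      finally show "Y1 t + (Y2 t + Y3 t) = Z t"
        unfolding Z_def Y2_def Y3_def a by (simp only: sum.distrib[symmetric] distrib_left)
    qed
    have S: "(\<lambda>t. Y1 t + (Y2 t + Y3 t)) \<in> elts X" by (intro add_elts Y1 Y2(1) Y3(1))
    have Zb: "Z \<in> BM" unfolding Z_def using T_BM[OF XV_SS[OF x]] level_set_sets by (intro borel_measurable_sum) auto
    have Z: "Z \<in> elts X" "nrm X Z = nrm X (\<lambda>t. Y1 t + (Y2 t + Y3 t))" using ae_cong[OF S Zb ae] by auto
    have "nrm X (\<lambda>t. Y1 t + (Y2 t + Y3 t)) \<le> nrm X Y1 + (nrm X Y2 + nrm X Y3)"
      using nrm_triangle[OF Y1 add_elts[OF Y2(1) Y3(1)]] nrm_triangle[OF Y2(1) Y3(1)] by linarith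
    then show ?thesis using Z nY1 nY2 nY3 by (simp add: algebra_simps)
  qed
  show "Z \<in> elts X" using bound by blast
  have "(\<lambda>N. interp_const * nrm XV x + (vF * (C * (1 / V 0)) + vF' * (C * (2 * (1 / V 0)))) * nrm XV x * s4 ^ N)
    \<longlonglongrightarrow> interp_const * nrm XV x + (vF * (C * (1 / V 0)) + vF' * (C * (2 * (1 / V 0)))) * nrm XV x * 0"
    using s4 by (intro tendsto_intros LIMSEQ_realpow_zero) auto
  then have "nrm X Z \<le> interp_const * nrm XV x + (vF * (C * (1 / V 0)) + vF' * (C * (2 * (1 / V 0)))) * nrm XV x * 0"
    by (rule LIMSEQ_le_const) (use bound in blast)
  then show "nrm X Z \<le> interp_const * nrm XV x" by simp
qed

text \<open>The bound of \<open>window_bound\<close> is the same for all windows. The truncations of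
  |T x v| to growing windows increase to it almost everywhere, so the Fatou property
  applies.\<close>

lemma T_XV:
  assumes fat: "fatou_property X" and x: "x \<in> elts XV"
  shows "T x \<in> elts XV" "nrm XV (T x) \<le> interp_const * nrm XV x"
proof -
  have yb: "T x \<in> BM" by (rule T_BM[OF XV_SS[OF x]])
  define Zn where "Zn n t = (\<Sum>j\<in>{- int n..int n}. indicator (level_set j) t * (V j * T x t))" for n t
  have Zn: "Zn n \<in> elts X" "nrm X (Zn n) \<le> interp_const * nrm XV x" for n
    unfolding Zn_def[abs_def] by (rule window_bound[OF x]; simp)+
  define u where "u n t = \<bar>Zn n t\<bar>" for n t
  have u: "u n \<in> elts X" "nrm X (u n) \<le> interp_const * nrm XV x" for n
    using nrm_abs[OF Zn(1), of n] Zn(2)[of n] unfolding u_def[abs_def] by auto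
  define f where "f t = \<bar>T x t * v t\<bar>" for t
  have fb: "f \<in> BM" unfolding f_def[abs_def] using yb v_BM by simp
  have ae: "AE t in I01. 0 \<le> u 0 t \<and> incseq (\<lambda>n. u n t) \<and> (\<lambda>n. u n t) \<longlonglongrightarrow> f t"
    using AE_level
  proof eventually_elim
    fix t assume t: "t \<in> level_set (level t)"
    have ut: "u n t = (if level t \<in> {- int n..int n} then f t else 0)" for n
      unfolding u_def Zn_def f_def v_def by (subst level_sum(1)[OF _ t]) (auto simp: mult.commute)
    have f0: "0 \<le> f t" by (simp add: f_def)
    have "incseq (\<lambda>n. u n t)" unfolding ut using f0 by (intro incseq_SucI) auto
    moreover have "eventually (\<lambda>n. u n t = f t) sequentially"
      unfolding eventually_sequentially ut by (intro exI[of _ "nat \<bar>level t\<bar>"]) auto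
    ultimately show "0 \<le> u 0 t \<and> incseq (\<lambda>n. u n t) \<and> (\<lambda>n. u n t) \<longlonglongrightarrow> f t"
      using f0 ut[of 0] by (auto intro: tendsto_eventually)
  qed
  have bdd: "bdd_above (range (\<lambda>n. nrm X (u n)))" using u(2) by (intro bdd_aboveI[of _ "interp_const * nrm XV x"]) auto
  have "f \<in> elts X \<and> incseq (\<lambda>n. nrm X (u n)) \<and> (\<lambda>n. nrm X (u n)) \<longlonglongrightarrow> nrm X f"
    using fat[unfolded fatou_property_def, rule_format, of u f] u(1) fb ae bdd by blast
  then have fX: "f \<in> elts X" and lim: "(\<lambda>n. nrm X (u n)) \<longlonglongrightarrow> nrm X f" by auto
  have nf: "nrm X f \<le> interp_const * nrm XV x" by (rule LIMSEQ_le_const2[OF lim]) (use u(2) in blast)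
  have mb: "(\<lambda>t. T x t * v t) \<in> BM" using yb v_BM by simp
  have "(\<lambda>t. T x t * v t) \<in> elts X" using abs_iff[OF mb] fX by (simp add: f_def[abs_def])
  then show "T x \<in> elts XV" "nrm XV (T x) \<le> interp_const * nrm XV x"
    using nf nrm_abs[of "\<lambda>t. T x t * v t"] yb by (auto simp: el nr f_def[abs_def])
qed

end

lemma KF_bdd: "0 \<le> t \<Longrightarrow> bdd_below {nrm X x0 + t * nrm XW x1 | x0 x1. x0 \<in> elts X \<and> x1 \<in> elts XW \<and> ae_eq x (\<lambda>s. x0 s + x1 s)}"
  by (rule bdd_belowI[of _ 0]) (auto intro!: add_nonneg_nonneg mult_nonneg_nonneg nrm_nonneg W.nrm_nonneg)

lemma KF_le:
  assumes "0 \<le> t" "x0 \<in> elts X" "x1 \<in> elts XW" "AE s in I01. x s = x0 s + x1 s"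
  shows "K_functional X XW t x \<le> nrm X x0 + t * nrm XW x1"
  unfolding K_functional_def
proof (rule cInf_lower[OF _ KF_bdd[OF assms(1)]])
  have "ae_eq x (\<lambda>s. x0 s + x1 s)" using assms(4) by (simp add: ae_eq_def)
  then show "nrm X x0 + t * nrm XW x1 \<in> {nrm X x0 + t * nrm XW x1 | x0 x1. x0 \<in> elts X \<and> x1 \<in> elts XW \<and> ae_eq x (\<lambda>s. x0 s + x1 s)}"
    using assms(2,3) by blast
qed

text \<open>The embeddings reflect that v lies between the two weights: it is at most
  \<open>V 0 * (1 + w)\<close>, and cutting at level 0 puts one part into X and the other into
  X(w).\<close>

lemma interpolation_XV:
  assumes fat: "fatou_property X" shows "interpolation_space XV X XW"
  unfolding interpolation_space_def
proof (intro conjI allI impI)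
  show "banach_fun_space XV" by (rule VL.bfs)
  show "embedded (meet_space X XW) XV" unfolding embedded_def
  proof (intro conjI exI ballI)
    have *: "x \<in> elts XV \<and> nrm XV x \<le> V 0 * (nrm X x + nrm XW x)" if x: "x \<in> elts X" "x \<in> elts XW" for x
    proof -
      have xb: "x \<in> BM" and xw: "(\<lambda>t. x t * w t) \<in> elts X" using x by (auto simp: el)
      have ax: "(\<lambda>t. \<bar>x t\<bar>) \<in> elts X" "nrm X (\<lambda>t. \<bar>x t\<bar>) = nrm X x" using nrm_abs[OF x(1)] by auto
      have aw: "(\<lambda>t. \<bar>x t * w t\<bar>) \<in> elts X" "nrm X (\<lambda>t. \<bar>x t * w t\<bar>) = nrm XW x" using nrm_abs[OF xw] by (auto simp: nr)
      have "AE t in I01. \<bar>x t * v t\<bar> \<le> \<bar>V 0 * (\<bar>x t\<bar> + \<bar>x t * w t\<bar>)\<bar>" using AE_level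
      proof eventually_elim
        fix t assume t: "t \<in> level_set (level t)"
        define j where "j = level t"
        have wp: "0 < w t" using t by (simp add: level_set_iff)
        have "V j \<le> V 0 * 2 powr (real_of_int j / 2 + \<bar>real_of_int j\<bar> / 4)" using Vratio[of j 0] by simp
        also have "2 powr (real_of_int j / 2 + \<bar>real_of_int j\<bar> / 4) \<le> 1 + w t"
        proof (cases "j \<le> 0")
          case True
          then have "2 powr (real_of_int j / 2 + \<bar>real_of_int j\<bar> / 4) \<le> 2 powr 0" by (intro powr_mono) auto
          then show ?thesis using wp by simp
        next
          case False
          then have "2 powr (real_of_int j / 2 + \<bar>real_of_int j\<bar> / 4) \<le> 2 powr real_of_int j" by (intro powr_mono) auto
          also have "\<dots> \<le> w t" using level_set_bounds(1)[OF t] by (simp add: j_def)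
          finally show ?thesis by linarith
        qed
        finally have "V j \<le> V 0 * (1 + w t)" using Vpos[of 0] by simp
        then have "V j * \<bar>x t\<bar> \<le> V 0 * (1 + w t) * \<bar>x t\<bar>" by (intro mult_right_mono) auto
        then show "\<bar>x t * v t\<bar> \<le> \<bar>V 0 * (\<bar>x t\<bar> + \<bar>x t * w t\<bar>)\<bar>"
          using wp Vpos[of 0] Vpos[of j] by (simp add: v_def j_def abs_mult algebra_simps)
      qed
      then have "(\<lambda>t. x t * v t) \<in> elts X \<and> nrm X (\<lambda>t. x t * v t) \<le> nrm X (\<lambda>t. V 0 * (\<bar>x t\<bar> + \<bar>x t * w t\<bar>))"
        using xb v_BM by (intro ideal scale_elts add_elts ax aw) auto
      moreover have "nrm X (\<lambda>t. V 0 * (\<bar>x t\<bar> + \<bar>x t * w t\<bar>)) = V 0 * nrm X (\<lambda>t. \<bar>x t\<bar> + \<bar>x t * w t\<bar>)"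
        using nrm_scale[OF add_elts[OF ax(1) aw(1)], of "V 0"] Vpos[of 0] by simp
      moreover have "V 0 * nrm X (\<lambda>t. \<bar>x t\<bar> + \<bar>x t * w t\<bar>) \<le> V 0 * (nrm X x + nrm XW x)"
        using nrm_triangle[OF ax(1) aw(1)] ax(2) aw(2) Vpos[of 0] by (intro mult_left_mono) auto
      ultimately show ?thesis using xb by (auto simp: el nr)
    qed
    show "elts (meet_space X XW) \<subseteq> elts XV" using * by (auto simp: meet_space_def)
    fix x assume "x \<in> elts (meet_space X XW)"
    then have x: "x \<in> elts X" "x \<in> elts XW" by (auto simp: meet_space_def)
    have "V 0 * (nrm X x + nrm XW x) \<le> V 0 * (2 * nrm (meet_space X XW) x)"
      using Vpos[of 0] by (intro mult_left_mono) (auto simp: meet_space_def)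
    then show "nrm XV x \<le> (V 0 * 2) * nrm (meet_space X XW) x" using *[OF x] by (simp add: mult_ac)
  qed
  show "embedded XV (sum_space X XW)" unfolding embedded_def
  proof (intro conjI exI ballI)
    show "elts XV \<subseteq> elts (sum_space X XW)" using XV_SS by blast
    fix x assume x: "x \<in> elts XV"
    have "nrm (sum_space X XW) x \<le> nrm X (upper_part 0 x) + 1 * nrm XW (lower_part 0 x)"
      unfolding sum_space_def fun_space.simps by (rule KF_le[OF _ upper_part_X(1)[OF x] lower_part_XW(1)[OF x] XV_ae]) simp
    then show "nrm (sum_space X XW) x \<le> (3 / V 0) * nrm XV x"
      using upper_part_X(2)[OF x, of 0] lower_part_XW(2)[OF x, of 0] by simp
  qed
  fix T assume T: "linear_operator_on (sum_space X XW) T \<and> maps_boundedly T X \<and> maps_boundedly T XW"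
  obtain D0 where D0: "\<And>x. x \<in> elts X \<Longrightarrow> T x \<in> elts X" "\<And>x. x \<in> elts X \<Longrightarrow> nrm X (T x) \<le> D0 * nrm X x"
    using T unfolding maps_boundedly_def by blast
  obtain D1 where D1: "\<And>x. x \<in> elts XW \<Longrightarrow> T x \<in> elts XW" "\<And>x. x \<in> elts XW \<Longrightarrow> nrm XW (T x) \<le> D1 * nrm XW x"
    using T unfolding maps_boundedly_def by blast
  define C where "C = max 0 (max D0 D1)"
  have C: "0 \<le> C" by (simp add: C_def)
  have E0: "nrm X (T x) \<le> C * nrm X x" if "x \<in> elts X" for x
    by (rule order_trans[OF D0(2)[OF that] mult_right_mono[OF _ nrm_nonneg[OF that]]]) (simp add: C_def)
  have E1: "nrm XW (T x) \<le> C * nrm XW x" if "x \<in> elts XW" for x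
    by (rule order_trans[OF D1(2)[OF that] mult_right_mono[OF _ W.nrm_nonneg[OF that]]]) (simp add: C_def)
  show "maps_boundedly T XV" unfolding maps_boundedly_def
    using T_XV[OF conjunct1[OF T] D0(1) E0 D1(1) E1 C fat] by blast
qed

end

subsection \<open>Decomposable spaces\<close>

locale sym_weight = sym_space X + weighted_lattice X w for X w
begin

lemma level_measure_eq: "level_measure w j = measure I01 (level_set j)"
  by (simp add: level_measure_def level_set_def)

lemma level_measure_nonneg: "0 \<le> level_measure w j"
  by (simp add: level_measure_eq)

lemma level_measure_sum:
  assumes "finite J" shows "(\<Sum>j\<in>J. level_measure w j) \<le> 1"
proof -
  have "(\<Sum>j\<in>J. measure I01 (level_set j)) = measure I01 (\<Union>j\<in>J. level_set j)"
    using assms level_set_sets level_set_disjoint by (intro I.finite_measure_finite_Union[symmetric]) auto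
  then show ?thesis by (simp add: level_measure_eq)
qed

lemma sum_le_1:
  assumes "finite J" "\<And>j. j \<in> J \<Longrightarrow> \<tau> j \<le> level_measure w j" shows "(\<Sum>j\<in>J. \<tau> j) \<le> 1"
  using sum_mono[of J \<tau> "level_measure w"] assms level_measure_sum[OF assms(1)] by fastforce

lemma disj_fam_in_levels:
  assumes "\<And>j. j \<in> J \<Longrightarrow> 0 < \<tau> j \<and> \<tau> j \<le> level_measure w j"
  shows "\<exists>A. disj_fam J \<tau> A \<and> (\<forall>j\<in>J. A j \<subseteq> level_set j)"
proof -
  have "\<forall>j\<in>J. \<exists>A. A \<in> sets I01 \<and> A \<subseteq> level_set j \<and> measure I01 A = \<tau> j"
  proof
    fix j assume "j \<in> J"
    then have "0 \<le> \<tau> j" "\<tau> j \<le> measure I01 (level_set j)" using assms[of j] by (auto simp: level_measure_eq)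
    then show "\<exists>A. A \<in> sets I01 \<and> A \<subseteq> level_set j \<and> measure I01 A = \<tau> j"
      using subset_of_measure[OF level_set_sets] by blast
  qed
  then obtain A where A: "\<forall>j\<in>J. A j \<in> sets I01 \<and> A j \<subseteq> level_set j \<and> measure I01 (A j) = \<tau> j"
    by (rule bchoice[THEN exE])
  have "disjoint_family_on A J" unfolding disjoint_family_on_def
  proof (intro ballI impI)
    fix i j assume "i \<in> J" "j \<in> J" "i \<noteq> j"
    then show "A i \<inter> A j = {}" using A level_set_disjoint[of J] unfolding disjoint_family_on_def by blast
  qed
  then show ?thesis using A by (auto simp: disj_fam_def)
qed

lemma level_ess_bounds:
  assumes S: "S \<in> sets I01" "S \<subseteq> level_set j"
  shows "ereal (2 powr j) \<le> ess_inf_on w S" "ess_sup_on w S \<le> ereal (2 * 2 powr j)"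
proof -
  have "S \<subseteq> {0..1}" using S(2) by (auto simp: level_set_def)
  then have m: "w \<in> borel_measurable (lebesgue_on S)"
    using w_BM by (rule measurable_restrict_mono[rotated])
  have "esssup (lebesgue_on S) (\<lambda>t. - ereal (w t)) \<le> - ereal (2 powr j)"
    using m S(2) by (intro esssup_I AE_I2) (auto dest!: subsetD intro: level_set_bounds)
  then show "ereal (2 powr j) \<le> ess_inf_on w S" unfolding ess_inf_on_def using ereal_minus_le_minus by fastforce
  show "ess_sup_on w S \<le> ereal (2 * 2 powr j)" unfolding ess_sup_on_def
    using m S(2) level_set_bounds(2) by (intro esssup_I AE_I2) auto
qed

lemma nrm_scaled_indicator:
  assumes A: "A \<in> sets I01" "measure I01 A = s" and s: "0 < s" and c: "0 < c"
  shows "(\<lambda>t. c / fund s * indicator A t) \<in> elts X" "nrm X (\<lambda>t. c / fund s * indicator A t) = c"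
proof -
  have "0 < fund s" using A s by (intro fund_pos) auto
  then show "nrm X (\<lambda>t. c / fund s * indicator A t) = c"
    using nrm_scale[OF indicator_in[OF A(1)], of "c / fund s"] nrm_indicator[OF A(1)] A(2) c by simp
qed (intro scale_elts indicator_in A)

text \<open>On neighbouring levels the values of w may be arbitrarily close. With one level in
  between, the infimum over the upper level is at least twice the supremum over the lower
  one.\<close>

lemma decomposable_spaced:
  assumes C: "0 < C" and dec: "\<And>(n::nat) (x :: nat \<Rightarrow> real \<Rightarrow> real) y.
        (\<forall>i\<in>{1..n}. x i \<in> elts X \<and> y i \<in> elts X \<and>
           \<not> ae_eq (x i) (\<lambda>t. 0) \<and> \<not> ae_eq (y i) (\<lambda>t. 0) \<and> nrm X (x i) = nrm X (y i)) \<and>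
        (\<forall>i\<in>{1..<n}. ess_inf_on w (supp (x i) \<union> supp (y i))
           \<ge> 2 * ess_sup_on w (supp (x (i + 1)) \<union> supp (y (i + 1)))) \<Longrightarrow>
        nrm X (\<lambda>t. \<Sum>i=1..n. y i t) \<le> C * nrm X (\<lambda>t. \<Sum>i=1..n. x i t)"
    and J: "finite J" and gap: "\<And>i j. i \<in> J \<Longrightarrow> j \<in> J \<Longrightarrow> i < j \<Longrightarrow> i + 2 \<le> j"
    and \<tau>: "\<And>j. j \<in> J \<Longrightarrow> 0 < \<tau> j \<and> \<tau> j \<le> level_measure w j"
    and \<sigma>: "\<And>j. j \<in> J \<Longrightarrow> 0 < \<sigma> j \<and> \<sigma> j \<le> level_measure w j"
    and a: "\<And>j. j \<in> J \<Longrightarrow> 0 < a j"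
  shows "step_norm J (\<lambda>j. a j / fund (\<tau> j)) \<tau> \<le> C * step_norm J (\<lambda>j. a j / fund (\<sigma> j)) \<sigma>"
proof -
  obtain A where A: "disj_fam J \<tau> A" "\<forall>j\<in>J. A j \<subseteq> level_set j" using disj_fam_in_levels[of J \<tau>, OF \<tau>] by auto
  obtain B where B: "disj_fam J \<sigma> B" "\<forall>j\<in>J. B j \<subseteq> level_set j" using disj_fam_in_levels[of J \<sigma>, OF \<sigma>] by auto
  define l where "l = sorted_list_of_set J"
  define n where "n = length l"
  \<comment> \<open>Decreasing enumeration, because in \<open>w_decomposable\<close> the larger
    values of w come first.\<close>
  define e where "e i = l ! (n - i)" for i
  have l: "set l = J" "distinct l" "sorted_wrt (<) l" using J by (auto simp: l_def)
  have "bij_betw (\<lambda>i. n - i) {1..n} {..<n}" by (rule bij_betw_byWitness[of _ "\<lambda>i. n - i"]) auto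
  moreover have "bij_betw ((!) l) {..<n} J" using bij_betw_nth[OF l(2), of "{..<n}" J] l by (simp add: n_def)
  ultimately have e: "bij_betw e {1..n} J"
    using bij_betw_trans[of "\<lambda>i. n - i" "{1..n}" "{..<n}" "(!) l" J] by (simp add: e_def[abs_def] comp_def)
  have eJ: "e i \<in> J" if "i \<in> {1..n}" for i using bij_betwE[OF e] that by blast
  have eless: "e (i + 1) < e i" if "i \<in> {1..<n}" for i
    unfolding e_def using that by (intro sorted_wrt_nth_less[OF l(3)]) (auto simp: n_def)
  define x where "x i t = a (e i) / fund (\<sigma> (e i)) * indicator (B (e i)) t" for i t
  define y where "y i t = a (e i) / fund (\<tau> (e i)) * indicator (A (e i)) t" for i t
  have x: "x i \<in> elts X" "nrm X (x i) = a (e i)" if "i \<in> {1..n}" for i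
    unfolding x_def[abs_def] by (rule nrm_scaled_indicator; use B(1) eJ[OF that] \<sigma> a in \<open>simp add: disj_fam_def\<close>)+
  have y: "y i \<in> elts X" "nrm X (y i) = a (e i)" if "i \<in> {1..n}" for i
    unfolding y_def[abs_def] by (rule nrm_scaled_indicator; use A(1) eJ[OF that] \<tau> a in \<open>simp add: disj_fam_def\<close>)+
  have sx: "(\<lambda>t. \<Sum>i=1..n. x i t) = step J (\<lambda>j. a j / fund (\<sigma> j)) B"
    unfolding step_def fun_eq_iff x_def by (intro allI sum.reindex_bij_betw[OF e])
  have sy: "(\<lambda>t. \<Sum>i=1..n. y i t) = step J (\<lambda>j. a j / fund (\<tau> j)) A"
    unfolding step_def fun_eq_iff y_def by (intro allI sum.reindex_bij_betw[OF e])
  define S where "S i = supp (x i) \<union> supp (y i)" for i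
  have S: "S i \<in> sets I01" "S i \<subseteq> level_set (e i)" if "i \<in> {1..n}" for i
  proof -
    have "{t \<in> space I01. z t \<noteq> 0} \<in> sets I01" if "z \<in> BM" for z :: "real \<Rightarrow> real"
      using that by measurable
    then show "S i \<in> sets I01" unfolding S_def supp_def using elts_BM[OF x(1)[OF that]] elts_BM[OF y(1)[OF that]] by auto
    show "S i \<subseteq> level_set (e i)" using A(2) B(2) eJ[OF that] unfolding S_def supp_def x_def y_def
      by (auto simp: indicator_def split: if_splits)
  qed
  have "nrm X (\<lambda>t. \<Sum>i=1..n. y i t) \<le> C * nrm X (\<lambda>t. \<Sum>i=1..n. x i t)"
  proof (rule dec, intro conjI ballI)
    fix i assume i: "i \<in> {1..n}"
    show "x i \<in> elts X" "y i \<in> elts X" "nrm X (x i) = nrm X (y i)" using x[OF i] y[OF i] by auto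
    show "\<not> ae_eq (x i) (\<lambda>t. 0)" using nrm_eq_0_iff[OF x(1)[OF i]] x(2)[OF i] a[OF eJ[OF i]] by simp
    show "\<not> ae_eq (y i) (\<lambda>t. 0)" using nrm_eq_0_iff[OF y(1)[OF i]] y(2)[OF i] a[OF eJ[OF i]] by simp
  next
    fix i assume i: "i \<in> {1..<n}"
    have i1: "i \<in> {1..n}" "i + 1 \<in> {1..n}" using i by auto
    have "e (i + 1) + 2 \<le> e i" by (rule gap[OF eJ[OF i1(2)] eJ[OF i1(1)] eless[OF i]])
    then have "2 powr (real_of_int (e (i + 1)) + 2) \<le> 2 powr e i" by (intro powr_mono) auto
    then have le: "2 * (2 * 2 powr e (i + 1)) \<le> 2 powr e i" by (simp add: powr_add)
    have "2 * ess_sup_on w (S (i + 1)) \<le> 2 * ereal (2 * 2 powr e (i + 1))"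
      by (intro ereal_mult_left_mono level_ess_bounds(2)[OF S[OF i1(2)]]) simp
    also have "\<dots> \<le> ereal (2 powr e i)" using le by simp
    also have "\<dots> \<le> ess_inf_on w (S i)" by (rule level_ess_bounds(1)[OF S[OF i1(1)]])
    finally show "ess_inf_on w (supp (x i) \<union> supp (y i)) \<ge> 2 * ess_sup_on w (supp (x (i + 1)) \<union> supp (y (i + 1)))"
      unfolding S_def .
  qed
  then show ?thesis unfolding sx sy step_norm_eq[OF J A(1)] step_norm_eq[OF J B(1)] .
qed

text \<open>The data to which the assumption \<open>LP\<close> of \<open>lp_space\<close> refers,
  for the measures of the levels of w.\<close>

definition config :: "int set \<Rightarrow> (int \<Rightarrow> real) \<Rightarrow> (int \<Rightarrow> real) \<Rightarrow> (int \<Rightarrow> real) \<Rightarrow> bool" where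
  "config J \<tau> \<sigma> a \<longleftrightarrow> finite J \<and> (\<forall>j\<in>J. 0 < \<tau> j \<and> \<tau> j \<le> level_measure w j) \<and>
      (\<forall>j\<in>J. 0 < \<sigma> j \<and> \<sigma> j \<le> level_measure w j) \<and> (\<forall>j\<in>J. 0 < a j) \<and>
      (\<forall>i\<in>J. \<forall>j\<in>J. a i * s4 ^ nat \<bar>i - j\<bar> \<le> a j)"

definition level_property :: "real \<Rightarrow> bool" where
  "level_property L \<longleftrightarrow> (\<forall>J \<tau> \<sigma> a. config J \<tau> \<sigma> a \<longrightarrow>
      step_norm J (\<lambda>j. a j / fund (\<tau> j)) \<tau> \<le> L * step_norm J (\<lambda>j. a j / fund (\<sigma> j)) \<sigma>)"

lemma decomposable_levels:
  assumes "w_decomposable w X" shows "\<exists>L\<ge>1. level_property L"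
proof -
  obtain C where C: "0 < C" and dec: "\<And>(n::nat) (x :: nat \<Rightarrow> real \<Rightarrow> real) y.
        (\<forall>i\<in>{1..n}. x i \<in> elts X \<and> y i \<in> elts X \<and>
           \<not> ae_eq (x i) (\<lambda>t. 0) \<and> \<not> ae_eq (y i) (\<lambda>t. 0) \<and> nrm X (x i) = nrm X (y i)) \<and>
        (\<forall>i\<in>{1..<n}. ess_inf_on w (supp (x i) \<union> supp (y i))
           \<ge> 2 * ess_sup_on w (supp (x (i + 1)) \<union> supp (y (i + 1)))) \<Longrightarrow>
        nrm X (\<lambda>t. \<Sum>i=1..n. y i t) \<le> C * nrm X (\<lambda>t. \<Sum>i=1..n. x i t)"
    using assms unfolding w_decomposable_def by meson
  have "level_property (max 1 (2 * C))" unfolding level_property_def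
  proof (intro allI impI)
    fix J :: "int set" and \<tau> \<sigma> a :: "int \<Rightarrow> real"
    assume "config J \<tau> \<sigma> a"
    then have J: "finite J" and \<tau>: "\<forall>j\<in>J. 0 < \<tau> j \<and> \<tau> j \<le> level_measure w j"
      and \<sigma>: "\<forall>j\<in>J. 0 < \<sigma> j \<and> \<sigma> j \<le> level_measure w j" and a: "\<forall>j\<in>J. 0 < a j"
      by (auto simp: config_def)
    let ?N = "\<lambda>K. step_norm K (\<lambda>j. a j / fund (\<tau> j)) \<tau>" and ?M = "\<lambda>K. step_norm K (\<lambda>j. a j / fund (\<sigma> j)) \<sigma>"
    have st: "(\<Sum>j\<in>J. \<tau> j) \<le> 1" and ss: "(\<Sum>j\<in>J. \<sigma> j) \<le> 1"
      using \<tau> \<sigma> by (auto intro!: sum_le_1[OF J])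
    have half: "?N {j\<in>J. even j = b} \<le> C * ?M J" for b
    proof -
      have "?N {j\<in>J. even j = b} \<le> C * ?M {j\<in>J. even j = b}"
      proof (rule decomposable_spaced[OF C dec])
        fix i j assume "i \<in> {j\<in>J. even j = b}" "j \<in> {j\<in>J. even j = b}" "i < j"
        moreover from this have "j \<noteq> i + 1" by auto
        ultimately show "i + 2 \<le> j" by linarith
      qed (use J \<tau> \<sigma> a in auto)
      also have "?M {j\<in>J. even j = b} \<le> ?M J" using \<sigma> by (intro step_norm_subset J ss) (auto simp: less_imp_le)
      finally show ?thesis using C by simp
    qed
    have "?N J \<le> ?N {j\<in>J. even j = True} + ?N {j\<in>J. even j = False}"
      using \<tau> by (intro step_norm_Un_le J st) (auto simp: less_imp_le)
    also have "\<dots> \<le> (2 * C) * ?M J" using half[of True] half[of False] by simp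
    also have "\<dots> \<le> max 1 (2 * C) * ?M J" using \<sigma> by (intro mult_right_mono step_norm_nonneg J ss) (auto simp: less_imp_le)
    finally show "?N J \<le> max 1 (2 * C) * ?M J" .
  qed
  then show ?thesis by (intro exI[of _ "max 1 (2 * C)"]) simp
qed

end

subsection \<open>The K-functional of step functions\<close>

locale sym_interpolation = sym_space X + weighted_interpolation X w V for X w V
begin

sublocale sym_weight X w ..

context
  fixes J :: "int set" and \<tau> :: "int \<Rightarrow> real" and A :: "int \<Rightarrow> real set"
  assumes J: "finite J" and A: "disj_fam J \<tau> A" "\<And>j. j \<in> J \<Longrightarrow> A j \<subseteq> level_set j" and \<tau>: "\<And>j. j \<in> J \<Longrightarrow> 0 < \<tau> j"
begin

text \<open>The factor 2^(-j/2) lies halfway between the weights 1 and 2^-j, so that every level in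
  J dominates the K-functional, up to constants, for t = 2^-j.\<close>

definition test_fun :: "real \<Rightarrow> real" where "test_fun = step J (\<lambda>j. 2 powr (- real_of_int j / 2) / fund (\<tau> j)) A"

text \<open>Up to constants the K-functional of the piece of \<open>test_fun\<close> in level j: it
  costs 2^(-j/2) in X, and about 2^j times as much in X(w).\<close>

definition kweight :: "real \<Rightarrow> int \<Rightarrow> real" where "kweight t j = 2 powr (- real_of_int j / 2) * min 1 (t * 2 powr j)"

lemma test_fun_X: "test_fun \<in> elts X"
  unfolding test_fun_def by (rule step_elts[OF A(1)])

lemma test_fun_XV: "(\<lambda>t. test_fun t * v t) = step J (\<lambda>j. (V j * 2 powr (- real_of_int j / 2)) / fund (\<tau> j)) A"
proof
  fix t
  have "c * indicator (A j) t * v t = V j * c * indicator (A j) t" if "j \<in> J" for j and c :: real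
    using A(2)[OF that] by (cases "t \<in> A j") (auto simp: v_def level_set_iff)
  then show "test_fun t * v t = step J (\<lambda>j. (V j * 2 powr (- real_of_int j / 2)) / fund (\<tau> j)) A t"
    unfolding test_fun_def step_def sum_distrib_right by (intro sum.cong refl) simp
qed

lemma test_fun_norm: "test_fun \<in> elts XV" "nrm XV test_fun = step_norm J (\<lambda>j. (V j * 2 powr (- real_of_int j / 2)) / fund (\<tau> j)) \<tau>"
  using elts_BM[OF test_fun_X] step_elts[OF A(1)] step_norm_eq[OF J A(1)] unfolding el nr test_fun_XV by auto

lemma piece:
  assumes j: "j \<in> J"
  shows "(\<lambda>t. 2 powr (- real_of_int j / 2) / fund (\<tau> j) * indicator (A j) t) \<in> elts X"
    "nrm X (\<lambda>t. 2 powr (- real_of_int j / 2) / fund (\<tau> j) * indicator (A j) t) = 2 powr (- real_of_int j / 2)"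
  by (rule nrm_scaled_indicator; use A(1) j \<tau>[OF j] in \<open>simp add: disj_fam_def\<close>)+

lemma piece_W:
  assumes j: "j \<in> J"
  shows "(\<lambda>t. 2 powr (- real_of_int j / 2) / fund (\<tau> j) * indicator (A j) t) \<in> elts XW"
    "nrm XW (\<lambda>t. 2 powr (- real_of_int j / 2) / fund (\<tau> j) * indicator (A j) t) \<le> 2 * 2 powr j * 2 powr (- real_of_int j / 2)"
proof -
  define u where "u = (\<lambda>t. 2 powr (- real_of_int j / 2) / fund (\<tau> j) * indicator (A j) t)"
  define k :: real where "k = 2 * 2 powr j"
  have u: "u \<in> elts X" "nrm X u = 2 powr (- real_of_int j / 2)" unfolding u_def by (rule piece[OF j])+
  have k: "0 \<le> k" by (simp add: k_def)
  have ub: "u \<in> BM" by (rule elts_BM[OF u(1)])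
  have le: "\<bar>u t * w t\<bar> \<le> \<bar>k * u t\<bar>" for t
  proof (cases "t \<in> A j")
    case True
    then have "t \<in> level_set j" using A(2)[OF j] by blast
    then have "\<bar>w t\<bar> \<le> \<bar>k\<bar>" using level_set_bounds[of t j] by (auto simp: level_set_iff k_def)
    then have "\<bar>u t\<bar> * \<bar>w t\<bar> \<le> \<bar>u t\<bar> * \<bar>k\<bar>" by (rule mult_left_mono) simp
    then show ?thesis by (simp only: abs_mult mult.commute)
  qed (simp add: u_def)
  have "(\<lambda>t. u t * w t) \<in> elts X \<and> nrm X (\<lambda>t. u t * w t) \<le> nrm X (\<lambda>t. k * u t)"
    by (rule ideal[OF scale_elts[OF u(1), of k]]) (use ub w_BM le in auto)
  moreover have "nrm X (\<lambda>t. k * u t) = k * 2 powr (- real_of_int j / 2)"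
    unfolding nrm_scale[OF u(1)] u(2) using k by simp
  ultimately have "u \<in> elts XW" "nrm XW u \<le> k * 2 powr (- real_of_int j / 2)"
    using ub unfolding el nr by auto
  then show "(\<lambda>t. 2 powr (- real_of_int j / 2) / fund (\<tau> j) * indicator (A j) t) \<in> elts XW"
    "nrm XW (\<lambda>t. 2 powr (- real_of_int j / 2) / fund (\<tau> j) * indicator (A j) t) \<le> 2 * 2 powr j * 2 powr (- real_of_int j / 2)"
    unfolding u_def k_def by auto
qed

lemma K_set_nonempty: "{nrm X x0 + t * nrm XW x1 |x0 x1. x0 \<in> elts X \<and> x1 \<in> elts XW \<and> ae_eq test_fun (\<lambda>s. x0 s + x1 s)} \<noteq> {}"
proof -
  have "ae_eq test_fun (\<lambda>s. test_fun s + 0)" by (simp add: ae_eq_def)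
  then show ?thesis using test_fun_X W.zero_elts by blast
qed

lemma K_nonneg:
  assumes t: "0 < t" shows "0 \<le> K_functional X XW t test_fun"
  unfolding K_functional_def
proof (rule cInf_greatest[OF K_set_nonempty])
  fix k assume "k \<in> {nrm X x0 + t * nrm XW x1 |x0 x1. x0 \<in> elts X \<and> x1 \<in> elts XW \<and> ae_eq test_fun (\<lambda>s. x0 s + x1 s)}"
  then obtain x0 x1 where "k = nrm X x0 + t * nrm XW x1" "x0 \<in> elts X" "x1 \<in> elts XW" by blast
  then show "0 \<le> k" using t nrm_nonneg[of x0] W.nrm_nonneg[of x1] by simp
qed

text \<open>On the set A j the weight is at least 2^j, so for any decomposition the piece in level j
  is dominated by |x0| + 2^-j |x1 w|. Multiplication by \<open>min 1 (t * 2 powr j)\<close> turns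
  the resulting estimate into the one claimed.\<close>

lemma K_lower:
  assumes t: "0 < t" and j: "j \<in> J"
  shows "kweight t j \<le> K_functional X XW t test_fun"
  unfolding K_functional_def
proof (rule cInf_greatest[OF K_set_nonempty])
  fix k assume "k \<in> {nrm X x0 + t * nrm XW x1 |x0 x1. x0 \<in> elts X \<and> x1 \<in> elts XW \<and> ae_eq test_fun (\<lambda>s. x0 s + x1 s)}"
  then obtain x0 x1 where k: "k = nrm X x0 + t * nrm XW x1" and x0: "x0 \<in> elts X" and x1: "x1 \<in> elts XW"
    and ae: "AE s in I01. test_fun s = x0 s + x1 s" by (auto simp: ae_eq_def)
  have xw: "(\<lambda>s. x1 s * w s) \<in> elts X" using x1 by (simp add: el)
  define u where "u = (\<lambda>t. 2 powr (- real_of_int j / 2) / fund (\<tau> j) * indicator (A j) t)"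
  define y0 where "y0 s = \<bar>x0 s\<bar>" for s
  define y1 where "y1 s = \<bar>x1 s * w s\<bar>" for s
  define d :: real where "d = 2 powr (- real_of_int j)"
  define b where "b s = y0 s + d * y1 s" for s
  have u: "u \<in> elts X" "nrm X u = 2 powr (- real_of_int j / 2)" unfolding u_def by (rule piece[OF j])+
  have y0: "y0 \<in> elts X" "nrm X y0 = nrm X x0" using nrm_abs[OF x0] by (auto simp: y0_def[abs_def])
  have y1: "y1 \<in> elts X" "nrm X y1 = nrm XW x1" using nrm_abs[OF xw] by (auto simp: y1_def[abs_def] nr)
  have d: "0 \<le> d" by (simp add: d_def)
  have b: "b \<in> elts X" unfolding b_def[abs_def] by (rule add_elts[OF y0(1) scale_elts[OF y1(1)]])
  have "AE s in I01. \<bar>u s\<bar> \<le> \<bar>b s\<bar>"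
    using ae
  proof eventually_elim
    fix s assume s: "test_fun s = x0 s + x1 s"
    show "\<bar>u s\<bar> \<le> \<bar>b s\<bar>"
    proof (cases "s \<in> A j")
      case True
      have "test_fun s = 2 powr (- real_of_int j / 2) / fund (\<tau> j)" unfolding test_fun_def
        by (rule step_in[OF J conjunct2[OF A(1)[unfolded disj_fam_def]] j True])
      then have us: "\<bar>u s\<bar> \<le> \<bar>x0 s\<bar> + \<bar>x1 s\<bar>" using True s by (simp add: u_def)
      have sM: "s \<in> level_set j" using A(2)[OF j] True by blast
      have "d * 2 powr j \<le> d * \<bar>w s\<bar>"
        using level_set_bounds(1)[OF sM] d by (intro mult_left_mono) auto
      then have "1 \<le> d * \<bar>w s\<bar>" by (simp add: d_def powr_add[symmetric])
      then have "\<bar>x1 s\<bar> * 1 \<le> \<bar>x1 s\<bar> * (d * \<bar>w s\<bar>)" by (intro mult_left_mono) auto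
      then have "\<bar>x0 s\<bar> + \<bar>x1 s\<bar> \<le> b s" by (simp add: b_def y0_def y1_def abs_mult mult_ac)
      then show ?thesis using us by linarith
    qed (simp add: u_def)
  qed
  then have "nrm X u \<le> nrm X b" by (rule ideal_nrm[OF b elts_BM[OF u(1)]])
  also have "nrm X b \<le> nrm X y0 + nrm X (\<lambda>s. d * y1 s)"
    unfolding b_def[abs_def] by (rule nrm_triangle[OF y0(1) scale_elts[OF y1(1)]])
  finally have *: "2 powr (- real_of_int j / 2) \<le> nrm X x0 + 2 powr (- real_of_int j) * nrm XW x1"
    unfolding u(2) y0(2) nrm_scale[OF y1(1)] y1(2) abs_of_nonneg[OF d] by (simp only: d_def)
  define m where "m = min 1 (t * 2 powr j)"
  have m: "0 \<le> m" "m \<le> 1" "m \<le> t * 2 powr j" using t by (auto simp: m_def)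
  have "m * 2 powr (- real_of_int j) \<le> t * 2 powr j * 2 powr (- real_of_int j)" by (rule mult_right_mono[OF m(3)]) simp
  also have "\<dots> = t" by (simp add: mult.assoc powr_add[symmetric])
  finally have mt: "m * 2 powr (- real_of_int j) \<le> t" .
  have "m * 2 powr (- real_of_int j / 2) \<le> m * nrm X x0 + (m * 2 powr (- real_of_int j)) * nrm XW x1"
    using mult_left_mono[OF * m(1)] by (simp add: algebra_simps)
  also have "\<dots> \<le> 1 * nrm X x0 + t * nrm XW x1"
    using m mt nrm_nonneg[OF x0] W.nrm_nonneg[OF x1] by (intro add_mono mult_right_mono) auto
  finally show "kweight t j \<le> k" by (simp add: kweight_def m_def k mult.commute)
qed

text \<open>The pieces with t 2^j at least 1 are put into X, the others into X(w). The factor 2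
  allows for the variation of w within a level.\<close>

lemma K_upper:
  assumes t: "0 < t" and c: "0 \<le> c"
  shows "K_functional X XW t (\<lambda>s. c * test_fun s) \<le> (\<Sum>j\<in>J. 2 * c * kweight t j)"
proof -
  let ?u = "\<lambda>j s. 2 powr (- real_of_int j / 2) / fund (\<tau> j) * indicator (A j) s"
  define J0 where "J0 = {j\<in>J. 1 \<le> t * 2 powr j}"
  define J1 where "J1 = {j\<in>J. t * 2 powr j < 1}"
  have JJ: "J = J0 \<union> J1" "J0 \<inter> J1 = {}" "finite J0" "finite J1" using J by (auto simp: J0_def J1_def)
  define x0 where "x0 = (\<lambda>s. \<Sum>j\<in>J0. c * ?u j s)"
  define x1 where "x1 = (\<lambda>s. \<Sum>j\<in>J1. c * ?u j s)"
  have x0: "x0 \<in> elts X" "nrm X x0 \<le> (\<Sum>j\<in>J0. nrm X (\<lambda>s. c * ?u j s))" unfolding x0_def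
    by (rule sum_elts; rule scale_elts; rule piece(1); simp add: J0_def)+
  have x1: "x1 \<in> elts XW" "nrm XW x1 \<le> (\<Sum>j\<in>J1. nrm XW (\<lambda>s. c * ?u j s))" unfolding x1_def
    by (rule W.sum_elts; rule W.scale_elts; rule piece_W(1); simp add: J1_def)+
  have "c * test_fun s = x0 s + x1 s" for s
    unfolding test_fun_def step_def x0_def x1_def sum_distrib_left using JJ by (simp add: sum.union_disjoint)
  then have K: "K_functional X XW t (\<lambda>s. c * test_fun s) \<le> nrm X x0 + t * nrm XW x1"
    using t by (intro KF_le x0 x1) auto
  have K0: "nrm X x0 \<le> (\<Sum>j\<in>J0. 2 * c * kweight t j)"
  proof (rule order_trans[OF x0(2)], rule sum_mono)
    fix j assume j: "j \<in> J0"
    then have "j \<in> J" "kweight t j = 2 powr (- real_of_int j / 2)" by (auto simp: J0_def kweight_def)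
    then show "nrm X (\<lambda>s. c * ?u j s) \<le> 2 * c * kweight t j" using nrm_scale[OF piece(1), of j c] piece(2)[of j] c by simp
  qed
  have K1: "t * nrm XW x1 \<le> (\<Sum>j\<in>J1. 2 * c * kweight t j)"
  proof -
    have "t * nrm XW x1 \<le> (\<Sum>j\<in>J1. t * nrm XW (\<lambda>s. c * ?u j s))"
      using mult_left_mono[OF x1(2)] t by (simp add: sum_distrib_left)
    also have "\<dots> \<le> (\<Sum>j\<in>J1. 2 * c * kweight t j)"
    proof (rule sum_mono)
      fix j assume j: "j \<in> J1"
      then have jJ: "j \<in> J" and g: "kweight t j = 2 powr (- real_of_int j / 2) * (t * 2 powr j)" by (auto simp: J1_def kweight_def)
      have "t * (c * nrm XW (?u j)) \<le> t * (c * (2 * 2 powr j * 2 powr (- real_of_int j / 2)))"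
        using piece_W(2)[OF jJ] t c by (intro mult_left_mono) auto
      then show "t * nrm XW (\<lambda>s. c * ?u j s) \<le> 2 * c * kweight t j"
        unfolding W.nrm_scale[OF piece_W(1)[OF jJ]] abs_of_nonneg[OF c] g by (simp add: mult_ac)
    qed
    finally show ?thesis .
  qed
  have "(\<Sum>j\<in>J. 2 * c * kweight t j) = (\<Sum>j\<in>J0. 2 * c * kweight t j) + (\<Sum>j\<in>J1. 2 * c * kweight t j)"
    unfolding JJ(1) by (rule sum.union_disjoint[OF JJ(3,4,2)])
  then show ?thesis using K K0 K1 by linarith
qed

text \<open>As a function of j, \<open>kweight t j\<close> decreases geometrically on both sides of
  the point where t 2^j = 1. So the sum is comparable with the maximum.\<close>

lemma sum_kweight:
  assumes t: "0 < t" and M0: "0 \<le> M" and M: "\<And>j. j \<in> J \<Longrightarrow> kweight t j \<le> M"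
  shows "(\<Sum>j\<in>J. kweight t j) \<le> 4 / (1 - s4) * M"
proof -
  define J0 where "J0 = {j\<in>J. 1 \<le> t * 2 powr j}"
  define J1 where "J1 = {j\<in>J. t * 2 powr j < 1}"
  have JJ: "J = J0 \<union> J1" "J0 \<inter> J1 = {}" "finite J0" "finite J1" using J by (auto simp: J0_def J1_def)
  have half: "(\<Sum>j\<in>K. kweight t j) \<le> 2 / (1 - s4) * M" 
    if K: "finite K" "K \<subseteq> J" and p: "p \<in> K" "\<And>j. j \<in> K \<Longrightarrow> kweight t j \<le> kweight t p * s4 ^ nat \<bar>j - p\<bar>" for K p
  proof -
    have g0: "0 \<le> kweight t p" using t by (simp add: kweight_def)
    have "(\<Sum>j\<in>K. kweight t j) \<le> (\<Sum>j\<in>K. kweight t p * s4 ^ nat \<bar>j - p\<bar>)" by (rule sum_mono) (rule p(2))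
    also have "\<dots> \<le> kweight t p * (2 / (1 - s4))" unfolding sum_distrib_left[symmetric]
      using g0 by (intro mult_left_mono sum_pow_int_le s4 K) auto
    also have "\<dots> \<le> M * (2 / (1 - s4))" using M[of p] p(1) K s4 by (intro mult_right_mono) auto
    finally show ?thesis by (simp add: mult.commute)
  qed
  have "(\<Sum>j\<in>J0. kweight t j) \<le> 2 / (1 - s4) * M"
  proof (cases "J0 = {}")
    case ne: False
    show ?thesis
    proof (rule half[of J0 "Min J0"])
      fix j assume j: "j \<in> J0"
      have p: "Min J0 \<in> J0" "Min J0 \<le> j" using JJ ne j by auto
      have "kweight t j = 2 powr (- real_of_int j / 2)" "kweight t (Min J0) = 2 powr (- real_of_int (Min J0) / 2)"
        using j p(1) by (auto simp: J0_def kweight_def)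
      moreover have "2 powr (- real_of_int j / 2) \<le> 2 powr (- real_of_int (Min J0) / 2 + - real (nat \<bar>j - Min J0\<bar>) / 4)"
        using p(2) by (intro powr_mono) (auto simp: field_simps)
      ultimately show "kweight t j \<le> kweight t (Min J0) * s4 ^ nat \<bar>j - Min J0\<bar>" by (simp only: s4_pow powr_add)
    qed (use JJ ne in auto)
  qed (use M0 s4 in auto)
  moreover have "(\<Sum>j\<in>J1. kweight t j) \<le> 2 / (1 - s4) * M"
  proof (cases "J1 = {}")
    case ne: False
    show ?thesis
    proof (rule half[of J1 "Max J1"])
      fix j assume j: "j \<in> J1"
      have p: "Max J1 \<in> J1" "j \<le> Max J1" using JJ ne j by auto
      have h: "2 powr (- real_of_int i / 2) * (t * 2 powr i) = t * 2 powr (real_of_int i / 2)" for i :: int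
        using powr_add[of 2 "- real_of_int i / 2" i] by simp
      have "kweight t j = t * 2 powr (real_of_int j / 2)" "kweight t (Max J1) = t * 2 powr (real_of_int (Max J1) / 2)"
        using j p(1) unfolding h[symmetric] by (auto simp: J1_def kweight_def)
      moreover have "2 powr (real_of_int j / 2) \<le> 2 powr (real_of_int (Max J1) / 2 + - real (nat \<bar>j - Max J1\<bar>) / 4)"
        using p(2) by (intro powr_mono) (auto simp: field_simps)
      ultimately show "kweight t j \<le> kweight t (Max J1) * s4 ^ nat \<bar>j - Max J1\<bar>" using t by (simp only: s4_pow powr_add mult.assoc mult_le_cancel_left_pos)
    qed (use JJ ne in auto)
  qed (use M0 s4 in auto)
  ultimately have "(\<Sum>j\<in>J. kweight t j) \<le> 2 / (1 - s4) * M + 2 / (1 - s4) * M" using JJ by (simp add: sum.union_disjoint)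
  then show ?thesis by simp
qed

end

text \<open>\<open>K_upper\<close> for one family of sets, and \<open>K_lower\<close> with
  \<open>sum_kweight\<close> for the other, bound the two K-functionals by the same sum over J,
  which does not depend on the sets. K-monotonicity turns this into a comparison of norms in
  XV.\<close>

lemma K_comparison:
  assumes J: "finite J" and \<tau>: "\<And>j. j \<in> J \<Longrightarrow> 0 < \<tau> j \<and> \<tau> j \<le> level_measure w j"
    and \<sigma>: "\<And>j. j \<in> J \<Longrightarrow> 0 < \<sigma> j \<and> \<sigma> j \<le> level_measure w j"
    and C: "\<And>x y. x \<in> elts XV \<Longrightarrow> y \<in> elts (sum_space X XW) \<Longrightarrow>
      (\<forall>t>0. K_functional X XW t y \<le> K_functional X XW t x) \<Longrightarrow> y \<in> elts XV \<and> nrm XV y \<le> C * nrm XV x"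
  shows "step_norm J (\<lambda>j. (V j * 2 powr (- real_of_int j / 2)) / fund (\<tau> j)) \<tau>
    \<le> C * (8 / (1 - s4)) * step_norm J (\<lambda>j. (V j * 2 powr (- real_of_int j / 2)) / fund (\<sigma> j)) \<sigma>"
proof -
  obtain A where A: "disj_fam J \<tau> A" "\<forall>j\<in>J. A j \<subseteq> level_set j" using disj_fam_in_levels[of J \<tau>, OF \<tau>] by auto
  obtain B where B: "disj_fam J \<sigma> B" "\<forall>j\<in>J. B j \<subseteq> level_set j" using disj_fam_in_levels[of J \<sigma>, OF \<sigma>] by auto
  note Afacts = J A(1) A(2)[rule_format] conjunct1[OF \<tau>]
  note Bfacts = J B(1) B(2)[rule_format] conjunct1[OF \<sigma>]
  define x where "x = test_fun J \<sigma> B"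
  define y where "y = test_fun J \<tau> A"
  \<comment> \<open>The inverse of the product of 2 from \<open>K_upper\<close> and
    \<open>4 / (1 - s4)\<close> from \<open>sum_kweight\<close>.\<close>
  define c where "c = (1 - s4) / 8"
  have c: "0 < c" "1 / c = 8 / (1 - s4)" using s4 by (auto simp: c_def)
  have yX: "y \<in> elts X" unfolding y_def by (rule test_fun_X[OF Afacts]; assumption)
  have yV: "y \<in> elts XV" unfolding y_def by (rule test_fun_norm(1)[OF Afacts]; assumption)
  have xV: "x \<in> elts XV" unfolding x_def by (rule test_fun_norm(1)[OF Bfacts]; assumption)
  have "\<forall>t>0. K_functional X XW t (\<lambda>s. c * y s) \<le> K_functional X XW t x"
  proof (intro allI impI)
    fix t :: real assume t: "0 < t"
    have 1: "K_functional X XW t (\<lambda>s. c * y s) \<le> 2 * c * (\<Sum>j\<in>J. kweight t j)"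
      unfolding y_def using K_upper[OF Afacts t, of c] c by (simp add: sum_distrib_left)
    have "(\<Sum>j\<in>J. kweight t j) \<le> 4 / (1 - s4) * K_functional X XW t x"
    proof (rule sum_kweight[OF Bfacts t])
      show "0 \<le> K_functional X XW t x" unfolding x_def by (rule K_nonneg[OF Bfacts t]; assumption)
      show "kweight t j \<le> K_functional X XW t x" if "j \<in> J" for j unfolding x_def by (rule K_lower[OF Bfacts t that]; assumption)
    qed
    then have "2 * c * (\<Sum>j\<in>J. kweight t j) \<le> 2 * c * (4 / (1 - s4) * K_functional X XW t x)" using c by (intro mult_left_mono) auto
    moreover have "2 * c * (4 / (1 - s4) * K_functional X XW t x) = K_functional X XW t x" using s4 by (simp add: c_def)
    ultimately show "K_functional X XW t (\<lambda>s. c * y s) \<le> K_functional X XW t x" using 1 by linarith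
  qed
  then have "nrm XV (\<lambda>s. c * y s) \<le> C * nrm XV x"
    using C[OF xV X_SS[OF scale_elts[OF yX]]] by blast
  then have "c * nrm XV y \<le> C * nrm XV x" using VL.nrm_scale[OF yV, of c] c by simp
  then have "nrm XV y \<le> C * (1 / c) * nrm XV x" using c by (simp add: field_simps)
  moreover have "nrm XV y = step_norm J (\<lambda>j. (V j * 2 powr (- real_of_int j / 2)) / fund (\<tau> j)) \<tau>"
    unfolding y_def by (rule test_fun_norm(2)[OF Afacts]; assumption)
  moreover have "nrm XV x = step_norm J (\<lambda>j. (V j * 2 powr (- real_of_int j / 2)) / fund (\<sigma> j)) \<sigma>"
    unfolding x_def by (rule test_fun_norm(2)[OF Bfacts]; assumption)
  ultimately show ?thesis using c(2) by simp
qed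

end

subsection \<open>Monotone couples\<close>

text \<open>The McShane extension: the minimum of the cones placed over the given points.\<close>

lemma lipschitz_extension_nat:
  fixes \<alpha> :: "nat \<Rightarrow> real"
  assumes K: "finite K" "K \<noteq> {}" and lip: "\<And>i j. i \<in> K \<Longrightarrow> j \<in> K \<Longrightarrow> \<alpha> i - \<alpha> j \<le> \<bar>real i - real j\<bar>"
  shows "\<exists>A. (\<forall>n. \<bar>A (Suc n) - A n\<bar> \<le> 1) \<and> (\<forall>k\<in>K. A k = \<alpha> k)"
proof -
  define A where "A n = Min ((\<lambda>k. \<alpha> k + \<bar>real n - real k\<bar>) ` K)" for n
  have up: "A n \<le> \<alpha> k + \<bar>real n - real k\<bar>" if "k \<in> K" for n k
    unfolding A_def using K that by (intro Min_le) auto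
  have attained: "\<exists>k\<in>K. A n = \<alpha> k + \<bar>real n - real k\<bar>" for n
  proof -
    have "A n \<in> (\<lambda>k. \<alpha> k + \<bar>real n - real k\<bar>) ` K" unfolding A_def using K by (intro Min_in) auto
    then show ?thesis by blast
  qed
  have le: "A m \<le> A n + \<bar>real m - real n\<bar>" for m n
  proof -
    obtain k where "k \<in> K" "A n = \<alpha> k + \<bar>real n - real k\<bar>" using attained by blast
    then show ?thesis using up[of k m] by linarith
  qed
  have "\<bar>A (Suc n) - A n\<bar> \<le> 1" for n using le[of "Suc n" n] le[of n "Suc n"] by simp
  moreover have "A k = \<alpha> k" if "k \<in> K" for k
  proof -
    obtain i where "i \<in> K" "A k = \<alpha> i + \<bar>real k - real i\<bar>" using attained by blast
    then show ?thesis using up[OF that, of k] lip[OF that, of i] by simp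
  qed
  ultimately show ?thesis by blast
qed

text \<open>F sums, on each block, the increments of the function that belongs to the block. The
  constants that appear are the mismatches at the ends of the blocks.\<close>

lemma glue_increments:
  fixes R :: "nat \<Rightarrow> nat" and A :: "nat \<Rightarrow> nat \<Rightarrow> real"
  assumes R: "strict_mono R" and A: "\<And>m n. \<bar>A m (Suc n) - A m n\<bar> \<le> 1"
  shows "\<exists>F. (\<forall>n. \<bar>F (Suc n) - F n\<bar> \<le> 1) \<and> (\<forall>m. \<exists>c. \<forall>n\<in>{R m..R (Suc m)}. F n = A m n + c)"
proof -
  define k where "k i = (LEAST m. i < R (Suc m))" for i
  define g where "g i = A (k i) (Suc i) - A (k i) i" for i
  define F where "F n = (\<Sum>i<n. g i)" for n
  have k: "k i = m" if "R m \<le> i" "i < R (Suc m)" for i m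
    unfolding k_def
  proof (rule Least_equality)
    show "i < R (Suc m)" by (rule that(2))
    fix m' assume "i < R (Suc m')"
    then have "R m < R (Suc m')" using that(1) by linarith
    then show "m \<le> m'" using strict_mono_less[OF R] by auto
  qed
  have "F n = A m n + (F (R m) - A m (R m))" if "R m \<le> n" "n \<le> R (Suc m)" for n m
    using that
  proof (induction n rule: dec_induct)
    case (step n)
    then have "F n = A m n + (F (R m) - A m (R m))" "k n = m" using k[of m n] by auto
    then show ?case by (simp add: F_def g_def)
  qed simp
  then have "\<forall>m. \<exists>c. \<forall>n\<in>{R m..R (Suc m)}. F n = A m n + c" by (metis atLeastAtMost_iff)
  moreover have "\<forall>n. \<bar>F (Suc n) - F n\<bar> \<le> 1" using A by (simp add: F_def g_def)
  ultimately show ?thesis by blast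
qed

lemma nat_lipschitz:
  fixes F :: "nat \<Rightarrow> real"
  assumes "\<And>n. \<bar>F (Suc n) - F n\<bar> \<le> 1"
  shows "F p - F q \<le> \<bar>real p - real q\<bar>"
proof -
  have *: "\<bar>F n - F m\<bar> \<le> real n - real m" if "m \<le> n" for m n
    using that
  proof (induction n rule: dec_induct)
    case (step n)
    then show ?case using assms[of n] by simp
  qed simp
  show ?thesis using *[of p q] *[of q p] by (cases "p \<le> q") auto
qed

section \<open>Violations of the level property\<close>

context sym_weight
begin

lemma configD:
  assumes "config J \<tau> \<sigma> a"
  shows "finite J" "\<And>j. j \<in> J \<Longrightarrow> 0 < \<tau> j \<and> \<tau> j \<le> level_measure w j" "\<And>j. j \<in> J \<Longrightarrow> 0 < \<sigma> j \<and> \<sigma> j \<le> level_measure w j"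
    "\<And>j. j \<in> J \<Longrightarrow> 0 < a j" "\<And>i j. i \<in> J \<Longrightarrow> j \<in> J \<Longrightarrow> a i * s4 ^ nat \<bar>i - j\<bar> \<le> a j"
    "\<And>j. j \<in> J \<Longrightarrow> 0 \<le> \<tau> j" "\<And>j. j \<in> J \<Longrightarrow> 0 \<le> \<sigma> j" "(\<Sum>j\<in>J. \<tau> j) \<le> 1" "(\<Sum>j\<in>J. \<sigma> j) \<le> 1"
  using assms by (auto simp: config_def less_imp_le intro: sum_le_1)

lemma config_subset: "config J \<tau> \<sigma> a \<Longrightarrow> K \<subseteq> J \<Longrightarrow> config K \<tau> \<sigma> a"
  unfolding config_def using finite_subset by blast

text \<open>Together with \<open>le_step_norm\<close>: on a bounded number of levels both norms are
  comparable with the largest coefficient, whatever the sets.\<close>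

lemma step_norm_le_sum:
  assumes c: "config J \<tau> \<sigma> a"
  shows "step_norm J (\<lambda>j. a j / fund (\<tau> j)) \<tau> \<le> (\<Sum>j\<in>J. a j)"
proof -
  obtain B where B: "disj_fam J \<tau> B" using disj_fam_exists[OF configD(1,6,8)[OF c]] by blast
  have *: "(\<lambda>t. a j / fund (\<tau> j) * indicator (B j) t) \<in> elts X \<and> nrm X (\<lambda>t. a j / fund (\<tau> j) * indicator (B j) t) = a j"
    if j: "j \<in> J" for j
  proof (rule conjI)
    show "(\<lambda>t. a j / fund (\<tau> j) * indicator (B j) t) \<in> elts X"
      by (rule nrm_scaled_indicator(1); use B configD(2,4)[OF c j] j in \<open>simp add: disj_fam_def\<close>)
    show "nrm X (\<lambda>t. a j / fund (\<tau> j) * indicator (B j) t) = a j"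
      by (rule nrm_scaled_indicator(2); use B configD(2,4)[OF c j] j in \<open>simp add: disj_fam_def\<close>)
  qed
  have "nrm X (step J (\<lambda>j. a j / fund (\<tau> j)) B) \<le> (\<Sum>j\<in>J. nrm X (\<lambda>t. a j / fund (\<tau> j) * indicator (B j) t))"
    unfolding step_def[abs_def] by (rule sum_elts(2)) (use * in blast)
  then show ?thesis unfolding step_norm_eq[OF configD(1)[OF c] B] using * by simp
qed

lemma le_step_norm:
  assumes c: "config J \<tau> \<sigma> a" and j: "j \<in> J"
  shows "a j \<le> step_norm J (\<lambda>j. a j / fund (\<sigma> j)) \<sigma>"
proof -
  obtain B where B: "disj_fam J \<sigma> B" using disj_fam_exists[OF configD(1,7,9)[OF c]] by blast
  have "a j = nrm X (\<lambda>t. a j / fund (\<sigma> j) * indicator (B j) t)"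
    by (rule nrm_scaled_indicator(2)[symmetric]; use B configD(3,4)[OF c j] j in \<open>simp add: disj_fam_def\<close>)
  also have "(\<lambda>t. a j / fund (\<sigma> j) * indicator (B j) t) = step {j} (\<lambda>j. a j / fund (\<sigma> j)) B"
    by (rule ext) (simp only: step_def sum.insert sum.empty finite.emptyI empty_iff not_False_eq_True add_0_right)
  also have "nrm X \<dots> = step_norm {j} (\<lambda>j. a j / fund (\<sigma> j)) \<sigma>"
    by (rule step_norm_eq[symmetric]) (use disj_fam_subset[OF B] j in auto)
  also have "\<dots> \<le> step_norm J (\<lambda>j. a j / fund (\<sigma> j)) \<sigma>" 
    by (rule step_norm_subset[OF configD(1,7,9)[OF c]]) (use j in auto)
  finally show ?thesis .
qed

text \<open>A single number R measures both how far out the levels lie and by how much the estimate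
  fails; the sign epsilon selects the side.\<close>

definition bad_config :: "int \<Rightarrow> nat \<Rightarrow> int set \<Rightarrow> (int \<Rightarrow> real) \<Rightarrow> (int \<Rightarrow> real) \<Rightarrow> (int \<Rightarrow> real) \<Rightarrow> bool" where
  "bad_config \<epsilon> R J \<tau> \<sigma> a \<longleftrightarrow> config J \<tau> \<sigma> a \<and> (\<forall>j\<in>J. int R < \<epsilon> * j) \<and>
     real R * step_norm J (\<lambda>j. a j / fund (\<sigma> j)) \<sigma> < step_norm J (\<lambda>j. a j / fund (\<tau> j)) \<tau>"

text \<open>The levels \<open>\<bar>j\<bar> \<le> R\<close> contribute a ratio of at most \<open>2 * R + 1\<close>, so violations of the level property live
  arbitrarily far out on one side.\<close>

lemma bad_config_exists:
  assumes neg: "\<not> (\<exists>L\<ge>1. level_property L)"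
  shows "\<exists>\<epsilon>\<in>{1, -1}. \<forall>R. \<exists>J \<tau> \<sigma> a. bad_config \<epsilon> R J \<tau> \<sigma> a"
proof (rule ccontr)
  assume "\<not> ?thesis"
  then obtain R1 R2 where R1: "\<And>J \<tau> \<sigma> a. \<not> bad_config 1 R1 J \<tau> \<sigma> a" and R2: "\<And>J \<tau> \<sigma> a. \<not> bad_config (-1) R2 J \<tau> \<sigma> a"
    by (simp, meson)
  define R where "R = max R1 R2"
  \<comment> \<open>\<open>2 * R + 1\<close> for the central levels and R for each of the two
    sides.\<close>
  have "\<not> level_property (4 * real R + 1)" using neg by auto
  then obtain J \<tau> \<sigma> a where c: "config J \<tau> \<sigma> a"
    and v: "\<not> step_norm J (\<lambda>j. a j / fund (\<tau> j)) \<tau> \<le> (4 * real R + 1) * step_norm J (\<lambda>j. a j / fund (\<sigma> j)) \<sigma>"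
    unfolding level_property_def by auto
  let ?N = "\<lambda>K. step_norm K (\<lambda>j. a j / fund (\<tau> j)) \<tau>" and ?M = "\<lambda>K. step_norm K (\<lambda>j. a j / fund (\<sigma> j)) \<sigma>"
  define Jc where "Jc = {j\<in>J. \<bar>j\<bar> \<le> int R}"
  define Js where "Js = {j\<in>J. int R < \<bar>j\<bar>}"
  define Jp where "Jp = {j\<in>J. int R < 1 * j}"
  define Jn where "Jn = {j\<in>J. int R < (-1) * j}"
  have sub: "Jc \<subseteq> J" "Js \<subseteq> J" "Jp \<subseteq> J" "Jn \<subseteq> J" by (auto simp: Jc_def Js_def Jp_def Jn_def)
  have M0: "0 \<le> ?M J" by (rule step_norm_nonneg[OF configD(1,7,9)[OF c]])
  have "?N J \<le> ?N Jc + ?N Js" by (rule step_norm_Un_le[OF configD(1,6,8)[OF c]]) (auto simp: Jc_def Js_def)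
  moreover have "?N Js \<le> ?N Jp + ?N Jn"
    by (rule step_norm_Un_le[OF configD(1,6,8)[OF config_subset[OF c sub(2)]]]) (auto simp: Js_def Jp_def Jn_def)
  moreover have "?N Jc \<le> (2 * real R + 1) * ?M J"
  proof -
    have "?N Jc \<le> (\<Sum>j\<in>Jc. a j)" by (rule step_norm_le_sum[OF config_subset[OF c sub(1)]])
    also have "\<dots> \<le> (\<Sum>j\<in>Jc. ?M J)" using le_step_norm[OF c] sub by (intro sum_mono) auto
    also have "\<dots> = real (card Jc) * ?M J" by simp
    also have "\<dots> \<le> (2 * real R + 1) * ?M J"
    proof (intro mult_right_mono M0)
      have "card Jc \<le> card {- int R..int R}" by (rule card_mono) (auto simp: Jc_def)
      then show "real (card Jc) \<le> 2 * real R + 1" by simp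
    qed
    finally show ?thesis .
  qed
  moreover have side: "?N K \<le> real R * ?M J"
    if K: "K \<subseteq> J" "\<forall>j\<in>K. int R < \<epsilon> * j" and nb: "\<not> bad_config \<epsilon> R' K \<tau> \<sigma> a" "R' \<le> R" for K \<epsilon> R'
  proof -
    have MK: "0 \<le> ?M K" by (rule step_norm_nonneg[OF configD(1,7,9)[OF config_subset[OF c K(1)]]])
    have "?N K \<le> real R' * ?M K" using nb K config_subset[OF c K(1)] unfolding bad_config_def by force
    also have "\<dots> \<le> real R * ?M K" using nb(2) MK by (intro mult_right_mono) auto
    also have "\<dots> \<le> real R * ?M J" using step_norm_subset[OF configD(1,7,9)[OF c] K(1)] by (intro mult_left_mono) auto
    finally show ?thesis .
  qed
  have "?N Jp \<le> real R * ?M J" by (rule side[OF sub(3) _ R1]) (auto simp: Jp_def R_def)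
  moreover have "?N Jn \<le> real R * ?M J" by (rule side[OF sub(4) _ R2]) (auto simp: Jn_def R_def)
  ultimately have "?N J \<le> (4 * real R + 1) * ?M J" by (simp add: algebra_simps)
  then show False using v by blast
qed

text \<open>Configurations with unbounded ratios are placed on consecutive blocks of levels and their
  coefficients are glued into one weight \<open>V\<close>: adding constants to their logarithms is harmless by homogeneity.
  The space with weight \<open>V\<close> then contradicts K-monotonicity.\<close>

lemma monotone_couple_levels:
  assumes fat: "fatou_property X" and km: "K_monotone_couple X XW"
  shows "\<exists>L\<ge>1. level_property L"
proof (rule ccontr)
  assume "\<not> ?thesis"
  then obtain \<epsilon> where \<epsilon>: "\<epsilon> \<in> {1, -1 :: int}" and ex: "\<forall>R. \<exists>J \<tau> \<sigma> a. bad_config \<epsilon> R J \<tau> \<sigma> a"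
    using bad_config_exists by blast
  obtain J \<tau> \<sigma> a where bad: "\<And>R. bad_config \<epsilon> R (J R) (\<tau> R) (\<sigma> R) (a R)" using ex by metis
  have cfg: "config (J R) (\<tau> R) (\<sigma> R) (a R)" for R using bad by (auto simp: bad_config_def)
  have side: "int R < \<epsilon> * j" if "j \<in> J R" for R j using bad[of R] that by (auto simp: bad_config_def)
  define N where "N R = step_norm (J R) (\<lambda>j. a R j / fund (\<tau> R j)) (\<tau> R)" for R
  define M where "M R = step_norm (J R) (\<lambda>j. a R j / fund (\<sigma> R j)) (\<sigma> R)" for R
  have NM: "real R * M R < N R" for R using bad[of R] by (simp add: bad_config_def N_def M_def)
  have M0: "0 \<le> M R" for R unfolding M_def by (rule step_norm_nonneg[OF configD(1,7,9)[OF cfg]])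
  have ne: "J R \<noteq> {}" for R
  proof
    assume e: "J R = {}"
    have "step {} c B = (\<lambda>t. 0)" for c :: "int \<Rightarrow> real" and B by (simp add: step_def[abs_def])
    then have "N R = 0" "M R = 0" by (auto simp: N_def M_def step_norm_def e)
    then show False using NM[of R] by simp
  qed
  \<comment> \<open>An index past R and past every level used by the configuration for R, so that
    the next one starts on fresh levels.\<close>
  define top where "top R = R + 1 + (\<Sum>j\<in>J R. nat (\<epsilon> * j))" for R
  define Rm where "Rm m = (top ^^ m) 0" for m
  have RmS: "Rm (Suc m) = top (Rm m)" for m by (simp add: Rm_def)
  have Rm: "strict_mono Rm" by (rule strict_monoI_Suc) (simp add: RmS top_def)
  have inR: "nat (\<epsilon> * j) \<in> {Rm m..Rm (Suc m)}" if j: "j \<in> J (Rm m)" for j m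
  proof -
    have "nat (\<epsilon> * j) \<le> (\<Sum>j\<in>J (Rm m). nat (\<epsilon> * j))"
      using configD(1)[OF cfg] j by (intro member_le_sum) auto
    then show ?thesis using side[OF j] by (auto simp: RmS top_def)
  qed
  have inv: "\<epsilon> * int (nat (\<epsilon> * j)) = j" if "0 < \<epsilon> * j" for j using \<epsilon> that by auto
  \<comment> \<open>Four times the binary logarithm turns slow variation at rate 2^(1/4) into a
    Lipschitz condition with constant 1; epsilon moves the levels to the positive side.\<close>
  have "\<exists>A. (\<forall>n. \<bar>A (Suc n) - A n\<bar> \<le> 1) \<and> (\<forall>j\<in>J (Rm m). A (nat (\<epsilon> * j)) = 4 * log 2 (a (Rm m) j))" for m
  proof -
    let ?\<alpha> = "\<lambda>k. 4 * log 2 (a (Rm m) (\<epsilon> * int k))"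
    have al: "?\<alpha> (nat (\<epsilon> * j)) = 4 * log 2 (a (Rm m) j)" if "j \<in> J (Rm m)" for j
    proof -
      have "0 < \<epsilon> * j" using side[OF that] by linarith
      then show ?thesis by (simp only: inv)
    qed
    have "\<exists>A. (\<forall>n. \<bar>A (Suc n) - A n\<bar> \<le> 1) \<and> (\<forall>k\<in>(\<lambda>j. nat (\<epsilon> * j)) ` J (Rm m). A k = ?\<alpha> k)"
    proof (rule lipschitz_extension_nat)
      fix p q assume "p \<in> (\<lambda>j. nat (\<epsilon> * j)) ` J (Rm m)" "q \<in> (\<lambda>j. nat (\<epsilon> * j)) ` J (Rm m)"
      then obtain i j where ij: "i \<in> J (Rm m)" "j \<in> J (Rm m)" and p: "p = nat (\<epsilon> * i)" and q: "q = nat (\<epsilon> * j)" by blast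
      have pos: "0 < a (Rm m) i" "0 < a (Rm m) j" using configD(4)[OF cfg] ij by auto
      have "log 2 (a (Rm m) i * s4 ^ nat \<bar>i - j\<bar>) \<le> log 2 (a (Rm m) j)"
        using configD(5)[OF cfg ij] pos s4 by simp
      then have "log 2 (a (Rm m) i) - real (nat \<bar>i - j\<bar>) / 4 \<le> log 2 (a (Rm m) j)"
        using pos s4 by (simp add: log_mult s4_pow)
      moreover have "real (nat \<bar>i - j\<bar>) = \<bar>real p - real q\<bar>"
        using \<epsilon> side[OF ij(1)] side[OF ij(2)] by (auto simp: p q)
      ultimately show "?\<alpha> p - ?\<alpha> q \<le> \<bar>real p - real q\<bar>" unfolding p q al[OF ij(1)] al[OF ij(2)] by linarith
    qed (use configD(1)[OF cfg] ne in auto)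
    then show ?thesis using al by auto
  qed
  then obtain A where A: "\<And>m n. \<bar>A m (Suc n) - A m n\<bar> \<le> 1"
    and Aeq: "\<And>m j. j \<in> J (Rm m) \<Longrightarrow> A m (nat (\<epsilon> * j)) = 4 * log 2 (a (Rm m) j)" by metis
  obtain F where F: "\<And>n. \<bar>F (Suc n) - F n\<bar> \<le> 1" and FA: "\<And>m. \<exists>c. \<forall>n\<in>{Rm m..Rm (Suc m)}. F n = A m n + c"
    using glue_increments[of Rm A, OF Rm A] by blast
  \<comment> \<open>2^(j/2) cancels the factor in \<open>test_fun\<close>; what is left on each
    block is a constant multiple of the coefficients there.\<close>
  define V where "V j = 2 powr (real_of_int j / 2 + F (nat (\<epsilon> * j)) / 4)" for j
  interpret SI: sym_interpolation X w V
  proof unfold_locales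
    show "0 < V j" for j by (simp add: V_def)
    fix i j :: int
    have "F (nat (\<epsilon> * i)) - F (nat (\<epsilon> * j)) \<le> \<bar>real (nat (\<epsilon> * i)) - real (nat (\<epsilon> * j))\<bar>" by (rule nat_lipschitz) (rule F)
    also have "\<dots> \<le> \<bar>real_of_int i - real_of_int j\<bar>" using \<epsilon> by auto
    finally have "real_of_int i / 2 + F (nat (\<epsilon> * i)) / 4
      \<le> real_of_int j / 2 + F (nat (\<epsilon> * j)) / 4 + ((real_of_int i - real_of_int j) / 2 + \<bar>real_of_int i - real_of_int j\<bar> / 4)"
      by argo
    then show "V i \<le> V j * 2 powr ((real_of_int i - real_of_int j) / 2 + \<bar>real_of_int i - real_of_int j\<bar> / 4)"
      unfolding V_def powr_add[symmetric] by (intro powr_mono) auto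
  qed
  obtain C where C: "1 \<le> C" and KM: "\<And>x y. x \<in> elts SI.XV \<Longrightarrow> y \<in> elts (sum_space X XW) \<Longrightarrow>
      (\<forall>t>0. K_functional X XW t y \<le> K_functional X XW t x) \<Longrightarrow> y \<in> elts SI.XV \<and> nrm SI.XV y \<le> C * nrm SI.XV x"
    using km SI.interpolation_XV[OF fat] unfolding K_monotone_couple_def K_monotone_space_def by meson
  define D where "D = C * (8 / (1 - s4))"
  have bound: "N (Rm m) \<le> D * M (Rm m)" for m
  proof -
    obtain c where c: "\<And>n. n \<in> {Rm m..Rm (Suc m)} \<Longrightarrow> F n = A m n + c" using FA by blast
    define \<kappa> where "\<kappa> = 2 powr (c / 4)"
    have \<kappa>: "0 < \<kappa>" by (simp add: \<kappa>_def)
    have Va: "V j * 2 powr (- real_of_int j / 2) = \<kappa> * a (Rm m) j" if j: "j \<in> J (Rm m)" for j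
    proof -
      have e: "F (nat (\<epsilon> * j)) / 4 = c / 4 + log 2 (a (Rm m) j)" using c[OF inR[OF j]] Aeq[OF j] by simp
      then have "V j * 2 powr (- real_of_int j / 2) = 2 powr (c / 4 + log 2 (a (Rm m) j))"
        unfolding V_def powr_add[symmetric] e by simp
      then show ?thesis using configD(4)[OF cfg j] by (simp add: powr_add \<kappa>_def)
    qed
    have "step_norm (J (Rm m)) (\<lambda>j. (V j * 2 powr (- real_of_int j / 2)) / fund (\<tau> (Rm m) j)) (\<tau> (Rm m))
      \<le> D * step_norm (J (Rm m)) (\<lambda>j. (V j * 2 powr (- real_of_int j / 2)) / fund (\<sigma> (Rm m) j)) (\<sigma> (Rm m))"
      unfolding D_def by (rule SI.K_comparison[OF configD(1,2,3)[OF cfg]]; (rule KM)?; assumption)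
    moreover have "step_norm (J (Rm m)) (\<lambda>j. (V j * 2 powr (- real_of_int j / 2)) / fund (\<tau> (Rm m) j)) (\<tau> (Rm m)) = \<bar>\<kappa>\<bar> * N (Rm m)"
    proof (rule trans)
      show "step_norm (J (Rm m)) (\<lambda>j. \<kappa> * (a (Rm m) j / fund (\<tau> (Rm m) j))) (\<tau> (Rm m)) = \<bar>\<kappa>\<bar> * N (Rm m)"
        unfolding N_def by (rule step_norm_scale[OF configD(1,6,8)[OF cfg]])
    qed (rule step_norm_cong[OF configD(1,6,8)[OF cfg]], simp_all only: Va times_divide_eq_right)
    moreover have "step_norm (J (Rm m)) (\<lambda>j. (V j * 2 powr (- real_of_int j / 2)) / fund (\<sigma> (Rm m) j)) (\<sigma> (Rm m)) = \<bar>\<kappa>\<bar> * M (Rm m)"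
    proof (rule trans)
      show "step_norm (J (Rm m)) (\<lambda>j. \<kappa> * (a (Rm m) j / fund (\<sigma> (Rm m) j))) (\<sigma> (Rm m)) = \<bar>\<kappa>\<bar> * M (Rm m)"
        unfolding M_def by (rule step_norm_scale[OF configD(1,7,9)[OF cfg]])
    qed (rule step_norm_cong[OF configD(1,7,9)[OF cfg]], simp_all only: Va times_divide_eq_right)
    ultimately have "\<kappa> * N (Rm m) \<le> \<kappa> * (D * M (Rm m))" using \<kappa> by (simp add: mult_ac)
    then show ?thesis using \<kappa> by simp
  qed
  \<comment> \<open>\<open>Rm m\<close> is at least m, so for this m the ratio of the configuration
    exceeds the constant that K-monotonicity permits.\<close>
  obtain m :: nat where "D \<le> real m" using real_arch_simple by blast
  then have "D \<le> real (Rm m)" using seq_suble[OF Rm, of m] by simp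
  then have "D * M (Rm m) \<le> real (Rm m) * M (Rm m)" using M0 by (rule mult_right_mono)
  then show False using bound[of m] NM[of "Rm m"] by linarith
qed

end

text \<open>A number under the infimum in \<open>weight_seq w k\<close> is not admissible there, so
  infinitely many or at least k levels have measure greater than it.\<close>

lemma weight_seq_levels:
  assumes c0: "0 < c0" and ws: "\<And>k. k0 \<le> k \<Longrightarrow> c0 \<le> weight_seq w k * 2 ^ k"
  shows "\<exists>q\<ge>1. \<forall>k. \<exists>J. finite J \<and> card J = k \<and> (\<forall>j\<in>J. 1 / 2 ^ (q * (k + 1)) \<le> level_measure w j)"
proof -
  obtain n0 where n0: "(1 / 2) ^ n0 < c0" using real_arch_pow_inv[OF c0, of "1 / 2"] by auto
  \<comment> \<open>n0 absorbs the constant c0, and k0 the range in which the hypothesis says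
    nothing.\<close>
  define q where "q = n0 + k0 + 1"
  have "\<exists>J. finite J \<and> card J = k \<and> (\<forall>j\<in>J. 1 / 2 ^ (q * (k + 1)) \<le> level_measure w j)" for k
  proof -
    \<comment> \<open>For k less than k0 the levels obtained for k0 are used.\<close>
    define k' where "k' = max k k0"
    \<comment> \<open>Half of the guaranteed value of \<open>weight_seq w k'\<close>, so that it is
      strictly smaller than this value.\<close>
    define l where "l = c0 / 2 ^ (k' + 1)"
    have l0: "0 \<le> l" using c0 by (simp add: l_def)
    have "c0 \<le> weight_seq w k' * 2 ^ k'" by (rule ws) (simp add: k'_def)
    then have "c0 / 2 ^ k' \<le> weight_seq w k'" by (simp add: field_simps)
    moreover have "l < c0 / 2 ^ k'" using c0 by (simp add: l_def field_simps)
    ultimately have lw: "l < weight_seq w k'" by linarith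
    have nl: "\<not> (finite {j. level_measure w j > l} \<and> card {j. level_measure w j > l} < k')"
    proof
      assume "finite {j. level_measure w j > l} \<and> card {j. level_measure w j > l} < k'"
      then have "weight_seq w k' \<le> l" unfolding weight_seq_def using l0
        by (intro cInf_lower bdd_belowI[of _ 0]) auto
      then show False using lw by simp
    qed
    have "\<exists>J. J \<subseteq> {j. level_measure w j > l} \<and> finite J \<and> card J = k"
    proof (cases "finite {j. level_measure w j > l}")
      case True
      then have "k \<le> card {j. level_measure w j > l}" using nl by (simp add: k'_def)
      then show ?thesis using obtain_subset_with_card_n by metis
    qed (use infinite_arbitrarily_large in blast)
    then obtain J where J: "J \<subseteq> {j. level_measure w j > l}" "finite J" "card J = k" by blast
    have "1 / 2 ^ (q * (k + 1)) \<le> l"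
    proof -
      have "k' + 1 + n0 \<le> k + k0 + 1 + n0" by (simp add: k'_def)
      also have "\<dots> \<le> q * (k + 1)" by (simp add: q_def algebra_simps)
      finally have "(2::real) ^ (k' + 1 + n0) \<le> 2 ^ (q * (k + 1))" by (intro power_increasing) auto
      then have "1 / 2 ^ (q * (k + 1)) \<le> (1::real) / 2 ^ (k' + 1 + n0)" by (intro divide_left_mono) auto
      also have "\<dots> = (1 / 2) ^ n0 / 2 ^ (k' + 1)" by (simp add: power_add power_divide)
      also have "\<dots> \<le> l" unfolding l_def using n0 by (intro divide_right_mono) auto
      finally show ?thesis .
    qed
    then show ?thesis using J by (intro exI[of _ J]) fastforce
  qed
  then show ?thesis by (intro exI[of _ q]) (simp add: q_def)
qed

theorem theorem6p1:
  fixes X :: fun_space and w :: "real \<Rightarrow> real"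
  assumes "symmetric_space X"
    and "nontrivial_boyd_indices X"
    and "weight w"
    and "nontrivial_weight w"
    and "\<exists>k0::nat. \<exists>c0::real. 1 \<le> k0 \<and> 0 < c0 \<and> (\<forall>k\<ge>k0. c0 \<le> weight_seq w k * 2 ^ k)"
  shows "(w_decomposable w X \<longrightarrow> ultrasymmetric_orlicz X) \<and>
    (fatou_property X \<and> K_monotone_couple X (weighted_space X w) \<longrightarrow> ultrasymmetric_orlicz X)"
proof -
  interpret sym_space X by unfold_locales (rule assms(1))
  interpret sym_weight X w by unfold_locales (rule assms(3))
  obtain Cb r where "0 < Cb" "0 < r" "r < 1" "\<forall>i j. psi (i + j) \<le> Cb * r ^ j * psi i" "\<forall>i j. psi i \<le> Cb * (2 * r) ^ j * psi (i + j)"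
    using boyd_geometric[OF assms(2)] by blast
  then interpret boyd_space X Cb r by unfold_locales auto
  obtain k0 c0 where "0 < c0" "\<And>k. k0 \<le> k \<Longrightarrow> c0 \<le> weight_seq w k * 2 ^ k" using assms(5) by blast
  then obtain q where q: "1 \<le> q" and lev: "\<And>k. \<exists>J. finite J \<and> card J = k \<and> (\<forall>j\<in>J. 1 / 2 ^ (q * (k + 1)) \<le> level_measure w j)"
    using weight_seq_levels[of c0 k0 w] by blast
  have main: "ultrasymmetric_orlicz X" if L: "1 \<le> L" "level_property L" for L
  proof -
    interpret lp_space X Cb r "level_measure w" L q
    proof unfold_locales
      fix J \<tau> \<sigma> and a :: "int \<Rightarrow> real"
      assume "finite J" "\<And>j. j \<in> J \<Longrightarrow> 0 < \<tau> j \<and> \<tau> j \<le> level_measure w j" "\<And>j. j \<in> J \<Longrightarrow> 0 < \<sigma> j \<and> \<sigma> j \<le> level_measure w j"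
        "\<And>j. j \<in> J \<Longrightarrow> 0 < a j" "\<And>i j. i \<in> J \<Longrightarrow> j \<in> J \<Longrightarrow> a i * s4 ^ nat \<bar>i - j\<bar> \<le> a j"
      then have "config J \<tau> \<sigma> a" by (simp add: config_def)
      then show "step_norm J (\<lambda>j. a j / fund (\<tau> j)) \<tau> \<le> L * step_norm J (\<lambda>j. a j / fund (\<sigma> j)) \<sigma>"
        using L(2) by (simp add: level_property_def)
    qed (use level_measure_nonneg level_measure_sum L(1) q lev in auto)
    obtain \<theta> p K D where "seq_model X Cb r \<theta> p K D q" using seq_model_exists by blast
    then show ?thesis by (rule seq_model.ultrasymmetric_orlicz_X)
  qed
  then show ?thesis using decomposable_levels monotone_couple_levels by blast
qed

end
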